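(* Suppose $\mathsf{Site}$ is a numerable site and $F\colon\mathsf{Site}^{\mathrm{op}}\to\mathsf{coCh}$ is a presheaf of cochain complexes of abelian groups such that in every cochain degree $n$ the presheaf of abelian groups $F_n\colon\mathsf{Site}^{\mathrm{op}}\to\mathsf{Ab}$ is a sheaf, and for any $M\in\mathsf{Site}$ and any covering family $\{U\to M,V\to M\}$ of $M$ the map $$F_n(U)\times F_n(V)\to F_n(U\cap V),\qquad(u,v)\mapsto u|_{U\cap V}-v|_{U\cap V}$$ is surjective. Then $F$ satisfies the homotopy descent property.
   Context: $\mathsf{Loc}$ is the category of locales. A locale is a poset (of opens) with finite infima and arbitrary suprema such that $b\mapsto\inf(a,b)$ preserves suprema for each $a$; a morphism of locales is a map of posets in the opposite direction preserving finite infima and arbitrary suprema. An open cover $\{U_i\}_{i\in I}$ of a locale $X$ is numerable if there are morphisms $f_i\colon X\to[0,\infty)$ whose sum exists and is a strictly positive real-valued function on $X$, with $f_i^*(0,\infty)\le U_i$ for all $i$. $\mathsf{Loc}$ is a site with the coverage of numerable open covers. A covering family of a site is a family of morphisms with common codomain such that the sieve it generates is a covering sieve for the Grothendieck topology generated by the coverage. A numerable site is a site $S$ with a functor $\mathbf U\colon S\to\mathsf{Loc}$ such that: (i) $\mathbf U$ admits cartesian lifts for all open embeddings, i.e., for any $\hat Z\in S$ and any open embedding $h\colon Y\to\mathbf U(\hat Z)$ there is $\hat h\colon\hat Y\to\hat Z$ with $\mathbf U(\hat h)=h$ that is cartesian: for any $\hat f\colon\hat X\to\hat Z$ in $S$ and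 $g\colon\mathbf U(\hat X)\to Y$ with $hg=\mathbf U(\hat f)$ there is a unique $\hat g\colon\hat X\to\hat Y$ with $\hat h\hat g=\hat f$ and $\mathbf U(\hat g)=g$; (ii) $\mathbf U$ creates covering families: a family in $S$ is covering if and only if its $\mathbf U$-image is covering in $\mathsf{Loc}$. Covering families in the statement (in the hypothesis, in the sheaf condition and in the descent property) consist of cartesian lifts of open embeddings, so that intersections such as $U\cap V$ are defined: $U\cap V\to M$ is the cartesian lift of the open inclusion $\mathbf U(U)\cap\mathbf U(V)\to\mathbf U(M)$, with its induced maps to $U$ and $V$. Homotopy descent property: for every covering family $\{U_i\to M\}_{i\in I}$ the canonical map from $F(M)$ to the homotopy limit, in cochain complexes of abelian groups ($\mathbf Z$-graded, weak equivalences are quasi-isomorphisms), of the Čech cosimplicial diagram $[m]\mapsto\prod_{i_0,\ldots,i_m}F(U_{i_0}\cap\cdots\cap U_{i_m})$ is a quasi-isomorphism. *)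

theory Defs
  imports
    "HOL-Analysis.Analysis"
    "HOL-Algebra.Complete_Lattice"
    "HOL-Algebra.FiniteProduct"
    "HOL-Algebra.Product_Groups"
begin

section \<open>Categories, functors, sieves and sites\<close>

record ('o, 'm) category =
  ob :: "'o set"
  ar :: "'m set"
  src :: "'m \<Rightarrow> 'o"
  tgt :: "'m \<Rightarrow> 'o"
  idn :: "'o \<Rightarrow> 'm"
  cmp :: "'m \<Rightarrow> 'm \<Rightarrow> 'm"

locale category =
  fixes C :: "('o, 'm) category"
  assumes src_ob: "f \<in> ar C \<Longrightarrow> src C f \<in> ob C"
    and tgt_ob: "f \<in> ar C \<Longrightarrow> tgt C f \<in> ob C"
    and idn_ar: "x \<in> ob C \<Longrightarrow> idn C x \<in> ar C \<and> src C (idn C x) = x \<and> tgt C (idn C x) = x"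
    and cmp_ar: "\<lbrakk>f \<in> ar C; g \<in> ar C; src C g = tgt C f\<rbrakk> \<Longrightarrow>
      cmp C g f \<in> ar C \<and> src C (cmp C g f) = src C f \<and> tgt C (cmp C g f) = tgt C g"
    and cmp_idn_right: "f \<in> ar C \<Longrightarrow> cmp C f (idn C (src C f)) = f"
    and cmp_idn_left: "f \<in> ar C \<Longrightarrow> cmp C (idn C (tgt C f)) f = f"
    and cmp_assoc: "\<lbrakk>f \<in> ar C; g \<in> ar C; h \<in> ar C; src C g = tgt C f; src C h = tgt C g\<rbrakk> \<Longrightarrow>
      cmp C h (cmp C g f) = cmp C (cmp C h g) f"

definition isomorphism_in :: "('o, 'm) category \<Rightarrow> 'm \<Rightarrow> bool" where
  "isomorphism_in C k \<longleftrightarrow> k \<in> ar C \<and>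
    (\<exists>g\<in>ar C. src C g = tgt C k \<and> tgt C g = src C k \<and>
      cmp C g k = idn C (src C k) \<and> cmp C k g = idn C (tgt C k))"

record ('o, 'm, 'p, 'q) funct =
  on_ob :: "'o \<Rightarrow> 'p"
  on_ar :: "'m \<Rightarrow> 'q"

definition is_functor ::
    "('o, 'm) category \<Rightarrow> ('p, 'q) category \<Rightarrow> ('o, 'm, 'p, 'q) funct \<Rightarrow> bool" where
  "is_functor C D U \<longleftrightarrow>
    (\<forall>x\<in>ob C. on_ob U x \<in> ob D \<and> on_ar U (idn C x) = idn D (on_ob U x)) \<and>
    (\<forall>f\<in>ar C. on_ar U f \<in> ar D \<and> src D (on_ar U f) = on_ob U (src C f) \<and>
      tgt D (on_ar U f) = on_ob U (tgt C f)) \<and>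
    (\<forall>f\<in>ar C. \<forall>g\<in>ar C. src C g = tgt C f \<longrightarrow>
      on_ar U (cmp C g f) = cmp D (on_ar U g) (on_ar U f))"

definition cartesian ::
    "('o, 'm) category \<Rightarrow> ('p, 'q) category \<Rightarrow> ('o, 'm, 'p, 'q) funct \<Rightarrow> 'm \<Rightarrow> bool" where
  "cartesian C D U h \<longleftrightarrow> h \<in> ar C \<and>
    (\<forall>f\<in>ar C. \<forall>g\<in>ar D. tgt C f = tgt C h \<and>
      src D g = on_ob U (src C f) \<and> tgt D g = on_ob U (src C h) \<and>
      cmp D (on_ar U h) g = on_ar U f \<longrightarrow>
      (\<exists>!k. k \<in> ar C \<and> src C k = src C f \<and> tgt C k = src C h \<and>
        cmp C h k = f \<and> on_ar U k = g))"

definition arrows_to :: "('o, 'm) category \<Rightarrow> 'o \<Rightarrow> 'm set" where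
  "arrows_to C x = {f \<in> ar C. tgt C f = x}"

definition sieve :: "('o, 'm) category \<Rightarrow> 'o \<Rightarrow> 'm set \<Rightarrow> bool" where
  "sieve C x R \<longleftrightarrow> R \<subseteq> arrows_to C x \<and>
    (\<forall>f\<in>R. \<forall>g\<in>ar C. tgt C g = src C f \<longrightarrow> cmp C f g \<in> R)"

definition generated_sieve :: "('o, 'm) category \<Rightarrow> 'm set \<Rightarrow> 'm set" where
  "generated_sieve C P = {cmp C p g | p g. p \<in> P \<and> g \<in> ar C \<and> tgt C g = src C p}"

definition pullback_sieve :: "('o, 'm) category \<Rightarrow> 'm \<Rightarrow> 'm set \<Rightarrow> 'm set" where
  "pullback_sieve C f R = {g \<in> ar C. tgt C g = src C f \<and> cmp C f g \<in> R}"

definition coverage :: "('o, 'm) category \<Rightarrow> ('o \<Rightarrow> 'm set set) \<Rightarrow> bool" where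
  "coverage C K \<longleftrightarrow> (\<forall>x\<in>ob C. \<forall>P\<in>K x. P \<subseteq> arrows_to C x \<and>
    (\<forall>g\<in>arrows_to C x. \<exists>Q\<in>K (src C g). \<forall>q\<in>Q. \<exists>p\<in>P. \<exists>k\<in>ar C.
      src C k = src C q \<and> tgt C k = src C p \<and> cmp C g q = cmp C p k))"

text \<open>The covering sieves of the Grothendieck topology generated by a coverage.\<close>

inductive covering_sieve ::
    "('o, 'm) category \<Rightarrow> ('o \<Rightarrow> 'm set set) \<Rightarrow> 'o \<Rightarrow> 'm set \<Rightarrow> bool"
  for C :: "('o, 'm) category" and K :: "'o \<Rightarrow> 'm set set" where
  generating: "\<lbrakk>x \<in> ob C; P \<in> K x\<rbrakk> \<Longrightarrow> covering_sieve C K x (generated_sieve C P)"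
| maximal: "x \<in> ob C \<Longrightarrow> covering_sieve C K x (arrows_to C x)"
| stability: "\<lbrakk>covering_sieve C K x R; f \<in> arrows_to C x\<rbrakk> \<Longrightarrow>
    covering_sieve C K (src C f) (pullback_sieve C f R)"
| local_character: "\<lbrakk>covering_sieve C K x R; sieve C x T;
    \<And>f. f \<in> R \<Longrightarrow> covering_sieve C K (src C f) (pullback_sieve C f T)\<rbrakk> \<Longrightarrow>
    covering_sieve C K x T"

definition covering_family ::
    "('o, 'm) category \<Rightarrow> ('o \<Rightarrow> 'm set set) \<Rightarrow> 'o \<Rightarrow> 'm set \<Rightarrow> bool" where
  "covering_family C K x P \<longleftrightarrow>
    x \<in> ob C \<and> P \<subseteq> arrows_to C x \<and> covering_sieve C K x (generated_sieve C P)"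


section \<open>The category of locales and numerable covers\<close>

definition frame :: "'a gorder \<Rightarrow> bool" where
  "frame X \<longleftrightarrow> complete_lattice X \<and>
    (\<forall>a\<in>carrier X. \<forall>B\<subseteq>carrier X.
      a \<sqinter>\<^bsub>X\<^esub> (\<Squnion>\<^bsub>X\<^esub> B) = \<Squnion>\<^bsub>X\<^esub> ((\<lambda>b. a \<sqinter>\<^bsub>X\<^esub> b) ` B))"

text \<open>The homomorphism points against the morphism of locales: morphisms \<open>Y \<rightarrow> X\<close> of locales are
  frame homomorphisms \<open>X \<rightarrow> Y\<close>.\<close>

definition frame_hom :: "'a gorder \<Rightarrow> 'b gorder \<Rightarrow> ('a \<Rightarrow> 'b) \<Rightarrow> bool" where
  "frame_hom X Y h \<longleftrightarrow> h \<in> carrier X \<rightarrow>\<^sub>E carrier Y \<and>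
    h \<top>\<^bsub>X\<^esub> = \<top>\<^bsub>Y\<^esub> \<and>
    (\<forall>a\<in>carrier X. \<forall>b\<in>carrier X. h (a \<sqinter>\<^bsub>X\<^esub> b) = h a \<sqinter>\<^bsub>Y\<^esub> h b) \<and>
    (\<forall>B\<subseteq>carrier X. h (\<Squnion>\<^bsub>X\<^esub> B) = \<Squnion>\<^bsub>Y\<^esub> (h ` B))"

datatype ('o, 'f) arrow = Arrow (arr_src: 'o) (arr_tgt: 'o) (arr_map: 'f)

text \<open>Requiring the order to be false outside the carrier makes equality of locales as records the
  same as equality of posets.\<close>

definition Loc :: "('a gorder, ('a gorder, 'a \<Rightarrow> 'a) arrow) category" where
  "Loc =
    (let obs = {X. frame X \<and> (\<forall>x y. x \<sqsubseteq>\<^bsub>X\<^esub> y \<longrightarrow> x \<in> carrier X \<and> y \<in> carrier X)}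
     in \<lparr>ob = obs,
         ar = {f. arr_src f \<in> obs \<and> arr_tgt f \<in> obs \<and>
                  frame_hom (arr_tgt f) (arr_src f) (arr_map f)},
         src = arr_src,
         tgt = arr_tgt,
         idn = (\<lambda>X. Arrow X X (\<lambda>x\<in>carrier X. x)),
         cmp = (\<lambda>g f. Arrow (arr_src f) (arr_tgt g)
                  (compose (carrier (arr_tgt g)) (arr_map f) (arr_map g)))\<rparr>)"

definition open_sublocale :: "'a gorder \<Rightarrow> 'a \<Rightarrow> 'a gorder" where
  "open_sublocale X u =
    \<lparr>carrier = {x \<in> carrier X. x \<sqsubseteq>\<^bsub>X\<^esub> u}, eq = (=), le = (\<lambda>x y. x \<sqsubseteq>\<^bsub>X\<^esub> y \<and> y \<sqsubseteq>\<^bsub>X\<^esub> u)\<rparr>"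

definition open_inclusion :: "'a gorder \<Rightarrow> 'a \<Rightarrow> ('a gorder, 'a \<Rightarrow> 'a) arrow" where
  "open_inclusion X u = Arrow (open_sublocale X u) X (\<lambda>x\<in>carrier X. u \<sqinter>\<^bsub>X\<^esub> x)"

definition open_embedding_onto :: "('a gorder, 'a \<Rightarrow> 'a) arrow \<Rightarrow> 'a \<Rightarrow> bool" where
  "open_embedding_onto h u \<longleftrightarrow> h \<in> ar Loc \<and> u \<in> carrier (tgt Loc h) \<and>
    (\<exists>k. isomorphism_in Loc k \<and> tgt Loc k = open_sublocale (tgt Loc h) u \<and>
      h = cmp Loc (open_inclusion (tgt Loc h) u) k)"

definition open_embedding :: "('a gorder, 'a \<Rightarrow> 'a) arrow \<Rightarrow> bool" where
  "open_embedding h \<longleftrightarrow> (\<exists>u. open_embedding_onto h u)"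

text \<open>The image is unique: it is the least open whose pullback along the embedding is the top
  element.\<close>

definition image_open :: "('a gorder, 'a \<Rightarrow> 'a) arrow \<Rightarrow> 'a" where
  "image_open h = (THE u. open_embedding_onto h u)"

text \<open>The locale \<open>[0,\<infinity>)\<close>.\<close>

definition half_line :: "real set gorder" where
  "half_line = \<lparr>carrier = {W. openin (top_of_set {0..}) W}, eq = (=), le = (\<subseteq>)\<rparr>"

text \<open>The preimage of the open \<open>W\<close> under the sum of the finitely many functions \<open>f i : X \<rightarrow> [0,\<infinity>)\<close>
  with \<open>i \<in> J\<close>, i.e., under \<open>X \<rightarrow> [0,\<infinity>)\<^sup>J \<rightarrow> [0,\<infinity>)\<close>: the preimage of \<open>W\<close> under addition is the union
  of the open boxes that it contains.\<close>

definition finite_sum :: "'a gorder \<Rightarrow> 'i set \<Rightarrow> ('i \<Rightarrow> real set \<Rightarrow> 'a) \<Rightarrow> real set \<Rightarrow> 'a" where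
  "finite_sum X J f W =
    \<Squnion>\<^bsub>X\<^esub> {\<Sqinter>\<^bsub>X\<^esub> ((\<lambda>i. f i (A i)) ` J) | A.
      (\<forall>i\<in>J. A i \<in> carrier half_line) \<and> (\<forall>t. (\<forall>i\<in>J. t i \<in> A i) \<longrightarrow> (\<Sum>i\<in>J. t i) \<in> W)}"

text \<open>The morphism \<open>s : X \<rightarrow> [0,\<infinity>)\<close> is the sum of a family of nonnegative functions if it is the
  (pointwise) supremum of the finite partial sums, i.e., if \<open>{s > c}\<close> is the union of the opens
  \<open>{(\<Sum>i\<in>J. f i) > c}\<close>.  The sum exists if this supremum is finite and continuous.  This is not the
  supremum in the poset of continuous functions, which is a weaker notion.\<close>

definition is_sum :: "'a gorder \<Rightarrow> 'i set \<Rightarrow> ('i \<Rightarrow> real set \<Rightarrow> 'a) \<Rightarrow> (real set \<Rightarrow> 'a) \<Rightarrow> bool" where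
  "is_sum X I f s \<longleftrightarrow> frame_hom half_line X s \<and>
    (\<forall>c::real. s ({0..} \<inter> {c<..}) =
      \<Squnion>\<^bsub>X\<^esub> {finite_sum X J f ({0..} \<inter> {c<..}) | J. finite J \<and> J \<subseteq> I})"

definition numerable_cover :: "'a gorder \<Rightarrow> 'i set \<Rightarrow> ('i \<Rightarrow> 'a) \<Rightarrow> bool" where
  "numerable_cover X I V \<longleftrightarrow> V ` I \<subseteq> carrier X \<and> \<Squnion>\<^bsub>X\<^esub> (V ` I) = \<top>\<^bsub>X\<^esub> \<and>
    (\<exists>f s. (\<forall>i\<in>I. frame_hom half_line X (f i)) \<and> is_sum X I f s \<and>
      s {0<..} = \<top>\<^bsub>X\<^esub> \<and> (\<forall>i\<in>I. f i {0<..} \<sqsubseteq>\<^bsub>X\<^esub> V i))"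

text \<open>Opens of \<open>X\<close> suffice as indices: a family of opens is a numerable cover if and only if the set
  of its members is one, and both generate the same sieve.\<close>

definition numerable_coverage :: "'a gorder \<Rightarrow> ('a gorder, 'a \<Rightarrow> 'a) arrow set set" where
  "numerable_coverage X =
    {(\<lambda>i. open_inclusion X (V i)) ` I | (I :: 'a set) V. numerable_cover X I V}"


section \<open>Numerable sites\<close>

locale numerable_site = category S
  for S :: "('o, 'm) category"
    and K :: "'o \<Rightarrow> 'm set set"
    and U :: "('o, 'm, 'a gorder, ('a gorder, 'a \<Rightarrow> 'a) arrow) funct" +
  assumes coverage: "coverage S K"
    and functor_to_Loc: "is_functor S Loc U"
    and cartesian_lifts: "\<lbrakk>Z \<in> ob S; open_embedding h; tgt Loc h = on_ob U Z\<rbrakk> \<Longrightarrow>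
      \<exists>k. cartesian S Loc U k \<and> tgt S k = Z \<and> on_ar U k = h"
    and creates_covering_families: "\<lbrakk>M \<in> ob S; P \<subseteq> arrows_to S M\<rbrakk> \<Longrightarrow>
      covering_family S K M P \<longleftrightarrow>
      covering_family Loc numerable_coverage (on_ob U M) (on_ar U ` P)"

definition open_covering_family ::
    "('o, 'm) category \<Rightarrow> ('o \<Rightarrow> 'm set set) \<Rightarrow>
     ('o, 'm, 'a gorder, ('a gorder, 'a \<Rightarrow> 'a) arrow) funct \<Rightarrow>
     'o \<Rightarrow> 'i set \<Rightarrow> ('i \<Rightarrow> 'm) \<Rightarrow> bool" where
  "open_covering_family S K U M I p \<longleftrightarrow> covering_family S K M (p ` I) \<and>
    (\<forall>i\<in>I. cartesian S Loc U (p i) \<and> open_embedding (on_ar U (p i)))"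

text \<open>The arrow \<open>w\<close> to \<open>M\<close> is an intersection of the arrows to \<open>M\<close> in \<open>Q\<close>.  Intersections are
  unique up to a unique isomorphism over \<open>M\<close>; below, all choices are considered.\<close>

definition is_intersection ::
    "('o, 'm) category \<Rightarrow> ('o, 'm, 'a gorder, ('a gorder, 'a \<Rightarrow> 'a) arrow) funct \<Rightarrow>
     'o \<Rightarrow> 'm set \<Rightarrow> 'm \<Rightarrow> bool" where
  "is_intersection S U M Q w \<longleftrightarrow> cartesian S Loc U w \<and> tgt S w = M \<and>
    on_ar U w = open_inclusion (on_ob U M)
      (\<Sqinter>\<^bsub>on_ob U M\<^esub> ((\<lambda>q. image_open (on_ar U q)) ` Q))"

text \<open>The induced map over \<open>M\<close> from the source of \<open>w\<close> to the source of \<open>p\<close>.  It is unique if \<open>p\<close> is a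
  cartesian lift of an open embedding, because open embeddings are monomorphisms.\<close>

definition induced :: "('o, 'm) category \<Rightarrow> 'm \<Rightarrow> 'm \<Rightarrow> 'm" where
  "induced S p w =
    (THE a. a \<in> ar S \<and> src S a = src S w \<and> tgt S a = src S p \<and> cmp S p a = w)"


section \<open>Cochain complexes and presheaves\<close>

text \<open>Abelian groups are written multiplicatively, as in HOL-Algebra.\<close>

record 'v cochain =
  grp :: "int \<Rightarrow> 'v monoid"
  dif :: "int \<Rightarrow> 'v \<Rightarrow> 'v"

definition cochain_complex :: "'v cochain \<Rightarrow> bool" where
  "cochain_complex A \<longleftrightarrow> (\<forall>n. comm_group (grp A n) \<and> dif A n \<in> hom (grp A n) (grp A (n + 1)) \<and>
    (\<forall>x\<in>carrier (grp A n). dif A (n + 1) (dif A n x) = \<one>\<^bsub>grp A (n + 1 + 1)\<^esub>))"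

definition cochain_map :: "'v cochain \<Rightarrow> 'w cochain \<Rightarrow> (int \<Rightarrow> 'v \<Rightarrow> 'w) \<Rightarrow> bool" where
  "cochain_map A B h \<longleftrightarrow> (\<forall>n. h n \<in> hom (grp A n) (grp B n) \<and>
    (\<forall>x\<in>carrier (grp A n). h (n + 1) (dif A n x) = dif B n (h n x)))"

definition cocycles :: "'v cochain \<Rightarrow> int \<Rightarrow> 'v set" where
  "cocycles A n = kernel (grp A n) (grp A (n + 1)) (dif A n)"

definition coboundaries :: "'v cochain \<Rightarrow> int \<Rightarrow> 'v set" where
  "coboundaries A n = dif A (n - 1) ` carrier (grp A (n - 1))"

definition cohomology :: "'v cochain \<Rightarrow> int \<Rightarrow> 'v set monoid" where
  "cohomology A n = ((grp A n)\<lparr>carrier := cocycles A n\<rparr>) Mod coboundaries A n"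

text \<open>Maps the class of \<open>x\<close> to the class of \<open>h n x\<close>.\<close>

definition cohomology_map ::
    "'v cochain \<Rightarrow> 'w cochain \<Rightarrow> (int \<Rightarrow> 'v \<Rightarrow> 'w) \<Rightarrow> int \<Rightarrow> 'v set \<Rightarrow> 'w set" where
  "cohomology_map A B h n c = coboundaries B n <#>\<^bsub>grp B n\<^esub> h n ` c"

definition quasi_isomorphism :: "'v cochain \<Rightarrow> 'w cochain \<Rightarrow> (int \<Rightarrow> 'v \<Rightarrow> 'w) \<Rightarrow> bool" where
  "quasi_isomorphism A B h \<longleftrightarrow> cochain_complex A \<and> cochain_complex B \<and> cochain_map A B h \<and>
    (\<forall>n. cohomology_map A B h n \<in> iso (cohomology A n) (cohomology B n))"

definition cochain_presheaf ::
    "('o, 'm) category \<Rightarrow> ('o, 'm, 'v cochain, int \<Rightarrow> 'v \<Rightarrow> 'v) funct \<Rightarrow> bool" where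
  "cochain_presheaf S F \<longleftrightarrow>
    (\<forall>M\<in>ob S. cochain_complex (on_ob F M)) \<and>
    (\<forall>f\<in>ar S. cochain_map (on_ob F (tgt S f)) (on_ob F (src S f)) (on_ar F f)) \<and>
    (\<forall>M\<in>ob S. \<forall>n. \<forall>x\<in>carrier (grp (on_ob F M) n). on_ar F (idn S M) n x = x) \<and>
    (\<forall>f\<in>ar S. \<forall>g\<in>ar S. src S g = tgt S f \<longrightarrow>
      (\<forall>n. \<forall>x\<in>carrier (grp (on_ob F (tgt S g)) n).
        on_ar F (cmp S g f) n x = on_ar F f n (on_ar F g n x)))"

definition degree_presheaf ::
    "('o, 'm, 'v cochain, int \<Rightarrow> 'v \<Rightarrow> 'v) funct \<Rightarrow> int \<Rightarrow> ('o, 'm, 'v monoid, 'v \<Rightarrow> 'v) funct" where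
  "degree_presheaf F n = \<lparr>on_ob = (\<lambda>M. grp (on_ob F M) n), on_ar = (\<lambda>f. on_ar F f n)\<rparr>"

text \<open>For the sheaf condition, families indexed by sets of arrows suffice, since every covering family
  can be replaced by the set of its members.\<close>

definition is_sheaf ::
    "('o, 'm) category \<Rightarrow> ('o \<Rightarrow> 'm set set) \<Rightarrow>
     ('o, 'm, 'a gorder, ('a gorder, 'a \<Rightarrow> 'a) arrow) funct \<Rightarrow>
     ('o, 'm, 'v monoid, 'v \<Rightarrow> 'v) funct \<Rightarrow> bool" where
  "is_sheaf S K U G \<longleftrightarrow> (\<forall>M (I :: 'm set) p. open_covering_family S K U M I p \<longrightarrow>
    (\<forall>s. (\<forall>i\<in>I. s i \<in> carrier (on_ob G (src S (p i)))) \<and>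
      (\<forall>i\<in>I. \<forall>j\<in>I. \<forall>w. is_intersection S U M {p i, p j} w \<longrightarrow>
        on_ar G (induced S (p i) w) (s i) = on_ar G (induced S (p j) w) (s j)) \<longrightarrow>
      (\<exists>!t. t \<in> carrier (on_ob G M) \<and> (\<forall>i\<in>I. on_ar G (p i) t = s i))))"

definition differences_surjective ::
    "('o, 'm) category \<Rightarrow> ('o \<Rightarrow> 'm set set) \<Rightarrow>
     ('o, 'm, 'a gorder, ('a gorder, 'a \<Rightarrow> 'a) arrow) funct \<Rightarrow>
     ('o, 'm, 'v monoid, 'v \<Rightarrow> 'v) funct \<Rightarrow> bool" where
  "differences_surjective S K U G \<longleftrightarrow>
    (\<forall>M p q w. open_covering_family S K U M {p, q} (\<lambda>r. r) \<and> is_intersection S U M {p, q} w \<longrightarrow>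
      (\<lambda>(u, v). on_ar G (induced S p w) u
          \<otimes>\<^bsub>on_ob G (src S w)\<^esub> inv\<^bsub>on_ob G (src S w)\<^esub> (on_ar G (induced S q w) v))
        ` (carrier (on_ob G (src S p)) \<times> carrier (on_ob G (src S q)))
      = carrier (on_ob G (src S w)))"


section \<open>Homotopy limits of cochain complexes\<close>

text \<open>The homotopy limit of a diagram \<open>D : C \<rightarrow> coCh\<close> is given by the Bousfield--Kan formula, i.e., it is
  the product total complex of the cosimplicial replacement, whose \<open>n\<close>th term is the product of
  \<open>D c\<^sub>n\<close> over all strings of arrows \<open>c\<^sub>0 \<rightarrow> \<dots> \<rightarrow> c\<^sub>n\<close> (all cochain complexes are fibrant).  A string
  is represented by \<open>c\<^sub>0\<close> and the list of its arrows.\<close>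

fun composable :: "('c, 'k) category \<Rightarrow> 'c \<Rightarrow> 'k list \<Rightarrow> bool" where
  "composable C c [] \<longleftrightarrow> c \<in> ob C"
| "composable C c (f # fs) \<longleftrightarrow> f \<in> ar C \<and> src C f = c \<and> composable C (tgt C f) fs"

definition strings :: "('c, 'k) category \<Rightarrow> ('c \<times> 'k list) set" where
  "strings C = {(c, fs). composable C c fs}"

definition last_ob :: "('c, 'k) category \<Rightarrow> 'c \<times> 'k list \<Rightarrow> 'c" where
  "last_ob C = (\<lambda>(c, fs). if fs = [] then c else tgt C (last fs))"

definition face :: "('c, 'k) category \<Rightarrow> nat \<Rightarrow> 'c \<times> 'k list \<Rightarrow> 'c \<times> 'k list" where
  "face C i = (\<lambda>(c, fs).
    if i = 0 then (tgt C (hd fs), tl fs)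
    else if i = length fs then (c, butlast fs)
    else (c, take (i - 1) fs @ cmp C (fs ! i) (fs ! (i - 1)) # drop (i + 1) fs))"

text \<open>The component at the string \<open>\<sigma>\<close> of the \<open>i\<close>th coface of \<open>x\<close>, where \<open>x\<close> has total degree \<open>k\<close>.\<close>

definition coface ::
    "('c, 'k) category \<Rightarrow> ('c, 'k, 'v cochain, int \<Rightarrow> 'v \<Rightarrow> 'v) funct \<Rightarrow>
     int \<Rightarrow> ('c \<times> 'k list \<Rightarrow> 'v) \<Rightarrow> 'c \<times> 'k list \<Rightarrow> nat \<Rightarrow> 'v" where
  "coface C D k x \<sigma> i =
    (let n = length (snd \<sigma>)
     in if i = n then on_ar D (last (snd \<sigma>)) (k + 1 - int n) (x (face C n \<sigma>))
        else x (face C i \<sigma>))"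

text \<open>In additive notation, the differential is
  \<open>(d x) \<sigma> = (\<Sum>i\<le>n. (-1)\<^sup>i (d\<^sup>i x) \<sigma>) + (-1)\<^sup>n d (x \<sigma>)\<close> for a string \<open>\<sigma>\<close> of \<open>n\<close> arrows,
  where the first summand is absent for \<open>n = 0\<close>.\<close>

definition holim ::
    "('c, 'k) category \<Rightarrow> ('c, 'k, 'v cochain, int \<Rightarrow> 'v \<Rightarrow> 'v) funct \<Rightarrow>
     ('c \<times> 'k list \<Rightarrow> 'v) cochain" where
  "holim C D =
    \<lparr>grp = (\<lambda>k. product_group (strings C)
        (\<lambda>\<sigma>. grp (on_ob D (last_ob C \<sigma>)) (k - int (length (snd \<sigma>))))),
     dif = (\<lambda>k x. \<lambda>\<sigma>\<in>strings C.
        let n = length (snd \<sigma>);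
            A = on_ob D (last_ob C \<sigma>);
            G = grp A (k + 1 - int n)
        in finprod G (\<lambda>i. coface C D k x \<sigma> i [^]\<^bsub>G\<^esub> ((-1) ^ i :: int)) (if n = 0 then {} else {..n})
           \<otimes>\<^bsub>G\<^esub> dif A (k - int n) (x \<sigma>) [^]\<^bsub>G\<^esub> ((-1) ^ n :: int))\<rparr>"

text \<open>The canonical map to the homotopy limit induced by a cone of cochain maps \<open>e c\<close> to \<open>D c\<close>.\<close>

definition to_holim ::
    "('c, 'k) category \<Rightarrow> ('c, 'k, 'v cochain, int \<Rightarrow> 'v \<Rightarrow> 'v) funct \<Rightarrow>
     ('c \<Rightarrow> int \<Rightarrow> 'w \<Rightarrow> 'v) \<Rightarrow> int \<Rightarrow> 'w \<Rightarrow> ('c \<times> 'k list \<Rightarrow> 'v)" where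
  "to_holim C D e k a = (\<lambda>\<sigma>\<in>strings C.
    if snd \<sigma> = [] then e (fst \<sigma>) k a
    else \<one>\<^bsub>grp (on_ob D (last_ob C \<sigma>)) (k - int (length (snd \<sigma>)))\<^esub>)"


section \<open>The \v{C}ech cosimplicial diagram and homotopy descent\<close>

text \<open>The number \<open>m\<close> stands for the ordinal \<open>[m] = {0, \<dots>, m}\<close>.\<close>

definition simplex_category :: "(nat, (nat, nat \<Rightarrow> nat) arrow) category" where
  "simplex_category =
    \<lparr>ob = UNIV,
     ar = {f. arr_map f \<in> {..arr_src f} \<rightarrow>\<^sub>E {..arr_tgt f} \<and> mono_on {..arr_src f} (arr_map f)},
     src = arr_src,
     tgt = arr_tgt,
     idn = (\<lambda>m. Arrow m m (\<lambda>k\<in>{..m}. k)),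
     cmp = (\<lambda>g f. Arrow (arr_src f) (arr_tgt g) (compose {..arr_src f} (arr_map g) (arr_map f)))\<rparr>"

definition words :: "'i set \<Rightarrow> nat \<Rightarrow> 'i list set" where
  "words I m = {s. length s = Suc m \<and> set s \<subseteq> I}"

definition subword :: "(nat, nat \<Rightarrow> nat) arrow \<Rightarrow> 'i list \<Rightarrow> 'i list" where
  "subword \<theta> s = map (\<lambda>k. s ! arr_map \<theta> k) [0..<Suc (arr_src \<theta>)]"

text \<open>A choice of the multiple intersections of a family, as arrows to \<open>M\<close>; the onefold ones are the
  given arrows.\<close>

definition intersections ::
    "('o, 'm) category \<Rightarrow> ('o, 'm, 'a gorder, ('a gorder, 'a \<Rightarrow> 'a) arrow) funct \<Rightarrow>
     'o \<Rightarrow> 'i set \<Rightarrow> ('i \<Rightarrow> 'm) \<Rightarrow> ('i list \<Rightarrow> 'm) \<Rightarrow> bool" where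
  "intersections S U M I p N \<longleftrightarrow>
    (\<forall>i\<in>I. N [i] = p i) \<and>
    (\<forall>m>0. \<forall>s\<in>words I m. is_intersection S U M (p ` set s) (N s))"

definition cech ::
    "('o, 'm) category \<Rightarrow> ('o, 'm, 'v cochain, int \<Rightarrow> 'v \<Rightarrow> 'v) funct \<Rightarrow> 'i set \<Rightarrow> ('i list \<Rightarrow> 'm) \<Rightarrow>
     (nat, (nat, nat \<Rightarrow> nat) arrow, ('i list \<Rightarrow> 'v) cochain,
      int \<Rightarrow> ('i list \<Rightarrow> 'v) \<Rightarrow> ('i list \<Rightarrow> 'v)) funct" where
  "cech S F I N =
    \<lparr>on_ob = (\<lambda>m.
       \<lparr>grp = (\<lambda>n. product_group (words I m) (\<lambda>s. grp (on_ob F (src S (N s))) n)),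
        dif = (\<lambda>n x. \<lambda>s\<in>words I m. dif (on_ob F (src S (N s))) n (x s))\<rparr>),
     on_ar = (\<lambda>\<theta> n x. \<lambda>s\<in>words I (arr_tgt \<theta>).
       on_ar F (induced S (N (subword \<theta> s)) (N s)) n (x (subword \<theta> s)))\<rparr>"

definition cech_cone ::
    "('o, 'm, 'v cochain, int \<Rightarrow> 'v \<Rightarrow> 'v) funct \<Rightarrow> 'i set \<Rightarrow> ('i list \<Rightarrow> 'm) \<Rightarrow>
     nat \<Rightarrow> int \<Rightarrow> 'v \<Rightarrow> ('i list \<Rightarrow> 'v)" where
  "cech_cone F I N m n a = (\<lambda>s\<in>words I m. on_ar F (N s) n a)"

text \<open>The type argument is the type of the indices of the covering families.\<close>

definition homotopy_descent ::
    "'i itself \<Rightarrow> ('o, 'm) category \<Rightarrow> ('o \<Rightarrow> 'm set set) \<Rightarrow>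
     ('o, 'm, 'a gorder, ('a gorder, 'a \<Rightarrow> 'a) arrow) funct \<Rightarrow>
     ('o, 'm, 'v cochain, int \<Rightarrow> 'v \<Rightarrow> 'v) funct \<Rightarrow> bool" where
  "homotopy_descent TYPE('i) S K U F \<longleftrightarrow>
    (\<forall>M (I :: 'i set) p N. open_covering_family S K U M I p \<and> intersections S U M I p N \<longrightarrow>
      quasi_isomorphism (on_ob F M) (holim simplex_category (cech S F I N))
        (to_holim simplex_category (cech S F I N) (cech_cone F I N)))"

end

theory Submission
 imports Defs "HOL-Algebra.Free_Abelian_Groups"
begin

text \<open>Compare the complex \<open>F(W)\<close> with the homotopy limit of the \v{C}ech diagram restricted to \<open>W\<close>, for all opens
 \<open>W\<close> of \<open>M\<close> at once, and call \<open>W\<close> good if the mapping cone of the comparison map is exact over every open below \<open>W\<close>.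
 An open below a member of the cover is good, because there the \v{C}ech diagram has an extra degeneracy, which contracts the
 homotopy limit.  In every degree the mapping cones form a product of sheaves of the given kind, i.e., they have unique gluing
 and all sections over an intersection are differences.  Hence good opens are stable under unions of two opens defined by
 functions to the half line (Mayer--Vietoris) and under disjoint unions.  The whole complex is treated at once, since
 row-wise exactness does not suffice for unbounded complexes and product totalizations.  A class of opens with these closure
 properties that contains a numerable cover contains the top: \<open>X\<close> is the union of the open shells on which a partial sum lies
 in a bounded interval, and the shells of even (odd) index are disjoint.\<close>

text \<open>The closure properties only join two opens or a disjoint family, whereas a numerable
  cover may involve infinitely many functions at once. The bridge is the \<open>n\<close>-th largest
  function of the family: the open where exactly \<open>n\<close> functions exceed a threshold is a
  disjoint union indexed by the \<open>n\<close>-element sets of functions, each piece lying in a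
  single member, and an induction on \<open>n\<close> combines these opens. Since a locale may lack
  points, this function cannot be given by values; it is built by a Urysohn-type construction from
  the opens where at least \<open>n\<close> functions exceed \<open>t\<close>. Its continuity rests
  on the existence of the sum, which makes all but finitely many functions small locally. Goodness
  is required below each open because the Mayer--Vietoris step also needs exactness on the
  intersection. The alternating sums of the homotopy limit live in a different group for every
  string, and these groups are carriers, not types. They are therefore manipulated in the free
  abelian group on the whole type of values and then evaluated.\<close>

section \<open>Alternating sums over strings of arrows and their homotopies, with values in one
  abelian group\<close>

fun bar_merge :: "('k => 'k => 'k) => ('k => 'b => 'b) => ('k list => 'b) => 'k => 'k list => 'b" where
 "bar_merge cm act x f [] = act f (x [])"
| "bar_merge cm act x f (g # l) = x (cm g f # l)"

text \<open>The alternating sum of the cofaces of index at least 1. Peeling off the first arrow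
  turns coface \<open>i + 1\<close> into coface \<open>i\<close> of the remaining string, which
  accounts for the sign of the recursive call. \<open>bar_merge\<close> is the coface of index 1; on
  a string of one arrow it is the last coface, where the arrow acts on the value.\<close>

fun bar_tail :: "('k => 'k => 'k) => ('k => 'b => 'b) => ('k list => 'b::ab_group_add) => 'k list => 'b" where
 "bar_tail cm act x [] = 0"
| "bar_tail cm act x (f # l) = - bar_merge cm act x f l - bar_tail cm act (%l. x (f # l)) l"

text \<open>Coface 0 drops the first arrow and so changes the initial object; it is kept apart from
  \<open>bar_tail\<close>, in which the initial object is fixed. A string without arrows has no
  faces, whence the value 0.\<close>

fun bar :: "('c, 'k) category => ('k => 'b => 'b) => ('c => 'k list => 'b::ab_group_add) => 'c => 'k list => 'b" where
 "bar C act x c [] = 0"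
| "bar C act x c (f # l) = x (tgt C f) l + bar_tail (cmp C) act (x c) (f # l)"

text \<open>Over a string \<open>f1, ..., fn\<close> this is the sum over \<open>i\<close> of
  \<open>(-1)^i\<close> times \<open>x\<close> at
  \<open>f1, ..., fi, \<eta>, T f(i+1), ..., T fn\<close>: the usual decomposition of a prism, i.e.,
  the homotopy induced by a natural transformation from the identity to \<open>T\<close>.\<close>

fun prism :: "('c, 'k) category => ('k => 'k) => ('c => 'k) => ('k list => 'b::ab_group_add) => 'c => 'k list => 'b" where
 "prism C T \<eta> x c [] = x [\<eta> c]"
| "prism C T \<eta> x c (f # l) = x (\<eta> c # map T (f # l)) - prism C T \<eta> (%l. x (f # l)) (tgt C f) l"

text \<open>All values lie in one abelian group, whatever the object. Additivity is required for
  every \<open>f\<close>, compatibility with composition for composable arrows;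
  \<open>push_arrow\<close> below has exactly these properties.\<close>

definition additive_action :: "('c, 'k) category => ('k => 'b::ab_group_add => 'b) => bool" where
 "additive_action C act \<longleftrightarrow> (\<forall>f a b. act f (a + b) = act f a + act f b) &
  (\<forall>f\<in>ar C. \<forall>g\<in>ar C. src C g = tgt C f --> (\<forall>a. act (cmp C g f) a = act g (act f a)))"

lemma additive_action_minus:
 assumes "additive_action C act"
 shows "act f (- a) = - act f (a :: 'b::ab_group_add)"
proof -
 have "act f (0 + 0) = act f 0 + act f 0" using assms unfolding additive_action_def by blast
 hence "act f 0 = 0" by simp
 moreover have "act f (a + - a) = act f a + act f (- a)" using assms unfolding additive_action_def by blast
 ultimately show ?thesis by (simp add: eq_neg_iff_add_eq_0 add.commute)
qed

lemma additive_action_zero: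
 assumes "additive_action C act"
 shows "act f 0 = (0 :: 'b::ab_group_add)"
 using additive_action_minus[OF assms, of f 0] assms
 by (metis add_cancel_right_left additive_action_def add.right_neutral)

lemma bar_merge_add:
 assumes "additive_action C act"
 shows "bar_merge cm act (%l. x l + y l) f l = bar_merge cm act x f l + bar_merge cm act y f l"
 using assms by (cases l) (auto simp: additive_action_def)

lemma bar_tail_add:
 assumes "additive_action C act"
 shows "bar_tail cm act (%l. x l + y l) l = bar_tail cm act x l + bar_tail cm act y l"
 by (induction l arbitrary: x y) (auto simp: bar_merge_add[OF assms] algebra_simps)

lemma bar_add:
 assumes "additive_action C act"
 shows "bar C act (%c l. x c l + y c l) c l = bar C act x c l + bar C act y c l"
 by (cases l) (auto simp del: bar_tail.simps simp: bar_tail_add[OF assms])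

lemma bar_merge_minus:
 assumes "additive_action C act"
 shows "bar_merge cm act (%l. - x l) f l = - bar_merge cm act x f l"
 by (cases l) (auto simp: additive_action_minus[OF assms])

lemma bar_tail_minus:
 assumes "additive_action C act"
 shows "bar_tail cm act (%l. - x l) l = - bar_tail cm act x l"
 by (induction l arbitrary: x) (auto simp: bar_merge_minus[OF assms])

lemma prism_add: "prism C T \<eta> (%l. x l + y l) c l = prism C T \<eta> x c l + prism C T \<eta> y c l"
 by (induction l arbitrary: x y c) (auto simp: algebra_simps)

lemma prism_minus: "prism C T \<eta> (%l. - x l) c l = - prism C T \<eta> x c l"
 by (induction l arbitrary: x c) auto

text \<open>Merging the first two arrows commutes with later merges by associativity, and with the
  action of the last arrow by functoriality. These are the cosimplicial identities behind the
  vanishing of the square.\<close>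

lemma bar_tail_merge:
 assumes "category C" "additive_action C act"
  and "f : ar C" "composable C (tgt C f) l"
 shows "bar_merge (cmp C) act (bar_tail (cmp C) act x) f l =
  bar_tail (cmp C) act (bar_merge (cmp C) act x f) l"
proof (cases l)
 case Nil
 then show ?thesis by (simp add: additive_action_zero[OF assms(2)])
next
 case (Cons g l')
 have 1: "bar_merge (cmp C) act x (cmp C g f) l' = bar_merge (cmp C) act (bar_merge (cmp C) act x f) g l'"
  using assms Cons by (cases l') (auto simp: additive_action_def category.cmp_assoc)
 show ?thesis by (simp add: Cons 1)
qed

text \<open>Induction on the string: a first merge followed by a later face cancels against the same
  pair in the opposite order, by \<open>bar_tail_merge\<close>, and what remains is the square for
  the shorter string.\<close>

lemma bar_tail_bar_tail:
 assumes "category C" "additive_action C act" "composable C c l"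
 shows "bar_tail (cmp C) act (bar_tail (cmp C) act x) l = 0"
 using assms(3)
proof (induction l arbitrary: x c)
 case (Cons f l)
 have [simp]: "composable C (tgt C f) l" "f : ar C" using Cons by auto
 have "bar_tail (cmp C) act (%l. bar_tail (cmp C) act x (f # l)) l
  = bar_tail (cmp C) act (%l. - bar_merge (cmp C) act x f l + - bar_tail (cmp C) act (%l. x (f # l)) l) l"
  by simp
 also have "\<dots> = - bar_tail (cmp C) act (bar_merge (cmp C) act x f) l
   - bar_tail (cmp C) act (bar_tail (cmp C) act (%l. x (f # l))) l"
  by (subst bar_tail_add[OF assms(2)]) (simp add: bar_tail_minus[OF assms(2)])
 finally show ?case
  using Cons.IH[of "tgt C f" "%l. x (f # l)"] by (simp add: bar_tail_merge[OF assms(1,2)])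
qed auto

lemma bar_bar:
 assumes "category C" "additive_action C act" "composable C c l"
 shows "bar C act (bar C act x) c l = 0"
proof (cases l)
 case Nil
 then show ?thesis by simp
next
 case (Cons f k)
 \<comment> \<open>Coface 0 as a function on strings with a fixed initial object, so that the
   additivity of \<open>bar_tail\<close> applies to both summands of \<open>bar\<close>.\<close>
 define d0 where "d0 = (%l. case l of [] => 0 | f # l => x (tgt C f) l)"
 have split: "bar C act x c = (%l. d0 l + bar_tail (cmp C) act (x c) l)"
 proof
  fix l show "bar C act x c l = d0 l + bar_tail (cmp C) act (x c) l"
   by (cases l) (auto simp: d0_def)
 qed
 have fk: "f : ar C" "composable C (tgt C f) k" using assms(3) Cons by auto
 have m: "bar_merge (cmp C) act d0 f k = (case k of [] => 0 | g # k => x (tgt C g) k)"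
  using fk assms(1) by (cases k) (auto simp: d0_def additive_action_zero[OF assms(2)] category.cmp_ar)
 have d: "(%l. d0 (f # l)) = x (tgt C f)" by (simp add: d0_def)
 have "bar_tail (cmp C) act (bar C act x c) l = bar_tail (cmp C) act d0 l + bar_tail (cmp C) act (bar_tail (cmp C) act (x c)) l"
  unfolding split by (rule bar_tail_add[OF assms(2)])
 also have "bar_tail (cmp C) act (bar_tail (cmp C) act (x c)) l = 0"
  by (rule bar_tail_bar_tail[OF assms])
 finally have "bar_tail (cmp C) act (bar C act x c) l =
   - (case k of [] => 0 | g # k => x (tgt C g) k) - bar_tail (cmp C) act (x (tgt C f)) k"
  by (simp add: Cons m d)
 moreover have "bar C act x (tgt C f) k = (case k of [] => 0 | g # k => x (tgt C g) k) + bar_tail (cmp C) act (x (tgt C f)) k"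
  by (cases k) auto
 ultimately show ?thesis by (simp add: Cons del: bar_tail.simps)
qed

definition endo_functor :: "('c, 'k) category => ('c => 'c) => ('k => 'k) => bool" where
 "endo_functor C To T \<longleftrightarrow> (\<forall>f\<in>ar C. T f : ar C & src C (T f) = To (src C f) & tgt C (T f) = To (tgt C f)) &
  (\<forall>f\<in>ar C. \<forall>g\<in>ar C. src C g = tgt C f --> T (cmp C g f) = cmp C (T g) (T f)) &
  (\<forall>c\<in>ob C. To c : ob C)"

definition nat_from_id :: "('c, 'k) category => ('c => 'c) => ('k => 'k) => ('c => 'k) => bool" where
 "nat_from_id C To T \<eta> \<longleftrightarrow> (\<forall>c\<in>ob C. \<eta> c : ar C & src C (\<eta> c) = c & tgt C (\<eta> c) = To c) &
  (\<forall>f\<in>ar C. cmp C (\<eta> (tgt C f)) f = cmp C (T f) (\<eta> (src C f)))"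

text \<open>A natural transformation to \<open>T\<close> from the functor constant at
  \<open>o'\<close>. Together with \<open>nat_from_id\<close> it contracts the category: the
  identity and a constant functor both map to \<open>T\<close>.\<close>

definition cone_over :: "('c, 'k) category => ('c => 'c) => ('k => 'k) => 'c => ('c => 'k) => bool" where
 "cone_over C To T o' \<iota> \<longleftrightarrow> o' : ob C & (\<forall>c\<in>ob C. \<iota> c : ar C & src C (\<iota> c) = o' & tgt C (\<iota> c) = To c) &
  (\<forall>f\<in>ar C. \<iota> (tgt C f) = cmp C (T f) (\<iota> (src C f)))"

lemma additive_action_functor:
 assumes "additive_action C act" "endo_functor C To T"
 shows "additive_action C (%f. act (T f))"
 using assms by (auto simp: additive_action_def endo_functor_def)

lemma composable_map:
 assumes "endo_functor C To T"
 shows "composable C c l ==> composable C (To c) (map T l)"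
 using assms by (induction l arbitrary: c) (auto simp: endo_functor_def)

lemma composable_ob: "category C ==> composable C c l ==> c : ob C"
 by (cases l) (auto simp: category.src_ob)

lemma bar_tail_map:
 assumes "endo_functor C To T" "composable C c l"
 shows "bar_tail (cmp C) (%f. act (T f)) (%l. z (map T l)) l = bar_tail (cmp C) act z (map T l)"
 using assms(2)
proof (induction l arbitrary: z c)
 case (Cons f l)
 have "bar_merge (cmp C) (%f. act (T f)) (%l. z (map T l)) f l = bar_merge (cmp C) act z (T f) (map T l)"
  using Cons.prems assms(1) by (cases l) (auto simp: endo_functor_def)
 moreover have "bar_tail (cmp C) (%f. act (T f)) (%l. z (T f # map T l)) l = bar_tail (cmp C) act (%l. z (T f # l)) (map T l)"
  using Cons.IH[of "tgt C f" "%l. z (T f # l)"] Cons.prems by simp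
 ultimately show ?case by simp
qed auto

text \<open>Merging \<open>f\<close> with its successor commutes with inserting
  \<open>\<eta>\<close> except where \<open>\<eta>\<close> stands next to \<open>f\<close>;
  naturality of \<open>\<eta>\<close> makes the two neighbouring positions meet in one
  composite.\<close>

lemma prism_merge:
 assumes "category C" "additive_action C act" "endo_functor C To T" "nat_from_id C To T \<eta>"
  and "f : ar C" "composable C (tgt C f) l"
 shows "prism C T \<eta> (bar_merge (cmp C) act x f) (tgt C f) l
   - bar_merge (cmp C) (%f. act (T f)) (prism C T \<eta> x (src C f)) f l
  = x (cmp C (T f) (\<eta> (src C f)) # map T l)
   - bar_merge (cmp C) act (%l. x (\<eta> (src C f) # l)) (T f) (map T l)"
proof (cases l)
 case Nil
 then show ?thesis using assms(4,5) by (simp add: nat_from_id_def)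
next
 case (Cons g k)
 have g: "g : ar C" "src C g = tgt C f" using Cons assms by auto
 show ?thesis using assms g by (simp add: Cons nat_from_id_def endo_functor_def category.cmp_ar)
qed

text \<open>The faces of the prism cancel in pairs, except for the one at its end, where the last
  \<open>\<eta>\<close> acts on the value. The opposite end comes from coface 0 and is added in
  \<open>prism_bar\<close>.\<close>

lemma prism_bar_tail:
 assumes "category C" "additive_action C act" "endo_functor C To T" "nat_from_id C To T \<eta>"
  and "composable C c l"
 shows "prism C T \<eta> (bar_tail (cmp C) act x) c l + bar_tail (cmp C) (%f. act (T f)) (prism C T \<eta> x c) l
  = - act (\<eta> (foldl (%_. tgt C) c l)) (x l)"
 using assms(5)
proof (induction l arbitrary: x c)
 case (Cons f l)
 let ?D = "bar_tail (cmp C) act" and ?D' = "bar_tail (cmp C) (%f. act (T f))" and ?P = "prism C T \<eta>"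
 let ?m = "bar_merge (cmp C) act" and ?m' = "bar_merge (cmp C) (%f. act (T f))"
 have f: "f : ar C" "src C f = c" "composable C (tgt C f) l" using Cons by auto
 have act': "additive_action C (%f. act (T f))" by (rule additive_action_functor[OF assms(2,3)])
 let ?z = "%l. x (\<eta> c # T f # l)"
 have A: "?P (?D x) c (f # l) = - x (cmp C (T f) (\<eta> c) # map T l) + ?m (%l. x (\<eta> c # l)) (T f) (map T l) + ?D ?z (map T l)
   + ?P (?m x f) (tgt C f) l + ?P (?D (%l. x (f # l))) (tgt C f) l"
 proof -
  have "?P (%l. ?D x (f # l)) (tgt C f) l = ?P (%l. - ?m x f l + - ?D (%l. x (f # l)) l) (tgt C f) l"
   by simp
  also have "\<dots> = - ?P (?m x f) (tgt C f) l - ?P (?D (%l. x (f # l))) (tgt C f) l"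
   by (subst prism_add) (simp add: prism_minus)
  finally show ?thesis by simp
 qed
 have B: "?D' (?P x c) (f # l) = - ?m' (?P x c) f l - ?D ?z (map T l) + ?D' (?P (%l. x (f # l)) (tgt C f)) l"
 proof -
  have "?D' (%l. ?P x c (f # l)) l = ?D' (%l. ?z (map T l) + - ?P (%l. x (f # l)) (tgt C f) l) l"
   by simp
  also have "\<dots> = ?D' (%l. ?z (map T l)) l - ?D' (?P (%l. x (f # l)) (tgt C f)) l"
   by (subst bar_tail_add[OF act']) (simp add: bar_tail_minus[OF act'])
  finally show ?thesis using bar_tail_map[OF assms(3) f(3), of act ?z] by simp
 qed
 have I: "?P (?D (%l. x (f # l))) (tgt C f) l + ?D' (?P (%l. x (f # l)) (tgt C f)) l = - act (\<eta> (foldl (%_. tgt C) (tgt C f) l)) (x (f # l))"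
  using Cons.IH[OF f(3), of "%l. x (f # l)"] .
 have M: "?P (?m x f) (tgt C f) l - ?m' (?P x c) f l = x (cmp C (T f) (\<eta> c) # map T l) - ?m (%l. x (\<eta> c # l)) (T f) (map T l)"
  using prism_merge[OF assms(1-4) f(1) f(3), of x] f(2) by simp
 have "?P (?D x) c (f # l) + ?D' (?P x c) (f # l) =
   (?P (?m x f) (tgt C f) l - ?m' (?P x c) f l) - (x (cmp C (T f) (\<eta> c) # map T l) - ?m (%l. x (\<eta> c # l)) (T f) (map T l))
   + (?P (?D (%l. x (f # l))) (tgt C f) l + ?D' (?P (%l. x (f # l)) (tgt C f)) l)"
  unfolding A B by (simp add: algebra_simps)
 also have "\<dots> = - act (\<eta> (foldl (%_. tgt C) (tgt C f) l)) (x (f # l))" unfolding I M by simp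
 finally show ?case by simp
qed simp

lemma add_cancel_middle:
 fixes a :: "'b::ab_group_add"
 shows "p = z + s ==> q = d + r ==> d = a - z ==> q + p = a + (r + s)"
 by (simp add: algebra_simps)

text \<open>The homotopy formula between \<open>x\<close> along \<open>T\<close> and
  \<open>x\<close> pushed along \<open>\<eta>\<close>. In the second term the arrows act through
  \<open>T\<close>, because \<open>prism\<close> takes its values at \<open>T\<close> of the end of
  the string.\<close>

lemma prism_bar:
 assumes "category C" "additive_action C act" "endo_functor C To T" "nat_from_id C To T \<eta>"
  and "composable C c l"
 shows "prism C T \<eta> (bar C act x c) c l + bar C (%f. act (T f)) (%c. prism C T \<eta> (x c) c) c l
  = x (To c) (map T l) - act (\<eta> (foldl (%_. tgt C) c l)) (x c l)"
proof -
 define d0 where "d0 = (%l. case l of [] => 0 | f # l => x (tgt C f) l)"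
 have split: "bar C act x c = (%l. d0 l + bar_tail (cmp C) act (x c) l)"
 proof
  fix l show "bar C act x c l = d0 l + bar_tail (cmp C) act (x c) l"
   by (cases l) (auto simp: d0_def)
 qed
 have e: "tgt C (\<eta> c) = To c" using assms(4) composable_ob[OF assms(1,5)] by (auto simp: nat_from_id_def)
 have d: "(%l. d0 (f # l)) = x (tgt C f)" for f by (simp add: d0_def)
 have "bar C (%f. act (T f)) (%c. prism C T \<eta> (x c) c) c l =
   (case l of [] => 0 | f # l => prism C T \<eta> (x (tgt C f)) (tgt C f) l) + bar_tail (cmp C) (%f. act (T f)) (prism C T \<eta> (x c) c) l"
  by (cases l) auto
 moreover have "prism C T \<eta> (bar C act x c) c l = prism C T \<eta> d0 c l + prism C T \<eta> (bar_tail (cmp C) act (x c)) c l"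
  unfolding split by (rule prism_add)
 moreover have "prism C T \<eta> d0 c l = x (To c) (map T l) - (case l of [] => 0 | f # l => prism C T \<eta> (x (tgt C f)) (tgt C f) l)"
  by (cases l) (auto simp: d e, simp_all add: d0_def e)
 ultimately have "prism C T \<eta> (bar C act x c) c l + bar C (%f. act (T f)) (%c. prism C T \<eta> (x c) c) c l
   = x (To c) (map T l) + (prism C T \<eta> (bar_tail (cmp C) act (x c)) c l + bar_tail (cmp C) (%f. act (T f)) (prism C T \<eta> (x c) c) l)"
  by (rule add_cancel_middle)
 then show ?thesis using prism_bar_tail[OF assms, of "x c"] by simp
qed

text \<open>The analogue for the cone. Of \<open>\<iota> c # map T l\<close>, coface 0 restores
  \<open>x\<close> along \<open>T\<close>, merging \<open>\<iota> c\<close> with \<open>T f\<close>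
  moves \<open>\<iota>\<close> to the next object, and only for the empty string is there another
  face, on which \<open>\<iota> c\<close> acts.\<close>

lemma cone_bar:
 assumes "category C" "additive_action C act" "endo_functor C To T" "cone_over C To T o' \<iota>"
  and "composable C c l"
 shows "bar C act x o' (\<iota> c # map T l) + bar C (%f. act (T f)) (%c l. x o' (\<iota> c # map T l)) c l
  = x (To c) (map T l) - (if l = [] then act (\<iota> c) (x o' []) else 0)"
proof -
 have e: "tgt C (\<iota> c) = To c" using assms(4) composable_ob[OF assms(1,5)] by (auto simp: cone_over_def)
 have t: "bar_tail (cmp C) (%f. act (T f)) (%l. x o' (\<iota> c # map T l)) l = bar_tail (cmp C) act (%l. x o' (\<iota> c # l)) (map T l)"
  using bar_tail_map[OF assms(3,5), of act "%l. x o' (\<iota> c # l)"] .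
 have b: "bar C (%f. act (T f)) (%c l. x o' (\<iota> c # map T l)) c l =
   (case l of [] => 0 | f # l => x o' (\<iota> (tgt C f) # map T l)) + bar_tail (cmp C) (%f. act (T f)) (%l. x o' (\<iota> c # map T l)) l"
  by (cases l) auto
 have m: "bar_merge (cmp C) act (x o') (\<iota> c) (map T l) = (case l of [] => act (\<iota> c) (x o' []) | f # l => x o' (\<iota> (tgt C f) # map T l))"
  using assms(4,5) by (cases l) (auto simp: cone_over_def)
 show ?thesis unfolding b t by (simp add: m e) (cases l; simp)
qed

section \<open>Formal sums of group elements and their evaluation\<close>

text \<open>Evaluates formal integer combinations; generators outside the carrier count as the unit,
  so that it is defined on the whole type. Formal combinations form a type in
  \<open>ab_group_add\<close>, where sums and signs are computed without carrier conditions.\<close>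

definition ev :: "('v, 'e) monoid_scheme => ('v \<Rightarrow>\<^sub>0 int) => 'v" where
 "ev G = (SOME h. h : hom (free_Abelian_group UNIV) G &
  (\<forall>v. h (frag_of v) = (if v : carrier G then v else \<one>\<^bsub>G\<^esub>)))"

text \<open>Generators outside the carrier go to 0, since nothing is known about \<open>h\<close>
  there. With this convention pushing forward is functorial although the maps compose only on
  carriers.\<close>

definition frag_push :: "('v, 'e) monoid_scheme => ('v => 'w) => ('v \<Rightarrow>\<^sub>0 int) => ('w \<Rightarrow>\<^sub>0 int)" where
 "frag_push G h = frag_extend (%v. if v : carrier G then frag_of (h v) else 0)"

context comm_group
begin

lemma ev_hom_of: "ev G : hom (free_Abelian_group UNIV) G &
  (\<forall>v. ev G (frag_of v) = (if v : carrier G then v else \<one>))"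
proof -
 have "(%v. if v : carrier G then v else \<one>) ` UNIV \<subseteq> carrier G" by auto
 then have "\<exists>h. h : hom (free_Abelian_group UNIV) G & (\<forall>v. h (frag_of v) = (if v : carrier G then v else \<one>))"
  by (rule free_Abelian_group_universal) (intro exI conjI allI, assumption, simp only: UNIV_I)
 then show ?thesis unfolding ev_def by (rule someI_ex)
qed

lemma ev_closed [simp]: "ev G z : carrier G"
 using ev_hom_of by (auto simp: hom_def)

lemma ev_add: "ev G (a + b) = ev G a \<otimes> ev G b"
 using ev_hom_of by (auto simp: hom_def)

lemma ev_zero [simp]: "ev G 0 = \<one>"
 using ev_add[of 0 0] by simp

lemma ev_minus: "ev G (- a) = inv (ev G a)"
 using ev_add[of "- a" a] by (simp add: inv_equality)

lemma ev_of [simp]: "v : carrier G ==> ev G (frag_of v) = v"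
 using ev_hom_of by auto

lemma ev_of' [simp]: "v ~: carrier G ==> ev G (frag_of v) = \<one>"
 using ev_hom_of by auto

text \<open>The coefficients in the differentials are signs, so the two cases 1 and -1 settle the
  comparison with integer powers.\<close>

lemma ev_sign: "ev G (frag_cmul ((-1) ^ n) z) = ev G z [^] ((-1) ^ n :: int)"
proof -
 consider "(-1) ^ n = (1::int)" | "(-1) ^ n = (-1::int)" by (metis minus_one_power_iff)
 then show ?thesis
 proof cases
  case 2
  have "inv (ev G z) = ev G z [^] (- 1 :: int)" using int_pow_neg[of "ev G z" 1] by simp
  with 2 show ?thesis by (simp only: frag_cmul_minus_one ev_minus)
 qed simp
qed

lemma ev_sum: "finite I ==> ev G (\<Sum>i\<in>I. z i) = finprod G (%i. ev G (z i)) I"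
 by (induction I rule: finite_induct) (auto simp: ev_add)

end

lemma frag_push_simps [simp]:
 "frag_push G h 0 = 0"
 "frag_push G h (- a) = - frag_push G h a"
 "frag_push G h (frag_cmul k a) = frag_cmul k (frag_push G h a)"
 "frag_push G h (a + b) = frag_push G h a + frag_push G h b"
 "frag_push G h (a - b) = frag_push G h a - frag_push G h b"
 "v : carrier G ==> frag_push G h (frag_of v) = frag_of (h v)"
 "v ~: carrier G ==> frag_push G h (frag_of v) = 0"
 by (auto simp: frag_push_def frag_extend_minus frag_extend_cmul frag_extend_add frag_extend_diff)

lemma ev_push:
 assumes "comm_group G" "comm_group H" "h : hom G H"
 shows "ev H (frag_push G h z) = h (ev G z)"
proof -
 interpret G: comm_group G by fact
 interpret H: comm_group H by fact
 interpret h: group_hom G H h using assms(3) by unfold_locales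
 have "ev H (frag_push G h z) = h (ev G z)" if "Poly_Mapping.keys z \<subseteq> UNIV" for z
  using that
 proof (induction z rule: frag_induction)
  case (one x) then show ?case by (cases "x : carrier G") auto
 next
  case (diff a b)
  then show ?case
   using G.ev_add[of a "- b"] H.ev_add[of "frag_push G h a" "- frag_push G h b"] by (simp add: H.ev_minus G.ev_minus)
 qed auto
 then show ?thesis by simp
qed

lemma frag_push_comp:
 assumes "!!v. v : carrier G ==> h v : carrier H" "!!v. v : carrier G ==> k v = h' (h v)"
 shows "frag_push G k z = frag_push H h' (frag_push G h z)"
proof -
 have "frag_push G k z = frag_push H h' (frag_push G h z)" if "Poly_Mapping.keys z \<subseteq> UNIV" for z
  using that
 proof (induction z rule: frag_induction)
  case (one x) then show ?case by (cases "x : carrier G") (auto simp: assms)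
 qed auto
 then show ?thesis by simp
qed

section \<open>Diagrams of cochain complexes and the differential of the homotopy limit\<close>

definition diagram :: "('c, 'k) category => ('c, 'k, 'v cochain, int => 'v => 'v) funct => bool" where
 "diagram C D \<longleftrightarrow> category C & (\<forall>c\<in>ob C. cochain_complex (on_ob D c)) &
  (\<forall>f\<in>ar C. cochain_map (on_ob D (src C f)) (on_ob D (tgt C f)) (on_ar D f)) &
  (\<forall>f\<in>ar C. \<forall>g\<in>ar C. src C g = tgt C f -->
   (\<forall>n. \<forall>x\<in>carrier (grp (on_ob D (src C f)) n). on_ar D (cmp C g f) n x = on_ar D g n (on_ar D f n x)))"

text \<open>One formal group serves all objects of the diagram in degree \<open>m\<close>; this
  makes \<open>bar\<close> and \<open>prism\<close> applicable.\<close>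

definition push_arrow :: "('c, 'k) category => ('c, 'k, 'v cochain, int => 'v => 'v) funct =>
  int => 'k => ('v \<Rightarrow>\<^sub>0 int) => ('v \<Rightarrow>\<^sub>0 int)" where
 "push_arrow C D m f = frag_push (grp (on_ob D (src C f)) m) (on_ar D f m)"

lemma diagram_comm_group: "diagram C D ==> c : ob C ==> comm_group (grp (on_ob D c) m)"
 by (auto simp: diagram_def cochain_complex_def)

lemma diagram_hom: "diagram C D ==> f : ar C ==>
  on_ar D f m : hom (grp (on_ob D (src C f)) m) (grp (on_ob D (tgt C f)) m)"
 by (auto simp: diagram_def cochain_map_def)

lemma push_arrow_additive: "diagram C D ==> additive_action C (push_arrow C D m)"
 unfolding additive_action_def push_arrow_def
 by (auto intro!: frag_push_comp simp: diagram_def cochain_map_def hom_def Pi_def category.cmp_ar)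

lemma ev_push_arrow:
 assumes "diagram C D" "f : ar C"
 shows "ev (grp (on_ob D (tgt C f)) m) (push_arrow C D m f z) = on_ar D f m (ev (grp (on_ob D (src C f)) m) z)"
 unfolding push_arrow_def
 by (rule ev_push) (use assms in \<open>auto intro: diagram_comm_group diagram_hom simp: diagram_def category.src_ob category.tgt_ob\<close>)

abbreviation chain_end :: "('c, 'k) category => 'c => 'k list => 'c" where
 "chain_end C c l \<equiv> foldl (%_. tgt C) c l"

lemma last_ob_chain_end: "last_ob C (c, l) = chain_end C c l"
 by (cases l rule: rev_cases) (auto simp: last_ob_def)

lemma chain_end_ob: "category C ==> composable C c l ==> chain_end C c l : ob C"
 by (induction l arbitrary: c) auto

lemma bar_tail_sum:
 "l ~= [] ==> bar_tail (cmp C) act x l = (\<Sum>i=1..length l. frag_cmul ((-1) ^ i)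
  (if i = length l then act (last l) (x (butlast l))
   else x (take (i - 1) l @ cmp C (l ! i) (l ! (i - 1)) # drop (i + 1) l)))"
proof (induction l arbitrary: x)
 case (Cons f l)
 show ?case
 proof (cases l)
  case (Cons g k)
  let ?h = "%i. frag_cmul ((-1) ^ i)
   (if i = length (f # l) then act (last (f # l)) (x (butlast (f # l)))
    else x (take (i - 1) (f # l) @ cmp C ((f # l) ! i) ((f # l) ! (i - 1)) # drop (i + 1) (f # l)))"
  have "(\<Sum>i=1..length (f # l). ?h i) = ?h 1 + (\<Sum>i=1..length l. ?h (Suc i))"
   using sum.atLeast_Suc_atMost[of 1 "length (f # l)" ?h] sum.shift_bounds_cl_Suc_ivl[of ?h 1 "length l"] by simp
  also have "(\<Sum>i=1..length l. ?h (Suc i)) = - bar_tail (cmp C) act (%l. x (f # l)) l"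
  proof (subst Cons.IH)
   show "l ~= []" using Cons by simp
   show "(\<Sum>i=1..length l. ?h (Suc i)) = - (\<Sum>i=1..length l. frag_cmul ((-1) ^ i)
     (if i = length l then act (last l) (x (f # butlast l))
      else x (f # take (i - 1) l @ cmp C (l ! i) (l ! (i - 1)) # drop (i + 1) l)))"
    unfolding sum_negf[symmetric]
   proof (rule sum.cong[OF refl], goal_cases)
    case (1 i)
    then obtain j where "i = Suc j" by (cases i) auto
    then show ?case using Cons by auto
   qed
  qed
  finally show ?thesis using Cons by simp
 qed simp
qed simp

text \<open>Matches the recursive \<open>bar\<close> with the faces in the definition of
  \<open>holim\<close>; an arrow acts on the last face only.\<close>

lemma bar_sum:
 assumes "l ~= []"
 shows "bar C act x c l = (\<Sum>i\<le>length l. frag_cmul ((-1) ^ i)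
  (if i = length l then act (last l) (case_prod x (face C i (c, l))) else case_prod x (face C i (c, l))))"
proof -
 obtain f k where l: "l = f # k" using assms by (cases l) auto
 let ?h = "%i. frag_cmul ((-1) ^ i)
  (if i = length l then act (last l) (case_prod x (face C i (c, l))) else case_prod x (face C i (c, l)))"
 have "(\<Sum>i\<le>length l. ?h i) = ?h 0 + (\<Sum>i=1..length l. ?h i)"
  by (simp add: atMost_atLeast0 sum.atLeast_Suc_atMost)
 also have "(\<Sum>i=1..length l. ?h i) = bar_tail (cmp C) act (x c) l"
  unfolding bar_tail_sum[OF assms] by (intro sum.cong) (auto simp: face_def)
 also have "?h 0 = x (tgt C f) k" by (simp add: face_def l)
 finally show ?thesis by (simp add: l)
qed

lemma composable_append: "category C ==> composable C c (l @ k) \<longleftrightarrow> composable C c l & composable C (chain_end C c l) k"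
 by (induction l arbitrary: c) (auto dest: composable_ob)

text \<open>Only the last face changes the end of a string, hence the complex in which the component
  lives; this is why \<open>coface\<close> applies a map of the diagram exactly there.\<close>

lemma face_string:
 assumes "category C" "(c, l) : strings C" "l ~= []" "i \<le> length l"
 shows "face C i (c, l) : strings C" "length (snd (face C i (c, l))) = length l - 1"
  "i ~= length l ==> last_ob C (face C i (c, l)) = last_ob C (c, l)"
  "i = length l ==> last_ob C (face C i (c, l)) = src C (last l)"
proof -
 have comp: "composable C c l" using assms(2) by (simp add: strings_def)
 consider "i = 0" | "i ~= 0" "i = length l" | "i ~= 0" "i < length l" using assms(4) by linarith
 then have "face C i (c, l) : strings C & length (snd (face C i (c, l))) = length l - 1 &
  (i ~= length l --> last_ob C (face C i (c, l)) = last_ob C (c, l)) &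
  (i = length l --> last_ob C (face C i (c, l)) = src C (last l))"
 proof cases
  case 1
  then show ?thesis using assms(3) comp by (cases l) (auto simp: face_def strings_def last_ob_chain_end)
 next
  case 2
  obtain k f where "l = k @ [f]" using assms(3) by (cases l rule: rev_cases) auto
  then show ?thesis using 2 comp composable_append[OF assms(1), of c k "[f]"]
   by (auto simp: face_def strings_def last_ob_chain_end)
 next
  case 3
  \<comment> \<open>An inner face replaces two neighbouring arrows by their composite, so the string
    is cut around positions \<open>i - 1\<close> and \<open>i\<close>.\<close>
  define a where "a = take (i - 1) l"
  define b where "b = drop (i + 1) l"
  have l: "l = a @ l ! (i - 1) # l ! i # b"
   using 3 by (simp add: a_def b_def) (metis Cons_nth_drop_Suc Suc_pred append_take_drop_id diff_le_self less_imp_diff_less neq0_conv nat_less_le order.strict_trans1)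
  have "composable C c (a @ l ! (i - 1) # l ! i # b)" using comp l by simp
  then have "composable C c (a @ cmp C (l ! i) (l ! (i - 1)) # b)"
   unfolding composable_append[OF assms(1)] using assms(1) by (auto simp: category.cmp_ar)
  moreover have "chain_end C c (a @ cmp C (l ! i) (l ! (i - 1)) # b) = chain_end C c l"
   using \<open>composable C c (a @ l ! (i - 1) # l ! i # b)\<close> assms(1)
   by (subst (2) l) (auto simp: composable_append category.cmp_ar)
  moreover have "length (a @ cmp C (l ! i) (l ! (i - 1)) # b) = length l - 1"
   using 3 by (simp add: a_def b_def)
  ultimately show ?thesis using 3
   by (auto simp: face_def strings_def last_ob_chain_end a_def b_def)
 qed
 then show "face C i (c, l) : strings C" "length (snd (face C i (c, l))) = length l - 1"
  "i ~= length l ==> last_ob C (face C i (c, l)) = last_ob C (c, l)"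
  "i = length l ==> last_ob C (face C i (c, l)) = src C (last l)" by auto
qed

abbreviation holim_term :: "('c, 'k) category => ('c, 'k, 'v cochain, int => 'v => 'v) funct => int => 'c => 'k list => 'v monoid" where
 "holim_term C D k c l \<equiv> grp (on_ob D (chain_end C c l)) (k - int (length l))"

abbreviation of_holim :: "('c \<times> 'k list => 'v) => 'c => 'k list => 'v \<Rightarrow>\<^sub>0 int" where
 "of_holim x \<equiv> %c l. frag_of (x (c, l))"

lemma holim_carrier:
 "x : carrier (grp (holim C D) k) \<longleftrightarrow> x : extensional (strings C) &
  (\<forall>c l. composable C c l --> x (c, l) : carrier (holim_term C D k c l))"
 by (auto simp: holim_def strings_def last_ob_chain_end PiE_iff)

lemma holim_mult:
 "x \<otimes>\<^bsub>grp (holim C D) k\<^esub> y = (\<lambda>(c, l)\<in>strings C. x (c, l) \<otimes>\<^bsub>holim_term C D k c l\<^esub> y (c, l))"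
 by (auto simp: holim_def last_ob_chain_end product_group_def intro!: restrict_ext)

lemma holim_one:
 "\<one>\<^bsub>grp (holim C D) k\<^esub> = (\<lambda>(c, l)\<in>strings C. \<one>\<^bsub>holim_term C D k c l\<^esub>)"
 by (auto simp: holim_def last_ob_chain_end intro!: restrict_ext)

lemma comm_product_group:
 assumes "!!i. i : I ==> comm_group (G i)"
 shows "comm_group (product_group I G)"
proof (rule group.group_comm_groupI)
 show "group (product_group I G)" by (intro product_group) (use assms in \<open>auto simp: comm_group_def\<close>)
 fix x y assume "x : carrier (product_group I G)" "y : carrier (product_group I G)"
 then show "x \<otimes>\<^bsub>product_group I G\<^esub> y = y \<otimes>\<^bsub>product_group I G\<^esub> x"
  by (auto simp: PiE_iff intro!: restrict_ext comm_monoid.m_comm[OF comm_group.axioms(1)[OF assms]])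
qed

lemma holim_comm_group:
 assumes "diagram C D"
 shows "comm_group (grp (holim C D) k)"
proof -
 have "comm_group (product_group (strings C) (\<lambda>\<sigma>. grp (on_ob D (last_ob C \<sigma>)) (k - int (length (snd \<sigma>)))))"
  using assms by (intro comm_product_group)
   (auto simp: strings_def last_ob_chain_end diagram_def intro!: diagram_comm_group[OF assms] chain_end_ob)
 then show ?thesis by (simp add: holim_def)
qed

text \<open>The differential becomes one evaluation of a formal sum: the cofaces give
  \<open>bar\<close>, the internal differential one more generator. A string of \<open>n\<close>
  arrows contributes degree \<open>k + 1 - n\<close> of the complex at its end.\<close>

lemma holim_dif_aux:
 assumes "diagram C D" "x : carrier (grp (holim C D) k)" "composable C c l"
 shows "dif (holim C D) k x (c, l) = ev (holim_term C D (k + 1) c l)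
  (bar C (push_arrow C D (k + 1 - int (length l))) (of_holim x) c l
   + frag_cmul ((-1) ^ length l) (frag_of (dif (on_ob D (chain_end C c l)) (k - int (length l)) (x (c, l)))))"
proof -
 let ?n = "length l" and ?\<sigma> = "(c, l)"
 let ?G = "holim_term C D (k + 1) c l"
 have cat: "category C" using assms(1) by (simp add: diagram_def)
 have \<sigma>: "?\<sigma> : strings C" using assms(3) by (simp add: strings_def)
 have e: "chain_end C c l : ob C" using chain_end_ob[OF cat assms(3)] .
 interpret G: comm_group ?G by (rule diagram_comm_group[OF assms(1) e])
 have x: "x (c, l) : carrier (holim_term C D k c l)" if "composable C c l" for c l
  using assms(2) that unfolding holim_carrier by blast
 have dx: "dif (on_ob D (chain_end C c l)) (k - int ?n) (x ?\<sigma>) : carrier ?G"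
 proof -
  have "dif (on_ob D (chain_end C c l)) (k - int ?n) : hom (holim_term C D k c l) (grp (on_ob D (chain_end C c l)) (k - int ?n + 1))"
   using assms(1) e by (auto simp: diagram_def cochain_complex_def)
  then show ?thesis using x[OF assms(3)] by (auto simp: hom_def algebra_simps)
 qed
 have sum: "finprod ?G (%i. coface C D k x ?\<sigma> i [^]\<^bsub>?G\<^esub> ((-1) ^ i :: int)) (if ?n = 0 then {} else {..?n})
  = ev ?G (bar C (push_arrow C D (k + 1 - int ?n)) (of_holim x) c l)"
 proof (cases "l = []")
  case False
  have cf: "(if i = ?n then push_arrow C D (k + 1 - int ?n) (last l) (case_prod (of_holim x) (face C i ?\<sigma>))
    else case_prod (of_holim x) (face C i ?\<sigma>)) = frag_of (coface C D k x ?\<sigma> i)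
    & coface C D k x ?\<sigma> i : carrier ?G" if "i \<le> ?n" for i
  proof -
   note fs = face_string[OF cat \<sigma> False that]
   obtain c' l' where f: "face C i ?\<sigma> = (c', l')" by fastforce
   \<comment> \<open>A face has one arrow less, so total degree \<open>k\<close> places it in degree
     \<open>k + 1 - length l\<close>, the degree of the value of the differential at
     \<open>l\<close>.\<close>
   have v: "x (c', l') : carrier (grp (on_ob D (chain_end C c' l')) (k + 1 - int ?n))"
    using x[of c' l'] fs(1,2) False by (simp add: f strings_def of_nat_diff Suc_leI algebra_simps)
   show ?thesis
   proof (cases "i = ?n")
    case True
    have "chain_end C c' l' = src C (last l)" using fs(4)[OF True] unfolding f last_ob_chain_end .
    moreover have "last l : ar C" "chain_end C c l = tgt C (last l)"
     using assms(3) False composable_append[OF cat, of c "butlast l" "[last l]"] by (auto simp: last_ob_chain_end[symmetric] last_ob_def)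
    moreover have "on_ar D (last l) (k + 1 - int ?n) : hom (grp (on_ob D (src C (last l))) (k + 1 - int ?n)) ?G"
     using diagram_hom[OF assms(1), of "last l"] calculation by simp
    ultimately show ?thesis using v True f by (auto simp: coface_def push_arrow_def hom_def)
   next
    case nl: False
    have "chain_end C c' l' = chain_end C c l" using fs(3)[OF nl] unfolding f last_ob_chain_end .
    then show ?thesis using v nl f by (auto simp: coface_def Let_def)
   qed
  qed
  have "ev ?G (bar C (push_arrow C D (k + 1 - int ?n)) (of_holim x) c l)
   = finprod ?G (%i. ev ?G (frag_cmul ((-1) ^ i) (if i = ?n then push_arrow C D (k + 1 - int ?n) (last l) (case_prod (of_holim x) (face C i ?\<sigma>))
    else case_prod (of_holim x) (face C i ?\<sigma>)))) {..?n}"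
   unfolding bar_sum[OF False] by (rule G.ev_sum) simp
  also have "\<dots> = finprod ?G (%i. coface C D k x ?\<sigma> i [^]\<^bsub>?G\<^esub> ((-1) ^ i :: int)) {..?n}"
  proof (rule G.finprod_cong'[OF refl])
   show "(%i. coface C D k x ?\<sigma> i [^]\<^bsub>?G\<^esub> ((-1) ^ i :: int)) : {..?n} \<rightarrow> carrier ?G"
    using cf by auto
   fix i assume "i : {..?n}"
   then have "i \<le> ?n" by simp
   from cf[OF this] show "ev ?G (frag_cmul ((-1) ^ i) (if i = ?n then push_arrow C D (k + 1 - int ?n) (last l) (case_prod (of_holim x) (face C i ?\<sigma>))
    else case_prod (of_holim x) (face C i ?\<sigma>))) = coface C D k x ?\<sigma> i [^]\<^bsub>?G\<^esub> ((-1) ^ i :: int)"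
    by (simp only: G.ev_sign G.ev_of)
  qed
  finally show ?thesis using False by simp
 next
  case True
  then show ?thesis
   using G.ev_zero G.finprod_empty[of "%i. coface C D k x ?\<sigma> i [^]\<^bsub>?G\<^esub> ((-1) ^ i :: int)"] by simp
 qed
 have "dif (holim C D) k x ?\<sigma> = finprod ?G (%i. coface C D k x ?\<sigma> i [^]\<^bsub>?G\<^esub> ((-1) ^ i :: int)) (if ?n = 0 then {} else {..?n})
   \<otimes>\<^bsub>?G\<^esub> dif (on_ob D (chain_end C c l)) (k - int ?n) (x ?\<sigma>) [^]\<^bsub>?G\<^esub> ((-1) ^ ?n :: int)"
  using \<sigma> by (simp add: holim_def last_ob_chain_end Let_def)
 then show ?thesis
  unfolding sum by (simp only: G.ev_add G.ev_sign G.ev_of[OF dx])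
qed

lemma (in comm_group) ev_diff: "ev G (a - b) = ev G a \<otimes> inv (ev G b)"
 using ev_add[of a "- b"] by (simp add: ev_minus)

lemma holim_dif:
 assumes "diagram C D" "x : carrier (grp (holim C D) k)" "composable C c l" "m = k + 1 - int (length l)"
 shows "dif (holim C D) k x (c, l) = ev (grp (on_ob D (chain_end C c l)) m)
  (bar C (push_arrow C D m) (of_holim x) c l
   + frag_cmul ((-1) ^ length l) (frag_of (dif (on_ob D (chain_end C c l)) (m - 1) (x (c, l)))))"
proof -
 have "m - 1 = k - int (length l)" using assms(4) by simp
 then show ?thesis using holim_dif_aux[OF assms(1-3)] by (simp add: assms(4))
qed

lemma holim_component:
 "x : carrier (grp (holim C D) k) ==> composable C c l ==> m = k - int (length l) ==>
  x (c, l) : carrier (grp (on_ob D (chain_end C c l)) m)"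
 unfolding holim_carrier by blast

lemma diagram_dif:
 assumes "diagram C D" "c : ob C"
 shows "dif (on_ob D c) m : hom (grp (on_ob D c) m) (grp (on_ob D c) (m + 1))"
  "x : carrier (grp (on_ob D c) m) ==> dif (on_ob D c) (m + 1) (dif (on_ob D c) m x) = \<one>\<^bsub>grp (on_ob D c) (m + 1 + 1)\<^esub>"
 using assms by (auto simp: diagram_def cochain_complex_def)

text \<open>The evaluated sum depends only on the evaluations of its entries at strings one arrow
  shorter. A formal entry may thus be replaced by the single generator of its value, and
  homomorphisms such as internal differentials may be pulled out of the sum.\<close>

lemma bar_tail_ev_hom:
 assumes "category C" "!!c. c : ob C ==> comm_group (Gr c) & comm_group (Gr' c) & hh c : hom (Gr c) (Gr' c)"
  and "!!f w z. f : ar C ==> ev (Gr' (src C f)) w = hh (src C f) (ev (Gr (src C f)) z) ==>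
   ev (Gr' (tgt C f)) (act' f w) = hh (tgt C f) (ev (Gr (tgt C f)) (act f z))"
  and "composable C c l"
  and "!!l'. composable C c l' ==> Suc (length l') = length l ==>
   ev (Gr' (chain_end C c l')) (z' l') = hh (chain_end C c l') (ev (Gr (chain_end C c l')) (z l'))"
 shows "ev (Gr' (chain_end C c l)) (bar_tail (cmp C) act' z' l) = hh (chain_end C c l) (ev (Gr (chain_end C c l)) (bar_tail (cmp C) act z l))"
 using assms(4,5)
proof (induction l arbitrary: c z z')
 case Nil
 then have "c : ob C" by simp
 then interpret g: comm_group "Gr c" + g': comm_group "Gr' c" using assms(2) by blast+
 show ?case using hom_one[of "hh c" "Gr c" "Gr' c"] assms(2) \<open>c : ob C\<close> by (simp add: g.is_group g'.is_group)
next
 case (Cons f l)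
 have f: "f : ar C" "src C f = c" "composable C (tgt C f) l" using Cons.prems(1) by auto
 define e where "e = chain_end C (tgt C f) l"
 have e: "e : ob C" unfolding e_def by (rule chain_end_ob[OF assms(1) f(3)])
 interpret g: comm_group "Gr e" using assms(2)[OF e] by blast
 interpret g': comm_group "Gr' e" using assms(2)[OF e] by blast
 interpret h: group_hom "Gr e" "Gr' e" "hh e" using assms(2)[OF e] by unfold_locales auto
 have 1: "ev (Gr' e) (bar_merge (cmp C) act' z' f l) = hh e (ev (Gr e) (bar_merge (cmp C) act z f l))"
 proof (cases l)
  case Nil
  have "ev (Gr' c) (z' []) = hh c (ev (Gr c) (z []))"
   using Cons.prems(2)[of "[]"] Nil f composable_ob[OF assms(1) Cons.prems(1)] by simp
  then show ?thesis using assms(3)[OF f(1)] Nil f(2) by (simp add: e_def)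
 next
  case (Cons g k)
  then show ?thesis using Cons.prems(2)[of "cmp C g f # k"] f assms(1) by (simp add: category.cmp_ar e_def)
 qed
 have 2: "ev (Gr' e) (bar_tail (cmp C) act' (%l. z' (f # l)) l) = hh e (ev (Gr e) (bar_tail (cmp C) act (%l. z (f # l)) l))"
  unfolding e_def by (rule Cons.IH[OF f(3)]) (use Cons.prems(2)[of "f # l'" for l'] f in auto)
 show ?case
  unfolding foldl_Cons bar_tail.simps e_def[symmetric]
  by (simp add: g.ev_diff g'.ev_diff g.ev_minus g'.ev_minus 1 2)
qed

lemma bar_ev_hom:
 assumes "category C" "!!c. c : ob C ==> comm_group (Gr c) & comm_group (Gr' c) & hh c : hom (Gr c) (Gr' c)"
  and "!!f w z. f : ar C ==> ev (Gr' (src C f)) w = hh (src C f) (ev (Gr (src C f)) z) ==>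
   ev (Gr' (tgt C f)) (act' f w) = hh (tgt C f) (ev (Gr (tgt C f)) (act f z))"
  and "composable C c l"
  and "!!c' l'. composable C c' l' ==> Suc (length l') = length l ==>
   ev (Gr' (chain_end C c' l')) (z' c' l') = hh (chain_end C c' l') (ev (Gr (chain_end C c' l')) (z c' l'))"
 shows "ev (Gr' (chain_end C c l)) (bar C act' z' c l) = hh (chain_end C c l) (ev (Gr (chain_end C c l)) (bar C act z c l))"
proof -
 define e where "e = chain_end C c l"
 have e: "e : ob C" unfolding e_def by (rule chain_end_ob[OF assms(1,4)])
 interpret g: comm_group "Gr e" using assms(2)[OF e] by blast
 interpret g': comm_group "Gr' e" using assms(2)[OF e] by blast
 interpret h: group_hom "Gr e" "Gr' e" "hh e" using assms(2)[OF e] by unfold_locales auto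
 show ?thesis
 proof (cases l)
  case Nil
  show ?thesis unfolding e_def[symmetric] using Nil by simp
 next
  case (Cons f k)
  have f: "f : ar C" "src C f = c" "composable C (tgt C f) k" using assms(4) Cons by auto
  have ek: "e = chain_end C (tgt C f) k" by (simp add: e_def Cons)
  have 1: "ev (Gr' e) (z' (tgt C f) k) = hh e (ev (Gr e) (z (tgt C f) k))"
   using assms(5)[OF f(3)] Cons by (simp add: ek)
  have 2: "ev (Gr' e) (bar_tail (cmp C) act' (z' c) l) = hh e (ev (Gr e) (bar_tail (cmp C) act (z c) l))"
   unfolding e_def by (rule bar_tail_ev_hom[where Gr = Gr and Gr' = Gr' and hh = hh and act = act and act' = act', OF assms(1-4)]) (use assms(5) in auto)
  show ?thesis unfolding e_def[symmetric]
   using 1 2 by (simp add: Cons g.ev_add g'.ev_add del: bar_tail.simps)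
 qed
qed

text \<open>As for \<open>bar\<close>, but the entries sit at strings one arrow longer and the value
  in the group at \<open>To\<close> of the end.\<close>

lemma prism_ev_hom:
 assumes "category C" "endo_functor C To T" "nat_from_id C To T \<eta>"
  and "!!c. c : ob C ==> comm_group (Gr c) & comm_group (Gr' c) & hh c : hom (Gr c) (Gr' c)"
  and "composable C c l"
  and "!!l'. composable C c l' ==> length l' = Suc (length l) ==>
   ev (Gr' (chain_end C c l')) (z' l') = hh (chain_end C c l') (ev (Gr (chain_end C c l')) (z l'))"
 shows "ev (Gr' (To (chain_end C c l))) (prism C T \<eta> z' c l) = hh (To (chain_end C c l)) (ev (Gr (To (chain_end C c l))) (prism C T \<eta> z c l))"
 using assms(5,6)
proof (induction l arbitrary: c z z')
 case Nil
 then show ?case using Nil(2)[of "[\<eta> c]"] assms(2,3) by (auto simp: nat_from_id_def endo_functor_def)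
next
 case (Cons f l)
 have f: "f : ar C" "src C f = c" "composable C (tgt C f) l" using Cons.prems(1) by auto
 have c: "c : ob C" using composable_ob[OF assms(1) Cons.prems(1)] .
 define e where "e = To (chain_end C (tgt C f) l)"
 have e: "e : ob C" using chain_end_ob[OF assms(1) f(3)] assms(2) by (simp add: e_def endo_functor_def)
 interpret g: comm_group "Gr e" using assms(4)[OF e] by blast
 interpret g': comm_group "Gr' e" using assms(4)[OF e] by blast
 interpret h: group_hom "Gr e" "Gr' e" "hh e" using assms(4)[OF e] by unfold_locales auto
 have ends: "chain_end C (To c) (map T l) = To (chain_end C c l)" if "composable C c l" for c l
  using that assms(2) by (induction l arbitrary: c) (auto simp: endo_functor_def)
 have 1: "ev (Gr' e) (z' (\<eta> c # map T (f # l))) = hh e (ev (Gr e) (z (\<eta> c # map T (f # l))))"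
  using Cons.prems(2)[of "\<eta> c # map T (f # l)"] composable_map[OF assms(2) Cons.prems(1)] assms(3) c ends[OF Cons.prems(1)]
  by (simp add: nat_from_id_def e_def)
 have 2: "ev (Gr' e) (prism C T \<eta> (%l. z' (f # l)) (tgt C f) l) = hh e (ev (Gr e) (prism C T \<eta> (%l. z (f # l)) (tgt C f) l))"
  unfolding e_def by (rule Cons.IH[OF f(3)]) (use Cons.prems(2)[of "f # l'" for l'] f in auto)
 show ?case
  unfolding foldl_Cons prism.simps e_def[symmetric]
  by (simp add: g.ev_diff g'.ev_diff 1[simplified] 2)
qed

lemma diagram_dif_nat:
 assumes "diagram C D" "f : ar C" "z : carrier (grp (on_ob D (src C f)) m)"
 shows "on_ar D f (m + 1) (dif (on_ob D (src C f)) m z) = dif (on_ob D (tgt C f)) m (on_ar D f m z)"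
 using assms unfolding diagram_def cochain_map_def by blast

lemma bar_cmul:
 "additive_action C act ==> bar C act (%c l. frag_cmul ((-1) ^ n) (x c l)) c l = frag_cmul ((-1) ^ n) (bar C act x c l)"
proof -
 assume a: "additive_action C act"
 consider "(-1) ^ n = (1::int)" | "(-1) ^ n = (-1::int)" by (metis minus_one_power_iff)
 then show ?thesis
 proof cases
  case 2
  then show ?thesis by (cases l) (auto simp: bar_tail_minus[OF a] simp del: bar_tail.simps)
 qed simp
qed

lemma push_arrow_hom:
 assumes "diagram C D" "diagram C D'" "f : ar C"
  and "!!x. x : carrier (grp (on_ob D (src C f)) m) ==> hh (tgt C f) (on_ar D f m x) = on_ar D' f m' (hh (src C f) x)"
  and "ev (grp (on_ob D' (src C f)) m') w = hh (src C f) (ev (grp (on_ob D (src C f)) m) z)"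
 shows "ev (grp (on_ob D' (tgt C f)) m') (push_arrow C D' m' f w) = hh (tgt C f) (ev (grp (on_ob D (tgt C f)) m) (push_arrow C D m f z))"
proof -
 interpret comm_group "grp (on_ob D (src C f)) m"
  using assms(1,3) by (auto intro!: diagram_comm_group simp: diagram_def category.src_ob)
 show ?thesis using assms by (simp add: ev_push_arrow)
qed

lemma bar_push_hom:
 assumes "diagram C D" "diagram C D'"
  and "!!c. c : ob C ==> hh c : hom (grp (on_ob D c) m) (grp (on_ob D' c) m')"
  and "!!f x. f : ar C ==> x : carrier (grp (on_ob D (src C f)) m) ==> hh (tgt C f) (on_ar D f m x) = on_ar D' f m' (hh (src C f) x)"
  and "composable C c l"
  and "!!c' l'. composable C c' l' ==> Suc (length l') = length l ==>
   ev (grp (on_ob D' (chain_end C c' l')) m') (z' c' l') = hh (chain_end C c' l') (ev (grp (on_ob D (chain_end C c' l')) m) (z c' l'))"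
 shows "ev (grp (on_ob D' (chain_end C c l)) m') (bar C (push_arrow C D' m') z' c l)
  = hh (chain_end C c l) (ev (grp (on_ob D (chain_end C c l)) m) (bar C (push_arrow C D m) z c l))"
proof -
 have cat: "category C" using assms(1) by (simp add: diagram_def)
 show ?thesis
  by (rule bar_ev_hom[where Gr = "%c. grp (on_ob D c) m" and Gr' = "%c. grp (on_ob D' c) m'" and hh = hh, OF cat])
   (use assms in \<open>auto intro!: diagram_comm_group push_arrow_hom\<close>)
qed

lemma bar_push_cong:
 assumes "diagram C D" "composable C c l"
  and "!!c' l'. composable C c' l' ==> Suc (length l') = length l ==>
   ev (grp (on_ob D (chain_end C c' l')) m) (z' c' l') = ev (grp (on_ob D (chain_end C c' l')) m) (z c' l')"
 shows "ev (grp (on_ob D (chain_end C c l)) m) (bar C (push_arrow C D m) z' c l)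
  = ev (grp (on_ob D (chain_end C c l)) m) (bar C (push_arrow C D m) z c l)"
 by (rule bar_push_hom[where hh = "%_ x. x", OF assms(1,1)]) (use assms in \<open>auto simp: hom_def\<close>)

lemma holim_dif_carrier:
 assumes "diagram C D" "x : carrier (grp (holim C D) k)"
 shows "dif (holim C D) k x : carrier (grp (holim C D) (k + 1))"
proof -
 have cat: "category C" using assms(1) by (simp add: diagram_def)
 have "dif (holim C D) k x : extensional (strings C)" by (simp add: holim_def)
 moreover have "dif (holim C D) k x (c, l) : carrier (holim_term C D (k + 1) c l)" if "composable C c l" for c l
  unfolding holim_dif[OF assms that refl]
  by (rule comm_group.ev_closed) (use assms chain_end_ob[OF cat that] in \<open>auto intro: diagram_comm_group\<close>)
 ultimately show ?thesis unfolding holim_carrier by blast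
qed

lemma holim_eqI:
 assumes "x : carrier (grp (holim C D) k)" "y : carrier (grp (holim C D) k)"
  and "!!c l. composable C c l ==> x (c, l) = y (c, l)"
 shows "x = y"
proof (rule extensionalityI[of _ "strings C"])
 show "x : extensional (strings C)" "y : extensional (strings C)" using assms(1,2) unfolding holim_carrier by auto
 fix \<sigma> assume "\<sigma> : strings C"
 then show "x \<sigma> = y \<sigma>" using assms(3) by (cases \<sigma>) (auto simp: strings_def)
qed

lemma holim_dif_hom:
 assumes "diagram C D"
 shows "dif (holim C D) k : hom (grp (holim C D) k) (grp (holim C D) (k + 1))"
proof (rule homI)
 show "dif (holim C D) k x : carrier (grp (holim C D) (k + 1))" if "x : carrier (grp (holim C D) k)" for x
  using holim_dif_carrier[OF assms that] .
 fix x y assume xy: "x : carrier (grp (holim C D) k)" "y : carrier (grp (holim C D) k)"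
 have cat: "category C" using assms(1) by (simp add: diagram_def)
 interpret H: comm_group "grp (holim C D) k" by (rule holim_comm_group[OF assms])
 interpret H1: comm_group "grp (holim C D) (k + 1)" by (rule holim_comm_group[OF assms])
 note xm = H.m_closed[OF xy]
 show "dif (holim C D) k (x \<otimes>\<^bsub>grp (holim C D) k\<^esub> y) = dif (holim C D) k x \<otimes>\<^bsub>grp (holim C D) (k + 1)\<^esub> dif (holim C D) k y"
 proof (rule holim_eqI)
  show "dif (holim C D) k (x \<otimes>\<^bsub>grp (holim C D) k\<^esub> y) : carrier (grp (holim C D) (k + 1))"
   using holim_dif_carrier[OF assms xm] .
  show "dif (holim C D) k x \<otimes>\<^bsub>grp (holim C D) (k + 1)\<^esub> dif (holim C D) k y : carrier (grp (holim C D) (k + 1))"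
   using holim_dif_carrier[OF assms] xy by simp
  fix c l assume cl: "composable C c l"
  define m where "m = k + 1 - int (length l)"
  define e where "e = chain_end C c l"
  have e: "e : ob C" unfolding e_def by (rule chain_end_ob[OF cat cl])
  interpret G: comm_group "grp (on_ob D e) m" by (rule diagram_comm_group[OF assms e])
  let ?x = "x \<otimes>\<^bsub>grp (holim C D) k\<^esub> y"
  let ?d = "dif (on_ob D e) (m - 1)"
  have v: "?x (c, l) = x (c, l) \<otimes>\<^bsub>grp (on_ob D (chain_end C c l)) (k - int (length l))\<^esub> y (c, l)" if "composable C c l" for c l
   using that by (simp add: holim_mult strings_def)
  have "?d : hom (grp (on_ob D e) (m - 1)) (grp (on_ob D e) m)" using diagram_dif(1)[OF assms e, of "m - 1"] by simp
  moreover have "x (c, l) : carrier (grp (on_ob D e) (m - 1))" "y (c, l) : carrier (grp (on_ob D e) (m - 1))"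
   using holim_component[OF xy(1) cl] holim_component[OF xy(2) cl] by (simp_all add: m_def e_def)
  moreover have "m - 1 = k - int (length l)" by (simp add: m_def)
  ultimately have d: "?d (?x (c, l)) = ?d (x (c, l)) \<otimes>\<^bsub>grp (on_ob D e) m\<^esub> ?d (y (c, l))"
    "?d (x (c, l)) : carrier (grp (on_ob D e) m)" "?d (y (c, l)) : carrier (grp (on_ob D e) m)"
   unfolding v[OF cl] by (auto simp: hom_def e_def)
  \<comment> \<open>The generator of a product is not the sum of the generators of its factors; the
    two agree only after evaluation.\<close>
  have b: "ev (grp (on_ob D e) m) (bar C (push_arrow C D m) (of_holim ?x) c l)
   = ev (grp (on_ob D e) m) (bar C (push_arrow C D m) (%c l. of_holim x c l + of_holim y c l) c l)"
   unfolding e_def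
  proof (rule bar_push_cong[OF assms cl])
   fix c' l' assume cl': "composable C c' l'" "Suc (length l') = length l"
   interpret G': comm_group "grp (on_ob D (chain_end C c' l')) m" by (rule diagram_comm_group[OF assms chain_end_ob[OF cat cl'(1)]])
   have m': "m = k - int (length l')" using cl'(2) by (simp add: m_def flip: cl'(2))
   show "ev (grp (on_ob D (chain_end C c' l')) m) (of_holim ?x c' l') =
     ev (grp (on_ob D (chain_end C c' l')) m) (of_holim x c' l' + of_holim y c' l')"
    using holim_component[OF xy(1) cl'(1) m'] holim_component[OF xy(2) cl'(1) m'] v[OF cl'(1)]
    by (simp add: G'.ev_add m'[symmetric])
  qed
  have p: "(dif (holim C D) k x \<otimes>\<^bsub>grp (holim C D) (k + 1)\<^esub> dif (holim C D) k y) (c, l)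
    = dif (holim C D) k x (c, l) \<otimes>\<^bsub>grp (on_ob D e) m\<^esub> dif (holim C D) k y (c, l)"
   using cl by (simp add: holim_mult strings_def m_def e_def)
  have q: "(ev (grp (on_ob D e) m) a \<otimes>\<^bsub>grp (on_ob D e) m\<^esub> ev (grp (on_ob D e) m) b) = ev (grp (on_ob D e) m) (a + b)" for a b
   by (simp add: G.ev_add)
  have "ev (grp (on_ob D e) m) (frag_of (?d (?x (c, l)))) = ev (grp (on_ob D e) m) (frag_of (?d (x (c, l))) + frag_of (?d (y (c, l))))"
   using d by (simp add: G.ev_add)
  then have "ev (grp (on_ob D e) m) (frag_cmul ((-1) ^ length l) (frag_of (?d (?x (c, l)))))
   = ev (grp (on_ob D e) m) (frag_cmul ((-1) ^ length l) (frag_of (?d (x (c, l))) + frag_of (?d (y (c, l)))))"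
   by (simp add: G.ev_sign del: frag_cmul_distrib2)
  then show "dif (holim C D) k ?x (c, l) = (dif (holim C D) k x \<otimes>\<^bsub>grp (holim C D) (k + 1)\<^esub> dif (holim C D) k y) (c, l)"
   unfolding p holim_dif[OF assms xm cl m_def] holim_dif[OF assms xy(1) cl m_def] holim_dif[OF assms xy(2) cl m_def] e_def[symmetric] q
   unfolding G.ev_add b bar_add[OF push_arrow_additive[OF assms]] frag_cmul_distrib2
   by (simp add: G.m_ac)
 qed
qed

text \<open>The cofaces square to zero by \<open>bar_bar\<close> and the internal differentials
  because the terms are complexes. The mixed terms cancel: the two orders see string lengths that
  differ by one, hence opposite signs.\<close>

lemma holim_dif_dif:
 assumes "diagram C D" "x : carrier (grp (holim C D) k)"
 shows "dif (holim C D) (k + 1) (dif (holim C D) k x) = \<one>\<^bsub>grp (holim C D) (k + 1 + 1)\<^esub>"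
proof (rule holim_eqI)
 have cat: "category C" using assms(1) by (simp add: diagram_def)
 note dx = holim_dif_carrier[OF assms]
 show "dif (holim C D) (k + 1) (dif (holim C D) k x) : carrier (grp (holim C D) (k + 1 + 1))"
  using holim_dif_carrier[OF assms(1) dx] .
 show "\<one>\<^bsub>grp (holim C D) (k + 1 + 1)\<^esub> : carrier (grp (holim C D) (k + 1 + 1))"
  using holim_comm_group[OF assms(1)] by (simp add: comm_group_def group_def monoid.one_closed)
 fix c l assume cl: "composable C c l"
 define m where "m = (k + 1) + 1 - int (length l)"
 have m1: "m - 1 = k + 1 - int (length l)" by (simp add: m_def)
 define e where "e = chain_end C c l"
 have e: "e : ob C" unfolding e_def by (rule chain_end_ob[OF cat cl])
 interpret G: comm_group "grp (on_ob D e) m" by (rule diagram_comm_group[OF assms(1) e])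
 interpret G1: comm_group "grp (on_ob D e) (m - 1)" by (rule diagram_comm_group[OF assms(1) e])
 let ?d = "%c. dif (on_ob D c) (m - 1)"
 let ?act = "push_arrow C D m"
 let ?y = "%c l. frag_of (?d (chain_end C c l) (x (c, l)))"
 \<comment> \<open>The entries of the sum have one arrow less than \<open>l\<close>. For
   \<open>l = []\<close> the exponent is 0 by truncation, which is harmless because
   \<open>bar\<close> vanishes there.\<close>
 let ?s = "(-1) ^ (length l - 1) :: int"
 note add = push_arrow_additive[OF assms(1), of m]
 have hd: "?d c : hom (grp (on_ob D c) (m - 1)) (grp (on_ob D c) m)" if "c : ob C" for c
  using diagram_dif(1)[OF assms(1) that, of "m - 1"] by simp
 interpret d: group_hom "grp (on_ob D e) (m - 1)" "grp (on_ob D e) m" "?d e"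
  using hd[OF e] by unfold_locales
 have nd: "?d (tgt C f) (on_ar D f (m - 1) z) = on_ar D f m (?d (src C f) z)"
  if "f : ar C" "z : carrier (grp (on_ob D (src C f)) (m - 1))" for f z
 proof -
  have "on_ar D f (m - 1 + 1) (?d (src C f) z) = ?d (tgt C f) (on_ar D f (m - 1) z)"
   using diagram_dif_nat[OF assms(1) that] .
  then show ?thesis by simp
 qed
 have 1: "ev (grp (on_ob D e) m) (bar C ?act (of_holim (dif (holim C D) k x)) c l)
  = ev (grp (on_ob D e) m) (frag_cmul ?s (bar C ?act ?y c l))"
 proof -
  have "ev (grp (on_ob D e) m) (bar C ?act (of_holim (dif (holim C D) k x)) c l)
   = ev (grp (on_ob D e) m) (bar C ?act (%c l. bar C ?act (of_holim x) c l + frag_cmul ?s (?y c l)) c l)"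
   unfolding e_def
  proof (rule bar_push_cong[OF assms(1) cl])
   fix c' l' assume cl': "composable C c' l'" "Suc (length l') = length l"
   have m': "m = k + 1 - int (length l')" using cl'(2) by (simp add: m_def flip: cl'(2))
   have "dif (holim C D) k x (c', l') : carrier (grp (on_ob D (chain_end C c' l')) m)"
    by (rule holim_component[OF dx cl'(1) m'])
   moreover have "length l' = length l - 1" using cl'(2) by simp
   ultimately show "ev (grp (on_ob D (chain_end C c' l')) m) (of_holim (dif (holim C D) k x) c' l')
    = ev (grp (on_ob D (chain_end C c' l')) m) (bar C ?act (of_holim x) c' l' + frag_cmul ?s (?y c' l'))"
    using holim_dif[OF assms cl'(1) m'] diagram_comm_group[OF assms(1) chain_end_ob[OF cat cl'(1)], of m]
    by (simp add: comm_group.ev_of)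
  qed
  also have "\<dots> = ev (grp (on_ob D e) m) (bar C ?act (bar C ?act (of_holim x)) c l + frag_cmul ?s (bar C ?act ?y c l))"
   by (simp only: bar_add[OF add] bar_cmul[OF add])
  finally show ?thesis by (simp add: bar_bar[OF cat add cl])
 qed
 have 2: "ev (grp (on_ob D e) m) (bar C ?act ?y c l) = ?d e (ev (grp (on_ob D e) (m - 1)) (bar C (push_arrow C D (m - 1)) (of_holim x) c l))"
  unfolding e_def
 proof (rule bar_push_hom[OF assms(1,1) hd nd cl])
  fix c' l' assume cl': "composable C c' l'" "Suc (length l') = length l"
  have m': "m - 1 = k - int (length l')" using cl'(2) by (simp add: m_def flip: cl'(2))
  have v: "x (c', l') : carrier (grp (on_ob D (chain_end C c' l')) (m - 1))" by (rule holim_component[OF assms(2) cl'(1) m'])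
  then have "?d (chain_end C c' l') (x (c', l')) : carrier (grp (on_ob D (chain_end C c' l')) m)"
   using hd[OF chain_end_ob[OF cat cl'(1)]] by (auto simp: hom_def)
  with v show "ev (grp (on_ob D (chain_end C c' l')) m) (?y c' l') = ?d (chain_end C c' l') (ev (grp (on_ob D (chain_end C c' l')) (m - 1)) (of_holim x c' l'))"
   using diagram_comm_group[OF assms(1) chain_end_ob[OF cat cl'(1)]] by (simp add: comm_group.ev_of)
 qed
 have v: "x (c, l) : carrier (grp (on_ob D e) (m - 1 - 1))" unfolding e_def by (rule holim_component[OF assms(2) cl]) (simp add: m_def)
 have dv: "dif (on_ob D e) (m - 1 - 1) (x (c, l)) : carrier (grp (on_ob D e) (m - 1))"
  using v diagram_dif(1)[OF assms(1) e, of "m - 1 - 1"] by (auto simp: hom_def)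
 have ddv: "?d e (dif (on_ob D e) (m - 1 - 1) (x (c, l))) = \<one>\<^bsub>grp (on_ob D e) m\<^esub>"
  using diagram_dif(2)[OF assms(1) e v] by simp
 have 3: "?d e (dif (holim C D) k x (c, l)) = ev (grp (on_ob D e) m) (bar C ?act ?y c l)"
 proof -
  obtain w where w: "w = dif (on_ob D e) (m - 1 - 1) (x (c, l))" by blast
  note dv' = dv[folded w] and ddv' = ddv[folded w]
  have "?d e (w [^]\<^bsub>grp (on_ob D e) (m - 1)\<^esub> ((-1) ^ length l :: int)) = \<one>\<^bsub>grp (on_ob D e) m\<^esub>"
   by (simp add: d.hom_int_pow dv' ddv' G.int_pow_one)
  then show ?thesis
   unfolding holim_dif[OF assms cl m1] e_def[symmetric] 2 G1.ev_add G1.ev_sign w[symmetric] G1.ev_of[OF dv']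
   by (simp add: dv' d.hom_mult)
 qed
 have dxm: "?d e (dif (holim C D) k x (c, l)) : carrier (grp (on_ob D e) m)" unfolding 3 by simp
 have "dif (holim C D) (k + 1) (dif (holim C D) k x) (c, l) =
   ev (grp (on_ob D e) m) (frag_cmul ?s (bar C ?act ?y c l)) \<otimes>\<^bsub>grp (on_ob D e) m\<^esub> ev (grp (on_ob D e) m) (frag_cmul ((-1) ^ length l) (bar C ?act ?y c l))"
  unfolding holim_dif[OF assms(1) dx cl m_def] e_def[symmetric] G.ev_add 1
  unfolding G.ev_sign 3[symmetric] G.ev_of[OF dxm] ..
 also have "\<dots> = ev (grp (on_ob D e) m) (frag_cmul (?s + (-1) ^ length l) (bar C ?act ?y c l))"
  by (simp add: G.ev_add frag_cmul_distrib)
 also have "\<dots> = \<one>\<^bsub>grp (on_ob D e) m\<^esub>"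
  by (cases l) (auto simp del: foldl_Cons)
 finally show "dif (holim C D) (k + 1) (dif (holim C D) k x) (c, l) = \<one>\<^bsub>grp (holim C D) (k + 1 + 1)\<^esub> (c, l)"
  using cl by (simp add: holim_one strings_def m_def e_def)
qed

lemma holim_complex: "diagram C D ==> cochain_complex (holim C D)"
 unfolding cochain_complex_def by (blast intro: holim_comm_group holim_dif_hom holim_dif_dif)

section \<open>Maps of homotopy limits and the canonical map from a cone\<close>

definition natural_map ::
  "('c, 'k) category => ('c, 'k, 'v cochain, int => 'v => 'v) funct =>
   ('c, 'k, 'v cochain, int => 'v => 'v) funct => ('c => int => 'v => 'v) => bool" where
 "natural_map C D D' \<tau> \<longleftrightarrow> (\<forall>c\<in>ob C. cochain_map (on_ob D c) (on_ob D' c) (\<tau> c)) &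
  (\<forall>f\<in>ar C. \<forall>n. \<forall>x\<in>carrier (grp (on_ob D (src C f)) n).
   \<tau> (tgt C f) n (on_ar D f n x) = on_ar D' f n (\<tau> (src C f) n x))"

definition holim_map ::
  "('c, 'k) category => ('c => int => 'v => 'v) => int => ('c \<times> 'k list => 'v) => ('c \<times> 'k list => 'v)" where
 "holim_map C \<tau> k x = (\<lambda>(c, l)\<in>strings C. \<tau> (chain_end C c l) (k - int (length l)) (x (c, l)))"

lemma holim_map_component:
 "composable C c l ==> m = k - int (length l) ==> holim_map C \<tau> k x (c, l) = \<tau> (chain_end C c l) m (x (c, l))"
 by (simp add: holim_map_def strings_def)

lemma holim_map_cochain_map:
 assumes D: "diagram C D" "diagram C D'" and \<tau>: "natural_map C D D' \<tau>"
 shows "cochain_map (holim C D) (holim C D') (holim_map C \<tau>)"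
 unfolding cochain_map_def
proof (intro allI conjI ballI)
 fix k
 have cat: "category C" using D(1) by (simp add: diagram_def)
 have h: "\<tau> c m : hom (grp (on_ob D c) m) (grp (on_ob D' c) m)" if "c : ob C" for c m
  using \<tau> that by (auto simp: natural_map_def cochain_map_def)
 have hd: "\<tau> c (m + 1) (dif (on_ob D c) m x) = dif (on_ob D' c) m (\<tau> c m x)" if "c : ob C" "x : carrier (grp (on_ob D c) m)" for c m x
  using \<tau> that unfolding natural_map_def cochain_map_def by blast
 have closed: "holim_map C \<tau> k x : carrier (grp (holim C D') k)" if x: "x : carrier (grp (holim C D) k)" for x k
  unfolding holim_carrier
 proof (intro conjI allI impI)
  show "holim_map C \<tau> k x : extensional (strings C)" by (simp add: holim_map_def)
  fix c l assume cl: "composable C c l"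
  show "holim_map C \<tau> k x (c, l) : carrier (holim_term C D' k c l)"
   using h[OF chain_end_ob[OF cat cl]] holim_component[OF x cl refl] by (auto simp: holim_map_component[OF cl refl] hom_def)
 qed
 show "holim_map C \<tau> k : hom (grp (holim C D) k) (grp (holim C D') k)"
 proof (rule homI[OF closed], assumption)
  fix x y assume xy: "x : carrier (grp (holim C D) k)" "y : carrier (grp (holim C D) k)"
  interpret H: comm_group "grp (holim C D) k" by (rule holim_comm_group[OF D(1)])
  interpret H': comm_group "grp (holim C D') k" by (rule holim_comm_group[OF D(2)])
  show "holim_map C \<tau> k (x \<otimes>\<^bsub>grp (holim C D) k\<^esub> y) = holim_map C \<tau> k x \<otimes>\<^bsub>grp (holim C D') k\<^esub> holim_map C \<tau> k y"
  proof (rule holim_eqI)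
   fix c l assume cl: "composable C c l"
   then show "holim_map C \<tau> k (x \<otimes>\<^bsub>grp (holim C D) k\<^esub> y) (c, l) = (holim_map C \<tau> k x \<otimes>\<^bsub>grp (holim C D') k\<^esub> holim_map C \<tau> k y) (c, l)"
    using h[OF chain_end_ob[OF cat cl]] holim_component[OF xy(1) cl refl] holim_component[OF xy(2) cl refl]
    by (simp add: holim_map_component[OF cl refl] holim_mult strings_def hom_mult)
  qed (use closed xy in auto)
 qed
 fix x assume x: "x : carrier (grp (holim C D) k)"
 show "holim_map C \<tau> (k + 1) (dif (holim C D) k x) = dif (holim C D') k (holim_map C \<tau> k x)"
 proof (rule holim_eqI)
  show "holim_map C \<tau> (k + 1) (dif (holim C D) k x) : carrier (grp (holim C D') (k + 1))"
   by (rule closed[OF holim_dif_carrier[OF D(1) x]])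
  show "dif (holim C D') k (holim_map C \<tau> k x) : carrier (grp (holim C D') (k + 1))"
   by (rule holim_dif_carrier[OF D(2) closed[OF x]])
  fix c l assume cl: "composable C c l"
  define m where "m = k + 1 - int (length l)"
  define e where "e = chain_end C c l"
  have e: "e : ob C" unfolding e_def by (rule chain_end_ob[OF cat cl])
  interpret G: comm_group "grp (on_ob D e) m" by (rule diagram_comm_group[OF D(1) e])
  interpret G': comm_group "grp (on_ob D' e) m" by (rule diagram_comm_group[OF D(2) e])
  interpret t: group_hom "grp (on_ob D e) m" "grp (on_ob D' e) m" "\<tau> e m"
   using h[OF e] by unfold_locales
  have m1: "m - 1 = k - int (length l)" by (simp add: m_def)
  have xc: "x (c, l) : carrier (grp (on_ob D e) (m - 1))" unfolding e_def by (rule holim_component[OF x cl m1])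
  have dx: "dif (on_ob D e) (m - 1) (x (c, l)) : carrier (grp (on_ob D e) m)"
   using xc diagram_dif(1)[OF D(1) e, of "m - 1"] by (auto simp: hom_def)
  have b: "ev (grp (on_ob D' e) m) (bar C (push_arrow C D' m) (of_holim (holim_map C \<tau> k x)) c l)
   = \<tau> e m (ev (grp (on_ob D e) m) (bar C (push_arrow C D m) (of_holim x) c l))"
   unfolding e_def
  proof (rule bar_push_hom[where hh = "%c. \<tau> c m", OF D h _ cl])
   fix f x assume "f : ar C" "x : carrier (grp (on_ob D (src C f)) m)"
   then show "\<tau> (tgt C f) m (on_ar D f m x) = on_ar D' f m (\<tau> (src C f) m x)"
    using \<tau> by (simp add: natural_map_def)
  next
   fix c' l' assume cl': "composable C c' l'" "Suc (length l') = length l"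
   have m': "m = k - int (length l')" using cl'(2) by (simp add: m_def flip: cl'(2))
   have e': "chain_end C c' l' : ob C" by (rule chain_end_ob[OF cat cl'(1)])
   have v: "x (c', l') : carrier (grp (on_ob D (chain_end C c' l')) m)" by (rule holim_component[OF x cl'(1) m'])
   moreover have "\<tau> (chain_end C c' l') m (x (c', l')) : carrier (grp (on_ob D' (chain_end C c' l')) m)"
    using v h[OF e'] by (auto simp: hom_def)
   ultimately show "ev (grp (on_ob D' (chain_end C c' l')) m) (of_holim (holim_map C \<tau> k x) c' l') =
     \<tau> (chain_end C c' l') m (ev (grp (on_ob D (chain_end C c' l')) m) (of_holim x c' l'))"
    using diagram_comm_group[OF D(1) e'] diagram_comm_group[OF D(2) e']
    by (simp add: comm_group.ev_of holim_map_component[OF cl'(1) m'])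
  qed
  have d: "dif (on_ob D' e) (m - 1) (holim_map C \<tau> k x (c, l)) = \<tau> e m (dif (on_ob D e) (m - 1) (x (c, l)))"
   using hd[OF e xc] by (simp add: holim_map_component[OF cl m1] e_def)
  show "holim_map C \<tau> (k + 1) (dif (holim C D) k x) (c, l) = dif (holim C D') k (holim_map C \<tau> k x) (c, l)"
   unfolding holim_map_component[OF cl m_def] holim_dif[OF D(1) x cl m_def] holim_dif[OF D(2) closed[OF x] cl m_def] e_def[symmetric] d
    G.ev_add G'.ev_add G.ev_sign G'.ev_sign b G.ev_of[OF dx] G'.ev_of[OF t.hom_closed[OF dx]]
   by (simp add: dx t.hom_int_pow)
 qed
qed

lemma frag_cmul_diff: "frag_cmul k (a - b) = frag_cmul k a - frag_cmul k b"
 by (rule poly_mapping_eqI) (simp add: lookup_minus algebra_simps)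

lemma bar_zero: "additive_action C act ==> bar C act (%c l. 0) c l = 0"
 using bar_add[of C act "%c l. 0" "%c l. 0" c l] by simp

lemma bar_diff:
 assumes "additive_action C act"
 shows "bar C act (%c l. x c l - y c l) c l = bar C act x c l - bar C act y c l"
 using bar_add[OF assms, where x = "%c l. x c l - y c l" and y = y and c = c and l = l] by (simp add: eq_diff_eq)

definition cone_map ::
  "('c, 'k) category => 'w cochain => ('c, 'k, 'v cochain, int => 'v => 'v) funct => ('c => int => 'w => 'v) => bool" where
 "cone_map C A D e \<longleftrightarrow> (\<forall>c\<in>ob C. cochain_map A (on_ob D c) (e c)) &
  (\<forall>f\<in>ar C. \<forall>n. \<forall>a\<in>carrier (grp A n). on_ar D f n (e (src C f) n a) = e (tgt C f) n a)"

lemma to_holim_component: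
 "composable C c l ==> m = k - int (length l) ==>
  to_holim C D e k a (c, l) = (if l = [] then e c k a else \<one>\<^bsub>grp (on_ob D (chain_end C c l)) m\<^esub>)"
 by (simp add: to_holim_def strings_def last_ob_chain_end)

text \<open>The image is trivial at strings with arrows, so the equation has content at strings with
  at most one arrow: without arrows it is the cochain map property of \<open>e\<close>, and at one
  arrow the two faces cancel by compatibility of the cone.\<close>

lemma to_holim_cochain_map:
 assumes D: "diagram C D" and A: "cochain_complex A" and e: "cone_map C A D e"
 shows "cochain_map A (holim C D) (to_holim C D e)"
 unfolding cochain_map_def
proof (intro allI conjI ballI)
 fix k
 have cat: "category C" using D(1) by (simp add: diagram_def)
 have h: "e c m : hom (grp A m) (grp (on_ob D c) m)" if "c : ob C" for c m
  using e that by (auto simp: cone_map_def cochain_map_def)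
 have hd: "e c (m + 1) (dif A m x) = dif (on_ob D c) m (e c m x)" if "c : ob C" "x : carrier (grp A m)" for c m x
  using e that unfolding cone_map_def cochain_map_def by blast
 have closed: "to_holim C D e k a : carrier (grp (holim C D) k)" if a: "a : carrier (grp A k)" for a k
  unfolding holim_carrier
 proof (intro conjI allI impI)
  show "to_holim C D e k a : extensional (strings C)" by (simp add: to_holim_def)
  fix c l assume cl: "composable C c l"
  show "to_holim C D e k a (c, l) : carrier (holim_term C D k c l)"
   using h[of c k] a composable_ob[OF cat cl] diagram_comm_group[OF D chain_end_ob[OF cat cl]]
   by (auto simp: to_holim_component[OF cl refl] hom_def comm_group_def group_def monoid.one_closed)
 qed
 show "to_holim C D e k : hom (grp A k) (grp (holim C D) k)"
 proof (rule homI[OF closed], assumption)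
  fix x y assume xy: "x : carrier (grp A k)" "y : carrier (grp A k)"
  interpret A: comm_group "grp A k" using A by (simp add: cochain_complex_def)
  interpret H: comm_group "grp (holim C D) k" by (rule holim_comm_group[OF D])
  show "to_holim C D e k (x \<otimes>\<^bsub>grp A k\<^esub> y) = to_holim C D e k x \<otimes>\<^bsub>grp (holim C D) k\<^esub> to_holim C D e k y"
  proof (rule holim_eqI)
   fix c l assume cl: "composable C c l"
   have "comm_group (grp (on_ob D (chain_end C c l)) (k - int (length l)))"
    by (rule diagram_comm_group[OF D chain_end_ob[OF cat cl]])
   then show "to_holim C D e k (x \<otimes>\<^bsub>grp A k\<^esub> y) (c, l) = (to_holim C D e k x \<otimes>\<^bsub>grp (holim C D) k\<^esub> to_holim C D e k y) (c, l)"
    using cl h[OF composable_ob[OF cat cl]] xy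
    by (auto simp: to_holim_component[OF cl refl] holim_mult strings_def hom_mult comm_group_def group_def monoid.l_one monoid.one_closed)
  qed (use closed xy in auto)
 qed
 fix a assume a: "a : carrier (grp A k)"
 have da: "dif A k a : carrier (grp A (k + 1))" using A a by (auto simp: cochain_complex_def hom_def)
 show "to_holim C D e (k + 1) (dif A k a) = dif (holim C D) k (to_holim C D e k a)"
 proof (rule holim_eqI)
  show "to_holim C D e (k + 1) (dif A k a) : carrier (grp (holim C D) (k + 1))" by (rule closed[OF da])
  show "dif (holim C D) k (to_holim C D e k a) : carrier (grp (holim C D) (k + 1))"
   by (rule holim_dif_carrier[OF D closed[OF a]])
  fix c l assume cl: "composable C c l"
  define m where "m = k + 1 - int (length l)"
  define t where "t = chain_end C c l"
  have t: "t : ob C" unfolding t_def by (rule chain_end_ob[OF cat cl])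
  have c: "c : ob C" by (rule composable_ob[OF cat cl])
  have m1: "m - 1 = k - int (length l)" by (simp add: m_def)
  interpret G: comm_group "grp (on_ob D t) m" by (rule diagram_comm_group[OF D t])
  interpret G1: comm_group "grp (on_ob D t) (m - 1)" by (rule diagram_comm_group[OF D t])
  interpret d: group_hom "grp (on_ob D t) (m - 1)" "grp (on_ob D t) m" "dif (on_ob D t) (m - 1)"
   using diagram_dif(1)[OF D t, of "m - 1"] by unfold_locales simp
  have x1: "to_holim C D e k a (c', l') = e c' k a" if "composable C c' l'" "l' = []" for c' l'
   using to_holim_component[OF that(1) refl] that(2) by simp
  note dif = holim_dif[OF D closed[OF a] cl m_def, folded t_def]
  note comp = to_holim_component[OF cl m1, of D e a, folded t_def]
  show "to_holim C D e (k + 1) (dif A k a) (c, l) = dif (holim C D) k (to_holim C D e k a) (c, l)"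
  proof (cases "l = []")
   case True
   then have tc: "t = c" "m = k + 1" by (simp_all add: t_def m_def)
   have "dif (on_ob D c) k (e c k a) : carrier (grp (on_ob D c) (k + 1))"
    using h[OF c, of k] a diagram_dif(1)[OF D c, of k] by (auto simp: hom_def)
   then show ?thesis unfolding dif to_holim_component[OF cl m_def] comp
    using True tc hd[OF c a] G.ev_of by simp
  next
   case False
   have "ev (grp (on_ob D t) m) (bar C (push_arrow C D m) (of_holim (to_holim C D e k a)) c l) = \<one>\<^bsub>grp (on_ob D t) m\<^esub>"
   proof (cases "length l = 1")
    case True
    then obtain f where l: "l = [f]" by (cases l) auto
    have f: "f : ar C" "src C f = c" "tgt C f = t" using cl by (simp_all add: l t_def)
    have mk: "m = k" by (simp add: m_def l)
    have v: "e c k a : carrier (grp (on_ob D c) k)" "e t k a : carrier (grp (on_ob D t) k)"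
     using h[OF c, of k] h[OF t, of k] a by (auto simp: hom_def)
    have nat: "on_ar D f k (e c k a) = e t k a" using e f a by (auto simp: cone_map_def)
    have "bar C (push_arrow C D m) (of_holim (to_holim C D e k a)) c l = 0"
     using v f nat x1[of t "[]"] x1[of c "[]"] t c by (simp add: l push_arrow_def mk)
    then show ?thesis by simp
   next
    \<comment> \<open>With at least two arrows every face still has an arrow, so all entries
      evaluate to the unit.\<close>
    case l1: False
    have "ev (grp (on_ob D t) m) (bar C (push_arrow C D m) (of_holim (to_holim C D e k a)) c l)
     = ev (grp (on_ob D t) m) (bar C (push_arrow C D m) (%c l. 0) c l)"
     unfolding t_def
    proof (rule bar_push_cong[OF D cl])
     fix c' l' assume cl': "composable C c' l'" "Suc (length l') = length l"
     have m': "m = k - int (length l')" using cl'(2) by (simp add: m_def flip: cl'(2))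
     have ne: "l' ~= []" using cl'(2) l1 by auto
     interpret G': comm_group "grp (on_ob D (chain_end C c' l')) m" by (rule diagram_comm_group[OF D chain_end_ob[OF cat cl'(1)]])
     show "ev (grp (on_ob D (chain_end C c' l')) m) (of_holim (to_holim C D e k a) c' l') = ev (grp (on_ob D (chain_end C c' l')) m) 0"
      using ne by (simp add: to_holim_component[OF cl'(1) m'])
    qed
    then show ?thesis by (simp add: bar_zero[OF push_arrow_additive[OF D]])
   qed
   then show ?thesis unfolding dif to_holim_component[OF cl m_def] comp t_def[symmetric] G.ev_add G.ev_sign
    using False by simp
  qed
 qed
qed

section \<open>Contraction of a homotopy limit by an extra degeneracy\<close>

text \<open>For the Cech diagram \<open>T\<close> will be the decalage, which adds a new first
  vertex, and \<open>r\<close> the extra degeneracy. The identity and the constant functor at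
  \<open>b\<close> both map to \<open>T\<close>, and \<open>r\<close> undoes the effect of
  \<open>\<eta>\<close> on the diagram.\<close>

locale contraction =
 fixes C :: "('c, 'k) category" and D :: "('c, 'k, 'v cochain, int => 'v => 'v) funct"
  and To :: "'c => 'c" and T :: "'k => 'k" and \<eta> :: "'c => 'k" and b :: 'c and \<iota> :: "'c => 'k"
  and r :: "'c => int => 'v => 'v"
 assumes D: "diagram C D" and T: "endo_functor C To T" and \<eta>: "nat_from_id C To T \<eta>" and \<iota>: "cone_over C To T b \<iota>"
  and r_map: "c : ob C ==> cochain_map (on_ob D (To c)) (on_ob D c) (r c)"
  and r_nat: "[|f : ar C; y : carrier (grp (on_ob D (To (src C f))) n)|] ==>
   r (tgt C f) n (on_ar D (T f) n y) = on_ar D f n (r (src C f) n y)"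
  and r_retract: "[|c : ob C; x : carrier (grp (on_ob D c) n)|] ==> r c n (on_ar D (\<eta> c) n x) = x"
begin

lemma cat: "category C" using D by (simp add: diagram_def)

lemma To_ob: "c : ob C ==> To c : ob C" using T by (simp add: endo_functor_def)

text \<open>Cone minus prism: in the difference of \<open>cone_bar\<close> and
  \<open>prism_bar\<close> the terms \<open>x (To c) (map T l)\<close> cancel. The value lies at
  \<open>To\<close> of the end of the string, from where \<open>r\<close> brings it back.\<close>

definition pre_htpy :: "('c \<times> 'k list => 'v) => 'c => 'k list => 'v \<Rightarrow>\<^sub>0 int" where
 "pre_htpy x c l = frag_of (x (b, \<iota> c # map T l)) - prism C T \<eta> (of_holim x c) c l"

definition htpy :: "int => ('c \<times> 'k list => 'v) => ('c \<times> 'k list => 'v)" where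
 "htpy k x = (\<lambda>(c, l)\<in>strings C. r (chain_end C c l) (k - int (length l))
  (ev (grp (on_ob D (To (chain_end C c l))) (k - int (length l))) (pre_htpy x c l)))"

lemma htpy_component:
 "composable C c l ==> m = k - int (length l) ==>
  htpy k x (c, l) = r (chain_end C c l) m (ev (grp (on_ob D (To (chain_end C c l))) m) (pre_htpy x c l))"
 by (simp add: htpy_def strings_def)

lemma r_hom: "c : ob C ==> r c m : hom (grp (on_ob D (To c)) m) (grp (on_ob D c) m)"
 using r_map by (simp add: cochain_map_def)

lemma htpy_carrier: "htpy k x : carrier (grp (holim C D) k)"
 unfolding holim_carrier
proof (intro conjI allI impI)
 show "htpy k x : extensional (strings C)" by (simp add: htpy_def)
 fix c l assume cl: "composable C c l"
 have e: "chain_end C c l : ob C" by (rule chain_end_ob[OF cat cl])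
 show "htpy k x (c, l) : carrier (holim_term C D k c l)"
  unfolding htpy_component[OF cl refl]
  by (rule hom_in_carrier[OF r_hom[OF e]]) (rule comm_group.ev_closed[OF diagram_comm_group[OF D To_ob[OF e]]])
qed

lemma chain_end_map: "composable C c l ==> chain_end C (To c) (map T l) = To (chain_end C c l)"
 using T by (induction l arbitrary: c) (auto simp: endo_functor_def)

lemma pre_htpy_hom:
 assumes "composable C c l"
  and "!!c. c : ob C ==> hh c : hom (grp (on_ob D c) m) (grp (on_ob D c) m')"
  and "!!c' l'. composable C c' l' ==> length l' = Suc (length l) ==>
   ev (grp (on_ob D (chain_end C c' l')) m') (z' c' l') = hh (chain_end C c' l') (ev (grp (on_ob D (chain_end C c' l')) m) (z c' l'))"
 shows "ev (grp (on_ob D (To (chain_end C c l))) m') (z' b (\<iota> c # map T l) - prism C T \<eta> (z' c) c l)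
  = hh (To (chain_end C c l)) (ev (grp (on_ob D (To (chain_end C c l))) m) (z b (\<iota> c # map T l) - prism C T \<eta> (z c) c l))"
proof -
 define t where "t = To (chain_end C c l)"
 have t: "t : ob C" unfolding t_def by (rule To_ob[OF chain_end_ob[OF cat assms(1)]])
 have c: "c : ob C" by (rule composable_ob[OF cat assms(1)])
 interpret G: comm_group "grp (on_ob D t) m" by (rule diagram_comm_group[OF D t])
 interpret G': comm_group "grp (on_ob D t) m'" by (rule diagram_comm_group[OF D t])
 interpret h: group_hom "grp (on_ob D t) m" "grp (on_ob D t) m'" "hh t" using assms(2)[OF t] by unfold_locales
 have "composable C b (\<iota> c # map T l)" "chain_end C b (\<iota> c # map T l) = t"
  using \<iota> c composable_map[OF T assms(1)] chain_end_map[OF assms(1)] by (auto simp: cone_over_def t_def)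
 with assms(3)[OF this(1)] have 1: "ev (grp (on_ob D t) m') (z' b (\<iota> c # map T l)) = hh t (ev (grp (on_ob D t) m) (z b (\<iota> c # map T l)))"
  by simp
 have 2: "ev (grp (on_ob D t) m') (prism C T \<eta> (z' c) c l) = hh t (ev (grp (on_ob D t) m) (prism C T \<eta> (z c) c l))"
  unfolding t_def
  by (rule prism_ev_hom[where Gr = "%c. grp (on_ob D c) m" and Gr' = "%c. grp (on_ob D c) m'" and hh = hh, OF cat T \<eta> _ assms(1)])
   (use assms D in \<open>auto intro: diagram_comm_group\<close>)
 show ?thesis unfolding t_def[symmetric] by (simp add: G.ev_diff G'.ev_diff 1 2)
qed

text \<open>Applying \<open>r\<close> to the difference of \<open>cone_bar\<close> and
  \<open>prism_bar\<close> leaves \<open>x\<close> itself, by \<open>r_retract\<close>, and at the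
  empty strings the value transported from \<open>b\<close>. The differential of \<open>x\<close>
  may be nontrivial at the empty strings: in a mapping cone it is the inverse of a value of the
  canonical map, which lives there.\<close>

theorem contraction:
 assumes x: "x : carrier (grp (holim C D) k)"
  and closed: "!!c l. composable C c l ==> l ~= [] ==> dif (holim C D) k x (c, l) = \<one>\<^bsub>grp (on_ob D (chain_end C c l)) (k + 1 - int (length l))\<^esub>"
  and cl: "composable C c l"
  and m: "m = k - int (length l)"
 shows "x (c, l) = dif (holim C D) (k - 1) (htpy (k - 1) x) (c, l) \<otimes>\<^bsub>grp (on_ob D (chain_end C c l)) m\<^esub>
  (if l = [] then r c m (on_ar D (\<iota> c) m (x (b, []))) else \<one>\<^bsub>grp (on_ob D (chain_end C c l)) m\<^esub>)"
proof -
 define e where "e = chain_end C c l"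
 have e: "e : ob C" unfolding e_def by (rule chain_end_ob[OF cat cl])
 have c: "c : ob C" by (rule composable_ob[OF cat cl])
 note Te = To_ob[OF e]
 let ?act = "push_arrow C D m"
 let ?actT = "%f. push_arrow C D m (T f)"
 let ?s = "(-1) ^ length l :: int"
 let ?dx = "%c l. frag_of (dif (on_ob D (chain_end C c l)) (m - 1) (x (c, l)))"
 interpret G: comm_group "grp (on_ob D e) m" by (rule diagram_comm_group[OF D e])
 interpret TG: comm_group "grp (on_ob D (To e)) m" by (rule diagram_comm_group[OF D Te])
 interpret G1: comm_group "grp (on_ob D e) (m - 1)" by (rule diagram_comm_group[OF D e])
 interpret TG1: comm_group "grp (on_ob D (To e)) (m - 1)" by (rule diagram_comm_group[OF D Te])
 interpret r: group_hom "grp (on_ob D (To e)) m" "grp (on_ob D e) m" "r e m" using r_hom[OF e] by unfold_locales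
 have hd: "dif (on_ob D c) (m - 1) : hom (grp (on_ob D c) (m - 1)) (grp (on_ob D c) m)" if "c : ob C" for c
  using diagram_dif(1)[OF D that, of "m - 1"] by simp
 note add = push_arrow_additive[OF D, of m]
 have addT: "additive_action C ?actT" by (rule additive_action_functor[OF add T])
 have xc: "x (c', l') : carrier (grp (on_ob D (chain_end C c' l')) (m - 1))" "ev (grp (on_ob D (chain_end C c' l')) m) (?dx c' l') = dif (on_ob D (chain_end C c' l')) (m - 1) (x (c', l'))"
  "dif (on_ob D (chain_end C c' l')) (m - 1) (x (c', l')) : carrier (grp (on_ob D (chain_end C c' l')) m)"
  if cl': "composable C c' l'" "length l' = Suc (length l)" for c' l'
 proof -
  have "m - 1 = k - int (length l')" using cl'(2) by (simp add: m)
  then show 1: "x (c', l') : carrier (grp (on_ob D (chain_end C c' l')) (m - 1))" by (rule holim_component[OF x cl'(1)])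
  then show 2: "dif (on_ob D (chain_end C c' l')) (m - 1) (x (c', l')) : carrier (grp (on_ob D (chain_end C c' l')) m)"
   using hd[OF chain_end_ob[OF cat cl'(1)]] by (auto simp: hom_def)
  then show "ev (grp (on_ob D (chain_end C c' l')) m) (?dx c' l') = dif (on_ob D (chain_end C c' l')) (m - 1) (x (c', l'))"
   using diagram_comm_group[OF D chain_end_ob[OF cat cl'(1)], of m] by (simp add: comm_group.ev_of)
 qed
 \<comment> \<open>The strings entering the homotopy have one arrow more than \<open>l\<close>, so
   the differential of \<open>x\<close> vanishes there and expresses the coface part of
   \<open>x\<close> by the internal differential.\<close>
 have A1: "ev (grp (on_ob D (To e)) m) (bar C ?act (of_holim x) b (\<iota> c # map T l) - prism C T \<eta> (bar C ?act (of_holim x) c) c l)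
  = ev (grp (on_ob D (To e)) m) (frag_cmul ?s (?dx b (\<iota> c # map T l)) - prism C T \<eta> (%l. frag_cmul ?s (?dx c l)) c l)"
  unfolding e_def
 proof (rule pre_htpy_hom[where hh = "%_ x. x" and z' = "bar C ?act (of_holim x)" and z = "%c l. frag_cmul ?s (?dx c l)", OF cl])
  fix c' l' assume cl': "composable C c' l'" "length l' = Suc (length l)"
  interpret E: comm_group "grp (on_ob D (chain_end C c' l')) m" by (rule diagram_comm_group[OF D chain_end_ob[OF cat cl'(1)]])
  have m': "m = k + 1 - int (length l')" using cl'(2) by (simp add: m)
  have "dif (holim C D) k x (c', l') = \<one>\<^bsub>grp (on_ob D (chain_end C c' l')) m\<^esub>"
   using closed[OF cl'(1)] cl'(2) m' by fastforce
  then have "ev (grp (on_ob D (chain_end C c' l')) m) (bar C ?act (of_holim x) c' l' + frag_cmul ((-1) ^ length l') (?dx c' l')) = \<one>\<^bsub>grp (on_ob D (chain_end C c' l')) m\<^esub>"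
   using holim_dif[OF D x cl'(1) m'] by simp
  moreover have "(-1) ^ length l' = - ?s" using cl'(2) by simp
  ultimately have "ev (grp (on_ob D (chain_end C c' l')) m) (bar C ?act (of_holim x) c' l' - frag_cmul ?s (?dx c' l')) = \<one>\<^bsub>grp (on_ob D (chain_end C c' l')) m\<^esub>"
   by (simp only: minus_frag_cmul[symmetric] add_uminus_conv_diff)
  then show "ev (grp (on_ob D (chain_end C c' l')) m) (bar C ?act (of_holim x) c' l') = ev (grp (on_ob D (chain_end C c' l')) m) (frag_cmul ?s (?dx c' l'))"
   using E.ev_diff by (metis E.ev_closed E.inv_closed E.inv_equality E.inv_inv)
 qed (simp add: hom_def)
 have A2: "ev (grp (on_ob D (To e)) m) (?dx b (\<iota> c # map T l) - prism C T \<eta> (?dx c) c l)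
  = dif (on_ob D (To e)) (m - 1) (ev (grp (on_ob D (To e)) (m - 1)) (pre_htpy x c l))"
  unfolding e_def pre_htpy_def
 proof (rule pre_htpy_hom[where hh = "%c. dif (on_ob D c) (m - 1)" and z = "of_holim x" and z' = ?dx, OF cl hd])
  fix c' l' assume cl': "composable C c' l'" "length l' = Suc (length l)"
  show "ev (grp (on_ob D (chain_end C c' l')) m) (?dx c' l') = dif (on_ob D (chain_end C c' l')) (m - 1) (ev (grp (on_ob D (chain_end C c' l')) (m - 1)) (of_holim x c' l'))"
   using xc[OF cl'] diagram_comm_group[OF D chain_end_ob[OF cat cl'(1)]] by (simp add: comm_group.ev_of)
 qed
 have ps: "prism C T \<eta> (%l. frag_cmul ?s (?dx c l)) c l = frag_cmul ?s (prism C T \<eta> (?dx c) c l)"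
 proof -
  consider "?s = 1" | "?s = -1" by (metis minus_one_power_iff)
  then show ?thesis by cases (simp_all add: prism_minus)
 qed
 have A: "ev (grp (on_ob D (To e)) m) (bar C ?act (of_holim x) b (\<iota> c # map T l) - prism C T \<eta> (bar C ?act (of_holim x) c) c l)
  = dif (on_ob D (To e)) (m - 1) (ev (grp (on_ob D (To e)) (m - 1)) (pre_htpy x c l)) [^]\<^bsub>grp (on_ob D (To e)) m\<^esub> ?s"
  unfolding A1 ps A2[symmetric] TG.ev_sign[symmetric] by (simp add: frag_cmul_diff)
 \<comment> \<open>Naturality of \<open>r\<close> turns the action through \<open>T\<close> into the
   action itself.\<close>
 have B: "ev (grp (on_ob D e) m) (bar C ?act (of_holim (htpy (k - 1) x)) c l) = r e m (ev (grp (on_ob D (To e)) m) (bar C ?actT (pre_htpy x) c l))"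
  unfolding e_def
 proof (rule bar_ev_hom[where Gr = "%c. grp (on_ob D (To c)) m" and Gr' = "%c. grp (on_ob D c) m" and hh = "%c. r c m", OF cat _ _ cl])
  fix c assume "c : ob C"
  then show "comm_group (grp (on_ob D (To c)) m) & comm_group (grp (on_ob D c) m) & r c m : hom (grp (on_ob D (To c)) m) (grp (on_ob D c) m)"
   using r_hom diagram_comm_group[OF D] To_ob by blast
 next
  fix f w z assume f: "f : ar C" and wz: "ev (grp (on_ob D (src C f)) m) w = r (src C f) m (ev (grp (on_ob D (To (src C f))) m) z)"
  have Tf: "T f : ar C" "src C (T f) = To (src C f)" "tgt C (T f) = To (tgt C f)" using T f by (auto simp: endo_functor_def)
  have v: "ev (grp (on_ob D (To (src C f))) m) z : carrier (grp (on_ob D (To (src C f))) m)"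
   using diagram_comm_group[OF D To_ob[OF category.src_ob[OF cat f]]] by (simp add: comm_group.ev_closed)
  show "ev (grp (on_ob D (tgt C f)) m) (push_arrow C D m f w) = r (tgt C f) m (ev (grp (on_ob D (To (tgt C f))) m) (push_arrow C D m (T f) z))"
   using ev_push_arrow[OF D f, of m w] ev_push_arrow[OF D Tf(1), of m z] wz r_nat[OF f v] Tf by simp
 next
  fix c' l' assume cl': "composable C c' l'" "Suc (length l') = length l"
  have m': "m = (k - 1) - int (length l')" using cl'(2) by (simp add: m flip: cl'(2))
  show "ev (grp (on_ob D (chain_end C c' l')) m) (of_holim (htpy (k - 1) x) c' l') = r (chain_end C c' l') m (ev (grp (on_ob D (To (chain_end C c' l'))) m) (pre_htpy x c' l'))"
   using diagram_comm_group[OF D chain_end_ob[OF cat cl'(1)], of m] holim_component[OF htpy_carrier cl'(1) m', of x]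
   by (simp add: comm_group.ev_of htpy_component[OF cl'(1) m'])
 qed
 let ?y = "ev (grp (on_ob D (To e)) (m - 1)) (pre_htpy x c l)"
 have dr: "dif (on_ob D e) (m - 1) (r e (m - 1) ?y) = r e m (dif (on_ob D (To e)) (m - 1) ?y)"
 proof -
  have "r e (m - 1 + 1) (dif (on_ob D (To e)) (m - 1) ?y) = dif (on_ob D e) (m - 1) (r e (m - 1) ?y)"
   using r_map[OF e] TG1.ev_closed unfolding cochain_map_def by blast
  then show ?thesis by simp
 qed
 have dy: "dif (on_ob D (To e)) (m - 1) ?y : carrier (grp (on_ob D (To e)) m)"
  using hd[OF Te] by (auto simp: hom_def)
 have h1: "htpy (k - 1) x (c, l) = r e (m - 1) ?y"
  using htpy_component[OF cl, of "m - 1" "k - 1" x] by (simp add: m e_def)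
 have m1: "m = (k - 1) + 1 - int (length l)" by (simp add: m)
 have "dif (holim C D) (k - 1) (htpy (k - 1) x) (c, l) = r e m (ev (grp (on_ob D (To e)) m) (bar C ?actT (pre_htpy x) c l))
   \<otimes>\<^bsub>grp (on_ob D e) m\<^esub> r e m (dif (on_ob D (To e)) (m - 1) ?y [^]\<^bsub>grp (on_ob D (To e)) m\<^esub> ?s)"
  unfolding holim_dif[OF D htpy_carrier cl m1] e_def[symmetric] h1 dr G.ev_add G.ev_sign B G.ev_of[OF r.hom_closed[OF dy]]
  by (simp add: r.hom_int_pow[OF dy])
 also have "\<dots> = r e m (ev (grp (on_ob D (To e)) m) (bar C ?actT (pre_htpy x) c l
   + (bar C ?act (of_holim x) b (\<iota> c # map T l) - prism C T \<eta> (bar C ?act (of_holim x) c) c l)))"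
  unfolding A[symmetric] by (simp add: TG.ev_add)
 also have "bar C ?actT (pre_htpy x) c l = bar C ?actT (%c l. of_holim x b (\<iota> c # map T l)) c l - bar C ?actT (%c l. prism C T \<eta> (of_holim x c) c l) c l"
  unfolding pre_htpy_def[abs_def] by (rule bar_diff[OF addT])
 also have "\<dots> + (bar C ?act (of_holim x) b (\<iota> c # map T l) - prism C T \<eta> (bar C ?act (of_holim x) c) c l)
  = (bar C ?act (of_holim x) b (\<iota> c # map T l) + bar C ?actT (%c l. of_holim x b (\<iota> c # map T l)) c l)
   - (prism C T \<eta> (bar C ?act (of_holim x) c) c l + bar C ?actT (%c l. prism C T \<eta> (of_holim x c) c l) c l)"
  by simp
 also have "\<dots> = ?act (\<eta> e) (of_holim x c l) - (if l = [] then ?act (\<iota> c) (of_holim x b []) else 0)"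
  using cone_bar[OF cat add T \<iota> cl, of "of_holim x"] prism_bar[OF cat add T \<eta> cl, of "of_holim x"]
  by (simp add: e_def)
 finally have E: "dif (holim C D) (k - 1) (htpy (k - 1) x) (c, l)
  = r e m (ev (grp (on_ob D (To e)) m) (?act (\<eta> e) (of_holim x c l) - (if l = [] then ?act (\<iota> c) (of_holim x b []) else 0)))" .
 have xv: "x (c, l) : carrier (grp (on_ob D e) m)" unfolding e_def by (rule holim_component[OF x cl m])
 have \<eta>e: "\<eta> e : ar C" "src C (\<eta> e) = e" "tgt C (\<eta> e) = To e" using \<eta> e by (auto simp: nat_from_id_def)
 have 1: "r e m (ev (grp (on_ob D (To e)) m) (?act (\<eta> e) (of_holim x c l))) = x (c, l)"
  using ev_push_arrow[OF D \<eta>e(1), of m "of_holim x c l"] \<eta>e xv r_retract[OF e xv] by simp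
 show ?thesis
 proof (cases "l = []")
  case False
  then show ?thesis unfolding E e_def[symmetric] using 1 xv by simp
 next
  case True
  then have ec: "e = c" and mk: "m = k" by (simp_all add: e_def m)
  have \<iota>c: "\<iota> c : ar C" "src C (\<iota> c) = b" "tgt C (\<iota> c) = To c" "b : ob C" using \<iota> c by (auto simp: cone_over_def)
  have xb: "x (b, []) : carrier (grp (on_ob D b) m)" using holim_component[OF x, of b "[]" m] \<iota>c(4) mk by simp
  have "ev (grp (on_ob D b) m) (of_holim x b []) = x (b, [])"
   using diagram_comm_group[OF D \<iota>c(4)] xb by (simp add: comm_group.ev_of)
  then have 2: "ev (grp (on_ob D (To e)) m) (?act (\<iota> c) (of_holim x b [])) = on_ar D (\<iota> c) m (x (b, []))"
   using ev_push_arrow[OF D \<iota>c(1), of m "of_holim x b []"] \<iota>c ec by simp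
  have v: "on_ar D (\<iota> c) m (x (b, [])) : carrier (grp (on_ob D (To e)) m)"
   unfolding 2[symmetric] by simp
  have "dif (holim C D) (k - 1) (htpy (k - 1) x) (c, l) = x (c, l) \<otimes>\<^bsub>grp (on_ob D e) m\<^esub> inv\<^bsub>grp (on_ob D e) m\<^esub> (r e m (on_ar D (\<iota> c) m (x (b, []))))"
   unfolding E TG.ev_diff using True 1 2 v by simp
  moreover have "x (c, l) \<otimes>\<^bsub>grp (on_ob D e) m\<^esub> inv\<^bsub>grp (on_ob D e) m\<^esub> (r e m (on_ar D (\<iota> c) m (x (b, []))))
    \<otimes>\<^bsub>grp (on_ob D e) m\<^esub> r e m (on_ar D (\<iota> c) m (x (b, []))) = x (c, l)"
   using xv r.hom_closed[OF v] by (simp add: G.m_assoc)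
  ultimately show ?thesis unfolding e_def[symmetric] using True ec by simp
 qed
qed

end

section \<open>Frames, generalized elements and pseudocomplements\<close>

text \<open>The order is false outside the carrier, as for objects of \<open>Loc\<close>, so an
  inequality already provides membership of both sides.\<close>

locale frame_lattice = complete_lattice X for X :: "'a gorder" (structure) +
 assumes meet_sup: "[|a : carrier X; B \<subseteq> carrier X|] ==> a \<sqinter> (\<Squnion> B) = \<Squnion> ((%b. a \<sqinter> b) ` B)"
  and le_carrier: "x \<sqsubseteq> y ==> x : carrier X & y : carrier X"

lemma frame_lattice_iff: "frame_lattice X \<longleftrightarrow> X : ob Loc"
 unfolding Loc_def Let_def frame_def frame_lattice_def frame_lattice_axioms_def by simp blast

text \<open>The pseudocomplement; for a space, the interior of the complement.\<close>

definition (in frame_lattice) neg :: "'a => 'a" where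
 "neg a = \<Squnion> {x : carrier X. x \<sqinter> a = \<bottom>}"

context frame_lattice
begin

lemma meet_lower:
 assumes "a : carrier X" "b : carrier X"
 shows "a \<sqinter> b : carrier X" "a \<sqinter> b \<sqsubseteq> a" "a \<sqinter> b \<sqsubseteq> b"
 using assms by (auto intro: meet_left meet_right)

lemma meet_greatest: "[|z \<sqsubseteq> a; z \<sqsubseteq> b; z : carrier X; a : carrier X; b : carrier X|] ==> z \<sqsubseteq> a \<sqinter> b"
 by (rule meet_le)

lemma le_meet_iff: "[|z : carrier X; a : carrier X; b : carrier X|] ==> z \<sqsubseteq> a \<sqinter> b \<longleftrightarrow> z \<sqsubseteq> a & z \<sqsubseteq> b"
 by (meson meet_greatest meet_lower le_trans)

lemma trans [trans]: "a \<sqsubseteq> b ==> b \<sqsubseteq> c ==> a \<sqsubseteq> c"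
 using le_carrier[of a b] le_carrier[of b c] le_trans[of a b c] by blast

lemma antisymI: "[|a \<sqsubseteq> b; b \<sqsubseteq> a; a : carrier X; b : carrier X|] ==> a = b"
 by (rule le_antisym)

lemma sup_eqI:
 assumes "s : carrier X" "B \<subseteq> carrier X" "!!b. b : B ==> b \<sqsubseteq> s"
  and "!!z. z : carrier X ==> (!!b. b : B ==> b \<sqsubseteq> z) ==> s \<sqsubseteq> z"
 shows "\<Squnion> B = s"
proof (rule antisymI)
 show "\<Squnion> B \<sqsubseteq> s" by (rule sup_least) (use assms in auto)
 show "s \<sqsubseteq> \<Squnion> B" by (rule assms(4)) (use assms(2) sup_upper in auto)
qed (use assms in auto)

lemma inf_eqI:
 assumes "s : carrier X" "B \<subseteq> carrier X" "!!b. b : B ==> s \<sqsubseteq> b"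
  and "!!z. z : carrier X ==> (!!b. b : B ==> z \<sqsubseteq> b) ==> z \<sqsubseteq> s"
 shows "\<Sqinter> B = s"
proof (rule antisymI)
 show "\<Sqinter> B \<sqsubseteq> s" by (rule assms(4)) (use assms(2) inf_lower in auto)
 show "s \<sqsubseteq> \<Sqinter> B" by (rule inf_greatest) (use assms in auto)
qed (use assms in auto)

lemma meet_eqI:
 assumes "s : carrier X" "a : carrier X" "b : carrier X" "s \<sqsubseteq> a" "s \<sqsubseteq> b"
  and "!!z. z : carrier X ==> z \<sqsubseteq> a ==> z \<sqsubseteq> b ==> z \<sqsubseteq> s"
 shows "a \<sqinter> b = s"
 by (rule antisymI) (use assms meet_lower meet_greatest in auto)

lemma meet_commute: "[|a : carrier X; b : carrier X|] ==> a \<sqinter> b = b \<sqinter> a"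
 by (rule antisymI) (auto simp: le_meet_iff meet_lower)

lemma meet_absorb: "[|a : carrier X; b : carrier X; a \<sqsubseteq> b|] ==> a \<sqinter> b = a" "[|a : carrier X; b : carrier X; a \<sqsubseteq> b|] ==> b \<sqinter> a = a"
 by (auto intro!: antisymI simp: le_meet_iff meet_lower)

lemma meet_assoc': "[|a : carrier X; b : carrier X; c : carrier X|] ==> a \<sqinter> b \<sqinter> c = a \<sqinter> (b \<sqinter> c)"
 by (rule meet_assoc)

lemma meet_sup_le:
 assumes "a : carrier X" "B \<subseteq> carrier X" "c : carrier X" "!!b. b : B ==> a \<sqinter> b \<sqsubseteq> c"
 shows "a \<sqinter> (\<Squnion> B) \<sqsubseteq> c"
 unfolding meet_sup[OF assms(1,2)] by (rule sup_least) (use assms in auto)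

text \<open>Opens \<open>v\<close> below \<open>a\<close> play the role of points, and a union is
  dealt with by passing to smaller \<open>v\<close>. This is the frame distributive law in the form
  used throughout.\<close>

lemma le_sup_cases:
 assumes "a \<sqsubseteq> \<Squnion> B" "a : carrier X" "B \<subseteq> carrier X" "c : carrier X"
  "!!b v. b : B ==> v : carrier X ==> v \<sqsubseteq> a ==> v \<sqsubseteq> b ==> v \<sqsubseteq> c"
 shows "a \<sqsubseteq> c"
proof -
 have "a = a \<sqinter> (\<Squnion> B)" using assms by (simp add: meet_absorb)
 moreover have "a \<sqinter> (\<Squnion> B) \<sqsubseteq> c"
  by (rule meet_sup_le) (use assms meet_lower in \<open>auto simp: subset_iff\<close>)
 ultimately show ?thesis by simp
qed

lemma bot_least: "a : carrier X ==> \<bottom> \<sqsubseteq> a" by simp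

lemma le_bot: "[|a : carrier X; a \<sqsubseteq> \<bottom>|] ==> a = \<bottom>"
 by (rule antisymI) auto

lemma neg_closed [simp]: "neg a : carrier X" by (simp add: neg_def)

lemma neg_meet: "a : carrier X ==> neg a \<sqinter> a = \<bottom>"
proof -
 assume a: "a : carrier X"
 have "a \<sqinter> neg a \<sqsubseteq> \<bottom>" unfolding neg_def
  by (rule meet_sup_le) (use a in \<open>auto simp: meet_commute\<close>)
 then show ?thesis using a le_bot meet_lower by (simp add: meet_commute)
qed

lemma le_negI:
 assumes "a : carrier X" "x : carrier X" "!!v. v : carrier X ==> v \<sqsubseteq> x ==> v \<sqsubseteq> a ==> v \<sqsubseteq> \<bottom>"
 shows "x \<sqsubseteq> neg a"
proof -
 have "x \<sqinter> a = \<bottom>" using assms meet_lower[of x a] by (auto intro: le_bot)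
 then show ?thesis unfolding neg_def by (intro sup_upper) (use assms in auto)
qed

lemma le_neg_disjoint:
 assumes "a : carrier X" "v : carrier X" "v \<sqsubseteq> a" "v \<sqsubseteq> neg a"
 shows "v \<sqsubseteq> \<bottom>"
 using neg_meet[OF assms(1)] assms le_meet_iff[of v "neg a" a] by simp

lemma neg_antimono: "[|a : carrier X; b : carrier X; a \<sqsubseteq> b|] ==> neg b \<sqsubseteq> neg a"
 by (rule le_negI) (auto intro: le_neg_disjoint[of b] le_trans)

lemma le_of_bot: "[|v \<sqsubseteq> \<bottom>; v : carrier X; c : carrier X|] ==> v \<sqsubseteq> c"
 by (rule le_trans[of v \<bottom>]) auto

end

subsection \<open>Open sublocales\<close>

lemma open_sublocale_simps [simp]:
 "carrier (open_sublocale X u) = {x : carrier X. x \<sqsubseteq>\<^bsub>X\<^esub> u}"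
 "x \<sqsubseteq>\<^bsub>open_sublocale X u\<^esub> y \<longleftrightarrow> x \<sqsubseteq>\<^bsub>X\<^esub> y & y \<sqsubseteq>\<^bsub>X\<^esub> u"
 "eq (open_sublocale X u) = (=)"
 by (auto simp: open_sublocale_def)

context frame_lattice
begin

lemma open_sublocale_partial_order:
 assumes "u : carrier X"
 shows "partial_order (open_sublocale X u)"
proof
 fix x y z assume "x \<sqsubseteq>\<^bsub>open_sublocale X u\<^esub> y" "y \<sqsubseteq>\<^bsub>open_sublocale X u\<^esub> z"
  "x : carrier (open_sublocale X u)" "y : carrier (open_sublocale X u)" "z : carrier (open_sublocale X u)"
 then show "x \<sqsubseteq>\<^bsub>open_sublocale X u\<^esub> z" using le_trans[of x y z] by simp
next
 fix x y assume "x \<sqsubseteq>\<^bsub>open_sublocale X u\<^esub> y" "y \<sqsubseteq>\<^bsub>open_sublocale X u\<^esub> x"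
  "x : carrier (open_sublocale X u)" "y : carrier (open_sublocale X u)"
 then show "x .=\<^bsub>open_sublocale X u\<^esub> y" using antisymI[of x y] by simp
qed auto

lemma open_sublocale_least:
 assumes "u : carrier X" "B \<subseteq> carrier (open_sublocale X u)"
 shows "least (open_sublocale X u) (\<Squnion> B) (Upper (open_sublocale X u) B)"
proof -
 have B: "B \<subseteq> carrier X" using assms by auto
 have 1: "\<Squnion> B \<sqsubseteq> u" by (rule sup_least) (use assms in auto)
 have 2: "\<Squnion> B \<sqsubseteq> z" if "z : carrier X" "\<forall>b. b : B --> b \<sqsubseteq> z" for z
  by (rule sup_least) (use that B in auto)
 show ?thesis
  unfolding least_def Upper_def using B 1 2 assms sup_upper[OF B] by (simp add: Ball_def subset_iff)
qed

text \<open>The meet with \<open>u\<close> matters for the empty family, whose infimum in the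
  sublocale is \<open>u\<close>.\<close>

lemma open_sublocale_greatest:
 assumes "u : carrier X" "B \<subseteq> carrier (open_sublocale X u)"
 shows "greatest (open_sublocale X u) (u \<sqinter> \<Sqinter> B) (Lower (open_sublocale X u) B)"
proof -
 have B: "B \<subseteq> carrier X" using assms by auto
 have i: "\<Sqinter> B : carrier X" using B by simp
 have "u \<sqinter> \<Sqinter> B \<sqsubseteq> b" if "b : B" for b
  using that B assms(1) i meet_lower[OF assms(1) i] inf_lower[OF B that] by (meson le_trans subsetD)
 moreover have "z \<sqsubseteq> u \<sqinter> \<Sqinter> B" if "z : carrier X" "z \<sqsubseteq> u" "\<forall>b. b : B --> z \<sqsubseteq> b" for z
  by (intro meet_greatest inf_greatest) (use that assms B i in auto)
 ultimately show ?thesis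
  unfolding greatest_def Lower_def using assms B i meet_lower[OF assms(1) i] by (simp add: subset_iff)
qed

lemma open_sublocale_complete_lattice:
 assumes "u : carrier X"
 shows "complete_lattice (open_sublocale X u)"
proof -
 interpret P: partial_order "open_sublocale X u" by (rule open_sublocale_partial_order[OF assms])
 show ?thesis
  by (rule P.complete_latticeI) (use open_sublocale_least[OF assms] open_sublocale_greatest[OF assms] in blast)+
qed

lemma open_sublocale_sup:
 assumes "u : carrier X" "B \<subseteq> carrier X" "!!b. b : B ==> b \<sqsubseteq> u"
 shows "\<Squnion>\<^bsub>open_sublocale X u\<^esub> B = \<Squnion> B"
proof -
 interpret P: complete_lattice "open_sublocale X u" by (rule open_sublocale_complete_lattice[OF assms(1)])
 have "B \<subseteq> carrier (open_sublocale X u)" using assms by auto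
 from P.least_unique[OF P.sup_lub[OF this] open_sublocale_least[OF assms(1) this]] show ?thesis .
qed

lemma open_sublocale_inf:
 assumes "u : carrier X" "B \<subseteq> carrier X" "!!b. b : B ==> b \<sqsubseteq> u"
 shows "\<Sqinter>\<^bsub>open_sublocale X u\<^esub> B = u \<sqinter> \<Sqinter> B"
proof -
 interpret P: complete_lattice "open_sublocale X u" by (rule open_sublocale_complete_lattice[OF assms(1)])
 have "B \<subseteq> carrier (open_sublocale X u)" using assms by auto
 from P.greatest_unique[OF P.inf_glb[OF this] open_sublocale_greatest[OF assms(1) this]] show ?thesis .
qed

lemma open_sublocale_meet:
 assumes "u : carrier X" "a : carrier X" "b : carrier X" "a \<sqsubseteq> u" "b \<sqsubseteq> u"
 shows "a \<sqinter>\<^bsub>open_sublocale X u\<^esub> b = a \<sqinter> b"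
proof -
 have "a \<sqinter>\<^bsub>open_sublocale X u\<^esub> b = u \<sqinter> (a \<sqinter> b)"
  using open_sublocale_inf[OF assms(1), of "{a, b}"] assms unfolding meet_def by blast
 also have "\<dots> = a \<sqinter> b" using assms meet_lower[of a b] by (metis le_trans meet_absorb(2))
 finally show ?thesis .
qed

lemma open_sublocale_top: "u : carrier X ==> \<top>\<^bsub>open_sublocale X u\<^esub> = u"
proof -
 assume u: "u : carrier X"
 interpret P: complete_lattice "open_sublocale X u" by (rule open_sublocale_complete_lattice[OF u])
 show ?thesis
  by (rule antisymI) (use u P.top_closed P.top_higher[of u] in auto)
qed

lemma open_sublocale_bottom: "u : carrier X ==> \<bottom>\<^bsub>open_sublocale X u\<^esub> = \<bottom>"
proof -
 assume u: "u : carrier X"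
 interpret P: complete_lattice "open_sublocale X u" by (rule open_sublocale_complete_lattice[OF u])
 show ?thesis
  by (rule antisymI) (use u P.bottom_closed P.bottom_lower[of "\<bottom>"] in auto)
qed

lemma open_sublocale_frame:
 assumes u: "u : carrier X"
 shows "frame_lattice (open_sublocale X u)"
proof -
 interpret P: complete_lattice "open_sublocale X u" by (rule open_sublocale_complete_lattice[OF u])
 show ?thesis
 proof
  fix a B assume a: "a : carrier (open_sublocale X u)" and B: "B \<subseteq> carrier (open_sublocale X u)"
  have 1: "\<Squnion>\<^bsub>open_sublocale X u\<^esub> B = \<Squnion> B" by (rule open_sublocale_sup) (use u B in auto)
  have B': "B \<subseteq> carrier X" using B by auto
  have "\<Squnion> B \<sqsubseteq> u" by (rule sup_least) (use u B in auto)
  then have 2: "a \<sqinter>\<^bsub>open_sublocale X u\<^esub> \<Squnion> B = a \<sqinter> \<Squnion> B"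
   by (intro open_sublocale_meet) (use u a sup_closed[OF B'] in auto)
  have 3: "(%b. a \<sqinter>\<^bsub>open_sublocale X u\<^esub> b) ` B = (%b. a \<sqinter> b) ` B"
   by (intro image_cong refl open_sublocale_meet) (use u a B in auto)
  have "\<Squnion>\<^bsub>open_sublocale X u\<^esub> ((%b. a \<sqinter> b) ` B) = \<Squnion> ((%b. a \<sqinter> b) ` B)"
  proof (rule open_sublocale_sup)
   show "(%b. a \<sqinter> b) ` B \<subseteq> carrier X" using a B by auto
   fix x assume "x : (%b. a \<sqinter> b) ` B"
   then obtain b where "b : B" "x = a \<sqinter> b" by auto
   moreover have "a : carrier X" "a \<sqsubseteq> u" "b : carrier X" using a B \<open>b : B\<close> by auto
   ultimately show "x \<sqsubseteq> u" using u meet_lower[of a b] le_trans[of "a \<sqinter> b" a u] by simp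
  qed (rule u)
  then show "a \<sqinter>\<^bsub>open_sublocale X u\<^esub> (\<Squnion>\<^bsub>open_sublocale X u\<^esub> B) = \<Squnion>\<^bsub>open_sublocale X u\<^esub> ((%b. a \<sqinter>\<^bsub>open_sublocale X u\<^esub> b) ` B)"
   using meet_sup[of a B] a B by (simp add: 1 2 3 subset_iff)
 next
  fix x y assume "x \<sqsubseteq>\<^bsub>open_sublocale X u\<^esub> y"
  then show "x : carrier (open_sublocale X u) & y : carrier (open_sublocale X u)"
   using le_carrier[of x y] trans[of x y u] by simp
 qed
qed

end

lemma (in frame_lattice) open_sublocale_twice:
 assumes "w \<sqsubseteq> v"
 shows "open_sublocale (open_sublocale X v) w = open_sublocale X w"
proof -
 have "{x : carrier X. x \<sqsubseteq> v & x \<sqsubseteq> w} = {x : carrier X. x \<sqsubseteq> w}" using assms trans by blast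
 moreover have "(x \<sqsubseteq> y & y \<sqsubseteq> v) & y \<sqsubseteq> w & w \<sqsubseteq> v \<longleftrightarrow> x \<sqsubseteq> y & y \<sqsubseteq> w" for x y
  using assms trans by blast
 ultimately show ?thesis using assms by (simp add: open_sublocale_def conj_ac)
qed

subsection \<open>The half line and its frame homomorphisms\<close>

lemma half_line_simps [simp]:
 "le half_line = (\<subseteq>)" "eq half_line = (=)"
 by (auto simp: half_line_def)

lemma half_line_open: "W : carrier half_line \<longleftrightarrow> openin (top_of_set {0..}) W"
 by (simp add: half_line_def)

lemma half_line_openI: "open A ==> {0..} \<inter> A : carrier half_line"
 by (auto simp: half_line_open openin_open)

lemma half_line_rays [simp]: "{0..} \<inter> {c<..} : carrier half_line" "{0..} \<inter> {..<c} : carrier half_line" "{0<..} : carrier half_line" "{} : carrier half_line" "{0..} : carrier half_line"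
proof -
 show "{0..} \<inter> {c<..} : carrier half_line" "{0..} \<inter> {..<c} : carrier half_line" by (auto intro: half_line_openI)
 have "{0<..} = {0..} \<inter> {0::real<..}" by auto
 then show "{0<..} : carrier half_line" by (metis half_line_openI open_greaterThan)
 show "{} : carrier half_line" "{0..} : carrier half_line" by (auto simp: half_line_open)
qed

lemma half_line_Int: "[|A : carrier half_line; B : carrier half_line|] ==> A \<inter> B : carrier half_line"
 by (auto simp: half_line_open intro: openin_Int)

lemma half_line_Un: "[|A : carrier half_line; B : carrier half_line|] ==> A \<union> B : carrier half_line"
 by (auto simp: half_line_open intro: openin_Un)

lemma half_line_Union: "\<A> \<subseteq> carrier half_line ==> \<Union> \<A> : carrier half_line"
 by (auto simp: half_line_open intro!: openin_Union)

lemma half_line_sub: "A : carrier half_line ==> A \<subseteq> {0..}"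
 by (auto simp: half_line_open dest: openin_imp_subset)

lemma half_line_partial_order: "partial_order half_line"
 by unfold_locales auto

lemma half_line_complete_lattice: "complete_lattice half_line"
proof -
 interpret P: partial_order half_line by (rule half_line_partial_order)
 show ?thesis
 proof (rule P.complete_latticeI)
  fix \<A> assume A: "\<A> \<subseteq> carrier half_line"
  have "least half_line (\<Union> \<A>) (Upper half_line \<A>)"
   unfolding least_def Upper_def using A half_line_Union[OF A] by auto
  then show "\<exists>s. least half_line s (Upper half_line \<A>)" ..
  have "\<Union> {W : carrier half_line. \<forall>A\<in>\<A>. W \<subseteq> A} : carrier half_line"
   by (intro half_line_Union) auto
  then have "greatest half_line (\<Union> {W : carrier half_line. \<forall>A\<in>\<A>. W \<subseteq> A}) (Lower half_line \<A>)"
   unfolding greatest_def Lower_def using A by auto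
  then show "\<exists>i. greatest half_line i (Lower half_line \<A>)" ..
 qed
qed

interpretation half_line: complete_lattice half_line by (rule half_line_complete_lattice)

lemma half_line_sup: "\<A> \<subseteq> carrier half_line ==> \<Squnion>\<^bsub>half_line\<^esub> \<A> = \<Union> \<A>"
proof (rule half_line.le_antisym)
 assume A: "\<A> \<subseteq> carrier half_line"
 show "\<Squnion>\<^bsub>half_line\<^esub> \<A> \<sqsubseteq>\<^bsub>half_line\<^esub> \<Union> \<A>"
  by (rule half_line.sup_least) (use A half_line_Union in auto)
 show "\<Union> \<A> \<sqsubseteq>\<^bsub>half_line\<^esub> \<Squnion>\<^bsub>half_line\<^esub> \<A>"
  using half_line.sup_upper[OF A] by auto
qed (auto intro: half_line_Union)

lemma half_line_meet: "[|A : carrier half_line; B : carrier half_line|] ==> A \<sqinter>\<^bsub>half_line\<^esub> B = A \<inter> B"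
proof (rule half_line.le_antisym)
 assume AB: "A : carrier half_line" "B : carrier half_line"
 show "A \<sqinter>\<^bsub>half_line\<^esub> B \<sqsubseteq>\<^bsub>half_line\<^esub> A \<inter> B"
  using half_line.meet_left[OF AB] half_line.meet_right[OF AB] by simp
 show "A \<inter> B \<sqsubseteq>\<^bsub>half_line\<^esub> A \<sqinter>\<^bsub>half_line\<^esub> B"
  by (rule half_line.meet_le) (use AB half_line_Int in auto)
qed (auto intro: half_line_Int)

lemma half_line_top: "\<top>\<^bsub>half_line\<^esub> = {0..}"
 by (rule half_line.le_antisym) (use half_line.top_higher[of "{0..}"] half_line_sub[of "\<top>\<^bsub>half_line\<^esub>"] in auto)

lemma frame_hom_half_line:
 "frame_hom half_line X h \<longleftrightarrow> h : carrier half_line \<rightarrow>\<^sub>E carrier X & h {0..} = \<top>\<^bsub>X\<^esub> &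
  (\<forall>A\<in>carrier half_line. \<forall>B\<in>carrier half_line. h (A \<inter> B) = h A \<sqinter>\<^bsub>X\<^esub> h B) &
  (\<forall>\<A>\<subseteq>carrier half_line. h (\<Union> \<A>) = \<Squnion>\<^bsub>X\<^esub> (h ` \<A>))"
 unfolding frame_hom_def by (auto simp: half_line_top half_line_meet half_line_sup)

locale half_line_hom = frame_lattice X for X :: "'a gorder" (structure) +
 fixes \<phi> :: "real set => 'a"
 assumes hom: "frame_hom half_line X \<phi>"
begin

lemma closed [simp]: "A : carrier half_line ==> \<phi> A : carrier X"
 using hom by (auto simp: frame_hom_half_line)

lemma hom_top: "\<phi> {0..} = \<top>" using hom by (simp add: frame_hom_half_line)

lemma hom_Int: "[|A : carrier half_line; B : carrier half_line|] ==> \<phi> (A \<inter> B) = \<phi> A \<sqinter> \<phi> B"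
 using hom by (simp add: frame_hom_half_line)

lemma hom_Union: "\<A> \<subseteq> carrier half_line ==> \<phi> (\<Union> \<A>) = \<Squnion> (\<phi> ` \<A>)"
 using hom by (simp add: frame_hom_half_line)

lemma hom_mono: "[|A : carrier half_line; B : carrier half_line; A \<subseteq> B|] ==> \<phi> A \<sqsubseteq> \<phi> B"
 using hom_Int[of A B] meet_lower[of "\<phi> A" "\<phi> B"] by (simp add: Int_absorb2)

lemma hom_empty: "\<phi> {} = \<bottom>"
proof -
 have "\<phi> {} = \<Squnion> {}" using hom_Union[of "{}"] by simp
 also have "\<dots> = \<bottom>" by (rule sup_eqI) auto
 finally show ?thesis .
qed

lemma hom_disjoint:
 assumes "A : carrier half_line" "B : carrier half_line" "A \<inter> B = {}" "v : carrier X" "v \<sqsubseteq> \<phi> A" "v \<sqsubseteq> \<phi> B"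
 shows "v \<sqsubseteq> \<bottom>"
proof -
 have "v \<sqsubseteq> \<phi> A \<sqinter> \<phi> B" using assms by (intro meet_greatest) auto
 then show ?thesis using hom_Int[of A B] assms hom_empty by simp
qed

lemma hom_Un:
 assumes "A : carrier half_line" "B : carrier half_line"
 shows "\<phi> (A \<union> B) = \<Squnion> {\<phi> A, \<phi> B}"
 using hom_Union[of "{A, B}"] assms by simp

end

context frame_lattice
begin

lemma sup2_cases:
 assumes "a \<sqsubseteq> \<Squnion> {b1, b2}" "b1 : carrier X" "b2 : carrier X" "c : carrier X"
  "!!v. v : carrier X ==> v \<sqsubseteq> a ==> v \<sqsubseteq> b1 ==> v \<sqsubseteq> c"
  "!!v. v : carrier X ==> v \<sqsubseteq> a ==> v \<sqsubseteq> b2 ==> v \<sqsubseteq> c"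
 shows "a \<sqsubseteq> c"
 by (rule le_sup_cases[OF assms(1)]) (use assms le_carrier in auto)

lemma le_inf_image:
 assumes "v : carrier X" "g ` J \<subseteq> carrier X"
 shows "v \<sqsubseteq> \<Sqinter> (g ` J) \<longleftrightarrow> (\<forall>j\<in>J. v \<sqsubseteq> g j)"
proof
 assume v: "v \<sqsubseteq> \<Sqinter> (g ` J)"
 show "\<forall>j\<in>J. v \<sqsubseteq> g j" by (intro ballI trans[OF v inf_lower[OF assms(2)]]) simp
next
 assume "\<forall>j\<in>J. v \<sqsubseteq> g j"
 then show "v \<sqsubseteq> \<Sqinter> (g ` J)" using assms by (intro inf_greatest) auto
qed

text \<open>Splits \<open>u\<close> into pieces on each of which, for every \<open>j\<close>, one of
  the alternatives \<open>a j\<close> and \<open>b j\<close> has been selected; \<open>K\<close>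
  collects the indices where it is \<open>a j\<close>.\<close>

lemma finite_cover_cases:
 assumes "finite J" "!!j. j : J ==> a j : carrier X & b j : carrier X & \<top> \<sqsubseteq> \<Squnion> {a j, b j}"
  and "u : carrier X" "c : carrier X"
  and "!!K v. K \<subseteq> J ==> v : carrier X ==> v \<sqsubseteq> u ==> (!!j. j : K ==> v \<sqsubseteq> a j) ==> (!!j. j : J - K ==> v \<sqsubseteq> b j) ==> v \<sqsubseteq> c"
 shows "u \<sqsubseteq> c"
 using assms
proof (induction J arbitrary: u rule: finite_induct)
 case empty
 show ?case by (rule empty(4)[of "{}"]) (use empty in auto)
next
 case (insert i J)
 have "u \<sqsubseteq> \<top>" using insert by simp
 moreover have "\<top> \<sqsubseteq> \<Squnion> {a i, b i}" using insert.prems(1)[of i] by simp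
 ultimately have "u \<sqsubseteq> \<Squnion> {a i, b i}" by (rule trans)
 then show ?case
 proof (rule sup2_cases)
  show "a i : carrier X" "b i : carrier X" using insert.prems(1) by auto
  fix v assume v: "v : carrier X" "v \<sqsubseteq> u" "v \<sqsubseteq> a i"
  show "v \<sqsubseteq> c"
  proof (rule insert.IH)
   fix K v' assume K: "K \<subseteq> J" "v' : carrier X" "v' \<sqsubseteq> v" "!!j. j : K ==> v' \<sqsubseteq> a j" "!!j. j : J - K ==> v' \<sqsubseteq> b j"
   show "v' \<sqsubseteq> c"
   proof (rule insert.prems(4)[of "insert i K"])
    show "v' \<sqsubseteq> u" by (rule trans[OF K(3) v(2)])
    show "v' \<sqsubseteq> a j" if "j : insert i K" for j using that K(4) trans[OF K(3) v(3)] by (elim insertE) simp_all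
    show "v' \<sqsubseteq> b j" if "j : insert i J - insert i K" for j by (rule K(5)) (use that in simp)
   qed (use K in auto)
  qed (use insert v in auto)
 next
  fix v assume v: "v : carrier X" "v \<sqsubseteq> u" "v \<sqsubseteq> b i"
  show "v \<sqsubseteq> c"
  proof (rule insert.IH)
   fix K v' assume K: "K \<subseteq> J" "v' : carrier X" "v' \<sqsubseteq> v" "!!j. j : K ==> v' \<sqsubseteq> a j" "!!j. j : J - K ==> v' \<sqsubseteq> b j"
   show "v' \<sqsubseteq> c"
   proof (rule insert.prems(4)[of K])
    show "v' \<sqsubseteq> u" by (rule trans[OF K(3) v(2)])
    show "v' \<sqsubseteq> b j" if "j : insert i J - K" for j using that K(5) trans[OF K(3) v(3)] by (cases "j = i") simp_all
   qed (use K in auto)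
  qed (use insert v in auto)
 qed (use insert in auto)
qed

text \<open>A Urysohn-type construction in which \<open>a t\<close> stands for the open where the
  function exceeds \<open>t\<close>. In the absence of points the function is given by inverse
  images, generated by the opens \<open>up p \<sqinter> lo q\<close> for closed intervals
  \<open>{p..q}\<close> inside the given set. The hypothesis \<open>cover\<close> says that
  \<open>a t\<close> is well inside \<open>a s\<close> for \<open>s < t\<close>, which is what
  continuity demands.\<close>

lemma scale_hom:
 fixes a :: "real => 'a"
 assumes a: "!!t. t > 0 ==> a t : carrier X"
  and anti: "!!s t. 0 < s ==> s \<le> t ==> a t \<sqsubseteq> a s"
  and cover: "!!s t. 0 < s ==> s < t ==> \<top> \<sqsubseteq> \<Squnion> {a s, neg (a t)}"
  and top: "\<top> \<sqsubseteq> \<Squnion> {neg (a t) | t. t > 0}"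
 obtains \<phi> where "frame_hom half_line X \<phi>"
  "!!t. t > 0 ==> \<phi> ({0..} \<inter> {t<..}) \<sqsubseteq> a t"
  "!!t. t > 0 ==> \<phi> ({0..} \<inter> {..<t}) \<sqsubseteq> neg (a t)"
proof -
 \<comment> \<open>A lower bound \<open>p \<le> 0\<close> is no restriction for a function to the
   half line, whence the top element; a strict upper bound \<open>q \<le> 0\<close> cannot be met,
   whence the bottom element.\<close>
 define up where "up p = (if p > 0 then a p else \<top>)" for p
 define lo where "lo q = (if q > 0 then neg (a q) else \<bottom>)" for q
 have c [simp]: "up p : carrier X" "lo q : carrier X" for p q using a by (auto simp: up_def lo_def)
 have up_anti: "up q \<sqsubseteq> up p" if "p \<le> q" for p q
 proof (cases "p > 0")
  case True
  then show ?thesis using that anti[of p q] by (simp add: up_def)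
 next
  case False
  then have "up p = \<top>" by (simp add: up_def)
  then show ?thesis by (simp only: top_higher[OF c(1)])
 qed
 have lo_mono: "lo p \<sqsubseteq> lo q" if "p \<le> q" for p q
 proof (cases "p > 0")
  case True
  then show ?thesis using that neg_antimono[OF a a anti, of q p] by (simp add: lo_def)
 next
  case False
  then have "lo p = \<bottom>" by (simp add: lo_def)
  then show ?thesis by (simp only: bot_least[OF c(2)])
 qed
 have disj: "v \<sqsubseteq> \<bottom>" if "q \<le> p" "v \<sqsubseteq> up p" "v \<sqsubseteq> lo q" for v p q
 proof (cases "q > 0")
  case True
  then have "v \<sqsubseteq> a p" "v \<sqsubseteq> neg (a q)" using that by (simp_all add: up_def lo_def)
  moreover have "a p \<sqsubseteq> a q" by (rule anti[OF True that(1)])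
  ultimately show ?thesis using le_neg_disjoint[OF a[OF True]] le_carrier[OF that(2)] trans[of v "a p" "a q"] by simp
 qed (use that in \<open>simp add: lo_def\<close>)
 have cov: "\<top> \<sqsubseteq> \<Squnion> {up p, lo q}" if "p < q" for p q
 proof (cases "p > 0")
  case True
  then show ?thesis using cover[of p q] that by (simp add: up_def lo_def)
 next
  case False
  then have "up p = \<top>" by (simp add: up_def)
  moreover have "up p \<sqsubseteq> \<Squnion> {up p, lo q}" by (rule sup_upper) auto
  ultimately show ?thesis by simp
 qed
 define sub where "sub p q W \<longleftrightarrow> {0..} \<inter> {p..q} \<subseteq> W" for p q :: real and W
 define E where "E W = {up p \<sqinter> lo q | p q. sub p q W}" for W
 have E: "E W \<subseteq> carrier X" for W by (auto simp: E_def)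
 define \<phi> where "\<phi> = (\<lambda>W\<in>carrier half_line. \<Squnion> (E W))"
 have \<phi>c: "\<phi> W : carrier X" if "W : carrier half_line" for W using that E by (simp add: \<phi>_def)
 \<comment> \<open>\<open>K1\<close> and \<open>K2\<close> are the introduction and elimination
   rules for \<open>v \<sqsubseteq> \<phi> W\<close>; from here on the infima and suprema in
   \<open>\<phi>\<close> are handled through them.\<close>
 have K1: "v \<sqsubseteq> \<phi> W" if "sub p q W" "v \<sqsubseteq> up p" "v \<sqsubseteq> lo q" "W : carrier half_line" for v p q W
 proof -
  have "v \<sqsubseteq> up p \<sqinter> lo q" using that le_carrier by (intro meet_greatest) auto
  also have "up p \<sqinter> lo q \<sqsubseteq> \<Squnion> (E W)" by (rule sup_upper[OF E]) (use that in \<open>auto simp: E_def\<close>)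
  finally show ?thesis using that by (simp add: \<phi>_def)
 qed
 have K2: "v \<sqsubseteq> d" if "v \<sqsubseteq> \<phi> W" "W : carrier half_line" "d : carrier X"
   "!!p q v'. sub p q W ==> v' : carrier X ==> v' \<sqsubseteq> v ==> v' \<sqsubseteq> up p ==> v' \<sqsubseteq> lo q ==> v' \<sqsubseteq> d" for v W d
 proof (rule le_sup_cases[OF _ _ E])
  show "v \<sqsubseteq> \<Squnion> (E W)" using that by (simp add: \<phi>_def)
  then show "v : carrier X" using le_carrier by blast
  fix b v' assume "b : E W" "v' : carrier X" "v' \<sqsubseteq> v" "v' \<sqsubseteq> b"
  then obtain p q where "b = up p \<sqinter> lo q" "sub p q W" by (auto simp: E_def)
  then show "v' \<sqsubseteq> d" using that(4)[of p q v'] le_meet_iff[of v' "up p" "lo q"] \<open>v' \<sqsubseteq> b\<close> \<open>v' \<sqsubseteq> v\<close> \<open>v' : carrier X\<close> by auto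
 qed (rule that(3))
 have mono: "\<phi> A \<sqsubseteq> \<phi> B" if "A \<subseteq> B" "A : carrier half_line" "B : carrier half_line" for A B
  proof (rule K2[of _ A])
  fix p q v assume "sub p q A" "v \<sqsubseteq> up p" "v \<sqsubseteq> lo q"
  then show "v \<sqsubseteq> \<phi> B" using that by (intro K1[of p q B v]) (auto simp: sub_def)
 qed (use that \<phi>c in simp_all)
 have "frame_hom half_line X \<phi>"
  unfolding frame_hom_half_line
 proof (intro conjI ballI allI impI)
  show "\<phi> : carrier half_line \<rightarrow>\<^sub>E carrier X" unfolding \<phi>_def using E by auto
  have "\<top> \<sqsubseteq> \<phi> {0..}"
  proof (rule le_sup_cases[OF top])
   fix b v assume "b : {neg (a t) | t. t > 0}" "v : carrier X" "v \<sqsubseteq> b"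
   then obtain t where "t > 0" "v \<sqsubseteq> neg (a t)" by auto
   then show "v \<sqsubseteq> \<phi> {0..}" using \<open>v : carrier X\<close> by (intro K1[of "-1" t]) (auto simp: up_def lo_def sub_def)
  qed (use \<phi>c in auto)
  then show "\<phi> {0..} = \<top>" using \<phi>c by (intro antisymI) auto
 next
  fix A B assume AB: "A : carrier half_line" "B : carrier half_line"
  note ABI = half_line_Int[OF AB]
  show "\<phi> (A \<inter> B) = \<phi> A \<sqinter> \<phi> B"
  proof (rule antisymI)
   show "\<phi> (A \<inter> B) \<sqsubseteq> \<phi> A \<sqinter> \<phi> B" by (intro meet_greatest mono) (use AB ABI \<phi>c in auto)
   show "\<phi> A \<sqinter> \<phi> B \<sqsubseteq> \<phi> (A \<inter> B)"
   proof (rule K2[of _ A])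
    fix p q v assume A: "sub p q A" "v : carrier X" "v \<sqsubseteq> \<phi> A \<sqinter> \<phi> B" "v \<sqsubseteq> up p" "v \<sqsubseteq> lo q"
    show "v \<sqsubseteq> \<phi> (A \<inter> B)"
    proof (rule K2[of _ B])
     show "v \<sqsubseteq> \<phi> B" by (rule trans[OF A(3) meet_lower(3)]) (use AB \<phi>c in auto)
     fix p' q' v' assume B: "sub p' q' B" "v' : carrier X" "v' \<sqsubseteq> v" "v' \<sqsubseteq> up p'" "v' \<sqsubseteq> lo q'"
     show "v' \<sqsubseteq> \<phi> (A \<inter> B)"
      by (rule K1[of "max p p'" "min q q'"]) (use A B ABI trans[OF B(3)] in \<open>auto simp: max_def min_def sub_def\<close>)
    qed (use AB ABI \<phi>c in auto)
   qed (use AB ABI \<phi>c meet_lower in auto)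
  qed (use AB ABI \<phi>c in auto)
 next
  fix \<A> assume A: "\<A> \<subseteq> carrier half_line"
  define R where "R = \<Squnion> (\<phi> ` \<A>)"
  have im: "\<phi> ` \<A> \<subseteq> carrier X" using A \<phi>c by auto
  have R: "R : carrier X" using im by (simp add: R_def)
  note AU = half_line_Union[OF A]
  have up_R: "\<phi> W \<sqsubseteq> R" if "W : \<A>" for W unfolding R_def by (rule sup_upper[OF im]) (use that in auto)
  have "\<phi> (\<Union> \<A>) \<sqsubseteq> R"
  proof (rule K2[of _ "\<Union> \<A>"])
   show "\<phi> (\<Union> \<A>) \<sqsubseteq> \<phi> (\<Union> \<A>)" using \<phi>c[OF AU] by simp
   fix p q v assume I: "sub (p) (q) (\<Union> \<A>)" "v : carrier X" "v \<sqsubseteq> up p" "v \<sqsubseteq> lo q"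
   show "v \<sqsubseteq> R"
   proof (cases "p \<le> q")
    case False
    then have "v \<sqsubseteq> \<bottom>" using disj[of q p v] I by simp
    then show ?thesis using le_of_bot I R by blast
   next
    case True
    \<comment> \<open>Preservation of unions is compactness of the interval, in the form of
      bisection. The margin \<open>\<delta>\<close> is part of the statement so that adjacent
      intervals overlap and \<open>cov\<close> applies at the common endpoint.\<close>
    have "\<exists>\<delta>>0. \<forall>v. v \<sqsubseteq> up (p - \<delta>) & v \<sqsubseteq> lo (q + \<delta>) --> v \<sqsubseteq> R"
    proof (rule Bolzano[OF True])
     fix x y z :: real
     assume xy: "\<exists>\<delta>>0. \<forall>v. v \<sqsubseteq> up (x - \<delta>) & v \<sqsubseteq> lo (y + \<delta>) --> v \<sqsubseteq> R"
      and yz: "\<exists>\<delta>>0. \<forall>v. v \<sqsubseteq> up (y - \<delta>) & v \<sqsubseteq> lo (z + \<delta>) --> v \<sqsubseteq> R"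
     obtain d1 where d1: "d1 > 0" "!!v. v \<sqsubseteq> up (x - d1) ==> v \<sqsubseteq> lo (y + d1) ==> v \<sqsubseteq> R" using xy by blast
     obtain d2 where d2: "d2 > 0" "!!v. v \<sqsubseteq> up (y - d2) ==> v \<sqsubseteq> lo (z + d2) ==> v \<sqsubseteq> R" using yz by blast
     have "v \<sqsubseteq> R" if v: "v \<sqsubseteq> up (x - min d1 d2)" "v \<sqsubseteq> lo (z + min d1 d2)" for v
     proof -
      have vc: "v : carrier X" using v le_carrier by blast
      have "v \<sqsubseteq> \<Squnion> {up (y - d2), lo (y + d1)}"
       using trans[OF _ cov[of "y - d2" "y + d1"], of v] vc d1 d2 by simp
      then show ?thesis
      proof (rule sup2_cases)
       fix v' assume v': "v' \<sqsubseteq> v"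
       have 1: "v' \<sqsubseteq> up (x - d1)" by (rule trans[OF trans[OF v' v(1)] up_anti]) simp
       have 2: "v' \<sqsubseteq> lo (z + d2)" by (rule trans[OF trans[OF v' v(2)] lo_mono]) simp
       show "v' \<sqsubseteq> R" if "v' \<sqsubseteq> up (y - d2)" using d2(2) 2 that by blast
       show "v' \<sqsubseteq> R" if "v' \<sqsubseteq> lo (y + d1)" using d1(2) 1 that by blast
      qed (use R in auto)
     qed
     then show "\<exists>\<delta>>0. \<forall>v. v \<sqsubseteq> up (x - \<delta>) & v \<sqsubseteq> lo (z + \<delta>) --> v \<sqsubseteq> R"
      using d1 d2 by (intro exI[of _ "min d1 d2"]) auto
    next
     fix x assume x: "p \<le> x" "x \<le> q"
     show "\<exists>d>0. \<forall>a b. a \<le> x & x \<le> b & b - a < d --> (\<exists>\<delta>>0. \<forall>v. v \<sqsubseteq> up (a - \<delta>) & v \<sqsubseteq> lo (b + \<delta>) --> v \<sqsubseteq> R)"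
     proof (cases "x < 0")
      case True
      \<comment> \<open>Half the distance from \<open>x\<close> to 0, so that
        \<open>b < x + e\<close> keeps \<open>b + e\<close> negative and \<open>lo (b + e)\<close>
        is the bottom element.\<close>
      define e where "e = - x / 2"
      have e: "e > 0" "x + e + e = 0" using True by (simp_all add: e_def)
      have "v \<sqsubseteq> R" if "b < x + e" "v \<sqsubseteq> lo (b + e)" for b v
      proof -
       have z: "\<not> b + e > 0" using that(1) e by linarith
       have "lo (b + e) = \<bottom>" unfolding lo_def by (rule if_not_P[OF z])
       then have "v \<sqsubseteq> \<bottom>" using that(2) by (rule subst)
       then show ?thesis using le_of_bot[OF _ _ R] le_carrier[of v \<bottom>] by blast
      qed
      note R1 = this
      show ?thesis
      proof (rule exI[of _ e], intro conjI allI impI)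
       show "e > 0" by (rule e(1))
       fix a b assume ab: "a \<le> x & x \<le> b & b - a < e"
       then have "b < x + e" by linarith
       then show "\<exists>\<delta>>0. \<forall>v. v \<sqsubseteq> up (a - \<delta>) & v \<sqsubseteq> lo (b + \<delta>) --> v \<sqsubseteq> R"
        using R1 e(1) by (intro exI[of _ e] conjI allI impI) simp_all
      qed
     next
      case False
      have "x : {0..} \<inter> {p..q}" using x False by (simp only: Int_iff atLeast_iff atLeastAtMost_iff not_less)
      then have "x : \<Union> \<A>" using I(1) unfolding sub_def by (rule rev_subsetD)
      then obtain W where W: "W : \<A>" "x : W" by (rule UnionE)
      have "openin (top_of_set {0..}) W" using W(1) A half_line_open by blast
      then obtain T where T: "open T" "W = {0..} \<inter> T" unfolding openin_open by blast
      have "x : T" using W(2) T(2) by blast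
      then obtain e where e: "e > 0" "ball x e \<subseteq> T" using T(1) open_contains_ball by blast
      have "v \<sqsubseteq> R" if "a \<le> x" "x \<le> b" "b - a < e / 2" "v \<sqsubseteq> up (a - e / 2)" "v \<sqsubseteq> lo (b + e / 2)" for a b v
      proof -
       have "{a - e / 2 .. b + e / 2} \<subseteq> ball x e" using that by (auto simp: dist_real_def)
       then have "sub (a - e / 2) (b + e / 2) (W)" unfolding sub_def using e T by blast
       then have "v \<sqsubseteq> \<phi> W" by (rule K1[OF _ that(4,5)]) (use W A in auto)
       then show ?thesis using up_R[OF W(1)] by (rule trans)
      qed
      note R1 = this
      have e2: "e / 2 > 0" using e(1) by simp
      show ?thesis
      proof (rule exI[of _ "e / 2"], intro conjI allI impI)
       show "e / 2 > 0" by (rule e2)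
       fix a b assume ab: "a \<le> x & x \<le> b & b - a < e / 2"
       then show "\<exists>\<delta>>0. \<forall>v. v \<sqsubseteq> up (a - \<delta>) & v \<sqsubseteq> lo (b + \<delta>) --> v \<sqsubseteq> R"
        using R1[of a b] e2 by (intro exI[of _ "e / 2"] conjI allI impI) simp_all
      qed
     qed
    qed
    then obtain \<delta> where d: "\<delta> > 0" "\<forall>v. v \<sqsubseteq> up (p - \<delta>) & v \<sqsubseteq> lo (q + \<delta>) --> v \<sqsubseteq> R" by (elim exE conjE)
    have "v \<sqsubseteq> up (p - \<delta>)" by (rule trans[OF I(3) up_anti]) (use d(1) in simp)
    moreover have "v \<sqsubseteq> lo (q + \<delta>)" by (rule trans[OF I(4) lo_mono]) (use d(1) in simp)
    ultimately show ?thesis by (intro d(2)[rule_format] conjI)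
   qed
  qed (rule AU, rule R)
  moreover have "R \<sqsubseteq> \<phi> (\<Union> \<A>)" unfolding R_def
  proof (rule sup_least[OF im \<phi>c[OF AU]])
   fix b assume "b : \<phi> ` \<A>"
   then obtain W where W: "W : \<A>" "b = \<phi> W" by auto
   show "b \<sqsubseteq> \<phi> (\<Union> \<A>)" unfolding W(2) by (rule mono) (use W A AU in auto)
  qed
  ultimately have "\<phi> (\<Union> \<A>) = R" by (rule antisymI[OF _ _ \<phi>c[OF AU] R])
  then show "\<phi> (\<Union> \<A>) = \<Squnion> (\<phi> ` \<A>)" unfolding R_def .
 qed
 moreover have "\<phi> ({0..} \<inter> {t<..}) \<sqsubseteq> a t" if t: "t > 0" for t
 proof (rule K2[OF _ half_line_rays(1) a[OF t]])
  show "\<phi> ({0..} \<inter> {t<..}) \<sqsubseteq> \<phi> ({0..} \<inter> {t<..})" by (rule le_refl[OF \<phi>c[OF half_line_rays(1)]])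
  fix p q v assume v: "sub p q ({0..} \<inter> {t<..})" "v : carrier X" "v \<sqsubseteq> up p" "v \<sqsubseteq> lo q"
  show "v \<sqsubseteq> a t"
  proof (cases "p > t")
   case True
   then have "up p = a p" using t by (simp add: up_def)
   with v(3) have "v \<sqsubseteq> a p" by simp
   then show ?thesis by (rule trans[OF _ anti]) (use True t in auto)
  next
   case False
   \<comment> \<open>Otherwise \<open>max p 0\<close> would be a point of the interval in the half
     line and would have to exceed \<open>t\<close>, against \<open>p \<le> t\<close> and
     \<open>t > 0\<close>.\<close>
   have "q \<le> p \<or> q \<le> 0"
   proof (rule ccontr)
    assume "\<not> (q \<le> p \<or> q \<le> 0)"
    then have "max p 0 : {0..} \<inter> {p..q}" by auto
    then have "max p 0 > t" using v(1) unfolding sub_def by blast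
    then show False using False t by auto
   qed
   then have "v \<sqsubseteq> \<bottom>"
   proof
    show "v \<sqsubseteq> \<bottom>" if "q \<le> p" by (rule disj[OF that v(3,4)])
    show "v \<sqsubseteq> \<bottom>" if "q \<le> 0" using v(4) that by (simp add: lo_def)
   qed
   then show ?thesis by (rule le_of_bot[OF _ v(2) a[OF t]])
  qed
 qed
 moreover have "\<phi> ({0..} \<inter> {..<t}) \<sqsubseteq> neg (a t)" if t: "t > 0" for t
 proof (rule K2[OF _ half_line_rays(2) neg_closed])
  show "\<phi> ({0..} \<inter> {..<t}) \<sqsubseteq> \<phi> ({0..} \<inter> {..<t})" by (rule le_refl[OF \<phi>c[OF half_line_rays(2)]])
  fix p q v assume v: "sub p q ({0..} \<inter> {..<t})" "v : carrier X" "v \<sqsubseteq> up p" "v \<sqsubseteq> lo q"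
  show "v \<sqsubseteq> neg (a t)"
  proof (cases "q < t")
   case True
   have "v \<sqsubseteq> lo t" by (rule trans[OF v(4) lo_mono]) (use True in simp)
   then show ?thesis using t by (simp add: lo_def)
  next
   case False
   have "q \<le> p"
   proof (rule ccontr)
    assume "\<not> q \<le> p"
    then have "q : {0..} \<inter> {p..q}" using False t by auto
    then have "q < t" using v(1) unfolding sub_def by blast
    then show False using False by simp
   qed
   then have "v \<sqsubseteq> \<bottom>" by (rule disj[OF _ v(3,4)])
   then show ?thesis by (rule le_of_bot[OF _ v(2) neg_closed])
  qed
 qed
 ultimately show ?thesis by (rule that)
qed

end

section \<open>Numerably closed classes of opens\<close>

text \<open>The function in the second clause is defined on an open \<open>w\<close> only. This
  makes the notion stable under passing to open sublocales, as the induction over covering sieves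
  requires.\<close>

definition numerably_closed :: "'a gorder => ('a => bool) => bool" where
 "numerably_closed X P \<longleftrightarrow>
  (\<forall>v w. P v & w \<sqsubseteq>\<^bsub>X\<^esub> v --> P w) &
  (\<forall>w\<in>carrier X. \<forall>\<phi>. \<forall>A\<in>carrier half_line. \<forall>B\<in>carrier half_line.
   frame_hom half_line (open_sublocale X w) \<phi> & P (\<phi> A) & P (\<phi> B) --> P (\<phi> (A \<union> B))) &
  (\<forall>D\<subseteq>carrier X. (\<forall>a\<in>D. \<forall>b\<in>D. a ~= b --> a \<sqinter>\<^bsub>X\<^esub> b = \<bottom>\<^bsub>X\<^esub>) & (\<forall>d\<in>D. P d) --> P (\<Squnion>\<^bsub>X\<^esub> D))"

lemma numerably_closed_down: "[|numerably_closed X P; P v; w \<sqsubseteq>\<^bsub>X\<^esub> v|] ==> P w"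
 unfolding numerably_closed_def by blast

lemma numerably_closed_fun: "[|numerably_closed X P; w : carrier X; frame_hom half_line (open_sublocale X w) \<phi>;
  A : carrier half_line; B : carrier half_line; P (\<phi> A); P (\<phi> B)|] ==> P (\<phi> (A \<union> B))"
 unfolding numerably_closed_def by blast

lemma numerably_closed_disjoint: "[|numerably_closed X P; D \<subseteq> carrier X;
  !!a b. a : D ==> b : D ==> a ~= b ==> a \<sqinter>\<^bsub>X\<^esub> b = \<bottom>\<^bsub>X\<^esub>; !!d. d : D ==> P d|] ==> P (\<Squnion>\<^bsub>X\<^esub> D)"
 unfolding numerably_closed_def by simp

context half_line_hom
begin

lemma restrict_hom:
 assumes w: "w : carrier X"
 shows "frame_hom half_line (open_sublocale X w) (\<lambda>A\<in>carrier half_line. w \<sqinter> \<phi> A)"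
proof -
 let ?h = "\<lambda>A\<in>carrier half_line. w \<sqinter> \<phi> A"
 have c: "w \<sqinter> \<phi> A : carrier X & w \<sqinter> \<phi> A \<sqsubseteq> w" if "A : carrier half_line" for A
  using meet_lower[OF w closed[OF that]] by simp
 show ?thesis
  unfolding frame_hom_half_line
 proof (intro conjI ballI allI impI)
  show "?h : carrier half_line \<rightarrow>\<^sub>E carrier (open_sublocale X w)" using c by simp
  show "?h {0..} = \<top>\<^bsub>open_sublocale X w\<^esub>"
   using w by (simp add: hom_top open_sublocale_top meet_absorb(1))
 next
  fix A B assume AB: "A : carrier half_line" "B : carrier half_line"
  have "w \<sqinter> (\<phi> A \<sqinter> \<phi> B) = (w \<sqinter> \<phi> A) \<sqinter> (w \<sqinter> \<phi> B)"
  proof (rule antisymI)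
   have "\<phi> A \<sqinter> \<phi> B : carrier X" using AB meet_lower by simp
   note m = meet_lower[OF w this] and n = meet_lower[OF closed[OF AB(1)] closed[OF AB(2)]]
   show "w \<sqinter> (\<phi> A \<sqinter> \<phi> B) \<sqsubseteq> (w \<sqinter> \<phi> A) \<sqinter> (w \<sqinter> \<phi> B)"
    using m n c[OF AB(1)] c[OF AB(2)] trans[OF m(3) n(2)] trans[OF m(3) n(3)] w AB by (simp add: le_meet_iff)
   note p = meet_lower[OF w closed[OF AB(1)]] and q = meet_lower[OF w closed[OF AB(2)]]
   note r = meet_lower[OF p(1) q(1)]
   show "(w \<sqinter> \<phi> A) \<sqinter> (w \<sqinter> \<phi> B) \<sqsubseteq> w \<sqinter> (\<phi> A \<sqinter> \<phi> B)"
    using r n m trans[OF r(2) p(2)] trans[OF r(2) p(3)] trans[OF r(3) q(3)] w AB by (simp add: le_meet_iff)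
   show "w \<sqinter> (\<phi> A \<sqinter> \<phi> B) : carrier X" "(w \<sqinter> \<phi> A) \<sqinter> (w \<sqinter> \<phi> B) : carrier X" by (rule m(1), rule r(1))
  qed
  then show "?h (A \<inter> B) = ?h A \<sqinter>\<^bsub>open_sublocale X w\<^esub> ?h B"
   using AB c[OF AB(1)] c[OF AB(2)] w by (simp add: half_line_Int hom_Int open_sublocale_meet)
 next
  fix \<A> assume A: "\<A> \<subseteq> carrier half_line"
  have im: "\<phi> ` \<A> \<subseteq> carrier X" using A closed by auto
  have eq: "?h ` \<A> = (%b. w \<sqinter> b) ` \<phi> ` \<A>" using A by (auto simp: image_image)
  have "\<Squnion>\<^bsub>open_sublocale X w\<^esub> (?h ` \<A>) = \<Squnion> (?h ` \<A>)"
  proof (rule open_sublocale_sup[OF w])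
   show "?h ` \<A> \<subseteq> carrier X" using A c by auto
   show "b \<sqsubseteq> w" if "b : ?h ` \<A>" for b using that A c by auto
  qed
  note 1 = this
  have 2: "?h (\<Union> \<A>) = w \<sqinter> \<Squnion> (\<phi> ` \<A>)"
   using half_line_Union[OF A] by (simp add: hom_Union[OF A])
  show "?h (\<Union> \<A>) = \<Squnion>\<^bsub>open_sublocale X w\<^esub> (?h ` \<A>)"
   unfolding 1 2 unfolding eq meet_sup[OF w im] by (rule HOL.refl)
 qed
qed

lemma closed_Un:
 assumes "numerably_closed X P" "w : carrier X" "A : carrier half_line" "B : carrier half_line"
  "P (w \<sqinter> \<phi> A)" "P (w \<sqinter> \<phi> B)"
 shows "P (w \<sqinter> \<phi> (A \<union> B))"
 using numerably_closed_fun[OF assms(1,2) restrict_hom[OF assms(2)] assms(3,4)] assms by (simp add: half_line_Un)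

lemma closed_disjoint_Union:
 assumes P: "numerably_closed X P" and w: "w : carrier X" and A: "\<A> \<subseteq> carrier half_line"
  and disj: "!!A B. A : \<A> ==> B : \<A> ==> A ~= B ==> A \<inter> B = {}" and PA: "!!A. A : \<A> ==> P (w \<sqinter> \<phi> A)"
 shows "P (w \<sqinter> \<phi> (\<Union> \<A>))"
proof -
 have im: "\<phi> ` \<A> \<subseteq> carrier X" using A closed by auto
 have "P (\<Squnion> ((%b. w \<sqinter> b) ` \<phi> ` \<A>))"
 proof (rule numerably_closed_disjoint[OF P])
  show "(%b. w \<sqinter> b) ` \<phi> ` \<A> \<subseteq> carrier X" using im w meet_lower(1) by auto
  fix a b assume "a : (%b. w \<sqinter> b) ` \<phi> ` \<A>" "b : (%b. w \<sqinter> b) ` \<phi> ` \<A>" "a ~= b"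
  then obtain A B where AB: "A : \<A>" "B : \<A>" "a = w \<sqinter> \<phi> A" "b = w \<sqinter> \<phi> B" by auto
  then have AB': "A : carrier half_line" "B : carrier half_line" "A \<inter> B = {}" using A disj[of A B] \<open>a ~= b\<close> by auto
  note p = meet_lower[OF w closed[OF AB'(1)]] and q = meet_lower[OF w closed[OF AB'(2)]]
  note r = meet_lower[OF p(1) q(1)]
  have "a \<sqinter> b \<sqsubseteq> \<bottom>" unfolding AB(3,4)
   by (rule hom_disjoint[OF AB' r(1) trans[OF r(2) p(3)] trans[OF r(3) q(3)]])
  then show "a \<sqinter> b = \<bottom>" using r(1) by (intro le_bot) (simp_all add: AB)
 next
  fix d assume "d : (%b. w \<sqinter> b) ` \<phi> ` \<A>"
  then show "P d" using PA by auto
 qed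
 then show ?thesis using meet_sup[OF w im] by (simp add: hom_Union[OF A])
qed

text \<open>The shells of even index are disjoint, and so are those of odd index.\<close>

lemma closed_shells:
 fixes A :: "nat => real set"
 assumes P: "numerably_closed X P" and w: "w : carrier X" and A: "!!n. A n : carrier half_line"
  and disj: "!!m n. m + 2 \<le> n ==> A m \<inter> A n = {}" and PA: "!!n. P (w \<sqinter> \<phi> (A n))"
 shows "P (w \<sqinter> \<phi> (\<Union> n. A n))"
proof -
 have *: "P (w \<sqinter> \<phi> (\<Union> (A ` {n. n mod 2 = r})))" for r
 proof (rule closed_disjoint_Union[OF P w])
  show "A ` {n. n mod 2 = r} \<subseteq> carrier half_line" using A by auto
  fix B C assume BC: "B : A ` {n. n mod 2 = r}" "C : A ` {n. n mod 2 = r}" "B ~= C"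
  then obtain m n where mn: "B = A m" "C = A n" "m mod 2 = r" "n mod 2 = r" by auto
  then have "m ~= n" using BC by auto
  then have "m + 2 \<le> n \<or> n + 2 \<le> m" using mn(3)[folded mn(4)] by presburger
  then consider "m + 2 \<le> n" | "n + 2 \<le> m" by blast
  then show "B \<inter> C = {}" using disj[of m n] disj[of n m] mn by cases auto
 qed (use PA in auto)
 have "(\<Union> n. A n) = \<Union> (A ` {n. n mod 2 = 0}) \<union> \<Union> (A ` {n. n mod 2 = 1})"
 proof -
  have "UNIV = {n. n mod 2 = 0} \<union> {n. n mod 2 = (1::nat)}" by auto
  then show ?thesis by (simp only: UN_Un[symmetric] flip: image_Un Union_Un_distrib)
 qed
 moreover have "\<Union> (A ` {n. n mod 2 = r}) : carrier half_line" for r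
  by (rule half_line_Union) (use A in auto)
 ultimately show ?thesis using closed_Un[OF P w _ _ *[of 0] *[of 1]] by simp
qed

end

section \<open>Families of functions with a sum, and the opens where several of them are
  large\<close>

definition gt_ray :: "real => real set" where "gt_ray c = {0..} \<inter> {c<..}"
definition lt_ray :: "real => real set" where "lt_ray c = {0..} \<inter> {..<c}"

lemma ray_open [simp]: "gt_ray c : carrier half_line" "lt_ray c : carrier half_line"
 by (auto simp: gt_ray_def lt_ray_def)

lemma gt_ray_iff [simp]: "t : gt_ray c \<longleftrightarrow> 0 \<le> t & c < t" by (auto simp: gt_ray_def)
lemma lt_ray_iff [simp]: "t : lt_ray c \<longleftrightarrow> 0 \<le> t & t < c" by (auto simp: lt_ray_def)

lemma gt_ray_zero: "gt_ray 0 = {0<..}" by auto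

locale nonneg_functions = frame_lattice X for X :: "'a gorder" (structure) +
 fixes I :: "'i set" and f :: "'i => real set => 'a"
 assumes f_hom: "i : I ==> frame_hom half_line X (f i)"
begin

lemma f: "i : I ==> half_line_hom X (f i)"
 by unfold_locales (rule f_hom)

lemma f_closed: "i : I ==> A : carrier half_line ==> f i A : carrier X"
 using half_line_hom.closed[OF f] .

definition boxes :: "'i set => real set => ('i => real set) set" where
 "boxes J W = {A. (\<forall>i\<in>J. A i : carrier half_line) & (\<forall>t. (\<forall>i\<in>J. t i : A i) --> (\<Sum>i\<in>J. t i) : W)}"

lemma finite_sum_boxes: "finite_sum X J f W = \<Squnion> ((%A. \<Sqinter> ((%i. f i (A i)) ` J)) ` boxes J W)"
 unfolding finite_sum_def boxes_def by (rule arg_cong[where f = "Lattice.sup X"]) auto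

lemma box_carrier: "J \<subseteq> I ==> A : boxes J W ==> (%i. f i (A i)) ` J \<subseteq> carrier X"
 by (auto simp: boxes_def intro!: f_closed)

lemma boxes_carrier: "J \<subseteq> I ==> (%A. \<Sqinter> ((%i. f i (A i)) ` J)) ` boxes J W \<subseteq> carrier X"
 using box_carrier by auto

lemma finite_sum_closed: "J \<subseteq> I ==> finite_sum X J f W : carrier X"
 unfolding finite_sum_boxes by (rule sup_closed[OF boxes_carrier])

lemma le_finite_sum:
 assumes "J \<subseteq> I" "A : boxes J W" "v : carrier X" "!!j. j : J ==> v \<sqsubseteq> f j (A j)"
 shows "v \<sqsubseteq> finite_sum X J f W"
proof -
 have "v \<sqsubseteq> \<Sqinter> ((%i. f i (A i)) ` J)" using le_inf_image[OF assms(3) box_carrier[OF assms(1,2)]] assms(4) by simp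
 moreover have "\<Sqinter> ((%i. f i (A i)) ` J) \<sqsubseteq> finite_sum X J f W" unfolding finite_sum_boxes
  by (rule sup_upper[OF boxes_carrier[OF assms(1)]]) (use assms(2) in simp)
 ultimately show ?thesis by (rule trans)
qed

lemma finite_sum_cases:
 assumes "v \<sqsubseteq> finite_sum X J f W" "J \<subseteq> I" "c : carrier X"
  "!!A v'. A : boxes J W ==> v' : carrier X ==> v' \<sqsubseteq> v ==> (!!j. j : J ==> v' \<sqsubseteq> f j (A j)) ==> v' \<sqsubseteq> c"
 shows "v \<sqsubseteq> c"
proof (rule le_sup_cases[OF _ _ boxes_carrier[OF assms(2)] assms(3)])
 show "v \<sqsubseteq> \<Squnion> ((%A. \<Sqinter> ((%i. f i (A i)) ` J)) ` boxes J W)" using assms(1) by (simp add: finite_sum_boxes)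
 show "v : carrier X" using le_carrier[OF assms(1)] by simp
 fix b v' assume b: "b : (%A. \<Sqinter> ((%i. f i (A i)) ` J)) ` boxes J W" "v' : carrier X" "v' \<sqsubseteq> v" "v' \<sqsubseteq> b"
 then obtain A where A: "A : boxes J W" "b = \<Sqinter> ((%i. f i (A i)) ` J)" by auto
 show "v' \<sqsubseteq> c"
  by (rule assms(4)[OF A(1) b(2,3)]) (use le_inf_image[OF b(2) box_carrier[OF assms(2) A(1)]] b(4) A(2) in simp)
qed

lemma sums_carrier: "{finite_sum X J f (gt_ray c) | J. finite J & J \<subseteq> I} \<subseteq> carrier X"
 using finite_sum_closed by auto

end

locale numerable_functions = nonneg_functions +
 fixes s :: "real set => 'a"
 assumes sum: "is_sum X I f s" and positive: "s {0<..} = \<top>"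
begin

lemma s: "half_line_hom X s"
 by unfold_locales (use sum in \<open>simp add: is_sum_def\<close>)

lemma s_closed: "A : carrier half_line ==> s A : carrier X"
 using half_line_hom.closed[OF s] .

lemma s_gt: "s (gt_ray c) = \<Squnion> {finite_sum X J f (gt_ray c) | J. finite J & J \<subseteq> I}"
 using sum by (simp add: is_sum_def gt_ray_def)

lemma finite_sum_le_s:
 assumes "v \<sqsubseteq> finite_sum X J f (gt_ray c)" "finite J" "J \<subseteq> I"
 shows "v \<sqsubseteq> s (gt_ray c)"
proof (rule trans[OF assms(1)])
 show "finite_sum X J f (gt_ray c) \<sqsubseteq> s (gt_ray c)"
  unfolding s_gt by (rule sup_upper[OF sums_carrier]) (use assms in auto)
qed

lemma s_gt_cases:
 assumes "v \<sqsubseteq> s (gt_ray c)" "d : carrier X"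
  "!!J A v'. finite J ==> J \<subseteq> I ==> A : boxes J (gt_ray c) ==> v' : carrier X ==> v' \<sqsubseteq> v ==>
   (!!j. j : J ==> v' \<sqsubseteq> f j (A j)) ==> v' \<sqsubseteq> d"
 shows "v \<sqsubseteq> d"
proof (rule le_sup_cases[OF _ _ sums_carrier assms(2)])
 show "v \<sqsubseteq> \<Squnion> {finite_sum X J f (gt_ray c) | J. finite J & J \<subseteq> I}" using assms(1) by (simp add: s_gt)
 show "v : carrier X" using le_carrier[OF assms(1)] by simp
 fix b v' assume b: "b : {finite_sum X J f (gt_ray c) | J. finite J & J \<subseteq> I}" "v' \<sqsubseteq> v" "v' \<sqsubseteq> b"
 then obtain J where J: "finite J" "J \<subseteq> I" "b = finite_sum X J f (gt_ray c)" by auto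
 show "v' \<sqsubseteq> d"
 proof (rule finite_sum_cases[OF b(3)[unfolded J(3)] J(2) assms(2)])
  fix A v'' assume A: "A : boxes J (gt_ray c)" "v'' : carrier X" "v'' \<sqsubseteq> v'" "!!j. j : J ==> v'' \<sqsubseteq> f j (A j)"
  show "v'' \<sqsubseteq> d" by (rule assms(3)[OF J(1,2) A(1,2) trans[OF A(3) b(2)] A(4)])
 qed
qed

lemma ray_disjoint: "c \<le> d ==> half_line_hom X h ==> v \<sqsubseteq> h (lt_ray c) ==> v \<sqsubseteq> h (gt_ray d) ==> v \<sqsubseteq> \<bottom>"
 using half_line_hom.hom_disjoint[of X h "lt_ray c" "gt_ray d" v] le_carrier[of v "h (lt_ray c)"] by fastforce

text \<open>Locally, all but finitely many of the functions are small.\<close>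

lemma locally_small:
 assumes "\<epsilon> > 0" "u : carrier X" "d : carrier X"
  and "!!J v. finite J ==> J \<subseteq> I ==> v : carrier X ==> v \<sqsubseteq> u ==>
   (!!l v'. l : I - J ==> v' \<sqsubseteq> v ==> v' \<sqsubseteq> f l (gt_ray \<epsilon>) ==> v' \<sqsubseteq> \<bottom>) ==> v \<sqsubseteq> d"
 shows "u \<sqsubseteq> d"
proof -
 interpret s: half_line_hom X s by (rule s)
 \<comment> \<open>Where the sum lies in a window of length \<open>\<epsilon>\<close> above
   \<open>c\<close>, some finite partial sum already exceeds \<open>c\<close>; a further function
   exceeding \<open>\<epsilon>\<close> would push the sum out of the window.\<close>
 let ?N = "%c. gt_ray c \<inter> lt_ray (c + \<epsilon>)"
 have N: "?N c : carrier half_line" for c by (rule half_line_Int) auto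
 have im: "range ?N \<subseteq> carrier half_line" using N by auto
 have "{0..} = \<Union> (range ?N)"
 proof
  show "{0..} \<subseteq> \<Union> (range ?N)"
  proof
   fix t :: real assume "t : {0..}"
   then have "t : ?N (t - \<epsilon> / 2)" using assms(1) by auto
   then show "t : \<Union> (range ?N)" by blast
  qed
 qed auto
 then have "\<top> = \<Squnion> (s ` range ?N)" using s.hom_top s.hom_Union[OF im] by simp
 then have "u \<sqsubseteq> \<Squnion> (s ` range ?N)" using top_higher[OF assms(2)] by (rule subst)
 then show ?thesis
 proof (rule le_sup_cases[OF _ assms(2) _ assms(3)])
  show "s ` range ?N \<subseteq> carrier X" using N s.closed by auto
  fix b v assume "b : s ` range ?N" and v: "v : carrier X" "v \<sqsubseteq> u" "v \<sqsubseteq> b"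
  then obtain c where "b = s (?N c)" by auto
  with v(3) have vc: "v \<sqsubseteq> s (?N c)" by simp
  have gt: "v \<sqsubseteq> s (gt_ray c)" by (rule trans[OF vc s.hom_mono[OF N]]) auto
  have lt: "v \<sqsubseteq> s (lt_ray (c + \<epsilon>))" by (rule trans[OF vc s.hom_mono[OF N]]) auto
  show "v \<sqsubseteq> d"
  proof (rule s_gt_cases[OF gt assms(3)])
   fix J A v' assume J: "finite J" "J \<subseteq> I" "A : boxes J (gt_ray c)" "v' : carrier X" "v' \<sqsubseteq> v" "!!j. j : J ==> v' \<sqsubseteq> f j (A j)"
   show "v' \<sqsubseteq> d"
   proof (rule assms(4)[OF J(1,2,4) trans[OF J(5) v(2)]])
    fix l v'' assume l: "l : I - J" "v'' \<sqsubseteq> v'" "v'' \<sqsubseteq> f l (gt_ray \<epsilon>)"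
    let ?A = "A(l := gt_ray \<epsilon>)"
    have "?A : boxes (insert l J) (gt_ray (c + \<epsilon>))"
    proof -
     have 1: "(\<Sum>i\<in>insert l J. t i) : gt_ray (c + \<epsilon>)" if "\<forall>i\<in>insert l J. t i : ?A i" for t
     proof -
      have "t l : gt_ray \<epsilon>" using that by simp
      moreover have "t i : A i" if i: "i : J" for i
      proof -
       have "i ~= l" using i l(1) by auto
       then show ?thesis using bspec[OF \<open>\<forall>i\<in>insert l J. t i : ?A i\<close>, of i] i by simp
      qed
      then have "(\<Sum>i\<in>J. t i) : gt_ray c" using J(3) by (simp add: boxes_def)
      ultimately show ?thesis using J(1) l(1) by simp
     qed
     have 2: "\<forall>i\<in>insert l J. ?A i : carrier half_line" using J(3) by (simp add: boxes_def)
     show ?thesis unfolding boxes_def mem_Collect_eq by (intro conjI allI impI 2 1)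
    qed
    then have "v'' \<sqsubseteq> finite_sum X (insert l J) f (gt_ray (c + \<epsilon>))"
    proof (rule le_finite_sum[rotated])
     show "insert l J \<subseteq> I" using l(1) J(2) by auto
     show "v'' : carrier X" using le_carrier[OF l(2)] by simp
     fix j assume "j : insert l J"
     then show "v'' \<sqsubseteq> f j (?A j)" using l(3) trans[OF l(2) J(6), of j] by (cases "j = l") simp_all
    qed
    then have "v'' \<sqsubseteq> s (gt_ray (c + \<epsilon>))" by (rule finite_sum_le_s) (use J l in auto)
    then show "v'' \<sqsubseteq> \<bottom>" using ray_disjoint[OF order_refl s trans[OF l(2) trans[OF J(5) lt]]] by simp
   qed
  qed
 qed
qed

text \<open>The open on which at least \<open>n\<close> functions exceed \<open>t\<close>, in other
  words on which the \<open>n\<close>-th largest function does. For \<open>n = 1\<close> this is the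
  largest function of the family.\<close>

definition level :: "nat => real => 'a" where
 "level n t = \<Squnion> ((%J. \<Sqinter> ((%j. f j (gt_ray t)) ` J)) ` {J. finite J & J \<subseteq> I & card J = n})"

lemma level_carrier: "(%J. \<Sqinter> ((%j. f j (gt_ray t)) ` J)) ` {J. finite J & J \<subseteq> I & card J = n} \<subseteq> carrier X"
proof -
 have "(%j. f j (gt_ray t)) ` J \<subseteq> carrier X" if "J \<subseteq> I" for J using that by (auto intro!: f_closed)
 then show ?thesis by auto
qed

lemma level_closed [simp]: "level n t : carrier X"
 unfolding level_def by (rule sup_closed[OF level_carrier])

lemma inf_level_closed: "J \<subseteq> I ==> \<Sqinter> ((%j. f j (gt_ray t)) ` J) : carrier X"
 by (rule inf_closed) (auto intro!: f_closed)

lemma le_inf_level: "J \<subseteq> I ==> v : carrier X ==> v \<sqsubseteq> \<Sqinter> ((%j. f j (gt_ray t)) ` J) \<longleftrightarrow> (\<forall>j\<in>J. v \<sqsubseteq> f j (gt_ray t))"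
 by (rule le_inf_image) (auto intro!: f_closed)

lemma le_level:
 assumes "finite J" "J \<subseteq> I" "card J = n" "v : carrier X" "!!j. j : J ==> v \<sqsubseteq> f j (gt_ray t)"
 shows "v \<sqsubseteq> level n t"
proof -
 have "v \<sqsubseteq> \<Sqinter> ((%j. f j (gt_ray t)) ` J)" using le_inf_level[OF assms(2,4)] assms(5) by simp
 moreover have "\<Sqinter> ((%j. f j (gt_ray t)) ` J) \<sqsubseteq> level n t" unfolding level_def
  by (rule sup_upper[OF level_carrier]) (use assms in auto)
 ultimately show ?thesis by (rule trans)
qed

lemma level_cases:
 assumes "v \<sqsubseteq> level n t" "d : carrier X"
  "!!J v'. finite J ==> J \<subseteq> I ==> card J = n ==> v' : carrier X ==> v' \<sqsubseteq> v ==> (!!j. j : J ==> v' \<sqsubseteq> f j (gt_ray t)) ==> v' \<sqsubseteq> d"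
 shows "v \<sqsubseteq> d"
proof (rule le_sup_cases[OF _ _ level_carrier assms(2)])
 show "v \<sqsubseteq> \<Squnion> ((%J. \<Sqinter> ((%j. f j (gt_ray t)) ` J)) ` {J. finite J & J \<subseteq> I & card J = n})"
  using assms(1) by (simp add: level_def)
 show "v : carrier X" using le_carrier[OF assms(1)] by simp
 fix b v' assume b: "b : (%J. \<Sqinter> ((%j. f j (gt_ray t)) ` J)) ` {J. finite J & J \<subseteq> I & card J = n}" "v' : carrier X" "v' \<sqsubseteq> v" "v' \<sqsubseteq> b"
 then obtain J where J: "finite J" "J \<subseteq> I" "card J = n" "b = \<Sqinter> ((%j. f j (gt_ray t)) ` J)" by auto
 show "v' \<sqsubseteq> d"
  by (rule assms(3)[OF J(1-3) b(2,3)]) (use le_inf_level[OF J(2) b(2)] b(4) J(4) in simp)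
qed

lemma f_gt_mono: "i : I ==> a \<le> b ==> f i (gt_ray b) \<sqsubseteq> f i (gt_ray a)"
 by (rule half_line_hom.hom_mono[OF f]) auto

lemma level_antimono:
 assumes "a \<le> b" shows "level n b \<sqsubseteq> level n a"
proof (rule level_cases[OF le_refl[OF level_closed] level_closed])
 fix J v assume J: "finite J" "J \<subseteq> I" "card J = n" "v : carrier X" "!!j. j : J ==> v \<sqsubseteq> f j (gt_ray b)"
 show "v \<sqsubseteq> level n a"
  by (rule le_level[OF J(1-4)]) (rule trans[OF J(5) f_gt_mono], use J(2) assms in auto)
qed

text \<open>This is the hypothesis \<open>cover\<close> of \<open>scale_hom\<close>, i.e., the
  continuity of the \<open>n\<close>-th largest function. Locally only functions from a finite set
  can exceed \<open>b\<close>; for each of these one passes to where it exceeds \<open>a\<close> or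
  stays below \<open>b\<close>, and the number of the former selects the alternative.\<close>

lemma level_cover:
 assumes "0 < a" "a < b"
 shows "\<top> \<sqsubseteq> \<Squnion> {level n a, neg (level n b)}"
proof (rule locally_small[of b])
 let ?c = "\<Squnion> {level n a, neg (level n b)}"
 have up: "level n a \<sqsubseteq> ?c" "neg (level n b) \<sqsubseteq> ?c" by (rule sup_upper; simp)+
 show c: "?c : carrier X" by (rule sup_closed) simp
 fix J v assume J: "finite J" "J \<subseteq> I" "v : carrier X"
  and small: "!!l v'. l : I - J ==> v' \<sqsubseteq> v ==> v' \<sqsubseteq> f l (gt_ray b) ==> v' \<sqsubseteq> \<bottom>"
 show "v \<sqsubseteq> ?c"
 proof (rule finite_cover_cases[where a = "%j. f j (gt_ray a)" and b = "%j. f j (lt_ray b)", OF J(1) _ J(3) c])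
  fix j assume "j : J"
  then have jI: "j : I" using J(2) by auto
  interpret f: half_line_hom X "f j" by (rule f[OF jI])
  have "gt_ray a \<union> lt_ray b = {0..}" using assms by auto
  then have "\<top> = \<Squnion> {f j (gt_ray a), f j (lt_ray b)}"
   using f.hom_Un[of "gt_ray a" "lt_ray b"] f.hom_top by simp
  moreover have "\<top> \<sqsubseteq> \<top>" by simp
  ultimately show "f j (gt_ray a) : carrier X & f j (lt_ray b) : carrier X & \<top> \<sqsubseteq> \<Squnion> {f j (gt_ray a), f j (lt_ray b)}"
   by simp
 next
  fix K v' assume K: "K \<subseteq> J" "v' : carrier X" "v' \<sqsubseteq> v" "!!j. j : K ==> v' \<sqsubseteq> f j (gt_ray a)" "!!j. j : J - K ==> v' \<sqsubseteq> f j (lt_ray b)"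
  have fK: "finite K" "K \<subseteq> I" using K(1) J finite_subset by auto
  show "v' \<sqsubseteq> ?c"
  proof (cases "card K \<ge> n")
   case True
   then obtain K' where K': "K' \<subseteq> K" "card K' = n" "finite K'" using obtain_subset_with_card_n by metis
   have "v' \<sqsubseteq> level n a" by (rule le_level[OF K'(3) _ K'(2) K(2)]) (use K' fK K(4) in auto)
   then show ?thesis using up(1) by (rule trans)
  next
   case False
   have "v' \<sqsubseteq> neg (level n b)"
   proof (rule le_negI[OF level_closed K(2)])
    fix x assume x: "x \<sqsubseteq> v'" "x \<sqsubseteq> level n b"
    show "x \<sqsubseteq> \<bottom>"
    proof (rule level_cases[OF x(2) bottom_closed])
     fix L y assume L: "finite L" "L \<subseteq> I" "card L = n" "y \<sqsubseteq> x" "!!j. j : L ==> y \<sqsubseteq> f j (gt_ray b)"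
     \<comment> \<open>\<open>K\<close> has fewer than \<open>n\<close> elements, so some index of
       the \<open>n\<close>-element set \<open>L\<close> is outside: its function is either below
       \<open>b\<close> or among the small ones outside \<open>J\<close>.\<close>
     have "\<not> L \<subseteq> K" using False L(3) card_mono[OF fK(1)] by auto
     then obtain l where l: "l : L" "l ~: K" by auto
     have yv': "y \<sqsubseteq> v'" by (rule trans[OF L(4) x(1)])
     show "y \<sqsubseteq> \<bottom>"
     proof (cases "l : J")
      case True
      then have "y \<sqsubseteq> f l (lt_ray b)" using trans[OF yv' K(5)] l by simp
      then show ?thesis using ray_disjoint[OF order_refl f _ L(5)[OF l(1)]] l L(2) by auto
     next
      case False
      then show ?thesis using small[OF _ trans[OF yv' K(3)] L(5)[OF l(1)]] l L(2) by auto
     qed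
    qed
   qed
   then show ?thesis using up(2) by (rule trans)
  qed
 qed
qed (use assms in auto)

text \<open>If \<open>n\<close> functions exceed \<open>t\<close>, their partial sum, hence
  \<open>s\<close>, exceeds \<open>n * t\<close>.\<close>

lemma s_lt_level:
 assumes "n \<ge> 1" "c \<le> real n * t" "v \<sqsubseteq> s (lt_ray c)" "v \<sqsubseteq> level n t" "t > 0"
 shows "v \<sqsubseteq> \<bottom>"
proof (rule level_cases[OF assms(4) bottom_closed])
 fix L y assume L: "finite L" "L \<subseteq> I" "card L = n" "y : carrier X" "y \<sqsubseteq> v" "!!j. j : L ==> y \<sqsubseteq> f j (gt_ray t)"
 have "(%_. gt_ray t) : boxes L (gt_ray (real n * t))"
 proof -
  have "(\<Sum>i\<in>L. r i) : gt_ray (real n * t)" if "\<forall>i\<in>L. r i : gt_ray t" for r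
  proof -
   have "L ~= {}" using L(3) assms(1) by auto
   then have "(\<Sum>i\<in>L. t) < (\<Sum>i\<in>L. r i)" using that L(1) by (intro sum_strict_mono) auto
   moreover have "0 \<le> (\<Sum>i\<in>L. r i)" using that by (intro sum_nonneg) auto
   ultimately show ?thesis using L(3) by simp
  qed
  then show ?thesis by (simp add: boxes_def)
 qed
 then have "y \<sqsubseteq> finite_sum X L f (gt_ray (real n * t))" by (rule le_finite_sum[OF L(2) _ L(4)]) (rule L(6))
 then have "y \<sqsubseteq> s (gt_ray (real n * t))" by (rule finite_sum_le_s[OF _ L(1,2)])
 then show "y \<sqsubseteq> \<bottom>" by (rule ray_disjoint[OF assms(2) s trans[OF L(5) assms(3)]])
qed

lemma s_lt_neg_level: "n \<ge> 1 ==> c \<le> real n * t ==> t > 0 ==> s (lt_ray c) \<sqsubseteq> neg (level n t)"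
 by (rule le_negI[OF level_closed s_closed[OF ray_open(2)]]) (rule s_lt_level)

text \<open>This is the \<open>n\<close>-th largest function as a morphism to the half line. That it
  is finite, the hypothesis \<open>top\<close> of \<open>scale_hom\<close>, comes from the sum,
  which bounds it.\<close>

lemma level_hom:
 assumes "n \<ge> 1"
 obtains \<phi> where "half_line_hom X \<phi>" "!!t. t > 0 ==> \<phi> (gt_ray t) \<sqsubseteq> level n t" "!!t. t > 0 ==> \<phi> (lt_ray t) \<sqsubseteq> neg (level n t)"
proof -
 interpret s: half_line_hom X s by (rule s)
 let ?N = "{neg (level n t) | t. t > 0}"
 have N: "?N \<subseteq> carrier X" by auto
 have "{0..} = \<Union> (range lt_ray)"
 proof
  show "{0..} \<subseteq> \<Union> (range lt_ray)"
  proof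
   fix t :: real assume "t : {0..}"
   then have "t : lt_ray (t + 1)" by auto
   then show "t : \<Union> (range lt_ray)" by blast
  qed
 qed auto
 moreover have "range lt_ray \<subseteq> carrier half_line" by auto
 ultimately have "\<top> = \<Squnion> (s ` range lt_ray)" using s.hom_top s.hom_Union[of "range lt_ray"] by simp
 moreover have "\<Squnion> (s ` range lt_ray) \<sqsubseteq> \<Squnion> ?N"
 proof (rule sup_least)
  fix b assume "b : s ` range lt_ray"
  then obtain c where c: "b = s (lt_ray c)" by auto
  \<comment> \<open>Positive and at least \<open>c\<close>, so that \<open>c \<le> n * t\<close>
    follows from \<open>n \<ge> 1\<close>.\<close>
  define t where "t = max c 1"
  have "c \<le> real n * t"
  proof -
   have "1 * t \<le> real n * t" using assms by (intro mult_right_mono) (auto simp: t_def)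
   then show ?thesis by (simp add: t_def)
  qed
  then have "b \<sqsubseteq> neg (level n t)" unfolding c by (rule s_lt_neg_level[OF assms]) (simp add: t_def)
  moreover have "neg (level n t) \<sqsubseteq> \<Squnion> ?N" by (rule sup_upper[OF N]) (auto simp: t_def)
  ultimately show "b \<sqsubseteq> \<Squnion> ?N" by (rule trans)
 qed (use N s.closed in auto)
 ultimately have top: "\<top> \<sqsubseteq> \<Squnion> ?N" by simp
 show ?thesis
 proof (rule scale_hom[of "level n", OF level_closed level_antimono level_cover top])
  fix \<phi> assume \<phi>: "frame_hom half_line X \<phi>" "!!t. t > 0 ==> \<phi> ({0..} \<inter> {t<..}) \<sqsubseteq> level n t"
   "!!t. t > 0 ==> \<phi> ({0..} \<inter> {..<t}) \<sqsubseteq> neg (level n t)"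
  have "half_line_hom X \<phi>" by unfold_locales (rule \<phi>(1))
  then show thesis by (rule that) (use \<phi>(2,3) in \<open>simp_all only: gt_ray_def lt_ray_def\<close>)
 qed
qed

end

section \<open>From the members of a numerable cover to the top element\<close>

context numerable_functions
begin

text \<open>Opens on which exactly \<open>n\<close> functions exceed a threshold split into disjoint
  pieces of single members. The claim \<open>region\<close> joins them two at a time, along the
  \<open>n\<close>-th largest functions; then the shells of \<open>s\<close>, and finally those of
  the reciprocal of the largest function, exhaust \<open>X\<close>.\<close>

theorem closed_top:
 assumes P: "numerably_closed X P" and Pf: "!!i. i : I ==> P (f i {0<..})"
 shows "P \<top>"
proof -
 note down = numerably_closed_down[OF P]
 have bot: "P \<bottom>"
 proof -
  have "P (\<Squnion> {})" by (rule numerably_closed_disjoint[OF P]) auto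
  moreover have "\<Squnion> {} = \<bottom>" by (rule sup_eqI) auto
  ultimately show ?thesis by simp
 qed
 \<comment> \<open>At most \<open>n\<close> and at least \<open>n\<close> functions exceed
   \<open>q\<close>. The sets of \<open>n\<close> functions that do so separate this open into
   disjoint pieces, since two different such sets would give at least \<open>n + 1\<close>
   functions.\<close>
 have exact: "P (neg (level (Suc n) q) \<sqinter> level n q)" if n: "n \<ge> 1" and q: "q > 0" for n q
 proof -
  let ?D = "(%J. \<Sqinter> ((%j. f j (gt_ray q)) ` J)) ` {J. finite J & J \<subseteq> I & card J = n}"
  let ?N = "neg (level (Suc n) q)"
  have "P (\<Squnion> ((%b. ?N \<sqinter> b) ` ?D))"
  proof (rule numerably_closed_disjoint[OF P])
   show "(%b. ?N \<sqinter> b) ` ?D \<subseteq> carrier X" using level_carrier meet_lower(1)[OF neg_closed] by (auto simp: image_subset_iff)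
  next
   fix a b assume "a : (%b. ?N \<sqinter> b) ` ?D" "b : (%b. ?N \<sqinter> b) ` ?D" and ne: "a ~= b"
   then obtain J K where J: "finite J" "J \<subseteq> I" "card J = n" "a = ?N \<sqinter> \<Sqinter> ((%j. f j (gt_ray q)) ` J)"
    and K: "finite K" "K \<subseteq> I" "card K = n" "b = ?N \<sqinter> \<Sqinter> ((%j. f j (gt_ray q)) ` K)" by auto
   note m = meet_lower[OF neg_closed[of "level (Suc n) q"] inf_level_closed[OF J(2), of q], folded J(4)] meet_lower[OF neg_closed[of "level (Suc n) q"] inf_level_closed[OF K(2), of q], folded K(4)]
   note ab = meet_lower[OF m(1) m(4)]
   have "J ~= K" using ne J(4) K(4) by auto
   then have "\<not> K \<subseteq> J" using J K card_subset_eq[of J K] by auto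
   then obtain l where l: "l : K" "l ~: J" by auto
   have "a \<sqinter> b \<sqsubseteq> level (Suc n) q"
   proof (rule le_level[of "insert l J"])
    fix j assume "j : insert l J"
    then show "a \<sqinter> b \<sqsubseteq> f j (gt_ray q)"
     using trans[OF ab(2) m(3)] trans[OF ab(3) m(6)] le_inf_level[OF J(2) ab(1), of q] le_inf_level[OF K(2) ab(1), of q] l(1)
     by auto
   qed (use J K l ab(1) in auto)
   moreover have "a \<sqinter> b \<sqsubseteq> ?N" by (rule trans[OF ab(2) m(2)])
   ultimately have "a \<sqinter> b \<sqsubseteq> \<bottom>" by (rule le_neg_disjoint[OF level_closed ab(1)])
   then show "a \<sqinter> b = \<bottom>" using ab(1) by (intro le_bot)
  next
   fix d assume "d : (%b. ?N \<sqinter> b) ` ?D"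
   then obtain J where J: "finite J" "J \<subseteq> I" "card J = n" "d = ?N \<sqinter> \<Sqinter> ((%j. f j (gt_ray q)) ` J)" by auto
   obtain j where j: "j : J" using J(3) n by (cases "J = {}") auto
   then have jI: "j : I" using J(2) by auto
   note m = meet_lower[OF neg_closed[of "level (Suc n) q"] inf_level_closed[OF J(2), of q], folded J(4)]
   have "d \<sqsubseteq> f j (gt_ray q)" using le_inf_level[OF J(2) m(1), of q] m(3) j by simp
   moreover have "f j (gt_ray q) \<sqsubseteq> f j {0<..}"
    by (rule half_line_hom.hom_mono[OF f[OF jI]]) (use q in auto)
   ultimately have "d \<sqsubseteq> f j {0<..}" by (rule trans)
   then show "P d" by (rule down[OF Pf[OF jI]])
  qed
  then show ?thesis unfolding level_def[of n] meet_sup[OF neg_closed level_carrier] .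
 qed
 \<comment> \<open>At most \<open>k\<close> functions exceed \<open>p\<close>, and some function
   exceeds \<open>q\<close>. The gap between \<open>p\<close> and \<open>q\<close> leaves room for
   the induction, in which the lower threshold rises.\<close>
 have region: "P (neg (level (Suc k) p) \<sqinter> level 1 q)" if "0 < p" "p < q" for k p q
  using that
 proof (induction k arbitrary: p q)
  case 0
  note m = meet_lower[OF neg_closed level_closed, of "level (Suc 0) p" 1 q]
  have "neg (level (Suc 0) p) \<sqinter> level 1 q \<sqsubseteq> \<bottom>"
   by (rule le_neg_disjoint[OF level_closed m(1) trans[OF m(3)] m(2)])
    (use level_antimono[of p q 1] 0 in simp)
  then show ?case by (rule down[OF bot])
 next
  case (Suc k)
  obtain \<phi> where \<phi>: "half_line_hom X \<phi>" "!!t. t > 0 ==> \<phi> (gt_ray t) \<sqsubseteq> level (Suc k) t" "!!t. t > 0 ==> \<phi> (lt_ray t) \<sqsubseteq> neg (level (Suc k) t)"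
   by (rule level_hom[of "Suc k"]) auto
  interpret h: half_line_hom X \<phi> by (rule \<phi>(1))
  \<comment> \<open>Where the \<open>(k + 1)\<close>-th largest function \<open>\<phi>\<close> is
    below \<open>r\<close>, at most \<open>k\<close> functions exceed \<open>r\<close>, and the
    induction hypothesis applies to \<open>r < q\<close>. Where it is above \<open>p\<close>,
    exactly \<open>k + 1\<close> functions exceed \<open>p\<close>. The two ranges cover the half
    line because \<open>p < r\<close>.\<close>
  define r where "r = (p + q) / 2"
  have r: "0 < r" "p < r" "r < q" using Suc.prems by (auto simp: r_def)
  let ?w = "neg (level (Suc (Suc k)) p) \<sqinter> level 1 q"
  note m = meet_lower[OF neg_closed level_closed, of "level (Suc (Suc k)) p" 1 q]
  have "P (?w \<sqinter> \<phi> (lt_ray r \<union> gt_ray p))"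
  proof (rule h.closed_Un[OF P m(1) ray_open(2) ray_open(1)])
   note n = meet_lower[OF m(1) h.closed[OF ray_open(2)], of r]
   have "?w \<sqinter> \<phi> (lt_ray r) \<sqsubseteq> neg (level (Suc k) r) \<sqinter> level 1 q"
    by (rule meet_greatest[OF trans[OF n(3) \<phi>(3)[OF r(1)]] trans[OF n(2) m(3)] n(1)]) auto
   then show "P (?w \<sqinter> \<phi> (lt_ray r))" by (rule down[OF Suc.IH[OF r(1,3)]])
  next
   note n = meet_lower[OF m(1) h.closed[OF ray_open(1)], of p]
   have "?w \<sqinter> \<phi> (gt_ray p) \<sqsubseteq> neg (level (Suc (Suc k)) p) \<sqinter> level (Suc k) p"
    by (rule meet_greatest[OF trans[OF n(2) m(2)] trans[OF n(3) \<phi>(2)] n(1)]) (use Suc.prems in auto)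
   then show "P (?w \<sqinter> \<phi> (gt_ray p))" by (rule down[rotated]) (use exact[of "Suc k" p] Suc.prems in simp)
  qed
  moreover have "lt_ray r \<union> gt_ray p = {0..}" using r Suc.prems by auto
  ultimately show ?case using m(1) by (simp add: h.hom_top meet_absorb(1))
 qed
 \<comment> \<open>Where \<open>s < n + 1\<close>, at most \<open>k\<close> functions exceed
   \<open>q / 2\<close> once \<open>k\<close> is large, so each shell of \<open>s\<close> meets
   \<open>level 1 q\<close> inside a region for the thresholds \<open>q / 2 < q\<close>.\<close>
 have level1: "P (level 1 q)" if q: "q > 0" for q
 proof -
  interpret s: half_line_hom X s by (rule s)
  define A where "A = (\<lambda>n::nat. gt_ray (real n - 1) \<inter> lt_ray (real n + 1))"
  have A_iff: "t : A n \<longleftrightarrow> 0 \<le> t & real n - 1 < t & t < real n + 1" for t n by (auto simp: A_def)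
  have A: "A n : carrier half_line" for n unfolding A_def by (rule half_line_Int) auto
  have "P (level 1 q \<sqinter> s (\<Union> n. A n))"
  proof (rule s.closed_shells[OF P level_closed A])
   fix m n :: nat assume "m + 2 \<le> n"
   then have "real m + 2 \<le> real n" by linarith
   then show "A m \<inter> A n = {}" by (intro equals0I) (simp add: A_iff)
  next
   fix n :: nat
   have A_sub: "A n \<subseteq> lt_ray (real n + 1)" by (auto simp: A_def)
   obtain k :: nat where k: "real n + 1 \<le> real k * (q / 2)"
    using reals_Archimedean3[of "q / 2" ] q by (metis half_gt_zero less_imp_le)
   have "real n + 1 \<le> real (Suc k) * (q / 2)" using k q by (simp add: algebra_simps)
   then have "s (lt_ray (real n + 1)) \<sqsubseteq> neg (level (Suc k) (q / 2))" by (intro s_lt_neg_level) (use q in auto)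
   note l = trans[OF s.hom_mono[OF A ray_open(2) A_sub] this]
   note m = meet_lower[OF level_closed s.closed[OF A], of 1 q n]
   have "level 1 q \<sqinter> s (A n) \<sqsubseteq> neg (level (Suc k) (q / 2)) \<sqinter> level 1 q"
    by (rule meet_greatest[OF trans[OF m(3) l] m(2) m(1)]) auto
   then show "P (level 1 q \<sqinter> s (A n))" by (rule down[rotated]) (use region[of "q / 2" q k] q in simp)
  qed
  moreover have "(\<Union> n. A n) = {0..}"
  proof (intro equalityI subsetI)
   fix t :: real assume t: "t : {0..}"
   then have "real (nat \<lfloor>t\<rfloor>) = of_int \<lfloor>t\<rfloor>" by simp
   moreover have "0 \<le> t" "of_int \<lfloor>t\<rfloor> \<le> t" "t < of_int \<lfloor>t\<rfloor> + 1" using t by simp_all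
   ultimately have "t : A (nat \<lfloor>t\<rfloor>)" unfolding A_iff by linarith
   then show "t : (\<Union> n. A n)" by (rule UN_I[OF UNIV_I])
  next
   fix t assume "t : (\<Union> n. A n)"
   then show "t : {0..}" by (auto simp: A_iff)
  qed
  ultimately have "P (level 1 q \<sqinter> s {0..})" by simp
  then show ?thesis by (simp add: s.hom_top meet_absorb(1))
 qed
 \<comment> \<open>The largest function of the family; the opens where it is bounded away from 0
   will exhaust \<open>X\<close>.\<close>
 obtain \<phi> where \<phi>: "half_line_hom X \<phi>" "!!t. t > 0 ==> \<phi> (gt_ray t) \<sqsubseteq> level 1 t" "!!t. t > 0 ==> \<phi> (lt_ray t) \<sqsubseteq> neg (level 1 t)"
  by (rule level_hom[of 1]) auto
 interpret h: half_line_hom X \<phi> by (rule \<phi>(1))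
 \<comment> \<open>Where some function exceeds \<open>t\<close>, the largest one cannot be below
   \<open>t\<close>, so there it exceeds \<open>t / 2\<close>.\<close>
 have pos: "v \<sqsubseteq> \<phi> {0<..}" if v: "v \<sqsubseteq> f j (gt_ray t)" "j : I" "t > 0" for v j t
 proof -
  have vc: "v : carrier X" using le_carrier[OF v(1)] by simp
  have "lt_ray t \<union> gt_ray (t / 2) = {0..}" using v(3) by auto
  then have "\<top> = \<Squnion> {\<phi> (lt_ray t), \<phi> (gt_ray (t / 2))}" using h.hom_Un[of "lt_ray t" "gt_ray (t / 2)"] h.hom_top by simp
  then have "v \<sqsubseteq> \<Squnion> {\<phi> (lt_ray t), \<phi> (gt_ray (t / 2))}" using top_higher[OF vc] by (rule subst)
  then show ?thesis
  proof (rule sup2_cases[OF _ h.closed h.closed h.closed])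
   fix v' assume v': "v' \<sqsubseteq> v" "v' \<sqsubseteq> \<phi> (lt_ray t)"
   have v'c: "v' : carrier X" using le_carrier[OF v'(1)] by simp
   have "v' \<sqsubseteq> level 1 t" by (rule le_level[of "{j}"]) (use v v' v'c trans[OF v'(1) v(1)] in auto)
   then have "v' \<sqsubseteq> \<bottom>" using trans[OF v'(2) \<phi>(3)[OF v(3)]] by (rule le_neg_disjoint[OF level_closed v'c])
   then show "v' \<sqsubseteq> \<phi> {0<..}" by (rule le_of_bot[OF _ v'c h.closed]) simp
  next
   fix v' assume v': "v' \<sqsubseteq> v" "v' \<sqsubseteq> \<phi> (gt_ray (t / 2))"
   show "v' \<sqsubseteq> \<phi> {0<..}" by (rule trans[OF v'(2) h.hom_mono]) (use v(3) in auto)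
  qed auto
 qed
 have top: "\<phi> {0<..} = \<top>"
 proof (rule antisymI)
  show "\<top> \<sqsubseteq> \<phi> {0<..}"
  proof (rule s_gt_cases[of \<top> 0])
   show "\<top> \<sqsubseteq> s (gt_ray 0)" by (simp add: gt_ray_zero positive)
   fix J A v assume J: "finite J" "J \<subseteq> I" "A : boxes J (gt_ray 0)" "v : carrier X" "!!j. j : J ==> v \<sqsubseteq> f j (A j)"
   \<comment> \<open>A box on which the sum is positive cannot contain the origin.\<close>
   have "\<exists>j\<in>J. 0 ~: A j"
   proof (rule ccontr)
    assume "\<not> (\<exists>j\<in>J. 0 ~: A j)"
    then have A0: "\<forall>j\<in>J. 0 : A j" by simp
    have "\<forall>t. (\<forall>i\<in>J. t i : A i) --> sum t J : gt_ray 0" using J(3) by (simp add: boxes_def)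
    from spec[OF this, of "%_. 0"] A0 show False by simp
   qed
   then obtain j where j: "j : J" "0 ~: A j" by auto
   have jI: "j : I" using j J by auto
   interpret f: half_line_hom X "f j" by (rule f[OF jI])
   have Aj: "A j : carrier half_line" using J(3) j by (simp add: boxes_def)
   have sub: "A j \<subseteq> \<Union> (range (\<lambda>n::nat. gt_ray (1 / (real n + 1))))"
   proof
    fix t assume t: "t : A j"
    then have "t > 0" using half_line_sub[OF Aj] j(2) by (metis atLeast_iff less_eq_real_def subsetD)
    then obtain n where "inverse (real (Suc n)) < t" using reals_Archimedean by blast
    then have "t : gt_ray (1 / (real n + 1))" using \<open>t > 0\<close> by (simp add: inverse_eq_divide add.commute)
    then show "t : \<Union> (range (\<lambda>n::nat. gt_ray (1 / (real n + 1))))" by blast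
   qed
   have im: "range (\<lambda>n::nat. gt_ray (1 / (real n + 1))) \<subseteq> carrier half_line" by auto
   have "v \<sqsubseteq> f j (\<Union> (range (\<lambda>n::nat. gt_ray (1 / (real n + 1)))))"
    by (rule trans[OF J(5)[OF j(1)] f.hom_mono[OF Aj half_line_Union[OF im] sub]])
   then have "v \<sqsubseteq> \<Squnion> (f j ` range (\<lambda>n::nat. gt_ray (1 / (real n + 1))))" unfolding f.hom_Union[OF im] .
   then show "v \<sqsubseteq> \<phi> {0<..}"
   proof (rule le_sup_cases[OF _ J(4)])
    fix b v' assume "b : f j ` range (\<lambda>n::nat. gt_ray (1 / (real n + 1)))" "v' \<sqsubseteq> b"
    then show "v' \<sqsubseteq> \<phi> {0<..}" using pos[OF _ jI] by fastforce
   qed auto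
  qed simp
 qed auto
 \<comment> \<open>The shells of the reciprocal \<open>1 / t\<close>; on the shell of index
   \<open>n\<close> the function \<open>\<phi>\<close> exceeds \<open>1 / (n + 1)\<close>.\<close>
 define A where "A = (\<lambda>n::nat. {t::real. 0 < t & real n - 1 < 1 / t & 1 / t < real n + 1})"
 have A: "A n : carrier half_line" for n
 proof -
  have "continuous_on {0<..} (\<lambda>t::real. 1 / t)" by (intro continuous_intros) auto
  then have "open ({0<..} \<inter> (\<lambda>t::real. 1 / t) -` {real n - 1 <..< real n + 1})"
   by (rule continuous_open_preimage) simp_all
  moreover have "{0<..} \<inter> (\<lambda>t::real. 1 / t) -` {real n - 1 <..< real n + 1} = A n"
   unfolding A_def by (intro equalityI subsetI) simp_all
  moreover have "A n = {0..} \<inter> A n" unfolding A_def by (intro equalityI subsetI) simp_all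
  ultimately show ?thesis using half_line_openI[of "A n"] by simp
 qed
 have "P (\<top> \<sqinter> \<phi> (\<Union> n. A n))"
 proof (rule h.closed_shells[OF P top_closed A])
  fix m n :: nat assume "m + 2 \<le> n"
  then have mn: "real m + 2 \<le> real n" by linarith
  show "A m \<inter> A n = {}"
  proof (rule equals0I)
   fix t assume "t : A m \<inter> A n"
   then have "1 / t < real m + 1" "real n - 1 < 1 / t" unfolding A_def by simp_all
   then show False using mn by linarith
  qed
 next
  fix n :: nat
  let ?t = "1 / (real n + 1)"
  have "A n \<subseteq> gt_ray ?t"
  proof
   fix t assume "t : A n"
   then have "0 < t" "1 / t < real n + 1" unfolding A_def by simp_all
   then show "t : gt_ray ?t" by (simp add: field_simps)
  qed
  then have "\<phi> (A n) \<sqsubseteq> \<phi> (gt_ray ?t)" by (rule h.hom_mono[OF A ray_open(1)])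
  moreover have "\<phi> (gt_ray ?t) \<sqsubseteq> level 1 ?t" by (rule \<phi>(2)) simp
  ultimately have "\<phi> (A n) \<sqsubseteq> level 1 ?t" by (rule trans)
  then have "\<top> \<sqinter> \<phi> (A n) \<sqsubseteq> level 1 ?t" by (rule trans[OF meet_lower(3)[OF top_closed h.closed[OF A]]])
  moreover have "P (level 1 ?t)" by (rule level1) simp
  ultimately show "P (\<top> \<sqinter> \<phi> (A n))" by (rule down[rotated])
 qed
 moreover have "(\<Union> n. A n) = {0<..}"
 proof (intro equalityI subsetI)
  fix t :: real assume t: "t : {0<..}"
  then have "real (nat \<lfloor>1 / t\<rfloor>) = of_int \<lfloor>1 / t\<rfloor>" by simp
  moreover have "0 < t" "of_int \<lfloor>1 / t\<rfloor> \<le> 1 / t" "1 / t < of_int \<lfloor>1 / t\<rfloor> + 1" using t by simp_all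
  ultimately have "t : A (nat \<lfloor>1 / t\<rfloor>)" unfolding A_def mem_Collect_eq by linarith
  then show "t : (\<Union> n. A n)" by (rule UN_I[OF UNIV_I])
 next
  fix t assume "t : (\<Union> n. A n)"
  then show "t : {0<..}" by (auto simp: A_def)
 qed
 ultimately have "P (\<top> \<sqinter> \<phi> {0<..})" by simp
 then show ?thesis by (simp add: top meet_absorb(1))
qed

end

subsection \<open>The category of locales\<close>

lemma Loc_ob: "X : ob Loc \<longleftrightarrow> frame_lattice X"
 by (simp add: frame_lattice_iff)

lemma Loc_simps [simp]:
 "src Loc = arr_src" "tgt Loc = arr_tgt"
 "idn Loc X = Arrow X X (\<lambda>x\<in>carrier X. x)"
 "cmp Loc g f = Arrow (arr_src f) (arr_tgt g) (compose (carrier (arr_tgt g)) (arr_map f) (arr_map g))"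
 by (simp_all add: Loc_def Let_def)

lemma Loc_ar: "f : ar Loc \<longleftrightarrow> frame_lattice (arr_src f) & frame_lattice (arr_tgt f) &
  frame_hom (arr_tgt f) (arr_src f) (arr_map f)"
 unfolding frame_lattice_iff by (simp add: Loc_def Let_def)

lemma frame_homD:
 assumes "frame_hom X Y h"
 shows "h : carrier X \<rightarrow>\<^sub>E carrier Y" "x : carrier X ==> h x : carrier Y" "h \<top>\<^bsub>X\<^esub> = \<top>\<^bsub>Y\<^esub>"
  "[|a : carrier X; b : carrier X|] ==> h (a \<sqinter>\<^bsub>X\<^esub> b) = h a \<sqinter>\<^bsub>Y\<^esub> h b"
  "B \<subseteq> carrier X ==> h (\<Squnion>\<^bsub>X\<^esub> B) = \<Squnion>\<^bsub>Y\<^esub> (h ` B)"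
 using assms unfolding frame_hom_def by (simp_all add: PiE_iff)

lemma frame_homI:
 assumes "h : carrier X \<rightarrow>\<^sub>E carrier Y" "h \<top>\<^bsub>X\<^esub> = \<top>\<^bsub>Y\<^esub>"
  "!!a b. a : carrier X ==> b : carrier X ==> h (a \<sqinter>\<^bsub>X\<^esub> b) = h a \<sqinter>\<^bsub>Y\<^esub> h b"
  "!!B. B \<subseteq> carrier X ==> h (\<Squnion>\<^bsub>X\<^esub> B) = \<Squnion>\<^bsub>Y\<^esub> (h ` B)"
 shows "frame_hom X Y h"
 using assms unfolding frame_hom_def by simp

lemma frame_hom_compose:
 assumes h: "frame_hom X Y h" and k: "frame_hom Y Z k" and X: "\<top>\<^bsub>X\<^esub> : carrier X"
  "!!a b. a : carrier X ==> b : carrier X ==> a \<sqinter>\<^bsub>X\<^esub> b : carrier X"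
  "!!B. B \<subseteq> carrier X ==> \<Squnion>\<^bsub>X\<^esub> B : carrier X"
 shows "frame_hom X Z (compose (carrier X) k h)"
proof (rule frame_homI)
 note h' = frame_homD[OF h] and k' = frame_homD[OF k]
 show "compose (carrier X) k h : carrier X \<rightarrow>\<^sub>E carrier Z" using h'(2) k'(2) by (auto simp: compose_def)
 show "compose (carrier X) k h \<top>\<^bsub>X\<^esub> = \<top>\<^bsub>Z\<^esub>" using h' k' X by (simp add: compose_def)
 fix a b assume "a : carrier X" "b : carrier X"
 then show "compose (carrier X) k h (a \<sqinter>\<^bsub>X\<^esub> b) = compose (carrier X) k h a \<sqinter>\<^bsub>Z\<^esub> compose (carrier X) k h b"
  using h' k' X by (simp add: compose_def)
next
 note h' = frame_homD[OF h] and k' = frame_homD[OF k]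
 fix B assume B: "B \<subseteq> carrier X"
 have hB: "h ` B \<subseteq> carrier Y" using h'(2) B by auto
 have "compose (carrier X) k h ` B = k ` h ` B" using B by (auto simp: compose_def image_iff subset_iff)
 then show "compose (carrier X) k h (\<Squnion>\<^bsub>X\<^esub> B) = \<Squnion>\<^bsub>Z\<^esub> (compose (carrier X) k h ` B)"
  using X(3)[OF B] h'(5)[OF B] k'(5)[OF hB] by (simp add: compose_def)
qed

lemma (in frame_lattice) frame_hom_compose_from:
 "frame_hom X Y h ==> frame_hom Y Z k ==> frame_hom X Z (compose (carrier X) k h)"
 by (rule frame_hom_compose) (auto intro: meet_lower(1))

lemma half_line_compose:
 "frame_hom half_line Y h ==> frame_hom Y Z k ==> frame_hom half_line Z (compose (carrier half_line) k h)"
 by (rule frame_hom_compose) (auto simp: half_line_top half_line_meet half_line_Int)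

locale two_frames = X: frame_lattice X + Y: frame_lattice Y for X :: "'a gorder" and Y :: "'b gorder" +
 fixes h :: "'a => 'b"
 assumes hom: "frame_hom X Y h"
begin

lemmas closed = frame_homD(2)[OF hom] and hom_top = frame_homD(3)[OF hom]
 and hom_meet = frame_homD(4)[OF hom] and hom_sup = frame_homD(5)[OF hom]

lemma mono: "a \<sqsubseteq>\<^bsub>X\<^esub> b ==> h a \<sqsubseteq>\<^bsub>Y\<^esub> h b"
proof -
 assume ab: "a \<sqsubseteq>\<^bsub>X\<^esub> b"
 then have c: "a : carrier X" "b : carrier X" using X.le_carrier by auto
 have "h a = h a \<sqinter>\<^bsub>Y\<^esub> h b" using hom_meet[OF c] X.meet_absorb(1)[OF c ab] by simp
 then show ?thesis using Y.meet_lower(3)[OF closed[OF c(1)] closed[OF c(2)]] by simp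
qed

lemma hom_bot: "h \<bottom>\<^bsub>X\<^esub> = \<bottom>\<^bsub>Y\<^esub>"
proof -
 have "\<Squnion>\<^bsub>X\<^esub> {} = \<bottom>\<^bsub>X\<^esub>" by (rule X.sup_eqI) auto
 moreover have "\<Squnion>\<^bsub>Y\<^esub> {} = \<bottom>\<^bsub>Y\<^esub>" by (rule Y.sup_eqI) auto
 ultimately show ?thesis using hom_sup[of "{}"] by simp
qed

lemma restrict_hom:
 assumes v: "v : carrier X" "h v = \<top>\<^bsub>Y\<^esub>"
 shows "frame_hom (open_sublocale X v) Y (\<lambda>x\<in>carrier (open_sublocale X v). h x)"
proof (rule frame_homI)
 let ?h = "\<lambda>x\<in>carrier (open_sublocale X v). h x"
 show "?h : carrier (open_sublocale X v) \<rightarrow>\<^sub>E carrier Y" using closed by auto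
 show "?h \<top>\<^bsub>open_sublocale X v\<^esub> = \<top>\<^bsub>Y\<^esub>" using v by (simp add: X.open_sublocale_top)
 fix a b assume ab: "a : carrier (open_sublocale X v)" "b : carrier (open_sublocale X v)"
 then have "a \<sqinter>\<^bsub>X\<^esub> b : carrier X" "a \<sqinter>\<^bsub>X\<^esub> b \<sqsubseteq>\<^bsub>X\<^esub> v" using X.meet_lower[of a b] X.trans[of "a \<sqinter>\<^bsub>X\<^esub> b" a v] by auto
 then show "?h (a \<sqinter>\<^bsub>open_sublocale X v\<^esub> b) = ?h a \<sqinter>\<^bsub>Y\<^esub> ?h b"
  using ab v hom_meet[of a b] by (simp add: X.open_sublocale_meet)
next
 let ?h = "\<lambda>x\<in>carrier (open_sublocale X v). h x"
 fix B assume B: "B \<subseteq> carrier (open_sublocale X v)"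
 then have B': "B \<subseteq> carrier X" "!!b. b : B ==> b \<sqsubseteq>\<^bsub>X\<^esub> v" by auto
 have "\<Squnion>\<^bsub>X\<^esub> B \<sqsubseteq>\<^bsub>X\<^esub> v" by (rule X.sup_least) (use B' v in auto)
 moreover have "\<Squnion>\<^bsub>X\<^esub> B : carrier X" using B'(1) by simp
 moreover have "?h ` B = h ` B" using B by (intro image_cong refl) auto
 ultimately show "?h (\<Squnion>\<^bsub>open_sublocale X v\<^esub> B) = \<Squnion>\<^bsub>Y\<^esub> (?h ` B)"
  using hom_sup[OF B'(1)] X.open_sublocale_sup[OF v(1) B'] by simp
qed

lemma inverse_hom:
 assumes bij: "bij_betw h (carrier X) (carrier Y)"
 shows "frame_hom Y X (\<lambda>y\<in>carrier Y. inv_into (carrier X) h y)" (is "frame_hom Y X ?g")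
proof -
 have inj: "inj_on h (carrier X)" using bij by (rule bij_betw_imp_inj_on)
 have g: "?g y : carrier X" "h (?g y) = y" if "y : carrier Y" for y
  using that bij by (auto simp: bij_betw_def inv_into_into f_inv_into_f)
 have eqI: "x = ?g y" if "y : carrier Y" "x : carrier X" "h x = y" for x y
  using inj_onD[OF inj, of x "?g y"] that g by simp
 show ?thesis
 proof (rule frame_homI)
  show "?g : carrier Y \<rightarrow>\<^sub>E carrier X" using g by auto
  show "?g \<top>\<^bsub>Y\<^esub> = \<top>\<^bsub>X\<^esub>" by (rule eqI[symmetric]) (auto simp: hom_top)
  fix a b assume ab: "a : carrier Y" "b : carrier Y"
  show "?g (a \<sqinter>\<^bsub>Y\<^esub> b) = ?g a \<sqinter>\<^bsub>X\<^esub> ?g b"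
   by (rule eqI[symmetric]) (use ab g X.meet_lower(1) Y.meet_lower(1) hom_meet in simp_all)
 next
  fix B assume B: "B \<subseteq> carrier Y"
  have gB: "?g ` B \<subseteq> carrier X" using B g by auto
  have "h ` ?g ` B = B" using B g(2) by (auto simp: image_iff subset_iff)
  then have "h (\<Squnion>\<^bsub>X\<^esub> (?g ` B)) = \<Squnion>\<^bsub>Y\<^esub> B" using hom_sup[OF gB] by simp
  then show "?g (\<Squnion>\<^bsub>Y\<^esub> B) = \<Squnion>\<^bsub>X\<^esub> (?g ` B)"
   by (intro eqI[symmetric]) (use B gB in auto)
 qed
qed

end

lemma Loc_arD:
 assumes "f : ar Loc"
 shows "two_frames (arr_tgt f) (arr_src f) (arr_map f)"
 using assms by (simp add: Loc_ar two_frames_def two_frames_axioms_def)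

lemma Loc_cmp_map: "x : carrier (arr_tgt g) ==> arr_map (cmp Loc g f) x = arr_map f (arr_map g x)"
 by (simp add: compose_def)

lemma Loc_ext:
 assumes "f : ar Loc" "g : ar Loc" "arr_src f = arr_src g" "arr_tgt f = arr_tgt g"
  "!!x. x : carrier (arr_tgt f) ==> arr_map f x = arr_map g x"
 shows "f = g"
proof -
 have "arr_map f = arr_map g"
  by (rule PiE_ext[of _ "carrier (arr_tgt f)" "%_. carrier (arr_src f)"])
   (use assms in \<open>auto simp: Loc_ar dest: frame_homD(1)\<close>)
 then show ?thesis using assms by (cases f; cases g) simp
qed

lemma Loc_category: "category Loc"
proof
 fix f :: "('a gorder, 'a => 'a) arrow" assume f: "f : ar Loc"
 show "src Loc f : ob Loc" "tgt Loc f : ob Loc" using f by (simp_all add: Loc_ar Loc_ob)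
 have e: "arr_map f : carrier (arr_tgt f) \<rightarrow>\<^sub>E carrier (arr_src f)" using f by (auto simp: Loc_ar dest: frame_homD(1))
 show "cmp Loc f (idn Loc (src Loc f)) = f" "cmp Loc (idn Loc (tgt Loc f)) f = f"
  using e by (cases f; auto simp: compose_def fun_eq_iff PiE_iff extensional_def)+
next
 fix x :: "'a gorder" assume x: "x : ob Loc"
 interpret frame_lattice x using x by (simp add: Loc_ob)
 have "frame_hom x x (\<lambda>a\<in>carrier x. a)"
 proof (rule frame_homI)
  fix B assume "B \<subseteq> carrier x"
  moreover from this have "(\<lambda>a\<in>carrier x. a) ` B = B" by (auto simp: subset_iff image_iff)
  ultimately show "(\<lambda>a\<in>carrier x. a) (\<Squnion>\<^bsub>x\<^esub> B) = \<Squnion>\<^bsub>x\<^esub> ((\<lambda>a\<in>carrier x. a) ` B)" by simp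
 qed (auto simp: meet_lower(1))
 then show "idn Loc x : ar Loc & src Loc (idn Loc x) = x & tgt Loc (idn Loc x) = x"
  using x by (simp add: Loc_ar Loc_ob)
next
 fix f g :: "('a gorder, 'a => 'a) arrow" assume fg: "f : ar Loc" "g : ar Loc" "src Loc g = tgt Loc f"
 interpret T: frame_lattice "arr_tgt g" using fg by (simp add: Loc_ar)
 show "cmp Loc g f : ar Loc & src Loc (cmp Loc g f) = src Loc f & tgt Loc (cmp Loc g f) = tgt Loc g"
  using fg T.frame_hom_compose_from[of "arr_src g" "arr_map g" "arr_src f" "arr_map f"] by (simp add: Loc_ar)
next
 fix f g h :: "('a gorder, 'a => 'a) arrow" assume fgh: "f : ar Loc" "g : ar Loc" "h : ar Loc" "src Loc g = tgt Loc f" "src Loc h = tgt Loc g"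
 have "arr_map h : carrier (arr_tgt h) \<rightarrow> carrier (arr_tgt g)" using fgh frame_homD(1)[of "arr_tgt h" "arr_src h" "arr_map h"] by (auto simp: Loc_ar)
 then show "cmp Loc h (cmp Loc g f) = cmp Loc (cmp Loc h g) f"
  by (auto simp: compose_def fun_eq_iff)
qed

subsection \<open>Open embeddings\<close>

lemma (in frame_lattice) open_inclusion_map:
 assumes u: "u : carrier X"
 shows "frame_hom X (open_sublocale X u) (\<lambda>x\<in>carrier X. u \<sqinter> x)" "open_inclusion X u : ar Loc"
proof -
 have c: "u \<sqinter> x : carrier X & u \<sqinter> x \<sqsubseteq> u" if "x : carrier X" for x using meet_lower[OF u that] by simp
 show "frame_hom X (open_sublocale X u) (\<lambda>x\<in>carrier X. u \<sqinter> x)"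
 proof (rule frame_homI)
  show "(\<lambda>x\<in>carrier X. u \<sqinter> x) : carrier X \<rightarrow>\<^sub>E carrier (open_sublocale X u)" using c by simp
  show "(\<lambda>x\<in>carrier X. u \<sqinter> x) \<top> = \<top>\<^bsub>open_sublocale X u\<^esub>" using u by (simp add: open_sublocale_top meet_absorb(1))
 next
  fix a b assume ab: "a : carrier X" "b : carrier X"
  have "u \<sqinter> (a \<sqinter> b) = (u \<sqinter> a) \<sqinter> (u \<sqinter> b)"
  proof (rule meet_eqI[symmetric])
   note m = meet_lower[OF ab] and n = meet_lower[OF u meet_lower(1)[OF ab]]
   show "u \<sqinter> (a \<sqinter> b) : carrier X" "u \<sqinter> a : carrier X" "u \<sqinter> b : carrier X" using n c ab by auto
   show "u \<sqinter> (a \<sqinter> b) \<sqsubseteq> u \<sqinter> a" "u \<sqinter> (a \<sqinter> b) \<sqsubseteq> u \<sqinter> b"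
    using n m u ab trans[OF n(3) m(2)] trans[OF n(3) m(3)] by (simp_all add: le_meet_iff)
   fix z assume z: "z : carrier X" "z \<sqsubseteq> u \<sqinter> a" "z \<sqsubseteq> u \<sqinter> b"
   then show "z \<sqsubseteq> u \<sqinter> (a \<sqinter> b)" using u ab m by (simp add: le_meet_iff)
  qed
  then show "(\<lambda>x\<in>carrier X. u \<sqinter> x) (a \<sqinter> b) = (\<lambda>x\<in>carrier X. u \<sqinter> x) a \<sqinter>\<^bsub>open_sublocale X u\<^esub> (\<lambda>x\<in>carrier X. u \<sqinter> x) b"
   using u ab c[OF ab(1)] c[OF ab(2)] by (simp add: open_sublocale_meet meet_lower(1))
 next
  fix B assume B: "B \<subseteq> carrier X"
  have "(\<lambda>x\<in>carrier X. u \<sqinter> x) ` B = (%x. u \<sqinter> x) ` B" using B by (intro image_cong HOL.refl) auto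
  moreover have "\<Squnion>\<^bsub>open_sublocale X u\<^esub> ((%x. u \<sqinter> x) ` B) = \<Squnion> ((%x. u \<sqinter> x) ` B)"
   by (rule open_sublocale_sup[OF u]) (use B c in auto)
  ultimately show "(\<lambda>x\<in>carrier X. u \<sqinter> x) (\<Squnion> B) = \<Squnion>\<^bsub>open_sublocale X u\<^esub> ((\<lambda>x\<in>carrier X. u \<sqinter> x) ` B)"
   using meet_sup[OF u B] B by simp
 qed
 then show "open_inclusion X u : ar Loc"
  using open_sublocale_frame[OF u] by (simp add: Loc_ar open_inclusion_def frame_lattice_axioms)
qed

lemma open_inclusion_simps [simp]:
 "arr_src (open_inclusion X u) = open_sublocale X u" "arr_tgt (open_inclusion X u) = X"
 "x : carrier X ==> arr_map (open_inclusion X u) x = u \<sqinter>\<^bsub>X\<^esub> x"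
 by (simp_all add: open_inclusion_def)

text \<open>Describes open embeddings on frames alone: \<open>v\<close> goes to the top, and the
  opens below \<open>v\<close> correspond to those of the source. The converse is
  \<open>open_embedding_ontoI\<close>.\<close>

lemma open_embedding_ontoD:
 assumes "open_embedding_onto h v"
 shows "h : ar Loc" "v : carrier (arr_tgt h)" "arr_map h v = \<top>\<^bsub>arr_src h\<^esub>"
  "bij_betw (arr_map h) {x : carrier (arr_tgt h). x \<sqsubseteq>\<^bsub>arr_tgt h\<^esub> v} (carrier (arr_src h))"
proof -
 obtain k where h: "h : ar Loc" and v: "v : carrier (arr_tgt h)" and k: "isomorphism_in Loc k"
  and kt: "arr_tgt k = open_sublocale (arr_tgt h) v" and hk: "h = cmp Loc (open_inclusion (arr_tgt h) v) k"
  using assms unfolding open_embedding_onto_def by auto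
 interpret frame_lattice "arr_tgt h" using h by (simp add: Loc_ar)
 obtain g where kg: "k : ar Loc" "g : ar Loc" "arr_src g = arr_tgt k" "arr_tgt g = arr_src k"
  "cmp Loc g k = idn Loc (arr_src k)" "cmp Loc k g = idn Loc (arr_tgt k)"
  using k unfolding isomorphism_in_def by auto
 interpret K: two_frames "arr_tgt k" "arr_src k" "arr_map k" by (rule Loc_arD[OF kg(1)])
 interpret G: two_frames "arr_tgt g" "arr_src g" "arr_map g" by (rule Loc_arD[OF kg(2)])
 have 1: "arr_map k (arr_map g y) = y" if "y : carrier (arr_src k)" for y
  using that kg(4,5) Loc_cmp_map[of y g k] by simp
 have 2: "arr_map g (arr_map k y) = y" if "y : carrier (arr_tgt k)" for y
  using that kg(6) Loc_cmp_map[of y k g] by simp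
 have src: "arr_src h = arr_src k" by (subst hk) simp
 have m: "arr_map h x = arr_map k (v \<sqinter>\<^bsub>arr_tgt h\<^esub> x)" if "x : carrier (arr_tgt h)" for x
  using that by (subst hk) (simp add: compose_def)
 have m': "arr_map h x = arr_map k x" if "x : carrier (arr_tgt h)" "x \<sqsubseteq>\<^bsub>arr_tgt h\<^esub> v" for x
  using m that v meet_absorb(2)[of x v] by simp
 show "h : ar Loc" "v : carrier (arr_tgt h)" by fact+
 show "arr_map h v = \<top>\<^bsub>arr_src h\<^esub>"
  using m'[OF v] K.hom_top v unfolding kt src by (simp add: open_sublocale_top)
 show "bij_betw (arr_map h) {x : carrier (arr_tgt h). x \<sqsubseteq>\<^bsub>arr_tgt h\<^esub> v} (carrier (arr_src h))"
 proof (rule bij_betw_byWitness[where f' = "arr_map g"])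
  show "\<forall>a\<in>{x : carrier (arr_tgt h). x \<sqsubseteq>\<^bsub>arr_tgt h\<^esub> v}. arr_map g (arr_map h a) = a"
   using 2 m' by (simp add: kt)
  show "arr_map g ` carrier (arr_src h) \<subseteq> {x : carrier (arr_tgt h). x \<sqsubseteq>\<^bsub>arr_tgt h\<^esub> v}"
   using G.closed kg(3,4) by (auto simp: src kt)
  then show "\<forall>a'\<in>carrier (arr_src h). arr_map h (arr_map g a') = a'" using 1 m' by (auto simp: src)
  show "arr_map h ` {x : carrier (arr_tgt h). x \<sqsubseteq>\<^bsub>arr_tgt h\<^esub> v} \<subseteq> carrier (arr_src h)"
   using K.closed m' by (auto simp: src kt)
 qed
qed

lemma open_embedding_ontoI:
 assumes h: "h : ar Loc" and v: "v : carrier (arr_tgt h)" and top: "arr_map h v = \<top>\<^bsub>arr_src h\<^esub>"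
  and bij: "bij_betw (arr_map h) {x : carrier (arr_tgt h). x \<sqsubseteq>\<^bsub>arr_tgt h\<^esub> v} (carrier (arr_src h))"
 shows "open_embedding_onto h v"
proof -
 let ?X = "arr_tgt h" and ?Y = "arr_src h"
 let ?V = "open_sublocale ?X v"
 interpret H: two_frames ?X ?Y "arr_map h" by (rule Loc_arD[OF h])
 let ?m = "\<lambda>x\<in>carrier ?V. arr_map h x"
 have V: "frame_lattice ?V" by (rule H.X.open_sublocale_frame[OF v])
 interpret M: two_frames ?V ?Y ?m
  using V H.restrict_hom[OF v top] H.Y.frame_lattice_axioms by (simp add: two_frames_def two_frames_axioms_def)
 have b: "bij_betw ?m (carrier ?V) (carrier ?Y)"
  using bij by (subst bij_betw_cong[where g = "arr_map h"]) auto
 let ?g = "\<lambda>y\<in>carrier ?Y. inv_into (carrier ?V) ?m y"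
 define k where "k = Arrow ?Y ?V ?m"
 define g where "g = Arrow ?V ?Y ?g"
 have gi: "?g y : carrier ?V" "?m (?g y) = y" if "y : carrier ?Y" for y
 proof -
  show "?g y : carrier ?V" using that b by (simp only: restrict_apply' bij_betw_def) (metis inv_into_into)
  show "?m (?g y) = y" using that b by (simp only: restrict_apply'[of y] bij_betw_def) (metis f_inv_into_f)
 qed
 have gm: "?g (?m x) = x" if "x : carrier ?V" for x
  using that b M.closed[OF that] by (simp only: restrict_apply'[of "?m x"] bij_betw_def inv_into_f_f)
 have kg: "k : ar Loc" "g : ar Loc"
  using V H.Y.frame_lattice_axioms M.hom M.inverse_hom[OF b] by (simp_all add: k_def g_def Loc_ar)
 have "isomorphism_in Loc k"
  unfolding isomorphism_in_def
 proof (intro conjI bexI[of _ g] kg)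
  show "cmp Loc g k = idn Loc (src Loc k)"
   unfolding k_def g_def Loc_simps arrow.sel arrow.inject compose_def
   by (intro conjI HOL.refl restrict_ext gi(2))
  show "cmp Loc k g = idn Loc (tgt Loc k)"
   unfolding k_def g_def Loc_simps arrow.sel arrow.inject compose_def
   by (intro conjI HOL.refl restrict_ext gm)
 qed (simp_all add: k_def g_def)
 moreover have "h = cmp Loc (open_inclusion ?X v) k"
 proof (rule Loc_ext[OF h])
  have i: "open_inclusion ?X v : ar Loc" by (rule H.X.open_inclusion_map(2)[OF v])
  show "cmp Loc (open_inclusion ?X v) k : ar Loc"
   using category.cmp_ar[OF Loc_category kg(1) i] by (simp add: k_def)
  fix x assume x: "x : carrier ?X"
  note mt = H.X.meet_lower[OF v x]
  have "arr_map h (v \<sqinter>\<^bsub>?X\<^esub> x) = arr_map h x"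
   using H.hom_meet[OF v x] top H.closed[OF x] H.Y.meet_absorb(2)[of "arr_map h x" "\<top>\<^bsub>?Y\<^esub>"] by simp
  then show "arr_map h x = arr_map (cmp Loc (open_inclusion ?X v) k) x"
   using x mt by (simp add: compose_def k_def)
 qed (simp_all add: k_def)
 ultimately show ?thesis
  unfolding open_embedding_onto_def using h v by (auto simp: k_def)
qed

lemma open_inclusion_onto:
 assumes "frame_lattice X" "u : carrier X"
 shows "open_embedding_onto (open_inclusion X u) u"
proof -
 interpret frame_lattice X by fact
 show ?thesis
 proof (rule open_embedding_ontoI)
  have "bij_betw (%x. x) {x : carrier X. x \<sqsubseteq>\<^bsub>X\<^esub> u} {x : carrier X. x \<sqsubseteq>\<^bsub>X\<^esub> u}" by (auto simp: bij_betw_def inj_on_def)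
  moreover have "arr_map (open_inclusion X u) x = x" if "x : {x : carrier X. x \<sqsubseteq>\<^bsub>X\<^esub> u}" for x
   using that assms(2) meet_absorb(2)[of x u] by simp
  ultimately show "bij_betw (arr_map (open_inclusion X u)) {x : carrier (arr_tgt (open_inclusion X u)). x \<sqsubseteq>\<^bsub>arr_tgt (open_inclusion X u)\<^esub> u}
    (carrier (arr_src (open_inclusion X u)))"
   by (subst bij_betw_cong[where g = "%x. x"]) auto
 qed (use assms in \<open>auto simp: open_inclusion_map(2) open_sublocale_top meet_absorb(1)\<close>)
qed

text \<open>The image is the least open that pulls back to the top; its uniqueness follows.\<close>

lemma open_embedding_top_iff:
 assumes "open_embedding_onto h v" "x : carrier (arr_tgt h)"
 shows "arr_map h x = \<top>\<^bsub>arr_src h\<^esub> \<longleftrightarrow> v \<sqsubseteq>\<^bsub>arr_tgt h\<^esub> x"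
proof -
 note h = open_embedding_ontoD[OF assms(1)]
 interpret H: two_frames "arr_tgt h" "arr_src h" "arr_map h" by (rule Loc_arD[OF h(1)])
 note m = H.X.meet_lower[OF h(2) assms(2)]
 have e: "arr_map h (v \<sqinter>\<^bsub>arr_tgt h\<^esub> x) = arr_map h x"
  using H.hom_meet[OF h(2) assms(2)] h(3) H.closed[OF assms(2)] H.Y.meet_absorb(2)[of "arr_map h x" "\<top>\<^bsub>arr_src h\<^esub>"] by simp
 show ?thesis
 proof
  assume "arr_map h x = \<top>\<^bsub>arr_src h\<^esub>"
  then have "arr_map h (v \<sqinter>\<^bsub>arr_tgt h\<^esub> x) = arr_map h v" using e h(3) by simp
  then have "v \<sqinter>\<^bsub>arr_tgt h\<^esub> x = v"
   using inj_onD[OF bij_betw_imp_inj_on[OF h(4)]] m h(2) by simp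
  then show "v \<sqsubseteq>\<^bsub>arr_tgt h\<^esub> x" using m by simp
 next
  assume "v \<sqsubseteq>\<^bsub>arr_tgt h\<^esub> x"
  then show "arr_map h x = \<top>\<^bsub>arr_src h\<^esub>" using e h(2,3) assms(2) H.X.meet_absorb(1) by simp
 qed
qed

lemma image_open:
 assumes "open_embedding_onto h v"
 shows "image_open h = v"
 unfolding image_open_def
proof (rule the_equality[where a = v])
 fix u assume u: "open_embedding_onto h u"
 interpret H: two_frames "arr_tgt h" "arr_src h" "arr_map h" by (rule Loc_arD[OF open_embedding_ontoD(1)[OF u]])
 note hv = open_embedding_ontoD[OF assms] and hu = open_embedding_ontoD[OF u]
 show "u = v"
  by (rule H.X.antisymI)
   (use open_embedding_top_iff[OF assms hu(2)] open_embedding_top_iff[OF u hv(2)] hv hu in simp_all)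
qed (rule assms)

text \<open>Each open of the source of \<open>h\<close> comes from a unique open below
  \<open>v\<close>. Sending the latter on by \<open>e\<close> defines the factorization, and
  \<open>e\<close> mapping \<open>v\<close> to the top makes it preserve the top.\<close>

lemma open_embedding_factor:
 assumes h: "open_embedding_onto h v" and e: "e : ar Loc" "arr_tgt e = arr_tgt h" "arr_map e v = \<top>\<^bsub>arr_src e\<^esub>"
 shows "\<exists>g\<in>ar Loc. arr_src g = arr_src e & arr_tgt g = arr_src h & cmp Loc h g = e"
proof -
 note h' = open_embedding_ontoD[OF h]
 let ?X = "arr_tgt h" and ?Y = "arr_src h"
 let ?V = "open_sublocale ?X v"
 interpret H: two_frames ?X ?Y "arr_map h" by (rule Loc_arD[OF h'(1)])
 interpret E: two_frames ?X "arr_src e" "arr_map e" using Loc_arD[OF e(1)] by (simp add: e(2))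
 let ?m = "\<lambda>x\<in>carrier ?V. arr_map h x"
 interpret M: two_frames ?V ?Y ?m
  using H.X.open_sublocale_frame[OF h'(2)] H.restrict_hom[OF h'(2,3)] H.Y.frame_lattice_axioms by (simp add: two_frames_def two_frames_axioms_def)
 have b: "bij_betw ?m (carrier ?V) (carrier ?Y)"
  using h'(4) by (subst bij_betw_cong[where g = "arr_map h"]) auto
 let ?g = "\<lambda>y\<in>carrier ?Y. inv_into (carrier ?V) ?m y"
 let ?e = "\<lambda>x\<in>carrier ?V. arr_map e x"
 define g where "g = Arrow (arr_src e) ?Y (compose (carrier ?Y) ?e ?g)"
 have "frame_hom ?V (arr_src e) ?e" by (rule E.restrict_hom[OF h'(2) e(3)])
 then have g: "g : ar Loc"
  using H.Y.frame_hom_compose_from[OF M.inverse_hom[OF b]] H.Y.frame_lattice_axioms E.Y.frame_lattice_axioms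
  by (simp add: g_def Loc_ar)
 moreover have "cmp Loc h g = e"
 proof (rule Loc_ext[OF _ e(1)])
  show "cmp Loc h g : ar Loc" using category.cmp_ar[OF Loc_category g h'(1)] by (simp add: g_def)
  fix x assume "x : carrier (arr_tgt (cmp Loc h g))"
  then have x: "x : carrier ?X" by simp
  note mt = H.X.meet_lower[OF h'(2) x]
  have e1: "arr_map h (v \<sqinter>\<^bsub>?X\<^esub> x) = arr_map h x"
   using H.hom_meet[OF h'(2) x] h'(3) H.closed[OF x] H.Y.meet_absorb(2)[of "arr_map h x" "\<top>\<^bsub>?Y\<^esub>"] by simp
  have e2: "arr_map e (v \<sqinter>\<^bsub>?X\<^esub> x) = arr_map e x"
   using E.hom_meet[OF h'(2) x] e(3) E.closed[OF x] E.Y.meet_absorb(2)[of "arr_map e x" "\<top>\<^bsub>arr_src e\<^esub>"] by simp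
  have vx: "v \<sqinter>\<^bsub>?X\<^esub> x : carrier ?V" using mt by simp
  have "inv_into (carrier ?V) ?m (?m (v \<sqinter>\<^bsub>?X\<^esub> x)) = v \<sqinter>\<^bsub>?X\<^esub> x"
   by (rule inv_into_f_f[OF bij_betw_imp_inj_on[OF b] vx])
  then have "inv_into (carrier ?V) ?m (arr_map h x) = v \<sqinter>\<^bsub>?X\<^esub> x"
   using vx e1 by (simp only: restrict_apply')
  then have "compose (carrier ?Y) ?e ?g (arr_map h x) = arr_map e x"
   using H.closed[OF x] vx e2 by (simp only: compose_eq restrict_apply')
  then show "arr_map (cmp Loc h g) x = arr_map e x"
   unfolding g_def Loc_simps arrow.sel compose_eq[OF x] .
 qed (simp_all add: g_def e(2))
 ultimately show ?thesis by (intro bexI[of _ g]) (simp_all add: g_def)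
qed

text \<open>The frame map of an open embedding is surjective, so \<open>g\<close> and
  \<open>g'\<close> agree on every open.\<close>

lemma open_embedding_mono:
 assumes h: "open_embedding_onto h v" and g: "g : ar Loc" "g' : ar Loc" "arr_tgt g = arr_src h" "arr_tgt g' = arr_src h"
  "cmp Loc h g = cmp Loc h g'"
 shows "g = g'"
proof (rule Loc_ext[OF g(1,2)])
 note h' = open_embedding_ontoD[OF h]
 show "arr_src g = arr_src g'" using g(5) by simp
 show "arr_tgt g = arr_tgt g'" using g by simp
 fix y assume "y : carrier (arr_tgt g)"
 then obtain x where x: "x : carrier (arr_tgt h)" "y = arr_map h x"
  using h'(4) g(3) by (auto simp: bij_betw_def)
 then show "arr_map g y = arr_map g' y" using Loc_cmp_map[OF x(1), of g] Loc_cmp_map[OF x(1), of g'] g(5) by simp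
qed

section \<open>Base change of functions and induction over covering sieves\<close>

lemma numerably_closed_sublocale:
 assumes "frame_lattice X" "numerably_closed X P" "v : carrier X"
 shows "numerably_closed (open_sublocale X v) P"
proof -
 interpret frame_lattice X by fact
 let ?V = "open_sublocale X v"
 have down: "P w'" if "P w" "w' \<sqsubseteq>\<^bsub>?V\<^esub> w" for w w'
  using that numerably_closed_down[OF assms(2)] by simp
 have union: "P (\<phi> (A \<union> B))"
  if "w : carrier ?V" "A : carrier half_line" "B : carrier half_line" "frame_hom half_line (open_sublocale ?V w) \<phi>" "P (\<phi> A)" "P (\<phi> B)" for w \<phi> A B
  by (rule numerably_closed_fun[OF assms(2), of w]) (use that open_sublocale_twice[of w v] in simp_all)
 have disjoint: "P (\<Squnion>\<^bsub>?V\<^esub> D)"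
  if D: "D \<subseteq> carrier ?V" and disj: "\<forall>a\<in>D. \<forall>b\<in>D. a ~= b --> a \<sqinter>\<^bsub>?V\<^esub> b = \<bottom>\<^bsub>?V\<^esub>" and "\<forall>d\<in>D. P d" for D
 proof -
  have D': "D \<subseteq> carrier X" "!!d. d : D ==> d \<sqsubseteq>\<^bsub>X\<^esub> v" using D by auto
  have "P (\<Squnion>\<^bsub>X\<^esub> D)"
  proof (rule numerably_closed_disjoint[OF assms(2) D'(1)])
   fix a b assume ab: "a : D" "b : D" "a ~= b"
   then have "a \<sqinter>\<^bsub>?V\<^esub> b = \<bottom>\<^bsub>?V\<^esub>" using disj by simp
   moreover have "a \<sqinter>\<^bsub>?V\<^esub> b = a \<sqinter>\<^bsub>X\<^esub> b" by (rule open_sublocale_meet[OF assms(3)]) (use ab D' in auto)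
   ultimately show "a \<sqinter>\<^bsub>X\<^esub> b = \<bottom>\<^bsub>X\<^esub>" using open_sublocale_bottom[OF assms(3)] by simp
  qed (use that in auto)
  then show ?thesis using open_sublocale_sup[OF assms(3) D'] by simp
 qed
 show ?thesis
  unfolding numerably_closed_def
 proof (intro conjI allI impI ballI, goal_cases)
  case (1 w w')
  then show ?case by (elim conjE) (rule down[of w w'])
 next
  case (2 w \<phi> A B)
  then show ?case by (elim conjE) (rule union[of w A B \<phi>])
 next
  case (3 D)
  then show ?case by (elim conjE) (rule disjoint[of D])
 qed
qed

lemma (in two_frames) hom_finite_inf:
 "finite J ==> g ` J \<subseteq> carrier X ==> h (\<Sqinter>\<^bsub>X\<^esub> (g ` J)) = \<Sqinter>\<^bsub>Y\<^esub> ((%j. h (g j)) ` J)"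
proof (induction J rule: finite_induct)
 case empty
 have "\<Sqinter>\<^bsub>X\<^esub> {} = \<top>\<^bsub>X\<^esub>" by (rule X.inf_eqI) auto
 moreover have "\<Sqinter>\<^bsub>Y\<^esub> {} = \<top>\<^bsub>Y\<^esub>" by (rule Y.inf_eqI) auto
 ultimately show ?case by (simp add: hom_top)
next
 case (insert i J)
 have gJ: "g i : carrier X" "g ` J \<subseteq> carrier X" "\<Sqinter>\<^bsub>X\<^esub> (g ` J) : carrier X" using insert.prems by auto
 have 1: "\<Sqinter>\<^bsub>X\<^esub> (g ` insert i J) = g i \<sqinter>\<^bsub>X\<^esub> \<Sqinter>\<^bsub>X\<^esub> (g ` J)"
 proof (rule X.inf_eqI)
  note m = X.meet_lower[OF gJ(1,3)]
  show "g i \<sqinter>\<^bsub>X\<^esub> \<Sqinter>\<^bsub>X\<^esub> (g ` J) : carrier X" by (rule m(1))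
  show "g i \<sqinter>\<^bsub>X\<^esub> \<Sqinter>\<^bsub>X\<^esub> (g ` J) \<sqsubseteq>\<^bsub>X\<^esub> b" if "b : g ` insert i J" for b
   using that m(2) X.trans[OF m(3) X.inf_lower[OF gJ(2)], of b] by auto
  show "z \<sqsubseteq>\<^bsub>X\<^esub> g i \<sqinter>\<^bsub>X\<^esub> \<Sqinter>\<^bsub>X\<^esub> (g ` J)" if "z : carrier X" "!!b. b : g ` insert i J ==> z \<sqsubseteq>\<^bsub>X\<^esub> b" for z
   by (intro X.meet_greatest X.inf_greatest) (use that gJ in auto)
 qed (use insert.prems in auto)
 have hJ: "h (g i) : carrier Y" "(%j. h (g j)) ` J \<subseteq> carrier Y" "\<Sqinter>\<^bsub>Y\<^esub> ((%j. h (g j)) ` J) : carrier Y"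
  using gJ closed by (auto simp: image_subset_iff)
 have 2: "\<Sqinter>\<^bsub>Y\<^esub> ((%j. h (g j)) ` insert i J) = h (g i) \<sqinter>\<^bsub>Y\<^esub> \<Sqinter>\<^bsub>Y\<^esub> ((%j. h (g j)) ` J)"
 proof (rule Y.inf_eqI)
  note m = Y.meet_lower[OF hJ(1,3)]
  show "h (g i) \<sqinter>\<^bsub>Y\<^esub> \<Sqinter>\<^bsub>Y\<^esub> ((%j. h (g j)) ` J) : carrier Y" by (rule m(1))
  show "h (g i) \<sqinter>\<^bsub>Y\<^esub> \<Sqinter>\<^bsub>Y\<^esub> ((%j. h (g j)) ` J) \<sqsubseteq>\<^bsub>Y\<^esub> b" if "b : (%j. h (g j)) ` insert i J" for b
   using that m(2) Y.trans[OF m(3) Y.inf_lower[OF hJ(2)], of b] by auto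
  show "z \<sqsubseteq>\<^bsub>Y\<^esub> h (g i) \<sqinter>\<^bsub>Y\<^esub> \<Sqinter>\<^bsub>Y\<^esub> ((%j. h (g j)) ` J)" if "z : carrier Y" "!!b. b : (%j. h (g j)) ` insert i J ==> z \<sqsubseteq>\<^bsub>Y\<^esub> b" for z
   by (intro Y.meet_greatest Y.inf_greatest) (use that hJ in auto)
 qed (use hJ in auto)
 show ?case unfolding 1 2 using hom_meet[OF gJ(1,3)] insert.IH[OF gJ(2)] by simp
qed

text \<open>Finite sums are built from finite meets and arbitrary unions, both preserved by frame
  homomorphisms; so a family with a positive sum pulls back to such a family.\<close>

lemma (in two_frames) hom_numerable_functions:
 assumes "numerable_functions X I f s"
 shows "numerable_functions Y I (%i. compose (carrier half_line) h (f i)) (compose (carrier half_line) h s)"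
proof -
 interpret N: numerable_functions X I f s by fact
 let ?f = "%i. compose (carrier half_line) h (f i)" and ?s = "compose (carrier half_line) h s"
 have fs: "h (finite_sum X J f W) = finite_sum Y J ?f W" if J: "finite J" "J \<subseteq> I" for J W
 proof -
  have inf: "h (\<Sqinter>\<^bsub>X\<^esub> ((%i. f i (A i)) ` J)) = \<Sqinter>\<^bsub>Y\<^esub> ((%i. ?f i (A i)) ` J)" if A: "A : N.boxes J W" for A
  proof -
   have "(%j. h (f j (A j))) ` J = (%i. ?f i (A i)) ` J"
    using A by (intro image_cong HOL.refl) (simp add: N.boxes_def compose_def)
   then show ?thesis using hom_finite_inf[OF J(1) N.box_carrier[OF J(2) A]] by simp
  qed
  have "h (finite_sum X J f W) = \<Squnion>\<^bsub>Y\<^esub> (h ` (%A. \<Sqinter>\<^bsub>X\<^esub> ((%i. f i (A i)) ` J)) ` N.boxes J W)"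
   unfolding N.finite_sum_boxes by (rule hom_sup[OF N.boxes_carrier[OF J(2)]])
  also have "h ` (%A. \<Sqinter>\<^bsub>X\<^esub> ((%i. f i (A i)) ` J)) ` N.boxes J W = (%A. \<Sqinter>\<^bsub>Y\<^esub> ((%i. ?f i (A i)) ` J)) ` N.boxes J W"
   unfolding image_image by (intro image_cong HOL.refl inf)
  also have "\<dots> = {\<Sqinter>\<^bsub>Y\<^esub> ((%i. ?f i (A i)) ` J) | A.
   (\<forall>i\<in>J. A i : carrier half_line) & (\<forall>t. (\<forall>i\<in>J. t i : A i) --> (\<Sum>i\<in>J. t i) : W)}"
   unfolding N.boxes_def by auto
  finally show ?thesis unfolding finite_sum_def .
 qed
 have "nonneg_functions_axioms Y I ?f"
 proof
  fix i assume "i : I"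
  then show "frame_hom half_line Y (?f i)" using half_line_compose[OF N.f_hom hom] by simp
 qed
 moreover have "numerable_functions_axioms Y I ?f ?s"
 proof
  have "frame_hom half_line X s" using N.sum by (simp add: is_sum_def)
  then have 1: "frame_hom half_line Y ?s" using half_line_compose[OF _ hom] by blast
  have "?s (gt_ray c) = \<Squnion>\<^bsub>Y\<^esub> {finite_sum Y J ?f (gt_ray c) | J. finite J & J \<subseteq> I}" for c
  proof -
   have "?s (gt_ray c) = h (\<Squnion>\<^bsub>X\<^esub> {finite_sum X J f (gt_ray c) | J. finite J & J \<subseteq> I})"
    by (simp add: compose_def N.s_gt)
   also have "\<dots> = \<Squnion>\<^bsub>Y\<^esub> (h ` {finite_sum X J f (gt_ray c) | J. finite J & J \<subseteq> I})"
    by (rule hom_sup[OF N.sums_carrier])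
   also have "h ` {finite_sum X J f (gt_ray c) | J. finite J & J \<subseteq> I} = {finite_sum Y J ?f (gt_ray c) | J. finite J & J \<subseteq> I}"
    (is "?L = ?R")
   proof (intro equalityI subsetI)
    fix x assume "x : ?L"
    then obtain J where "finite J" "J \<subseteq> I" "x = h (finite_sum X J f (gt_ray c))" by auto
    then show "x : ?R" using fs by auto
   next
    fix x assume "x : ?R"
    then obtain J where J: "finite J" "J \<subseteq> I" "x = finite_sum Y J ?f (gt_ray c)" by auto
    then have "x = h (finite_sum X J f (gt_ray c))" using fs by simp
    then show "x : ?L" using J by blast
   qed
   finally show ?thesis .
  qed
  with 1 show "is_sum Y I ?f ?s" by (simp add: is_sum_def gt_ray_def)
  show "?s {0<..} = \<top>\<^bsub>Y\<^esub>" by (simp add: compose_def N.positive hom_top)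
 qed
 ultimately show ?thesis by (simp add: numerable_functions_def nonneg_functions_def Y.frame_lattice_axioms)
qed

text \<open>Induction over the generation of the topology. The statement concerns all
  \<open>g\<close> into \<open>X\<close>, so stability merely replaces \<open>g\<close> by a
  composite. Local character uses the claim over each open sublocale in the sieve, which is where
  \<open>numerably_closed_sublocale\<close> enters.\<close>

lemma covering_sieve_closed:
 assumes "covering_sieve Loc numerable_coverage (X :: 'a gorder) R" "g : ar Loc" "tgt Loc g = X" "numerably_closed (src Loc g) P"
  "!!v. v : carrier (src Loc g) ==> cmp Loc g (open_inclusion (src Loc g) v) : R ==> P v"
 shows "P \<top>\<^bsub>src Loc g\<^esub>"
 using assms
proof (induction arbitrary: g P rule: covering_sieve.induct)
 case (generating x Q)
 obtain I :: "'a set" and V where Q: "Q = (%i. open_inclusion x (V i)) ` I" and IV: "numerable_cover x I V"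
  using generating.hyps(2) unfolding numerable_coverage_def by auto
 have V: "V ` I \<subseteq> carrier x" using IV unfolding numerable_cover_def by simp
 have "\<exists>f s. (\<forall>i\<in>I. frame_hom half_line x (f i)) & is_sum x I f s & s {0<..} = \<top>\<^bsub>x\<^esub> & (\<forall>i\<in>I. f i {0<..} \<sqsubseteq>\<^bsub>x\<^esub> V i)"
  using IV unfolding numerable_cover_def by simp
 then obtain f s where "\<forall>i\<in>I. frame_hom half_line x (f i)" "is_sum x I f s" "s {0<..} = \<top>\<^bsub>x\<^esub>" "\<forall>i\<in>I. f i {0<..} \<sqsubseteq>\<^bsub>x\<^esub> V i"
  by (elim exE conjE)
 note ff = this
 have fs: "!!i. i : I ==> frame_hom half_line x (f i)" "is_sum x I f s" "s {0<..} = \<top>\<^bsub>x\<^esub>"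
   "!!i. i : I ==> f i {0<..} \<sqsubseteq>\<^bsub>x\<^esub> V i"
  using ff by simp_all
 have tg: "arr_tgt g = x" using generating.prems by simp
 interpret G: two_frames x "arr_src g" "arr_map g"
  using Loc_arD[OF generating.prems(1)] tg by simp
 have N: "numerable_functions x I f s"
  using fs G.X.frame_lattice_axioms by (simp add: numerable_functions_def numerable_functions_axioms_def nonneg_functions_def nonneg_functions_axioms_def)
 have "P \<top>\<^bsub>arr_src g\<^esub>"
 proof (rule numerable_functions.closed_top[OF G.hom_numerable_functions[OF N]])
  show P: "numerably_closed (arr_src g) P" using generating.prems(3) by simp
  fix i assume i: "i : I"
  have Vi: "V i : carrier x" using V i by auto
  let ?v = "arr_map g (V i)"
  have v: "?v : carrier (arr_src g)" by (rule G.closed[OF Vi])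
  have inc: "open_inclusion (arr_src g) ?v : ar Loc" by (rule G.Y.open_inclusion_map(2)[OF v])
  \<comment> \<open>The restriction of \<open>g\<close> to the pullback of \<open>V i\<close>
    factors through the inclusion of \<open>V i\<close>, so it belongs to the generated
    sieve.\<close>
  define e where "e = cmp Loc g (open_inclusion (arr_src g) ?v)"
  have e: "e : ar Loc" "arr_tgt e = x" "arr_src e = open_sublocale (arr_src g) ?v"
   using category.cmp_ar[OF Loc_category inc generating.prems(1)] tg by (simp_all add: e_def)
  have et: "arr_map e (V i) = \<top>\<^bsub>arr_src e\<^esub>"
   unfolding e(3) G.Y.open_sublocale_top[OF v] using Vi v tg G.Y.meet_absorb(1)[OF v v]
   by (simp add: e_def compose_def)
  have "\<exists>k\<in>ar Loc. arr_src k = arr_src e & arr_tgt k = arr_src (open_inclusion x (V i)) & cmp Loc (open_inclusion x (V i)) k = e"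
   by (rule open_embedding_factor[OF open_inclusion_onto[OF G.X.frame_lattice_axioms Vi] e(1) _ et]) (simp only: e(2) open_inclusion_simps)
  then obtain k where k: "k : ar Loc" "arr_tgt k = arr_src (open_inclusion x (V i))"
   "cmp Loc (open_inclusion x (V i)) k = e" by (elim bexE conjE)
  have "e : generated_sieve Loc Q"
   unfolding generated_sieve_def Q mem_Collect_eq
  proof (intro exI conjI)
   show "e = cmp Loc (open_inclusion x (V i)) k" by (rule k(3)[symmetric])
   show "open_inclusion x (V i) : (%i. open_inclusion x (V i)) ` I" using i by (rule imageI)
   show "tgt Loc k = src Loc (open_inclusion x (V i))" using k(2) by simp
  qed (rule k(1))
  then have "P ?v" using generating.prems(4)[of ?v] v by (simp add: e_def)
  moreover have "compose (carrier half_line) (arr_map g) (f i) {0<..} \<sqsubseteq>\<^bsub>arr_src g\<^esub> ?v"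
   using G.mono[OF fs(4)[OF i]] by (simp add: compose_def)
  ultimately show "P (compose (carrier half_line) (arr_map g) (f i) {0<..})" by (rule numerably_closed_down[OF P])
 qed
 then show ?case by simp
next
 case (maximal x)
 have Y: "frame_lattice (arr_src g)" using maximal.prems(1) by (simp add: Loc_ar)
 interpret frame_lattice "arr_src g" by (rule Y)
 have "cmp Loc g (open_inclusion (arr_src g) \<top>\<^bsub>arr_src g\<^esub>) : arrows_to Loc x"
  using category.cmp_ar[OF Loc_category open_inclusion_map(2)[OF top_closed] maximal.prems(1)] maximal.prems(2)
  unfolding arrows_to_def by simp
 then show ?case using maximal.prems(4)[of "\<top>\<^bsub>arr_src g\<^esub>"] by simp
next
 case (stability x R f)
 have f: "f : ar Loc" "tgt Loc f = x" using stability.hyps(2) by (auto simp: arrows_to_def)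
 have gf: "src Loc f = tgt Loc g" using stability.prems(2) by simp
 note c = category.cmp_ar[OF Loc_category stability.prems(1) f(1) gf]
 interpret Y: frame_lattice "arr_src g" using stability.prems(1) by (simp add: Loc_ar)
 have "P \<top>\<^bsub>src Loc (cmp Loc f g)\<^esub>"
 proof (rule stability.IH)
  show "cmp Loc f g : ar Loc" "tgt Loc (cmp Loc f g) = x" using c f by auto
  show "numerably_closed (src Loc (cmp Loc f g)) P" using stability.prems(3) c by simp
  fix v assume v: "v : carrier (src Loc (cmp Loc f g))" "cmp Loc (cmp Loc f g) (open_inclusion (src Loc (cmp Loc f g)) v) : R"
  then have v': "v : carrier (arr_src g)" by simp
  let ?i = "open_inclusion (arr_src g) v"
  have i: "?i : ar Loc" by (rule Y.open_inclusion_map(2)[OF v'])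
  have ci: "cmp Loc g ?i : ar Loc & tgt Loc (cmp Loc g ?i) = tgt Loc g"
   using category.cmp_ar[OF Loc_category i stability.prems(1)] by simp
  have "cmp Loc f (cmp Loc g ?i) = cmp Loc (cmp Loc f g) ?i"
   by (rule category.cmp_assoc[OF Loc_category i stability.prems(1) f(1) _ gf]) simp
  then have "cmp Loc f (cmp Loc g ?i) : R" using v(2) by simp
  then have "cmp Loc g ?i : pullback_sieve Loc f R"
   unfolding pullback_sieve_def using ci gf by simp
  then show "P v" using stability.prems(4)[of v] v' by simp
 qed
 then show ?case by simp
next
 case (local_character x R T)
 interpret Y: frame_lattice "arr_src g" using local_character.prems(1) by (simp add: Loc_ar)
 show ?case
 proof (rule local_character.IH(1)[OF local_character.prems(1-3)])
  fix v assume v: "v : carrier (src Loc g)" "cmp Loc g (open_inclusion (src Loc g) v) : R"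
  let ?Y = "arr_src g"
  let ?i = "open_inclusion ?Y v" and ?V = "open_sublocale ?Y v"
  have v': "v : carrier ?Y" using v by simp
  have i: "?i : ar Loc" by (rule Y.open_inclusion_map(2)[OF v'])
  interpret V: frame_lattice ?V by (rule Y.open_sublocale_frame[OF v'])
  define e where "e = cmp Loc g ?i"
  have e: "e : R" "src Loc e = ?V" "e : ar Loc"
   using v(2) category.cmp_ar[OF Loc_category i local_character.prems(1)] by (simp_all add: e_def)
  \<comment> \<open>The second induction hypothesis concerns the pulled back sieve on the open
    sublocale; it is applied with the identity as the arrow to that sublocale.\<close>
  define d where "d = idn Loc ?V"
  have d: "d : ar Loc" "src Loc d = ?V" "tgt Loc d = ?V"
   using category.idn_ar[OF Loc_category, of ?V] V.frame_lattice_axioms by (simp_all add: d_def Loc_ob)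
  have "P \<top>\<^bsub>src Loc d\<^esub>"
  proof (rule local_character.IH(2)[OF e(1), of d])
   show "d : ar Loc" "tgt Loc d = src Loc e" using d e by simp_all
   show "numerably_closed (src Loc d) P"
    unfolding d using numerably_closed_sublocale[OF Y.frame_lattice_axioms _ v'] local_character.prems(3) by simp
   fix u assume u: "u : carrier (src Loc d)" "cmp Loc d (open_inclusion (src Loc d) u) : pullback_sieve Loc e T"
   have u': "u : carrier ?Y" "u \<sqsubseteq>\<^bsub>?Y\<^esub> v" using u(1) unfolding d by auto
   have uV: "u : carrier ?V" using u' by simp
   let ?j = "open_inclusion ?V u"
   have j: "?j : ar Loc" by (rule V.open_inclusion_map(2)[OF uV])
   have dj: "cmp Loc d ?j = ?j"
    using category.cmp_idn_left[OF Loc_category j] unfolding d_def by simp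
   have "?j : pullback_sieve Loc e T" using u(2) unfolding d(2) dj .
   then have j1: "cmp Loc e ?j : T" unfolding pullback_sieve_def by (simp only: mem_Collect_eq)
   have j2: "cmp Loc e ?j = cmp Loc g (cmp Loc ?i ?j)"
    unfolding e_def by (rule category.cmp_assoc[OF Loc_category j i local_character.prems(1), symmetric]) simp_all
   have j3: "cmp Loc ?i ?j = open_inclusion ?Y u"
   proof (rule Loc_ext)
    show "cmp Loc ?i ?j : ar Loc" using category.cmp_ar[OF Loc_category j i] by simp
    show "open_inclusion ?Y u : ar Loc" by (rule Y.open_inclusion_map(2)[OF u'(1)])
    show "arr_src (cmp Loc ?i ?j) = arr_src (open_inclusion ?Y u)"
     using Y.open_sublocale_twice[OF u'(2)] by simp
    fix x assume "x : carrier (arr_tgt (cmp Loc ?i ?j))"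
    then have x: "x : carrier ?Y" by simp
    note m = Y.meet_lower[OF v' x]
    have "u \<sqinter>\<^bsub>?V\<^esub> (v \<sqinter>\<^bsub>?Y\<^esub> x) = u \<sqinter>\<^bsub>?Y\<^esub> (v \<sqinter>\<^bsub>?Y\<^esub> x)"
     by (rule Y.open_sublocale_meet[OF v' u'(1) m(1) u'(2) m(2)])
    also have "\<dots> = u \<sqinter>\<^bsub>?Y\<^esub> v \<sqinter>\<^bsub>?Y\<^esub> x" by (rule Y.meet_assoc'[OF u'(1) v' x, symmetric])
    also have "u \<sqinter>\<^bsub>?Y\<^esub> v = u" by (rule Y.meet_absorb(1)[OF u'(1) v' u'(2)])
    finally show "arr_map (cmp Loc ?i ?j) x = arr_map (open_inclusion ?Y u) x"
     using x m by (simp add: compose_def)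
   qed simp
   have "cmp Loc g (open_inclusion ?Y u) : T" using j1 unfolding j2 j3 .
   then show "P u" using local_character.prems(4)[of u] u' by simp
  qed
  then show "P v" using Y.open_sublocale_top[OF v'] d by simp
 qed
qed

subsection \<open>Numerable covers by two opens and by disjoint opens\<close>

text \<open>The composite of \<open>\<phi>\<close> with a continuous \<open>g\<close>. Since
  \<open>\<phi>\<close> maps \<open>C\<close> to the top, it takes its values in \<open>C\<close>,
  and only the part of a preimage inside \<open>C\<close> counts.\<close>

lemma (in half_line_hom) pullback_continuous:
 fixes g :: "real => real"
 assumes C: "C : carrier half_line" "\<phi> C = \<top>" and g: "continuous_on UNIV g" "!!t. g t \<ge> 0"
 shows "frame_hom half_line X (\<lambda>V\<in>carrier half_line. \<phi> (C \<inter> g -` V))"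
  "V : carrier half_line ==> C \<inter> g -` V : carrier half_line"
proof -
 have o: "C \<inter> g -` V : carrier half_line" if V: "V : carrier half_line" for V
 proof -
  obtain T where T: "open T" "V = {0..} \<inter> T" using V by (auto simp: half_line_open openin_open)
  have "open (g -` T)" using g(1) T(1) by (simp add: open_vimage)
  then have "{0..} \<inter> g -` T : carrier half_line" by (rule half_line_openI)
  moreover have "C \<inter> g -` V = C \<inter> ({0..} \<inter> g -` T)" using half_line_sub[OF C(1)] g(2) T(2) by auto
  ultimately show ?thesis using half_line_Int[OF C(1)] by simp
 qed
 then show "V : carrier half_line ==> C \<inter> g -` V : carrier half_line" .
 let ?h = "\<lambda>V\<in>carrier half_line. \<phi> (C \<inter> g -` V)"
 show "frame_hom half_line X ?h"
  unfolding frame_hom_half_line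
 proof (intro conjI ballI allI impI)
  show "?h : carrier half_line \<rightarrow>\<^sub>E carrier X" using o by simp
  have "C \<inter> g -` {0..} = C" using g(2) by auto
  then show "?h {0..} = \<top>" using C(2) by simp
 next
  fix A B assume AB: "A : carrier half_line" "B : carrier half_line"
  have "C \<inter> g -` (A \<inter> B) = (C \<inter> g -` A) \<inter> (C \<inter> g -` B)" by auto
  then show "?h (A \<inter> B) = ?h A \<sqinter> ?h B" using AB hom_Int[OF o[OF AB(1)] o[OF AB(2)]] by (simp add: half_line_Int)
 next
  fix \<A> assume A: "\<A> \<subseteq> carrier half_line"
  have im: "(%V. C \<inter> g -` V) ` \<A> \<subseteq> carrier half_line" using A o by auto
  have "C \<inter> g -` (\<Union> \<A>) = \<Union> ((%V. C \<inter> g -` V) ` \<A>)" by auto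
  then have "\<phi> (C \<inter> g -` (\<Union> \<A>)) = \<Squnion> (\<phi> ` (%V. C \<inter> g -` V) ` \<A>)" using hom_Union[OF im] by simp
  moreover have "\<phi> ` (%V. C \<inter> g -` V) ` \<A> = ?h ` \<A>" unfolding image_image using A by (intro image_cong HOL.refl) auto
  ultimately show "?h (\<Union> \<A>) = \<Squnion> (?h ` \<A>)" using half_line_Union[OF A] by simp
 qed
qed

context frame_lattice
begin

text \<open>On a partition \<open>D\<close> of the locale, the locally constant function with value
  \<open>g x\<close> on the part \<open>x\<close>.\<close>

definition weighted :: "'a set => ('a => real) => real set => 'a" where
 "weighted D g = (\<lambda>V\<in>carrier half_line. \<Squnion> {x : D. g x : V})"

lemma weighted_hom:
 assumes D: "D \<subseteq> carrier X" "!!a b. a : D ==> b : D ==> a ~= b ==> a \<sqinter> b = \<bottom>" "\<Squnion> D = \<top>" and g: "!!x. g x \<ge> 0"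
 shows "frame_hom half_line X (weighted D g)"
  "!!x v V. x : D ==> v \<sqsubseteq> x ==> V : carrier half_line ==> g x : V ==> v \<sqsubseteq> weighted D g V"
  "!!x v V. x : D ==> v \<sqsubseteq> x ==> V : carrier half_line ==> g x ~: V ==> v \<sqsubseteq> weighted D g V ==> v \<sqsubseteq> \<bottom>"
proof -
 let ?h = "weighted D g"
 have sub: "{x : D. g x : V} \<subseteq> carrier X" for V using D(1) by auto
 show in1: "v \<sqsubseteq> ?h V" if "x : D" "v \<sqsubseteq> x" "V : carrier half_line" "g x : V" for x v V
 proof -
  have "x \<sqsubseteq> \<Squnion> {x : D. g x : V}" by (rule sup_upper[OF sub]) (use that in simp)
  then show ?thesis using trans[OF that(2)] that(3) by (simp add: weighted_def)
 qed
 show out: "v \<sqsubseteq> \<bottom>" if "x : D" "v \<sqsubseteq> x" "V : carrier half_line" "g x ~: V" "v \<sqsubseteq> ?h V" for x v V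
 proof (rule le_sup_cases[OF _ _ sub bottom_closed])
  show "v \<sqsubseteq> \<Squnion> {x : D. g x : V}" using that by (simp add: weighted_def)
  show "v : carrier X" using le_carrier[OF that(2)] by simp
  fix b v' assume b: "b : {x : D. g x : V}" "v' : carrier X" "v' \<sqsubseteq> v" "v' \<sqsubseteq> b"
  then have "b ~= x" using that(4) by auto
  then have "x \<sqinter> b = \<bottom>" using D(2)[of x b] that(1) b(1) by auto
  moreover have "v' \<sqsubseteq> x \<sqinter> b" by (rule meet_greatest[OF trans[OF b(3) that(2)] b(4,2)]) (use that(1) b(1) D(1) in auto)
  ultimately show "v' \<sqsubseteq> \<bottom>" by simp
 qed
 have cases: "v \<sqsubseteq> c" if "v : carrier X" "c : carrier X" "!!x v'. x : D ==> v' : carrier X ==> v' \<sqsubseteq> v ==> v' \<sqsubseteq> x ==> v' \<sqsubseteq> c" for v c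
  by (rule le_sup_cases[OF _ that(1) D(1) that(2)]) (use that D(3) in simp_all)
 have c: "?h V : carrier X" if "V : carrier half_line" for V using that sub by (simp add: weighted_def)
 have le: "?h V \<sqsubseteq> c" if "V : carrier half_line" "c : carrier X" "!!x. x : D ==> g x : V ==> x \<sqsubseteq> c" for V c
  unfolding weighted_def using that sup_least[OF sub that(2)] by simp
 have up: "x \<sqsubseteq> ?h V" if "x : D" "V : carrier half_line" "g x : V" for x V
  by (rule in1[OF that(1) le_refl that(2,3)]) (use that(1) D(1) in auto)
 show "frame_hom half_line X ?h"
  unfolding frame_hom_half_line
 proof (intro conjI ballI allI impI)
  show "?h : carrier half_line \<rightarrow>\<^sub>E carrier X" using c by (simp add: weighted_def PiE_iff)
  have "{x : D. g x : {0..}} = D" using g by auto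
  then show "?h {0..} = \<top>" using D(3) by (simp add: weighted_def)
 next
  fix A B assume AB: "A : carrier half_line" "B : carrier half_line"
  note ABI = half_line_Int[OF AB]
  note m = meet_lower[OF c[OF AB(1)] c[OF AB(2)]]
  show "?h (A \<inter> B) = ?h A \<sqinter> ?h B"
  proof (rule antisymI)
   show "?h (A \<inter> B) \<sqsubseteq> ?h A \<sqinter> ?h B"
    by (rule le[OF ABI m(1)], rule meet_greatest) (use up AB c D(1) in auto)
   show "?h A \<sqinter> ?h B \<sqsubseteq> ?h (A \<inter> B)"
   proof (rule cases[OF m(1) c[OF ABI]])
    fix x v assume x: "x : D" "v : carrier X" "v \<sqsubseteq> ?h A \<sqinter> ?h B" "v \<sqsubseteq> x"
    note vA = trans[OF x(3) m(2)] and vB = trans[OF x(3) m(3)]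
    show "v \<sqsubseteq> ?h (A \<inter> B)"
    proof (cases "g x : A \<inter> B")
     case True
     then show ?thesis by (rule in1[OF x(1,4) ABI])
    next
     case False
     then have "v \<sqsubseteq> \<bottom>" using out[OF x(1,4) AB(1) _ vA] out[OF x(1,4) AB(2) _ vB] by (cases "g x : A") simp_all
     then show ?thesis by (rule le_of_bot[OF _ x(2) c[OF ABI]])
    qed
   qed
  qed (use m c ABI in auto)
 next
  fix \<A> assume A: "\<A> \<subseteq> carrier half_line"
  note AU = half_line_Union[OF A]
  have im: "?h ` \<A> \<subseteq> carrier X" using A c by auto
  show "?h (\<Union> \<A>) = \<Squnion> (?h ` \<A>)"
  proof (rule antisymI)
   show "?h (\<Union> \<A>) \<sqsubseteq> \<Squnion> (?h ` \<A>)"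
   proof (rule le[OF AU sup_closed[OF im]])
    fix x assume x: "x : D" "g x : \<Union> \<A>"
    then obtain V where V: "V : \<A>" "g x : V" by auto
    have "x \<sqsubseteq> ?h V" by (rule up) (use x V A in auto)
    moreover have "?h V \<sqsubseteq> \<Squnion> (?h ` \<A>)" by (rule sup_upper[OF im]) (use V in simp)
    ultimately show "x \<sqsubseteq> \<Squnion> (?h ` \<A>)" by (rule trans)
   qed
   show "\<Squnion> (?h ` \<A>) \<sqsubseteq> ?h (\<Union> \<A>)"
   proof (rule sup_least[OF im c[OF AU]])
    fix b assume "b : ?h ` \<A>"
    then obtain V where V: "V : \<A>" "b = ?h V" by auto
    show "b \<sqsubseteq> ?h (\<Union> \<A>)" unfolding V(2)
    proof (rule le[OF _ c[OF AU]])
     show "V : carrier half_line" using V A by auto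
     show "x \<sqsubseteq> ?h (\<Union> \<A>)" if "x : D" "g x : V" for x by (rule up[OF that(1) AU]) (use that V in auto)
    qed
   qed
  qed (use AU c im in auto)
 qed
qed

text \<open>The indicator functions of the parts are the witnesses; their sum is the constant
  1.\<close>

lemma numerable_cover_disjoint:
 assumes D: "D \<subseteq> carrier X" "!!a b. a : D ==> b : D ==> a ~= b ==> a \<sqinter> b = \<bottom>" "\<Squnion> D = \<top>"
 shows "numerable_cover X D (%x. x)"
proof -
 define ind where "ind d = (%x. if x = d then 1 else 0 :: real)" for d :: 'a
 have ind: "ind d x \<ge> 0" for d x by (simp add: ind_def)
 define f where "f d = weighted D (ind d)" for d
 define s where "s = weighted D (%_. 1)"
 have f1: "frame_hom half_line X (f d)" for d
  unfolding f_def by (rule weighted_hom(1)[OF D ind])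
 have f2: "v \<sqsubseteq> f d V" if "x : D" "v \<sqsubseteq> x" "V : carrier half_line" "ind d x : V" for d x v V
  unfolding f_def by (rule weighted_hom(2)[where g = "ind d", OF D ind that])
 have f3: "v \<sqsubseteq> \<bottom>" if "x : D" "v \<sqsubseteq> x" "V : carrier half_line" "ind d x ~: V" "v \<sqsubseteq> f d V" for d x v V
  by (rule weighted_hom(3)[where g = "ind d", OF D ind that(1-4)]) (use that(5) in \<open>simp_all add: f_def\<close>)
 have s: "frame_hom half_line X s" "!!x v V. x : D ==> v \<sqsubseteq> x ==> V : carrier half_line ==> 1 : V ==> v \<sqsubseteq> s V"
  using weighted_hom(1,2)[OF D, of "%_. 1", folded s_def] by simp_all
 interpret N: nonneg_functions X D f by unfold_locales (rule f1)
 have cases: "v \<sqsubseteq> c" if "v : carrier X" "c : carrier X" "!!x v'. x : D ==> v' : carrier X ==> v' \<sqsubseteq> v ==> v' \<sqsubseteq> x ==> v' \<sqsubseteq> c" for v c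
  by (rule le_sup_cases[OF _ that(1) D(1) that(2)]) (use that D(3) in simp_all)
 have "s (gt_ray c) = \<Squnion> {finite_sum X J f (gt_ray c) | J. finite J & J \<subseteq> D}" for c
 proof (rule antisymI)
  have sc: "s (gt_ray c) : carrier X" using s(1) by (auto simp: frame_hom_half_line)
  let ?R = "\<Squnion> {finite_sum X J f (gt_ray c) | J. finite J & J \<subseteq> D}"
  show Rc: "?R : carrier X" by (rule sup_closed[OF N.sums_carrier])
  show "s (gt_ray c) : carrier X" by (rule sc)
  show "s (gt_ray c) \<sqsubseteq> ?R"
  proof (rule cases[OF sc Rc])
   fix x v assume x: "x : D" "v : carrier X" "v \<sqsubseteq> s (gt_ray c)" "v \<sqsubseteq> x"
   show "v \<sqsubseteq> ?R"
   proof (cases "c < 1")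
    case True
    have "v \<sqsubseteq> finite_sum X {x} f (gt_ray c)"
    proof (rule N.le_finite_sum[of _ "%_. gt_ray c"])
     show "(%_. gt_ray c) : N.boxes {x} (gt_ray c)" by (simp add: N.boxes_def)
     fix j assume "j : {x}"
     then show "v \<sqsubseteq> f j (gt_ray c)" using f2[OF x(1,4) ray_open(1), where d = x] True by (simp add: ind_def)
    qed (use x in auto)
    moreover have "finite_sum X {x} f (gt_ray c) \<sqsubseteq> ?R"
     by (rule sup_upper[OF N.sums_carrier]) (use x in blast)
    ultimately show ?thesis by (rule trans)
   next
    case False
    then have "{y : D. (1::real) : gt_ray c} = {}" by auto
    moreover have "s (gt_ray c) = \<Squnion> {y : D. (1::real) : gt_ray c}"
     by (simp only: s_def weighted_def restrict_apply'[OF ray_open(1)])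
    ultimately have "s (gt_ray c) = \<Squnion> {}" by (simp only:)
    also have "\<dots> \<sqsubseteq> \<bottom>" by (rule sup_least) auto
    finally have "v \<sqsubseteq> \<bottom>" using trans[OF x(3)] by simp
    then show ?thesis by (rule le_of_bot[OF _ x(2) Rc])
   qed
  qed
  show "?R \<sqsubseteq> s (gt_ray c)"
  proof (rule sup_least[OF N.sums_carrier sc])
   fix b assume "b : {finite_sum X J f (gt_ray c) | J. finite J & J \<subseteq> D}"
   then obtain J where J: "finite J" "J \<subseteq> D" "b = finite_sum X J f (gt_ray c)" by auto
   have "b \<sqsubseteq> b" unfolding J(3) by (rule le_refl[OF N.finite_sum_closed[OF J(2)]])
   then show "b \<sqsubseteq> s (gt_ray c)"
    unfolding J(3)
   proof (rule N.finite_sum_cases[OF _ J(2) sc])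
    fix A v assume A: "A : N.boxes J (gt_ray c)" "v : carrier X" "!!j. j : J ==> v \<sqsubseteq> f j (A j)"
    show "v \<sqsubseteq> s (gt_ray c)"
    proof (rule cases[OF A(2) sc])
     fix x v' assume x: "x : D" "v' : carrier X" "v' \<sqsubseteq> v" "v' \<sqsubseteq> x"
     show "v' \<sqsubseteq> s (gt_ray c)"
     proof (cases "\<forall>j\<in>J. ind j x : A j")
      case True
      have "(\<Sum>j\<in>J. ind j x) : gt_ray c"
       using A(1) True unfolding N.boxes_def mem_Collect_eq by (elim conjE allE[of _ "%j. ind j x"]) simp
      moreover have "(\<Sum>j\<in>J. ind j x) \<le> 1"
       using J(1) by (simp add: ind_def)
      ultimately have "1 : gt_ray c" by simp
      then show ?thesis by (rule s(2)[OF x(1,4) ray_open(1)])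
     next
      case False
      then obtain j where j: "j : J" "ind j x ~: A j" by auto
      have "A j : carrier half_line" using A(1) j(1) by (simp add: N.boxes_def)
      then have "v' \<sqsubseteq> \<bottom>" by (rule f3[OF x(1,4) _ j(2) trans[OF x(3) A(3)[OF j(1)]]])
      then show ?thesis by (rule le_of_bot[OF _ x(2) sc])
     qed
    qed
   qed
  qed
 qed
 then have sum: "is_sum X D f s" using s(1) by (simp add: is_sum_def gt_ray_def)
 have "{y : D. (1::real) : {0<..}} = D" by simp
 then have top: "s {0<..} = \<top>" using D(3) unfolding s_def weighted_def by simp
 have "f i {0<..} \<sqsubseteq> i" if "i : D" for i
 proof -
  have "{y : D. ind i y : {0<..}} = {i}" using that by (auto simp: ind_def)
  then have "f i {0<..} = \<Squnion> {i}" by (simp add: f_def weighted_def)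
  also have "\<dots> \<sqsubseteq> i" by (rule sup_least) (use that D(1) in auto)
  finally show ?thesis .
 qed
 then show ?thesis
  unfolding numerable_cover_def using D sum top f1 by (intro conjI exI[of _ f] exI[of _ s]) simp_all
qed

end

text \<open>The distance to the complement. The whole half line is treated apart because
  \<open>infdist\<close> to the empty set is 0.\<close>

definition open_weight :: "real set => real => real" where
 "open_weight A t = (if {0..} \<subseteq> A then 1 else infdist t ({0..} - A))"

lemma open_weight:
 assumes "A : carrier half_line"
 shows "continuous_on UNIV (open_weight A)" "open_weight A t \<ge> 0" "0 \<le> t ==> open_weight A t > 0 \<longleftrightarrow> t : A"
proof -
 show "continuous_on UNIV (open_weight A)"
 proof (cases "{0..} \<subseteq> A")
  case True
  then show ?thesis by (simp add: open_weight_def[abs_def])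
 next
  case False
  then show ?thesis by (simp add: open_weight_def[abs_def] continuous_on_infdist)
 qed
 show "open_weight A t \<ge> 0" by (simp add: open_weight_def infdist_nonneg)
 obtain T where T: "open T" "A = {0..} \<inter> T" using assms by (auto simp: half_line_open openin_open)
 have "{0..} - A = {0..} - T" using T by auto
 then have cl: "closed ({0..} - A)" using T(1) by (simp add: closed_Diff)
 assume t: "0 \<le> t"
 show "open_weight A t > 0 \<longleftrightarrow> t : A"
 proof (cases "{0..} \<subseteq> A")
  case True
  then show ?thesis using t by (auto simp: open_weight_def)
 next
  case False
  then have ne: "{0..} - A ~= {}" by auto
  show ?thesis
  proof
   assume "open_weight A t > 0"
   then show "t : A" using False t infdist_zero[of t "{0..} - A"] by (auto simp: open_weight_def)
  next
   assume "t : A"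
   then have "infdist t ({0..} - A) ~= 0" using in_closed_iff_infdist_zero[OF cl ne, of t] by blast
   then show "open_weight A t > 0" using False infdist_nonneg[of t "{0..} - A"] by (simp add: open_weight_def less_le)
  qed
 qed
qed

text \<open>The witnesses are the distances to the complements of \<open>A\<close> and
  \<open>B\<close>, composed with \<open>\<phi>\<close>; on \<open>A \<union> B\<close> they do not
  vanish simultaneously. If \<open>\<phi> A = \<phi> B\<close>, the family has a single member, the
  top element, and counts as a disjoint cover.\<close>

lemma (in half_line_hom) numerable_cover_two:
 assumes A: "A : carrier half_line" and B: "B : carrier half_line" and top: "\<phi> (A \<union> B) = \<top>"
 shows "numerable_cover X {\<phi> A, \<phi> B} (%x. x)"
proof (cases "\<phi> A = \<phi> B")
 case True
 have "\<Squnion> {\<phi> A, \<phi> B} = \<top>" using hom_Un[OF A B] top by simp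
 then show ?thesis by (intro numerable_cover_disjoint) (use True closed[OF A] closed[OF B] in auto)
next
 case False
 let ?C = "A \<union> B"
 have C: "?C : carrier half_line" by (rule half_line_Un[OF A B])
 let ?wA = "open_weight A" and ?wB = "open_weight B"
 note wA = open_weight[OF A] and wB = open_weight[OF B]
 let ?ws = "%t. ?wA t + ?wB t"
 define f where "f x = (\<lambda>V\<in>carrier half_line. \<phi> (?C \<inter> (if x = \<phi> A then ?wA else ?wB) -` V))" for x
 define s where "s = (\<lambda>V\<in>carrier half_line. \<phi> (?C \<inter> ?ws -` V))"
 have ws: "continuous_on UNIV ?ws" "?ws t \<ge> 0" for t
  using wA(1,2) wB(1,2) by (auto intro!: continuous_on_add add_nonneg_nonneg)
 have f: "frame_hom half_line X (f x)" for x
  unfolding f_def using pullback_continuous(1)[OF C top wA(1,2)] pullback_continuous(1)[OF C top wB(1,2)] by simp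
 have s: "frame_hom half_line X s"
  unfolding s_def by (rule pullback_continuous(1)[OF C top ws])
 note oA = pullback_continuous(2)[OF C top wA(1,2)] and oB = pullback_continuous(2)[OF C top wB(1,2)] and os = pullback_continuous(2)[OF C top ws]
 have fA: "f (\<phi> A) V = \<phi> (?C \<inter> ?wA -` V)" if "V : carrier half_line" for V using that by (simp add: f_def)
 have fB: "f (\<phi> B) V = \<phi> (?C \<inter> ?wB -` V)" if "V : carrier half_line" for V using that False by (simp add: f_def)
 let ?I = "{\<phi> A, \<phi> B}"
 interpret N: nonneg_functions X ?I f by unfold_locales (rule f)
 have "s (gt_ray c) = \<Squnion> {finite_sum X J f (gt_ray c) | J. finite J & J \<subseteq> ?I}" for c
 proof (rule antisymI)
  let ?R = "\<Squnion> {finite_sum X J f (gt_ray c) | J. finite J & J \<subseteq> ?I}"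
  have sc: "s (gt_ray c) = \<phi> (?C \<inter> ?ws -` gt_ray c)" by (simp add: s_def)
  have scc: "s (gt_ray c) : carrier X" unfolding sc by (rule closed[OF os]) simp
  show Rc: "?R : carrier X" by (rule sup_closed[OF N.sums_carrier])
  show "s (gt_ray c) : carrier X" by (rule scc)
  show "s (gt_ray c) \<sqsubseteq> ?R"
  proof -
   \<comment> \<open>That the two weights add up to more than \<open>c\<close> is witnessed by
     thresholds with \<open>p + q \<ge> c\<close>; each such pair gives a box in the partial sum
     over both indices.\<close>
   let ?N = "\<lambda>(p, q). (?C \<inter> ?wA -` gt_ray p) \<inter> (?C \<inter> ?wB -` gt_ray q)"
   have im: "?N ` {(p, q). p + q \<ge> c} \<subseteq> carrier half_line"
    using oA[OF ray_open(1)] oB[OF ray_open(1)] half_line_Int by auto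
   have sub: "?C \<inter> ?ws -` gt_ray c \<subseteq> \<Union> (?N ` {(p, q). p + q \<ge> c})"
   proof
    fix t assume t: "t : ?C \<inter> ?ws -` gt_ray c"
    \<comment> \<open>Half of the excess over \<open>c\<close>: lowering both weights by
      \<open>e\<close> gives thresholds whose sum is exactly \<open>c\<close>.\<close>
    define e where "e = (?ws t - c) / 2"
    have "e > 0" "?wA t - e + (?wB t - e) \<ge> c" using t by (auto simp: e_def field_simps)
    moreover have "t : ?N (?wA t - e, ?wB t - e)" using t \<open>e > 0\<close> wA(2)[of t] wB(2)[of t] by auto
    ultimately show "t : \<Union> (?N ` {(p, q). p + q \<ge> c})" by blast
   qed
   have "s (gt_ray c) \<sqsubseteq> \<phi> (\<Union> (?N ` {(p, q). p + q \<ge> c}))"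
    unfolding sc by (rule hom_mono[OF os half_line_Union[OF im] sub]) simp
   then have "s (gt_ray c) \<sqsubseteq> \<Squnion> (\<phi> ` ?N ` {(p, q). p + q \<ge> c})" unfolding hom_Union[OF im] .
   moreover have "\<Squnion> (\<phi> ` ?N ` {(p, q). p + q \<ge> c}) \<sqsubseteq> ?R"
   proof (rule sup_least[OF _ Rc])
    show "\<phi> ` ?N ` {(p, q). p + q \<ge> c} \<subseteq> carrier X" using im closed by auto
    fix b assume "b : \<phi> ` ?N ` {(p, q). p + q \<ge> c}"
    then obtain p q where pq: "p + q \<ge> c" "b = \<phi> ((?C \<inter> ?wA -` gt_ray p) \<inter> (?C \<inter> ?wB -` gt_ray q))" by auto
    note oo = oA[OF ray_open(1), of p] oB[OF ray_open(1), of q]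
    have b: "b = f (\<phi> A) (gt_ray p) \<sqinter> f (\<phi> B) (gt_ray q)"
     unfolding pq(2) fA[OF ray_open(1)] fB[OF ray_open(1)] by (rule hom_Int[OF oo])
    have fc: "f (\<phi> A) (gt_ray p) : carrier X" "f (\<phi> B) (gt_ray q) : carrier X" by (auto intro: N.f_closed)
    note m = meet_lower[OF fc, folded b]
    let ?A = "%x. if x = \<phi> A then gt_ray p else gt_ray q"
    have "b \<sqsubseteq> finite_sum X ?I f (gt_ray c)"
    proof (rule N.le_finite_sum[of _ ?A])
     have "(\<Sum>i\<in>?I. t i) : gt_ray c" if "\<forall>i\<in>?I. t i : ?A i" for t
     proof -
      have "t (\<phi> A) : gt_ray p" "t (\<phi> B) : gt_ray q" using that False by auto
      moreover have "(\<Sum>i\<in>?I. t i) = t (\<phi> A) + t (\<phi> B)" using False by simp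
      ultimately show ?thesis using pq(1) by simp
     qed
     then show "?A : N.boxes ?I (gt_ray c)" unfolding N.boxes_def by simp
     fix j assume "j : ?I"
     then show "b \<sqsubseteq> f j (?A j)" using m False by auto
    qed (use m in auto)
    moreover have "finite_sum X ?I f (gt_ray c) \<sqsubseteq> ?R"
     by (rule sup_upper[OF N.sums_carrier]) blast
    ultimately show "b \<sqsubseteq> ?R" by (rule trans)
   qed
   ultimately show ?thesis by (rule trans)
  qed
  show "?R \<sqsubseteq> s (gt_ray c)"
  proof (rule sup_least[OF N.sums_carrier scc])
   fix b assume "b : {finite_sum X J f (gt_ray c) | J. finite J & J \<subseteq> ?I}"
   then obtain J where J: "finite J" "J \<subseteq> ?I" "b = finite_sum X J f (gt_ray c)" by auto
   have "b \<sqsubseteq> b" unfolding J(3) by (rule le_refl[OF N.finite_sum_closed[OF J(2)]])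
   then show "b \<sqsubseteq> s (gt_ray c)"
    unfolding J(3)
   proof (rule N.finite_sum_cases[OF _ J(2) scc])
    fix V v assume V: "V : N.boxes J (gt_ray c)" "v : carrier X" "!!j. j : J ==> v \<sqsubseteq> f j (V j)"
    let ?w = "%x. if x = \<phi> A then ?wA else ?wB"
    \<comment> \<open>The part of the half line where the weights lie in the box. Since
      \<open>v\<close> lies over it, the comparison with \<open>c\<close> can be made for real
      numbers.\<close>
    let ?S = "%K. ?C \<inter> (\<Inter>j\<in>K. ?w j -` V j)"
    have Vo: "V j : carrier half_line" if "j : J" for j using V(1) that by (simp add: N.boxes_def)
    have "?S K : carrier half_line & v \<sqsubseteq> \<phi> (?S K)" if "finite K" "K \<subseteq> J" for K
     using that
    proof (induction K rule: finite_induct)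
     case empty
     then show ?case using C top V(2) by simp
    next
     case (insert j K)
     have o: "?C \<inter> ?w j -` V j : carrier half_line" using oA[OF Vo[of j]] oB[OF Vo[of j]] insert.prems by (cases "j = \<phi> A") simp_all
     have IH: "?S K : carrier half_line" "v \<sqsubseteq> \<phi> (?S K)" using insert.IH insert.prems by auto
     have eq: "?S (insert j K) = (?C \<inter> ?w j -` V j) \<inter> ?S K" by auto
     have "v \<sqsubseteq> f j (V j)" using V(3) insert.prems by simp
     then have "v \<sqsubseteq> \<phi> (?C \<inter> ?w j -` V j)" using Vo insert.prems by (simp add: f_def)
     then have "v \<sqsubseteq> \<phi> (?S (insert j K))"
      unfolding eq hom_Int[OF o IH(1)] by (rule meet_greatest[OF _ IH(2) V(2) closed[OF o] closed[OF IH(1)]])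
     then show ?case unfolding eq using half_line_Int[OF o IH(1)] by simp
    qed
    then have S: "?S J : carrier half_line" "v \<sqsubseteq> \<phi> (?S J)" using J(1) by auto
    have "?S J \<subseteq> ?C \<inter> ?ws -` gt_ray c"
    proof
     fix t assume t: "t : ?S J"
     then have "\<forall>j\<in>J. ?w j t : V j" by auto
     then have "(\<Sum>j\<in>J. ?w j t) : gt_ray c"
      using V(1) unfolding N.boxes_def mem_Collect_eq by (elim conjE allE[of _ "%j. ?w j t"]) simp
     moreover have "(\<Sum>j\<in>J. ?w j t) \<le> (\<Sum>j\<in>?I. ?w j t)"
      by (rule sum_mono2) (use J wA(2) wB(2) in auto)
     moreover have "(\<Sum>j\<in>?I. ?w j t) = ?ws t" using False by auto
     ultimately show "t : ?C \<inter> ?ws -` gt_ray c" using t by simp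
    qed
    then show "v \<sqsubseteq> s (gt_ray c)"
     unfolding sc by (intro trans[OF S(2) hom_mono[OF S(1) os]]) simp_all
   qed
  qed
 qed
 then have sum: "is_sum X ?I f s" using s by (simp add: is_sum_def gt_ray_def)
 have "?C \<inter> ?ws -` {0<..} = ?C"
 proof -
  have "?ws t > 0" if "t : ?C" for t
  proof -
   have "0 \<le> t" using that half_line_sub[OF C] by auto
   then have "?wA t > 0 \<or> ?wB t > 0" using that wA(3)[of t] wB(3)[of t] by auto
   then show ?thesis using wA(2)[of t] wB(2)[of t] by linarith
  qed
  then show ?thesis by auto
 qed
 then have stop: "s {0<..} = \<top>" using top by (simp add: s_def)
 have "?C \<inter> ?wA -` {0<..} \<subseteq> A" "?C \<inter> ?wB -` {0<..} \<subseteq> B"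
  using wA(3) wB(3) half_line_sub[OF C] by auto
 then have "f (\<phi> A) {0<..} \<sqsubseteq> \<phi> A" "f (\<phi> B) {0<..} \<sqsubseteq> \<phi> B"
  using hom_mono[OF oA A, of "{0<..}"] hom_mono[OF oB B, of "{0<..}"] by (simp_all add: fA fB)
 then have "\<forall>i\<in>?I. f i {0<..} \<sqsubseteq> i" by simp
 moreover have "\<Squnion> ?I = \<top>" using hom_Un[OF A B] top by simp
 ultimately show ?thesis
  unfolding numerable_cover_def using sum stop f A B by (intro conjI exI[of _ f] exI[of _ s]) simp_all
qed

subsection \<open>Open arrows of a numerable site\<close>

context numerable_site
begin

text \<open>These arrows behave like open subobjects of \<open>M\<close>: by
  \<open>opn_factor\<close> below, the open \<open>im q\<close> decides which arrows to
  \<open>M\<close> factor through \<open>q\<close>.\<close>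

definition opn :: "'o => 'm => bool" where
 "opn M q \<longleftrightarrow> q : ar S & tgt S q = M & cartesian S Loc U q & open_embedding (on_ar U q)"

definition im :: "'m => 'a" where "im q = image_open (on_ar U q)"

lemma U_ob: "M : ob S ==> frame_lattice (on_ob U M)"
 using functor_to_Loc by (simp add: is_functor_def flip: Loc_ob)

lemma U_ar:
 assumes "f : ar S"
 shows "on_ar U f : ar Loc" "arr_src (on_ar U f) = on_ob U (src S f)" "arr_tgt (on_ar U f) = on_ob U (tgt S f)"
 using functor_to_Loc assms by (simp_all add: is_functor_def)

lemma U_cmp: "[|f : ar S; g : ar S; src S g = tgt S f|] ==> on_ar U (cmp S g f) = cmp Loc (on_ar U g) (on_ar U f)"
 using functor_to_Loc by (simp add: is_functor_def)

lemma opnD: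
 assumes "opn M q"
 shows "q : ar S" "tgt S q = M" "cartesian S Loc U q" "open_embedding_onto (on_ar U q) (im q)" "M : ob S" "src S q : ob S"
  "im q : carrier (on_ob U M)"
proof -
 obtain u where u: "open_embedding_onto (on_ar U q) u" using assms by (auto simp: opn_def open_embedding_def)
 show q: "q : ar S" "tgt S q = M" "cartesian S Loc U q" using assms by (simp_all add: opn_def)
 show o: "open_embedding_onto (on_ar U q) (im q)" using u image_open[OF u] by (simp add: im_def)
 show "M : ob S" "src S q : ob S" using tgt_ob[OF q(1)] src_ob[OF q(1)] q(2) by simp_all
 show "im q : carrier (on_ob U M)" using open_embedding_ontoD(2)[OF o] U_ar(3)[OF q(1)] q(2) by simp
qed

lemma opnI:
 assumes "cartesian S Loc U q" "tgt S q = M" "open_embedding_onto (on_ar U q) v"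
 shows "opn M q" "im q = v"
 using assms image_open[OF assms(3)] by (auto simp: opn_def cartesian_def open_embedding_def im_def)

lemma U_frames:
 assumes "q : ar S"
 shows "two_frames (on_ob U (tgt S q)) (on_ob U (src S q)) (arr_map (on_ar U q))"
 using Loc_arD[OF U_ar(1)[OF assms]] U_ar(2,3)[OF assms] by simp

lemma U_cmp_map:
 assumes "f : ar S" "g : ar S" "src S g = tgt S f" "x : carrier (on_ob U (tgt S g))"
 shows "arr_map (on_ar U (cmp S g f)) x = arr_map (on_ar U f) (arr_map (on_ar U g) x)"
 unfolding U_cmp[OF assms(1-3)] by (rule Loc_cmp_map) (use U_ar(3)[OF assms(2)] assms(4) in simp)

lemma opn_top:
 assumes "opn M q" "a : ar S" "tgt S a = src S q"
 shows "arr_map (on_ar U (cmp S q a)) (im q) = \<top>\<^bsub>on_ob U (src S a)\<^esub>"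
proof -
 note q = opnD[OF assms(1)]
 interpret A: two_frames "on_ob U (tgt S a)" "on_ob U (src S a)" "arr_map (on_ar U a)" by (rule U_frames[OF assms(2)])
 have "arr_map (on_ar U q) (im q) = \<top>\<^bsub>on_ob U (src S q)\<^esub>"
  using open_embedding_ontoD(3)[OF q(4)] U_ar(2)[OF q(1)] by simp
 then show ?thesis using U_cmp_map[OF assms(2) q(1) assms(3)[symmetric], of "im q"] q A.hom_top assms(3) by simp
qed

text \<open>The open embedding provides the factorization in locales and its uniqueness;
  cartesianness lifts it to \<open>S\<close>.\<close>

lemma opn_factor:
 assumes q: "opn M q" and e: "e : ar S" "tgt S e = M" "arr_map (on_ar U e) (im q) = \<top>\<^bsub>on_ob U (src S e)\<^esub>"
 shows "\<exists>!a. a : ar S & src S a = src S e & tgt S a = src S q & cmp S q a = e"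
proof -
 note q' = opnD[OF q]
 note Ue = U_ar[OF e(1)] and Uq = U_ar[OF q'(1)]
 have "\<exists>g\<in>ar Loc. arr_src g = arr_src (on_ar U e) & arr_tgt g = arr_src (on_ar U q) & cmp Loc (on_ar U q) g = on_ar U e"
  by (rule open_embedding_factor[OF q'(4) Ue(1)]) (use Ue Uq e q' in simp_all)
 then obtain g where g: "g : ar Loc" "arr_src g = arr_src (on_ar U e)" "arr_tgt g = arr_src (on_ar U q)" "cmp Loc (on_ar U q) g = on_ar U e"
  by (elim bexE conjE)
 have g': "src Loc g = on_ob U (src S e)" "tgt Loc g = on_ob U (src S q)" using g(2,3) Ue Uq by simp_all
 have te: "tgt S e = tgt S q" using e(2) q'(2) by simp
 have "\<exists>!a. a : ar S & src S a = src S e & tgt S a = src S q & cmp S q a = e & on_ar U a = g"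
  using q'(3)[unfolded cartesian_def, THEN conjunct2, rule_format, OF e(1) g(1) conjI[OF te conjI[OF g'(1) conjI[OF g'(2) g(4)]]]] .
 moreover have "on_ar U a = g" if a: "a : ar S" "src S a = src S e" "tgt S a = src S q" "cmp S q a = e" for a
 proof (rule open_embedding_mono[OF q'(4) _ g(1)])
  note Ua = U_ar[OF a(1)]
  show "on_ar U a : ar Loc" "arr_tgt (on_ar U a) = arr_src (on_ar U q)" "arr_tgt g = arr_src (on_ar U q)"
   using Ua g(3) a(3) Uq by simp_all
  show "cmp Loc (on_ar U q) (on_ar U a) = cmp Loc (on_ar U q) g"
   using U_cmp[OF a(1) q'(1) a(3)[symmetric]] a(4) g(4) by simp
 qed
 ultimately show ?thesis by metis
qed

lemma opn_cancel:
 assumes "opn M q" "a : ar S" "b : ar S" "tgt S a = src S q" "tgt S b = src S q" "cmp S q a = cmp S q b"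
 shows "a = b"
proof -
 note q = opnD[OF assms(1)]
 note ca = cmp_ar[OF assms(2) q(1) assms(4)[symmetric]] and cb = cmp_ar[OF assms(3) q(1) assms(5)[symmetric]]
 have s: "src S a = src S b" using ca cb assms(6) by simp
 have t: "arr_map (on_ar U (cmp S q a)) (im q) = \<top>\<^bsub>on_ob U (src S (cmp S q a))\<^esub>"
  using opn_top[OF assms(1,2,4)] ca by simp
 have e: "cmp S q a : ar S" "tgt S (cmp S q a) = M" using ca q(2) by simp_all
 show ?thesis
  using opn_factor[OF assms(1) e t] assms(2-6) ca s by (elim ex1E) metis
qed

lemma induced:
 assumes "opn M q" "e : ar S" "tgt S e = M" "arr_map (on_ar U e) (im q) = \<top>\<^bsub>on_ob U (src S e)\<^esub>"
 shows "induced S q e : ar S" "src S (induced S q e) = src S e" "tgt S (induced S q e) = src S q" "cmp S q (induced S q e) = e"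
 using theI'[OF opn_factor[OF assms]] by (simp_all add: induced_def)

lemma induced_eq:
 assumes "opn M q" "a : ar S" "tgt S a = src S q" "cmp S q a = e"
 shows "induced S q e = a"
proof -
 note q = opnD[OF assms(1)]
 note c = cmp_ar[OF assms(2) q(1) assms(3)[symmetric]]
 have e: "e : ar S" "tgt S e = M" "src S e = src S a" using c q(2) assms(4) by simp_all
 have t: "arr_map (on_ar U e) (im q) = \<top>\<^bsub>on_ob U (src S e)\<^esub>"
  using opn_top[OF assms(1-3)] e(3) assms(4) by simp
 note i = induced[OF assms(1) e(1,2) t]
 show ?thesis by (rule opn_cancel[OF assms(1) i(1) assms(2) i(3) assms(3)]) (use i(4) assms(4) in simp)
qed

lemma opn_le:
 assumes "opn M q" "opn M q'"
 shows "arr_map (on_ar U q') (im q) = \<top>\<^bsub>on_ob U (src S q')\<^esub> \<longleftrightarrow> im q' \<sqsubseteq>\<^bsub>on_ob U M\<^esub> im q"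
proof -
 note q = opnD[OF assms(1)] and q' = opnD[OF assms(2)]
 show ?thesis
  using open_embedding_top_iff[OF q'(4), of "im q"] q(7) U_ar(2,3)[OF q'(1)] q'(2) by simp
qed

lemma induced_opn:
 assumes "opn M q" "opn M q'" "im q' \<sqsubseteq>\<^bsub>on_ob U M\<^esub> im q"
 shows "induced S q q' : ar S" "src S (induced S q q') = src S q'" "tgt S (induced S q q') = src S q" "cmp S q (induced S q q') = q'"
 using induced[OF assms(1) opnD(1,2)[OF assms(2)]] opn_le[OF assms(1,2)] assms(3) by simp_all

lemma induced_comp:
 assumes "opn M q" "opn M q'" "im q' \<sqsubseteq>\<^bsub>on_ob U M\<^esub> im q"
  "e : ar S" "tgt S e = M" "arr_map (on_ar U e) (im q') = \<top>\<^bsub>on_ob U (src S e)\<^esub>"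
 shows "induced S q e = cmp S (induced S q q') (induced S q' e)"
proof -
 note i = induced_opn[OF assms(1-3)] and j = induced[OF assms(2,4-6)]
 have "src S (induced S q q') = tgt S (induced S q' e)" using i j by simp
 note c = cmp_ar[OF j(1) i(1) this]
 show ?thesis
 proof (rule induced_eq[OF assms(1)])
  show "cmp S q (cmp S (induced S q q') (induced S q' e)) = e"
   using cmp_assoc[OF j(1) i(1) opnD(1)[OF assms(1)]] i j by simp
 qed (use c i in simp_all)
qed

lemma idn_opn:
 assumes M: "M : ob S"
 shows "opn M (idn S M)" "im (idn S M) = \<top>\<^bsub>on_ob U M\<^esub>"
proof -
 note i = idn_ar[OF M]
 interpret X: frame_lattice "on_ob U M" by (rule U_ob[OF M])
 have Ui: "on_ar U (idn S M) = idn Loc (on_ob U M)" using functor_to_Loc M by (simp add: is_functor_def)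
 have "cartesian S Loc U (idn S M)"
  unfolding cartesian_def
 proof (intro conjI ballI impI)
  show "idn S M : ar S" using i by simp
  fix f g assume f: "f : ar S" and g: "g : ar Loc"
   and fg: "tgt S f = tgt S (idn S M) & src Loc g = on_ob U (src S f) & tgt Loc g = on_ob U (src S (idn S M)) & cmp Loc (on_ar U (idn S M)) g = on_ar U f"
  have "tgt S f = M" using fg i by simp
  have "cmp Loc (idn Loc (tgt Loc g)) g = g" by (rule category.cmp_idn_left[OF Loc_category g])
  moreover have "tgt Loc g = on_ob U M" using fg i by simp
  ultimately have "cmp Loc (on_ar U (idn S M)) g = g" unfolding Ui by (simp only:)
  then have g': "on_ar U f = g" using fg by (elim conjE) (simp only:)
  have l: "cmp S (idn S M) k = k" if "k : ar S" "tgt S k = M" for k using cmp_idn_left[OF that(1)] that(2) by simp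
  show "\<exists>!k. k : ar S & src S k = src S f & tgt S k = src S (idn S M) & cmp S (idn S M) k = f & on_ar U k = g"
   by (rule ex1I[of _ f]) (use f g' l i \<open>tgt S f = M\<close> in auto)
 qed
 moreover have "open_embedding_onto (on_ar U (idn S M)) \<top>\<^bsub>on_ob U M\<^esub>"
 proof (rule open_embedding_ontoI)
  show "on_ar U (idn S M) : ar Loc" using U_ar(1) i by blast
  have "{x : carrier (on_ob U M). x \<sqsubseteq>\<^bsub>on_ob U M\<^esub> \<top>\<^bsub>on_ob U M\<^esub>} = carrier (on_ob U M)" by auto
  moreover have "bij_betw (\<lambda>x\<in>carrier (on_ob U M). x) (carrier (on_ob U M)) (carrier (on_ob U M))"
   by (auto simp: bij_betw_def inj_on_def image_iff)
  ultimately show "bij_betw (arr_map (on_ar U (idn S M)))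
   {x : carrier (arr_tgt (on_ar U (idn S M))). x \<sqsubseteq>\<^bsub>arr_tgt (on_ar U (idn S M))\<^esub> \<top>\<^bsub>on_ob U M\<^esub>} (carrier (arr_src (on_ar U (idn S M))))"
   unfolding Ui by simp
 qed (simp_all add: Ui)
 moreover have "tgt S (idn S M) = M" using i by blast
 ultimately show "opn M (idn S M)" "im (idn S M) = \<top>\<^bsub>on_ob U M\<^esub>" using opnI by (simp_all only:)
qed

lemma opn_exists:
 assumes M: "M : ob S" and w: "w : carrier (on_ob U M)"
 obtains q where "opn M q" "on_ar U q = open_inclusion (on_ob U M) w" "im q = w"
proof -
 have o: "open_embedding_onto (open_inclusion (on_ob U M) w) w" by (rule open_inclusion_onto[OF U_ob[OF M] w])
 then have "open_embedding (open_inclusion (on_ob U M) w)" by (auto simp: open_embedding_def)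
 moreover have "tgt Loc (open_inclusion (on_ob U M) w) = on_ob U M" by simp
 ultimately obtain k where k: "cartesian S Loc U k" "tgt S k = M" "on_ar U k = open_inclusion (on_ob U M) w"
  using cartesian_lifts[OF M] by blast
 show ?thesis by (rule that[of k]) (use opnI[OF k(1,2)] k(3) o in simp_all)
qed

text \<open>The hypotheses on \<open>F\<close> concern covering families of one object; this turns
  open arrows over \<open>M\<close> into open arrows to the source of \<open>q\<close>.
  Factorizations through \<open>q'\<close> over \<open>M\<close> give those through the induced
  arrow, because \<open>q\<close> is a monomorphism.\<close>

lemma induced_opn_opn:
 assumes q: "opn M q" and q': "opn M q'" and le: "im q' \<sqsubseteq>\<^bsub>on_ob U M\<^esub> im q"
 shows "opn (src S q) (induced S q q')" "im (induced S q q') = arr_map (on_ar U q) (im q')"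
proof -
 let ?p = "induced S q q'"
 note p = induced_opn[OF assms] and q1 = opnD[OF q] and q1' = opnD[OF q']
 let ?X = "on_ob U M" and ?Y = "on_ob U (src S q)" and ?h = "arr_map (on_ar U q)"
 interpret H: two_frames ?X ?Y ?h using U_frames[OF q1(1)] q1(2) by simp
 interpret P: two_frames ?Y "on_ob U (src S q')" "arr_map (on_ar U ?p)" using U_frames[OF p(1)] p(2,3) by simp
 interpret H': two_frames ?X "on_ob U (src S q')" "arr_map (on_ar U q')" using U_frames[OF q1'(1)] q1'(2) by simp
 have map: "arr_map (on_ar U ?p) (?h x) = arr_map (on_ar U q') x" if "x : carrier ?X" for x
  using U_cmp_map[OF p(1) q1(1) p(3)[symmetric], of x] that p(4) q1(2) by simp
 have "cartesian S Loc U ?p"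
  unfolding cartesian_def
 proof (intro conjI ballI impI)
  show "?p : ar S" by (rule p(1))
  fix f g assume f: "f : ar S" and g: "g : ar Loc"
   and fg: "tgt S f = tgt S ?p & src Loc g = on_ob U (src S f) & tgt Loc g = on_ob U (src S ?p) & cmp Loc (on_ar U ?p) g = on_ar U f"
  have tf: "src S q = tgt S f" using fg p(3) by simp
  note e = cmp_ar[OF f q1(1) tf]
  have "arr_map (on_ar U (cmp S q f)) (im q') = arr_map (on_ar U f) (?h (im q'))"
   by (rule U_cmp_map[OF f q1(1) tf]) (use q1'(7) q1(2) in simp)
  also have "on_ar U f = cmp Loc (on_ar U ?p) g" using fg by (elim conjE) (rule sym)
  also have "arr_map \<dots> (?h (im q')) = arr_map g (arr_map (on_ar U ?p) (?h (im q')))"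
   by (rule Loc_cmp_map) (use U_ar(3)[OF p(1)] p(3) H.closed[OF q1'(7)] in simp)
  also have "arr_map (on_ar U ?p) (?h (im q')) = \<top>\<^bsub>on_ob U (src S q')\<^esub>"
   using map[OF q1'(7)] open_embedding_ontoD(3)[OF q1'(4)] U_ar(2)[OF q1'(1)] by simp
  also have "arr_map g \<dots> = \<top>\<^bsub>on_ob U (src S f)\<^esub>"
  proof -
   interpret G: two_frames "arr_tgt g" "arr_src g" "arr_map g" by (rule Loc_arD[OF g])
   show ?thesis using G.hom_top fg p(2) by simp
  qed
  finally have "arr_map (on_ar U (cmp S q f)) (im q') = \<top>\<^bsub>on_ob U (src S (cmp S q f))\<^esub>" using e by simp
  then have "\<exists>!a. a : ar S & src S a = src S (cmp S q f) & tgt S a = src S q' & cmp S q' a = cmp S q f"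
   by (intro opn_factor[OF q']) (use e q1(2) in simp_all)
  then have "\<exists>a. a : ar S & src S a = src S (cmp S q f) & tgt S a = src S q' & cmp S q' a = cmp S q f"
   by (rule ex1_implies_ex)
  then obtain a where a: "a : ar S" "src S a = src S f" "tgt S a = src S q'" "cmp S q' a = cmp S q f"
   using e by (elim exE conjE) simp
  have ta: "src S ?p = tgt S a" using a(3) p(2) by simp
  note pa = cmp_ar[OF a(1) p(1) ta]
  have pf: "cmp S ?p a = f"
  proof (rule opn_cancel[OF q _ f])
   show "cmp S q (cmp S ?p a) = cmp S q f"
    using cmp_assoc[OF a(1) p(1) q1(1) ta p(3)[symmetric]] p(4) a(4) by simp
  qed (use pa p tf in simp_all)
  have ug: "on_ar U a = g"
  proof (rule open_embedding_mono[OF q1'(4) U_ar(1)[OF a(1)] g])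
   show "arr_tgt (on_ar U a) = arr_src (on_ar U q')" using U_ar(3)[OF a(1)] U_ar(2)[OF q1'(1)] a(3) by simp
   show "arr_tgt g = arr_src (on_ar U q')" using fg p(2) U_ar(2)[OF q1'(1)] by simp
   have "cmp Loc (on_ar U q') g = cmp Loc (cmp Loc (on_ar U q) (on_ar U ?p)) g"
    using U_cmp[OF p(1) q1(1) p(3)[symmetric]] p(4) by simp
   also have "\<dots> = cmp Loc (on_ar U q) (cmp Loc (on_ar U ?p) g)"
    by (rule category.cmp_assoc[OF Loc_category g U_ar(1)[OF p(1)] U_ar(1)[OF q1(1)], symmetric])
     (use fg U_ar(2)[OF p(1)] U_ar(3)[OF p(1)] U_ar(2)[OF q1(1)] p(3) in simp_all)
   also have "cmp Loc (on_ar U ?p) g = on_ar U f" using fg by (elim conjE)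
   also have "cmp Loc (on_ar U q) (on_ar U f) = on_ar U (cmp S q' a)" using U_cmp[OF f q1(1) tf] a(4) by simp
   also have "\<dots> = cmp Loc (on_ar U q') (on_ar U a)" by (rule U_cmp[OF a(1) q1'(1) a(3)[symmetric]])
   finally show "cmp Loc (on_ar U q') (on_ar U a) = cmp Loc (on_ar U q') g" by (rule sym)
  qed
  show "\<exists>!k. k : ar S & src S k = src S f & tgt S k = src S ?p & cmp S ?p k = f & on_ar U k = g"
  proof (rule ex1I[of _ a])
   show "a : ar S & src S a = src S f & tgt S a = src S ?p & cmp S ?p a = f & on_ar U a = g"
    using a ta pf ug by simp
   fix k assume k: "k : ar S & src S k = src S f & tgt S k = src S ?p & cmp S ?p k = f & on_ar U k = g"
   show "k = a"
   proof (rule opn_cancel[OF q' _ a(1)])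
    have "cmp S q' k = cmp S q (cmp S ?p k)"
     using cmp_assoc[OF _ p(1) q1(1) _ p(3)[symmetric], of k] k p(4) by simp
    then show "cmp S q' k = cmp S q' a" using k a(4) by simp
   qed (use k a p in simp_all)
  qed
 qed
 moreover have "open_embedding_onto (on_ar U ?p) (?h (im q'))"
 proof (rule open_embedding_ontoI)
  show "on_ar U ?p : ar Loc" by (rule U_ar(1)[OF p(1)])
  note Up = U_ar[OF p(1)] and Uq = U_ar[OF q1(1)] and Uq' = U_ar[OF q1'(1)]
  note v = q1'(7)
  show "?h (im q') : carrier (arr_tgt (on_ar U ?p))" using Up(3) p(3) H.closed[OF v] by simp
  show "arr_map (on_ar U ?p) (?h (im q')) = \<top>\<^bsub>arr_src (on_ar U ?p)\<^esub>"
   using map[OF v] open_embedding_ontoD(3)[OF q1'(4)] Uq'(2) Up(2) p(2) by simp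
  have bq: "bij_betw ?h {x : carrier ?X. x \<sqsubseteq>\<^bsub>?X\<^esub> im q} (carrier ?Y)"
   using open_embedding_ontoD(4)[OF q1(4)] Uq q1(2) by simp
  have bq': "bij_betw (arr_map (on_ar U q')) {x : carrier ?X. x \<sqsubseteq>\<^bsub>?X\<^esub> im q'} (carrier (on_ob U (src S q')))"
   using open_embedding_ontoD(4)[OF q1'(4)] Uq' q1'(2) by simp
  let ?D = "{x : carrier ?X. x \<sqsubseteq>\<^bsub>?X\<^esub> im q'}" and ?E = "{y : carrier ?Y. y \<sqsubseteq>\<^bsub>?Y\<^esub> ?h (im q')}"
  have "bij_betw ?h ?D ?E"
  proof (rule bij_betw_imageI)
   have "?D \<subseteq> {x : carrier ?X. x \<sqsubseteq>\<^bsub>?X\<^esub> im q}" using H.X.trans[OF _ le] by auto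
   then show "inj_on ?h ?D" using bq unfolding bij_betw_def by (elim conjE) (rule inj_on_subset)
   show "?h ` ?D = ?E"
   proof (intro equalityI subsetI)
    fix y assume "y : ?h ` ?D"
    then show "y : ?E" using H.closed H.mono by auto
   next
    fix y assume y: "y : ?E"
    then obtain x where x: "x : carrier ?X" "y = ?h x" using bq unfolding bij_betw_def by auto
    note m = H.X.meet_lower[OF v x(1)]
    have "?h (im q' \<sqinter>\<^bsub>?X\<^esub> x) = y"
     using H.hom_meet[OF v x(1)] y x(2) H.Y.meet_absorb(2)[of y "?h (im q')"] H.closed[OF v] by simp
    then show "y : ?h ` ?D" using m by (intro image_eqI[of _ _ "im q' \<sqinter>\<^bsub>?X\<^esub> x"]) simp_all
   qed
  qed
  moreover have "bij_betw (arr_map (on_ar U ?p) \<circ> ?h) ?D (carrier (on_ob U (src S q')))"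
   using bq' by (subst bij_betw_cong[where g = "arr_map (on_ar U q')"]) (simp_all add: map)
  ultimately have "bij_betw (arr_map (on_ar U ?p)) ?E (carrier (on_ob U (src S q')))"
   by (simp add: bij_betw_comp_iff)
  then show "bij_betw (arr_map (on_ar U ?p)) {x : carrier (arr_tgt (on_ar U ?p)). x \<sqsubseteq>\<^bsub>arr_tgt (on_ar U ?p)\<^esub> ?h (im q')}
   (carrier (arr_src (on_ar U ?p)))"
   using Up p by simp
 qed
 ultimately show "opn (src S q) ?p" "im ?p = ?h (im q')" using opnI[OF _ p(3)] by (simp_all only:)
qed

end

context numerable_site
begin

subsection \<open>Numerable families are covering families\<close>

text \<open>Since covering families are created by \<open>U\<close>, it suffices to cover in
  \<open>Loc\<close>. There the images of the arrows in \<open>P\<close> generate the same sieve as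
  the inclusions of their image opens, which belong to the coverage.\<close>

lemma open_covering:
 assumes Z: "Z : ob S" and P: "!!p. p : P ==> opn Z p" and num: "numerable_cover (on_ob U Z) (im ` P) (%x. x)"
 shows "open_covering_family S K U Z P (%r. r)"
proof -
 let ?X = "on_ob U Z"
 interpret X: frame_lattice ?X by (rule U_ob[OF Z])
 have tgtU: "arr_tgt (on_ar U p) = ?X" if "p : P" for p using U_ar(3)[OF opnD(1)[OF P[OF that]]] opnD(2)[OF P[OF that]] by simp
 \<comment> \<open>Two open embeddings onto the same open factor through each other, so they
   generate the same sieve.\<close>
 have swap: "\<exists>g'\<in>ar Loc. arr_tgt g' = arr_src h' & cmp Loc h' g' = cmp Loc h g"
  if h: "open_embedding_onto h v" "arr_tgt h = ?X" and h': "open_embedding_onto h' v" "arr_tgt h' = ?X"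
   and g: "g : ar Loc" "arr_tgt g = arr_src h" for h h' v g
 proof -
  note hh = open_embedding_ontoD[OF h(1)]
  have c: "cmp Loc h g : ar Loc" using category.cmp_ar[OF Loc_category g(1) hh(1)] g(2) by simp
  interpret G: two_frames "arr_tgt g" "arr_src g" "arr_map g" by (rule Loc_arD[OF g(1)])
  have "arr_map (cmp Loc h g) v = \<top>\<^bsub>arr_src g\<^esub>"
   unfolding Loc_cmp_map[OF hh(2)] hh(3) using G.hom_top g(2) by simp
  then have "\<exists>g'\<in>ar Loc. arr_src g' = arr_src (cmp Loc h g) & arr_tgt g' = arr_src h' & cmp Loc h' g' = cmp Loc h g"
   by (intro open_embedding_factor[OF h'(1) c]) (use h h' in simp_all)
  then show ?thesis by blast
 qed
 have onto: "open_embedding_onto (on_ar U p) (im p)" "open_embedding_onto (open_inclusion ?X (im p)) (im p)" if "p : P" for p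
  by (rule opnD(4)[OF P[OF that]], rule open_inclusion_onto[OF X.frame_lattice_axioms opnD(7)[OF P[OF that]]])
 have "generated_sieve Loc (on_ar U ` P) = generated_sieve Loc ((%i. open_inclusion ?X i) ` im ` P)"
 proof (intro equalityI subsetI)
  fix e assume "e : generated_sieve Loc (on_ar U ` P)"
  then obtain p g where pg: "p : P" "g : ar Loc" "tgt Loc g = src Loc (on_ar U p)" "e = cmp Loc (on_ar U p) g"
   unfolding generated_sieve_def by auto
  have "\<exists>g'\<in>ar Loc. arr_tgt g' = arr_src (open_inclusion ?X (im p)) & cmp Loc (open_inclusion ?X (im p)) g' = cmp Loc (on_ar U p) g"
   by (rule swap[OF onto(1)[OF pg(1)] tgtU[OF pg(1)] onto(2)[OF pg(1)] _ pg(2)]) (use pg(3) in simp_all)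
  then obtain g' where g': "g' : ar Loc" "arr_tgt g' = arr_src (open_inclusion ?X (im p))" "cmp Loc (open_inclusion ?X (im p)) g' = e"
   unfolding pg(4) by (elim bexE conjE)
  show "e : generated_sieve Loc ((%i. open_inclusion ?X i) ` im ` P)"
   unfolding generated_sieve_def mem_Collect_eq
   by (rule exI[of _ "open_inclusion ?X (im p)"], rule exI[of _ g']) (use g' pg(1) in simp)
 next
  fix e assume "e : generated_sieve Loc ((%i. open_inclusion ?X i) ` im ` P)"
  then obtain p g where pg: "p : P" "g : ar Loc" "tgt Loc g = src Loc (open_inclusion ?X (im p))" "e = cmp Loc (open_inclusion ?X (im p)) g"
   unfolding generated_sieve_def by auto
  have "\<exists>g'\<in>ar Loc. arr_tgt g' = arr_src (on_ar U p) & cmp Loc (on_ar U p) g' = cmp Loc (open_inclusion ?X (im p)) g"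
   by (rule swap[OF onto(2)[OF pg(1)] _ onto(1)[OF pg(1)] tgtU[OF pg(1)] pg(2)]) (use pg(3) in simp_all)
  then obtain g' where g': "g' : ar Loc" "arr_tgt g' = arr_src (on_ar U p)" "cmp Loc (on_ar U p) g' = e"
   unfolding pg(4) by (elim bexE conjE)
  show "e : generated_sieve Loc (on_ar U ` P)"
   unfolding generated_sieve_def mem_Collect_eq
   by (rule exI[of _ "on_ar U p"], rule exI[of _ g']) (use g' pg(1) in simp)
 qed
 moreover have "covering_sieve Loc numerable_coverage ?X (generated_sieve Loc ((%i. open_inclusion ?X i) ` im ` P))"
 proof (rule covering_sieve.generating)
  show "?X : ob Loc" by (rule frame_lattice_iff[THEN iffD1, OF X.frame_lattice_axioms])
  show "(%i. open_inclusion ?X i) ` im ` P : numerable_coverage ?X" 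
   unfolding numerable_coverage_def mem_Collect_eq
   by (rule exI[of _ "im ` P"], rule exI[of _ "%x. x"]) (intro conjI HOL.refl num)
 qed
 moreover have "?X : ob Loc" by (rule frame_lattice_iff[THEN iffD1, OF X.frame_lattice_axioms])
 moreover have "on_ar U ` P \<subseteq> arrows_to Loc ?X"
 proof (rule image_subsetI)
  fix p assume p: "p : P"
  have "tgt Loc (on_ar U p) = ?X" using tgtU[OF p] by (simp add: Loc_simps)
  then show "on_ar U p : arrows_to Loc ?X" unfolding arrows_to_def using U_ar(1)[OF opnD(1)[OF P[OF p]]] by blast
 qed
 ultimately have "covering_family Loc numerable_coverage ?X (on_ar U ` P)"
  unfolding covering_family_def by (simp only:)
 moreover have "P \<subseteq> arrows_to S Z" unfolding arrows_to_def using opnD(1,2)[OF P] by blast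
 ultimately have "covering_family S K Z P"
  using creates_covering_families[OF Z] by blast
 moreover have "\<forall>p\<in>P. cartesian S Loc U p & open_embedding (on_ar U p)"
 proof
  fix p assume "p : P"
  from P[OF this] show "cartesian S Loc U p & open_embedding (on_ar U p)" unfolding opn_def by (elim conjE) (intro conjI)
 qed
 ultimately show ?thesis unfolding open_covering_family_def image_ident by (rule conjI)
qed

end

subsection \<open>Presheaves of cochain complexes on a numerable site\<close>

locale sheaf_site = numerable_site S K U
 for S :: "('o, 'm) category"
  and K :: "'o => 'm set set"
  and U :: "('o, 'm, 'a gorder, ('a gorder, 'a => 'a) arrow) funct" +
 fixes F :: "('o, 'm, 'v cochain, int => 'v => 'v) funct"
 assumes presheaf: "cochain_presheaf S F"
  and sheaf: "is_sheaf S K U (degree_presheaf F n)"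
  and surjective: "differences_surjective S K U (degree_presheaf F n)"
begin

abbreviation G :: "'m => int => 'v monoid" where
 "G q n \<equiv> grp (on_ob F (src S q)) n"

text \<open>Restriction along the induced arrow over \<open>M\<close>, meaningful when
  \<open>im q'\<close> lies below \<open>im q\<close>.\<close>

definition res :: "'m => 'm => int => 'v => 'v" where
 "res q q' n x = on_ar F (induced S q q') n x"

lemma F_complex: "M : ob S ==> cochain_complex (on_ob F M)"
 using presheaf by (simp add: cochain_presheaf_def)

lemma F_map: "f : ar S ==> cochain_map (on_ob F (tgt S f)) (on_ob F (src S f)) (on_ar F f)"
 using presheaf by (simp add: cochain_presheaf_def)

lemma F_idn: "[|M : ob S; x : carrier (grp (on_ob F M) n)|] ==> on_ar F (idn S M) n x = x"
 using presheaf by (simp add: cochain_presheaf_def)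

lemma F_cmp: "[|f : ar S; g : ar S; src S g = tgt S f; x : carrier (grp (on_ob F (tgt S g)) n)|] ==>
  on_ar F (cmp S g f) n x = on_ar F f n (on_ar F g n x)"
 using presheaf by (simp add: cochain_presheaf_def)

lemma F_hom: "f : ar S ==> on_ar F f n : hom (grp (on_ob F (tgt S f)) n) (grp (on_ob F (src S f)) n)"
 using F_map by (simp add: cochain_map_def)

lemma F_closed: "f : ar S ==> x : carrier (grp (on_ob F (tgt S f)) n) ==> on_ar F f n x : carrier (grp (on_ob F (src S f)) n)"
 using F_hom[of f n] by (auto simp: hom_def)

lemma G_group: "q : ar S ==> comm_group (G q n)"
 using F_complex[OF src_ob] by (simp add: cochain_complex_def)

lemma res_map:
 assumes "opn M q" "opn M q'" "im q' \<sqsubseteq>\<^bsub>on_ob U M\<^esub> im q"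
 shows "cochain_map (on_ob F (src S q)) (on_ob F (src S q')) (res q q')"
 using F_map[OF induced_opn(1)[OF assms]] induced_opn[OF assms] by (simp add: res_def[abs_def])

lemma res_hom:
 assumes "opn M q" "opn M q'" "im q' \<sqsubseteq>\<^bsub>on_ob U M\<^esub> im q"
 shows "res q q' n : hom (G q n) (G q' n)"
 using res_map[OF assms] by (simp add: cochain_map_def)

lemma res_closed:
 assumes "opn M q" "opn M q'" "im q' \<sqsubseteq>\<^bsub>on_ob U M\<^esub> im q" "x : carrier (G q n)"
 shows "res q q' n x : carrier (G q' n)"
 using res_hom[OF assms(1-3), of n] assms(4) by (auto simp: hom_def)

lemma res_self:
 assumes "opn M q" "x : carrier (G q n)"
 shows "res q q n x = x"
proof -
 note q = opnD[OF assms(1)]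
 have "induced S q q = idn S (src S q)"
  by (rule induced_eq[OF assms(1)]) (use idn_ar[OF q(6)] cmp_idn_right[OF q(1)] in auto)
 then show ?thesis using F_idn[OF q(6) assms(2)] by (simp add: res_def)
qed

lemma res_arrow:
 assumes "opn M q" "opn M q'" "im q' \<sqsubseteq>\<^bsub>on_ob U M\<^esub> im q"
  "e : ar S" "tgt S e = M" "arr_map (on_ar U e) (im q') = \<top>\<^bsub>on_ob U (src S e)\<^esub>"
  "x : carrier (G q n)"
 shows "on_ar F (induced S q' e) n (res q q' n x) = on_ar F (induced S q e) n x"
proof -
 note i = induced_opn[OF assms(1-3)] and j = induced[OF assms(2,4-6)]
 have "src S (induced S q q') = tgt S (induced S q' e)" using i(2) j(3) by simp
 from F_cmp[OF j(1) i(1) this] show ?thesis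
  unfolding induced_comp[OF assms(1-6)] res_def using assms(7) i(3) by simp
qed

lemma res_res:
 assumes "opn M q" "opn M q'" "opn M q''" "im q' \<sqsubseteq>\<^bsub>on_ob U M\<^esub> im q" "im q'' \<sqsubseteq>\<^bsub>on_ob U M\<^esub> im q'" "x : carrier (G q n)"
 shows "res q' q'' n (res q q' n x) = res q q'' n x"
 using res_arrow[OF assms(1,2,4) opnD(1,2)[OF assms(3)] _ assms(6)] opn_le[OF assms(2,3)] assms(5)
 by (simp add: res_def)

text \<open>The sheaf condition over the source of \<open>q\<close>, stated for opens of
  \<open>M\<close>. The hypothesis \<open>compat\<close> asks for one intersection over
  \<open>M\<close>, whereas \<open>is_sheaf\<close> speaks of all intersections over the source of
  \<open>q\<close>; each of these factors through the given one.\<close>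

lemma glue:
 assumes q: "opn M q" and Q: "!!p. p : Q ==> opn M p" "!!p. p : Q ==> im p \<sqsubseteq>\<^bsub>on_ob U M\<^esub> im q"
  and num: "numerable_cover (on_ob U (src S q)) ((%p. arr_map (on_ar U q) (im p)) ` Q) (%x. x)"
  and s: "!!p. p : Q ==> s p : carrier (G p n)"
  and compat: "!!a b. a : Q ==> b : Q ==> \<exists>c. opn M c & im c = im a \<sqinter>\<^bsub>on_ob U M\<^esub> im b & res a c n (s a) = res b c n (s b)"
 shows "\<exists>!t. t : carrier (G q n) & (\<forall>p\<in>Q. res q p n t = s p)"
proof -
 let ?Z = "src S q" and ?i = "induced S q"
 note q' = opnD[OF q]
 interpret H: two_frames "on_ob U M" "on_ob U ?Z" "arr_map (on_ar U q)" using U_frames[OF q'(1)] q'(2) by simp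
 note p = induced_opn[OF q Q] and po = induced_opn_opn[OF q Q]
 have "im ` ?i ` Q = (%p. arr_map (on_ar U q) (im p)) ` Q"
  unfolding image_image by (rule image_cong) (use po(2) in simp_all)
 then have "open_covering_family S K U ?Z (?i ` Q) (%r. r)"
  by (intro open_covering[OF q'(6)]) (use po(1) num in auto)
 then have cov: "open_covering_family S K U ?Z Q ?i" by (simp add: open_covering_family_def)
 have "on_ar F (induced S (?i a) w) n (s a) = on_ar F (induced S (?i b) w) n (s b)"
  if a: "a : Q" and b: "b : Q" and w: "is_intersection S U ?Z {?i a, ?i b} w" for a b w
 proof -
  note po' = po[OF a a] po[OF b b]
  obtain c where c: "opn M c" "im c = im a \<sqinter>\<^bsub>on_ob U M\<^esub> im b" "res a c n (s a) = res b c n (s b)"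
   using compat[OF a b] by blast
  note ma = opnD(7)[OF Q(1)[OF a]] and mb = opnD(7)[OF Q(1)[OF b]]
  note mc = H.X.meet_lower[OF ma mb]
  note hab = H.closed[OF ma] H.closed[OF mb]
  have w': "w : ar S" "tgt S w = ?Z" using w by (simp_all add: is_intersection_def cartesian_def)
  have inf: "\<Sqinter>\<^bsub>on_ob U ?Z\<^esub> ((%r. image_open (on_ar U r)) ` {?i a, ?i b}) = arr_map (on_ar U q) (im c)"
   using po' unfolding im_def[symmetric] c(2) H.hom_meet[OF ma mb] by (simp add: meet_def)
  have imc: "im c : carrier (on_ob U M)" using c(2) mc(1) by simp
  have "opn ?Z w" "im w = arr_map (on_ar U q) (im c)"
   using w opnI[of w ?Z "arr_map (on_ar U q) (im c)"] open_inclusion_onto[OF H.Y.frame_lattice_axioms H.closed[OF imc]]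
   unfolding is_intersection_def inf by simp_all
  note w'' = this
  have wt: "arr_map (on_ar U w) (arr_map (on_ar U q) (im c)) = \<top>\<^bsub>on_ob U (src S w)\<^esub>"
   using open_embedding_ontoD(3)[OF opnD(4)[OF w''(1)]] w''(2) U_ar(2)[OF w'(1)] by simp
  \<comment> \<open>The intersection \<open>w\<close> seen over \<open>M\<close>. It factors through
    \<open>c\<close>, and so do the restrictions of both sections to it.\<close>
  define e where "e = cmp S q w"
  have e: "e : ar S" "tgt S e = M" "src S e = src S w"
   using cmp_ar[OF w'(1) q'(1)] w'(2) q'(2) by (simp_all add: e_def)
  have et: "arr_map (on_ar U e) (im c) = \<top>\<^bsub>on_ob U (src S e)\<^esub>"
   using U_cmp_map[OF w'(1) q'(1), of "im c"] w'(2) q'(2) imc wt e(3) by (simp add: e_def)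
  have main: "on_ar F (induced S (?i r) w) n (s r) = on_ar F (induced S c e) n (res r c n (s r))"
   if r: "r : Q" "im c \<sqsubseteq>\<^bsub>on_ob U M\<^esub> im r" for r
  proof -
   note or = Q(1)[OF r(1)]
   interpret E: two_frames "on_ob U M" "on_ob U (src S e)" "arr_map (on_ar U e)" using U_frames[OF e(1)] e(2) by simp
   have "arr_map (on_ar U e) (im r) = \<top>\<^bsub>on_ob U (src S e)\<^esub>"
    using E.mono[OF r(2)] et E.Y.top_higher[OF E.closed[OF opnD(7)[OF or]]] E.Y.antisymI[of "arr_map (on_ar U e) (im r)"]
     E.closed[OF opnD(7)[OF or]] by simp
   note er = e(1,2) this
   note ir = induced[OF or er] and pr = p[OF r(1) r(1)]
   have "cmp S (?i r) (induced S r e) = induced S q e" by (rule induced_comp[OF q or Q(2)[OF r(1)] er, symmetric])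
   also have "\<dots> = w" by (rule induced_eq[OF q w']) (simp add: e_def)
   finally have "induced S (?i r) w = induced S r e"
    by (intro induced_eq[OF po(1)[OF r(1) r(1)]]) (use ir pr in simp_all)
   then show ?thesis using res_arrow[OF or c(1) r(2) e(1,2) et s[OF r(1)]] by simp
  qed
  show ?thesis using main[OF a] main[OF b] mc c(2,3) by simp
 qed
 note compat' = this
 have src: "src S (?i r) = src S r" if "r : Q" for r using p(2)[OF that that] .
 have "\<exists>!t. t : carrier (on_ob (degree_presheaf F n) ?Z) & (\<forall>i\<in>Q. on_ar (degree_presheaf F n) (?i i) t = s i)"
  using sheaf[of n, unfolded is_sheaf_def, rule_format, OF cov, of s] s src compat'
  by (simp add: degree_presheaf_def)
 then show ?thesis by (simp add: degree_presheaf_def res_def)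
qed

text \<open>The empty family covers the empty open, so the sheaf condition leaves a single
  section.\<close>

lemma trivial_group:
 assumes q: "opn M q" "im q = \<bottom>\<^bsub>on_ob U M\<^esub>" and xy: "x : carrier (G q n)" "y : carrier (G q n)"
 shows "x = y"
proof -
 note q' = opnD[OF q(1)]
 interpret H: two_frames "on_ob U M" "on_ob U (src S q)" "arr_map (on_ar U q)" using U_frames[OF q'(1)] q'(2) by simp
 have "arr_map (on_ar U q) (im q) = \<top>\<^bsub>on_ob U (src S q)\<^esub>"
  using open_embedding_ontoD(3)[OF q'(4)] U_ar(2)[OF q'(1)] by simp
 then have "\<bottom>\<^bsub>on_ob U (src S q)\<^esub> = \<top>\<^bsub>on_ob U (src S q)\<^esub>" using H.hom_bot q(2) by simp
 moreover have "\<Squnion>\<^bsub>on_ob U (src S q)\<^esub> {} = \<bottom>\<^bsub>on_ob U (src S q)\<^esub>"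
  by (rule H.Y.sup_eqI) (use H.Y.bottom_lower in auto)
 ultimately have "numerable_cover (on_ob U (src S q)) {} (%x. x)"
  by (intro H.Y.numerable_cover_disjoint) auto
 then have "\<exists>!t. t : carrier (G q n) & (\<forall>p\<in>{}. res q p n t = x)"
  by (intro glue[OF q(1)]) simp_all
 then show ?thesis using xy by auto
qed


text \<open>A set of arrows cannot repeat an arrow, so for \<open>a = b\<close> the two sections
  must be shown equal; they are, because \<open>c\<close> then has the same image as
  \<open>a\<close>.\<close>

lemma glue_two:
 assumes q: "opn M q" and a: "opn M a" and b: "opn M b" and c: "opn M c"
  and le: "im a \<sqsubseteq>\<^bsub>on_ob U M\<^esub> im q" "im b \<sqsubseteq>\<^bsub>on_ob U M\<^esub> im q" and imc: "im c = im a \<sqinter>\<^bsub>on_ob U M\<^esub> im b"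
  and num: "numerable_cover (on_ob U (src S q)) {arr_map (on_ar U q) (im a), arr_map (on_ar U q) (im b)} (%x. x)"
  and x: "x : carrier (G a n)" and y: "y : carrier (G b n)" and xy: "res a c n x = res b c n y"
 shows "\<exists>!t. t : carrier (G q n) & res q a n t = x & res q b n t = y"
proof -
 interpret X: frame_lattice "on_ob U M" by (rule U_ob[OF opnD(5)[OF q]])
 note mc = X.meet_lower[OF opnD(7)[OF a] opnD(7)[OF b], folded imc]
 have eq: "x = y" if "a = b"
 proof -
  have ac: "im a \<sqsubseteq>\<^bsub>on_ob U M\<^esub> im c" using imc that X.meet_absorb(1)[of "im a" "im a"] opnD(7)[OF a] by simp
  have "res c a n (res a c n z) = z" if "z : carrier (G a n)" for z
   using res_res[OF a c a mc(2) ac that] res_self[OF a that] by simp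
  then show ?thesis using xy x y that by metis
 qed
 define s where "s p = (if p = a then x else y)" for p
 have sab: "s a = x" "s b = y" using eq by (auto simp: s_def)
 have "\<exists>!t. t : carrier (G q n) & (\<forall>p\<in>{a, b}. res q p n t = s p)"
 proof (rule glue[OF q])
  fix p assume "p : {a, b}"
  then show "opn M p" "im p \<sqsubseteq>\<^bsub>on_ob U M\<^esub> im q" "s p : carrier (G p n)" using a b le x y sab by auto
 next
  have same: "\<exists>d. opn M d & im d = im p \<sqinter>\<^bsub>on_ob U M\<^esub> im p & res p d n (s p) = res p d n (s p)" if "opn M p" for p
   by (rule exI[of _ p]) (use that X.meet_absorb(1)[of "im p" "im p"] opnD(7)[OF that] in simp)
  have comm: "im c = im b \<sqinter>\<^bsub>on_ob U M\<^esub> im a" using imc X.meet_commute opnD(7)[OF a] opnD(7)[OF b] by simp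
  fix p r assume pr: "p : {a, b}" "r : {a, b}"
  show "\<exists>d. opn M d & im d = im p \<sqinter>\<^bsub>on_ob U M\<^esub> im r & res p d n (s p) = res r d n (s r)"
  proof (cases "p = r")
   case True
   then show ?thesis using same pr a b by auto
  next
   case False
   then have "p = a & r = b \<or> p = b & r = a" using pr by auto
   then show ?thesis
    using c imc comm sab xy by (elim disjE conjE) (simp_all, metis+)
  qed
 qed (use num in simp)
 then show ?thesis by (simp add: sab)
qed

text \<open>The surjectivity hypothesis concerns an intersection \<open>w\<close> over the source of
  \<open>q\<close>. The section \<open>z\<close> is carried to \<open>w\<close> by
  \<open>?\<beta>\<close>, written as a difference there and carried back by
  \<open>?\<gamma>\<close>; the composite of the two arrows is the identity.\<close>

lemma difference_two:
 assumes q: "opn M q" and a: "opn M a" and b: "opn M b" and c: "opn M c"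
  and le: "im a \<sqsubseteq>\<^bsub>on_ob U M\<^esub> im q" "im b \<sqsubseteq>\<^bsub>on_ob U M\<^esub> im q" and imc: "im c = im a \<sqinter>\<^bsub>on_ob U M\<^esub> im b"
  and num: "numerable_cover (on_ob U (src S q)) {arr_map (on_ar U q) (im a), arr_map (on_ar U q) (im b)} (%x. x)"
  and z: "z : carrier (G c n)"
 shows "\<exists>x\<in>carrier (G a n). \<exists>y\<in>carrier (G b n). z = res a c n x \<otimes>\<^bsub>G c n\<^esub> inv\<^bsub>G c n\<^esub> (res b c n y)"
proof -
 let ?Z = "src S q" and ?i = "induced S q"
 note q' = opnD[OF q]
 interpret H: two_frames "on_ob U M" "on_ob U ?Z" "arr_map (on_ar U q)" using U_frames[OF q'(1)] q'(2) by simp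
 note ma = opnD(7)[OF a] and mb = opnD(7)[OF b]
 note mc = H.X.meet_lower[OF ma mb, folded imc]
 have lc: "im c \<sqsubseteq>\<^bsub>on_ob U M\<^esub> im q" by (rule H.X.trans[OF mc(2) le(1)])
 note ia = induced_opn[OF q a le(1)] and ib = induced_opn[OF q b le(2)] and ic = induced_opn[OF q c lc]
 note oa = induced_opn_opn[OF q a le(1)] and obb = induced_opn_opn[OF q b le(2)] and oc = induced_opn_opn[OF q c lc]
 have "im ` {?i a, ?i b} = {arr_map (on_ar U q) (im a), arr_map (on_ar U q) (im b)}" using oa obb by simp
 then have cov: "open_covering_family S K U ?Z {?i a, ?i b} (%r. r)"
  by (intro open_covering[OF q'(6)]) (use oa obb num in auto)
 obtain w where w: "opn ?Z w" "on_ar U w = open_inclusion (on_ob U ?Z) (arr_map (on_ar U q) (im c))" "im w = arr_map (on_ar U q) (im c)"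
  by (rule opn_exists[OF q'(6) H.closed[OF mc(1)]])
 note w' = opnD[OF w(1)]
 have "\<Sqinter>\<^bsub>on_ob U ?Z\<^esub> ((%r. image_open (on_ar U r)) ` {?i a, ?i b}) = arr_map (on_ar U q) (im c)"
  using oa obb unfolding im_def[symmetric] imc H.hom_meet[OF ma mb] by (simp add: meet_def)
 then have int: "is_intersection S U ?Z {?i a, ?i b} w" using w' w(2) by (simp add: is_intersection_def)
 define e where "e = cmp S q w"
 have e: "e : ar S" "tgt S e = M" "src S e = src S w"
  using cmp_ar[OF w'(1) q'(1)] w'(2) q'(2) by (simp_all add: e_def)
 have top: "arr_map (on_ar U w) (arr_map (on_ar U q) (im c)) = \<top>\<^bsub>on_ob U (src S w)\<^esub>"
  using open_embedding_ontoD(3)[OF w'(4)] w(3) U_ar(2)[OF w'(1)] by simp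
 have et: "arr_map (on_ar U e) (im c) = \<top>\<^bsub>on_ob U (src S e)\<^esub>"
  using U_cmp_map[OF w'(1) q'(1), of "im c"] w'(2) q'(2) mc(1) top e(3) by (simp add: e_def)
 let ?\<beta> = "induced S c e" and ?\<gamma> = "induced S w (?i c)"
 note i\<beta> = induced[OF c e(1,2) et]
 have "im (?i c) \<sqsubseteq>\<^bsub>on_ob U ?Z\<^esub> im w" using oc(2) w(3) H.closed[OF mc(1)] by simp
 note i\<gamma> = induced_opn[OF w(1) oc(1) this] and lwc = this
 have \<gamma>: "src S ?\<gamma> = src S c" using i\<gamma>(2) ic(2) by simp
 have t: "src S ?\<beta> = tgt S ?\<gamma>" using i\<beta>(2) e(3) i\<gamma>(3) by simp
 note \<beta>\<gamma> = cmp_ar[OF i\<gamma>(1) i\<beta>(1) t]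
 have "cmp S ?\<beta> ?\<gamma> = idn S (src S c)"
 proof (rule opn_cancel[OF c])
  note c' = opnD[OF c]
  have "cmp S c (cmp S ?\<beta> ?\<gamma>) = cmp S e ?\<gamma>"
   using cmp_assoc[OF i\<gamma>(1) i\<beta>(1) c'(1) t] i\<beta>(3,4) by simp
  also have "\<dots> = cmp S q (cmp S w ?\<gamma>)"
   using cmp_assoc[OF i\<gamma>(1) w'(1) q'(1)] i\<gamma>(3) w'(2) by (simp add: e_def)
  also have "\<dots> = c" using i\<gamma>(4) ic(4) by simp
  finally show "cmp S c (cmp S ?\<beta> ?\<gamma>) = cmp S c (idn S (src S c))" using cmp_idn_right[OF c'(1)] by simp
  show "cmp S ?\<beta> ?\<gamma> : ar S" "tgt S (cmp S ?\<beta> ?\<gamma>) = src S c" using \<beta>\<gamma> i\<beta>(3) by simp_all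
  show "idn S (src S c) : ar S" "tgt S (idn S (src S c)) = src S c" using idn_ar[OF c'(6)] by simp_all
 qed
 moreover have "on_ar F (cmp S ?\<beta> ?\<gamma>) n z = on_ar F ?\<gamma> n (on_ar F ?\<beta> n z)"
  by (rule F_cmp[OF i\<gamma>(1) i\<beta>(1) t]) (use i\<beta>(3) z in simp)
 ultimately have bk: "on_ar F ?\<gamma> n (on_ar F ?\<beta> n z) = z" using F_idn[OF opnD(6)[OF c] z] by simp
 have "on_ar F ?\<beta> n z : carrier (G w n)" using F_closed[OF i\<beta>(1)] z i\<beta>(2,3) e(3) by simp
 then have "on_ar F ?\<beta> n z : (\<lambda>(u, v). on_ar F (induced S (?i a) w) n u \<otimes>\<^bsub>G w n\<^esub> inv\<^bsub>G w n\<^esub> (on_ar F (induced S (?i b) w) n v))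
   ` (carrier (G a n) \<times> carrier (G b n))"
  using surjective[of n, unfolded differences_surjective_def, rule_format, OF conjI[OF cov int]] ia(2) ib(2)
  by (simp add: degree_presheaf_def)
 then obtain x y where xy: "x : carrier (G a n)" "y : carrier (G b n)"
  "on_ar F ?\<beta> n z = on_ar F (induced S (?i a) w) n x \<otimes>\<^bsub>G w n\<^esub> inv\<^bsub>G w n\<^esub> (on_ar F (induced S (?i b) w) n y)" by auto
 have comp: "on_ar F (induced S (?i r) w) n u : carrier (G w n) & on_ar F ?\<gamma> n (on_ar F (induced S (?i r) w) n u) = res r c n u"
  if r: "opn M r" "im r \<sqsubseteq>\<^bsub>on_ob U M\<^esub> im q" "im c \<sqsubseteq>\<^bsub>on_ob U M\<^esub> im r" and u: "u : carrier (G r n)" for r u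
 proof -
  note ir = induced_opn[OF q r(1,2)] and or = induced_opn_opn[OF q r(1,2)] and ir' = induced_opn[OF r(1) c r(3)]
  have lw: "im w \<sqsubseteq>\<^bsub>on_ob U ?Z\<^esub> im (?i r)" using or(2) w(3) H.mono[OF r(3)] by simp
  have lc': "im (?i c) \<sqsubseteq>\<^bsub>on_ob U ?Z\<^esub> im (?i r)" using or(2) oc(2) H.mono[OF r(3)] by simp
  note iw = induced_opn[OF or(1) w(1) lw]
  have "induced S (?i r) (?i c) = induced S r c"
   by (rule induced_eq[OF or(1)])
    (use ir ir' induced_comp[OF q r(1,2) opnD(1,2)[OF c]] opn_le[OF r(1) c] r(3) in simp_all)
  moreover have "res (?i r) (?i c) n u = res w (?i c) n (res (?i r) w n u)"
   by (rule res_res[OF or(1) w(1) oc(1) lw lwc, symmetric]) (use u ir(2) in simp)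
  ultimately have "on_ar F ?\<gamma> n (on_ar F (induced S (?i r) w) n u) = res r c n u" by (simp add: res_def)
  moreover have "on_ar F (induced S (?i r) w) n u : carrier (G w n)"
   using F_closed[OF iw(1), of u n] iw(2,3) ir(2) u by simp
  ultimately show ?thesis by simp
 qed
 interpret W: comm_group "G w n" by (rule G_group[OF w'(1)])
 interpret C: comm_group "G c n" by (rule G_group[OF opnD(1)[OF c]])
 have "on_ar F ?\<gamma> n : hom (G w n) (G c n)" using F_hom[OF i\<gamma>(1), of n] i\<gamma>(3) \<gamma> by simp
 then interpret \<gamma>: group_hom "G w n" "G c n" "on_ar F ?\<gamma> n"
  by (simp add: group_hom_def group_hom_axioms_def)
 note cx = comp[OF a le(1) mc(2) xy(1)] and cy = comp[OF b le(2) mc(3) xy(2)]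
 have "z = res a c n x \<otimes>\<^bsub>G c n\<^esub> inv\<^bsub>G c n\<^esub> (res b c n y)"
  using bk cx cy unfolding xy(3) by simp
 then show ?thesis using xy(1,2) by blast
qed

text \<open>Sections on disjoint opens are compatible because the empty open carries only one
  section.\<close>

lemma glue_disjoint:
 assumes q: "opn M q" and Q: "!!p. p : Q ==> opn M p"
  and dis: "!!a b. a : Q ==> b : Q ==> a ~= b ==> im a \<sqinter>\<^bsub>on_ob U M\<^esub> im b = \<bottom>\<^bsub>on_ob U M\<^esub>"
  and sup: "\<Squnion>\<^bsub>on_ob U M\<^esub> (im ` Q) = im q"
  and s: "!!p. p : Q ==> s p : carrier (G p n)"
 shows "\<exists>!t. t : carrier (G q n) & (\<forall>p\<in>Q. res q p n t = s p)"
proof -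
 note q' = opnD[OF q]
 interpret H: two_frames "on_ob U M" "on_ob U (src S q)" "arr_map (on_ar U q)" using U_frames[OF q'(1)] q'(2) by simp
 have c: "im ` Q \<subseteq> carrier (on_ob U M)" using opnD(7)[OF Q] by blast
 have le: "im p \<sqsubseteq>\<^bsub>on_ob U M\<^esub> im q" if "p : Q" for p
  using H.X.sup_upper[OF c imageI[OF that]] sup by simp
 show ?thesis
 proof (rule glue[OF q Q le _ s])
  let ?D = "(%p. arr_map (on_ar U q) (im p)) ` Q"
  show "numerable_cover (on_ob U (src S q)) ?D (%x. x)"
  proof (rule H.Y.numerable_cover_disjoint)
   show "?D \<subseteq> carrier (on_ob U (src S q))" using H.closed c by blast
   fix u v assume "u : ?D" "v : ?D" "u ~= v"
   then obtain a b where ab: "a : Q" "b : Q" "a ~= b" "u = arr_map (on_ar U q) (im a)" "v = arr_map (on_ar U q) (im b)" by blast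
   show "u \<sqinter>\<^bsub>on_ob U (src S q)\<^esub> v = \<bottom>\<^bsub>on_ob U (src S q)\<^esub>"
    using H.hom_meet[OF opnD(7)[OF Q[OF ab(1)]] opnD(7)[OF Q[OF ab(2)]]] dis[OF ab(1-3)] H.hom_bot ab(4,5) by simp
  next
   have "\<Squnion>\<^bsub>on_ob U (src S q)\<^esub> ?D = arr_map (on_ar U q) (im q)"
    using H.hom_sup[OF c] sup by (simp add: image_image)
   then show "\<Squnion>\<^bsub>on_ob U (src S q)\<^esub> ?D = \<top>\<^bsub>on_ob U (src S q)\<^esub>"
    using open_embedding_ontoD(3)[OF q'(4)] U_ar(2)[OF q'(1)] by simp
  qed
 next
  fix a b assume a: "a : Q" and b: "b : Q"
  note oa = Q[OF a] and obb = Q[OF b]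
  note m = H.X.meet_lower[OF opnD(7)[OF oa] opnD(7)[OF obb]]
  obtain d where d: "opn M d" "im d = im a \<sqinter>\<^bsub>on_ob U M\<^esub> im b" by (rule opn_exists[OF q'(5) m(1)]) blast
  have "res a d n (s a) = res b d n (s b)"
  proof (cases "a = b")
   case False
   show ?thesis
    by (rule trivial_group[OF d(1)])
     (use d dis[OF a b False] m s[OF a] s[OF b] res_closed[OF oa d(1)] res_closed[OF obb d(1)] in simp_all)
  qed simp
  then show "\<exists>c. opn M c & im c = im a \<sqinter>\<^bsub>on_ob U M\<^esub> im b & res a c n (s a) = res b c n (s b)" using d by blast
 qed
qed

end

subsection \<open>Soft sheaves of groups on a frame\<close>

text \<open>The pairs for which gluing and differences are available: preimages of two open sets
  under one function on an open \<open>w\<close>. By \<open>numerable_cover_two\<close> such a pair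
  is a numerable cover of its union.\<close>

definition functional_pair :: "'a gorder => 'a => 'a => 'a => 'a => bool" where
 "functional_pair X a b c u \<longleftrightarrow> (\<exists>w\<in>carrier X. \<exists>\<phi>. \<exists>A\<in>carrier half_line. \<exists>B\<in>carrier half_line.
  frame_hom half_line (open_sublocale X w) \<phi> & a = \<phi> A & b = \<phi> B & c = \<phi> (A \<inter> B) & u = \<phi> (A \<union> B))"

context frame_lattice
begin

lemma functional_pairE:
 assumes "functional_pair X a b c u"
 obtains w \<phi> A B where "w : carrier X" "half_line_hom (open_sublocale X w) \<phi>" "A : carrier half_line" "B : carrier half_line"
  "a = \<phi> A" "b = \<phi> B" "c = \<phi> (A \<inter> B)" "u = \<phi> (A \<union> B)"
proof -
 obtain w \<phi> A B where *: "w : carrier X" "A : carrier half_line" "B : carrier half_line"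
  "frame_hom half_line (open_sublocale X w) \<phi>" "a = \<phi> A" "b = \<phi> B" "c = \<phi> (A \<inter> B)" "u = \<phi> (A \<union> B)"
  using assms unfolding functional_pair_def by (elim bexE exE conjE)
 have "half_line_hom (open_sublocale X w) \<phi>"
  using *(4) open_sublocale_frame[OF *(1)] by (simp add: half_line_hom_def half_line_hom_axioms_def)
 then show ?thesis using that * by blast
qed

lemma functional_pairD:
 assumes "functional_pair X a b c u"
 shows "a : carrier X" "b : carrier X" "c : carrier X" "u : carrier X" "c \<sqsubseteq> a" "c \<sqsubseteq> b" "c \<sqsubseteq> u" "a \<sqsubseteq> u" "b \<sqsubseteq> u" "c = a \<sqinter> b"
proof -
 obtain w \<phi> A B where *: "w : carrier X" "half_line_hom (open_sublocale X w) \<phi>" "A : carrier half_line" "B : carrier half_line"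
  "a = \<phi> A" "b = \<phi> B" "c = \<phi> (A \<inter> B)" "u = \<phi> (A \<union> B)"
  by (rule functional_pairE[OF assms])
 interpret H: half_line_hom "open_sublocale X w" \<phi> by (rule *(2))
 note AB = *(3,4) half_line_Int[OF *(3,4)] half_line_Un[OF *(3,4)]
 have cl: "\<phi> V : carrier X & \<phi> V \<sqsubseteq> w" if "V : carrier half_line" for V using H.closed[OF that] by simp
 show "a : carrier X" "b : carrier X" "c : carrier X" "u : carrier X" using cl AB *(5-8) by simp_all
 have m: "\<phi> V \<sqsubseteq> \<phi> V'" if "V : carrier half_line" "V' : carrier half_line" "V \<subseteq> V'" for V V'
  using H.hom_mono[OF that] by simp
 show "c \<sqsubseteq> a" "c \<sqsubseteq> b" "c \<sqsubseteq> u" "a \<sqsubseteq> u" "b \<sqsubseteq> u" unfolding *(5-8) by (rule m; use AB in blast)+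
 show "c = a \<sqinter> b" unfolding *(5-8) H.hom_Int[OF AB(1,2)]
  by (rule open_sublocale_meet) (use *(1) cl AB in simp_all)
qed

text \<open>The function is restricted to \<open>v\<close>. This heredity is needed because
  exactness is asserted below every open.\<close>

lemma functional_pair_meet:
 assumes f: "functional_pair X a b c u" and v: "v \<sqsubseteq> u"
 shows "functional_pair X (v \<sqinter> a) (v \<sqinter> b) (v \<sqinter> c) v"
proof -
 obtain w \<phi> A B where *: "w : carrier X" "half_line_hom (open_sublocale X w) \<phi>" "A : carrier half_line" "B : carrier half_line"
  "a = \<phi> A" "b = \<phi> B" "c = \<phi> (A \<inter> B)" "u = \<phi> (A \<union> B)"
  by (rule functional_pairE[OF f])
 interpret H: half_line_hom "open_sublocale X w" \<phi> by (rule *(2))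
 note AB = *(3,4) half_line_Int[OF *(3,4)] half_line_Un[OF *(3,4)]
 have cl: "\<phi> V : carrier X" "\<phi> V \<sqsubseteq> w" if "V : carrier half_line" for V using H.closed[OF that] by simp_all
 have vc: "v : carrier X" using v le_carrier by blast
 have vw: "v \<sqsubseteq> w" by (rule trans[OF v]) (use cl AB *(8) in simp)
 let ?\<psi> = "\<lambda>V\<in>carrier half_line. v \<sqinter>\<^bsub>open_sublocale X w\<^esub> \<phi> V"
 have "frame_hom half_line (open_sublocale X v) ?\<psi>"
  using H.restrict_hom[of v] vc vw open_sublocale_twice[OF vw] by simp
 moreover have "?\<psi> V = v \<sqinter> \<phi> V" if "V : carrier half_line" for V
  using open_sublocale_meet[OF *(1) vc cl(1)[OF that] vw cl(2)[OF that]] that by simp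
 moreover have "v \<sqinter> u = v" using meet_absorb(1)[OF vc _ v] cl AB *(8) by simp
 ultimately show ?thesis unfolding functional_pair_def using *(5-8) AB vc
  by (intro bexI[of _ v] exI[of _ ?\<psi>] bexI[of _ A] bexI[of _ B]) simp_all
qed

end

text \<open>The properties of one degree of \<open>F\<close> that the exactness argument uses. They
  pass to arbitrary products, hence to each degree of the product total complex.\<close>

locale soft_sheaf = frame_lattice X for X :: "'a gorder" (structure) +
 fixes G :: "'a => 'g monoid" and r :: "'a => 'a => 'g => 'g"
 assumes group: "v : carrier X ==> comm_group (G v)"
  and restrict_map: "v' \<sqsubseteq> v ==> r v v' : hom (G v) (G v')"
  and restrict_trans: "[|v' \<sqsubseteq> v; v'' \<sqsubseteq> v'; x : carrier (G v)|] ==> r v' v'' (r v v' x) = r v v'' x"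
  and glue: "[|functional_pair X a b c u; x : carrier (G a); y : carrier (G b); r a c x = r b c y|] ==>
   \<exists>!z. z : carrier (G u) & r u a z = x & r u b z = y"
  and difference: "[|functional_pair X a b c u; z : carrier (G c)|] ==>
   \<exists>x\<in>carrier (G a). \<exists>y\<in>carrier (G b). z = r a c x \<otimes>\<^bsub>G c\<^esub> inv\<^bsub>G c\<^esub> (r b c y)"
  and glue_disjoint: "[|D \<subseteq> carrier X; !!a b. a : D ==> b : D ==> a ~= b ==> a \<sqinter> b = \<bottom>; !!d. d : D ==> s d : carrier (G d)|] ==>
   \<exists>!t. t : carrier (G (\<Squnion> D)) & (\<forall>d\<in>D. r (\<Squnion> D) d t = s d)"
begin

lemma restrict_closed: "v' \<sqsubseteq> v ==> x : carrier (G v) ==> r v v' x : carrier (G v')"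
 using restrict_map by (auto simp: hom_def)

lemma restrict_group_hom: "v' \<sqsubseteq> v ==> group_hom (G v) (G v') (r v v')"
 using restrict_map group le_carrier by (simp add: group_hom_def group_hom_axioms_def comm_group_def)

lemma cong:
 assumes "!!v v' x. v' \<sqsubseteq> v ==> x : carrier (G v) ==> r' v v' x = r v v' x"
 shows "soft_sheaf X G r'"
proof (rule soft_sheaf.intro[OF frame_lattice_axioms soft_sheaf_axioms.intro])
 fix v assume "v : carrier X" then show "comm_group (G v)" by (rule group)
next
 fix v' v assume v: "v' \<sqsubseteq> v"
 interpret group_hom "G v" "G v'" "r v v'" by (rule restrict_group_hom[OF v])
 show "r' v v' : hom (G v) (G v')" by (rule homI) (simp_all add: assms[OF v])
next
 fix v' v v'' x assume v: "v' \<sqsubseteq> v" "v'' \<sqsubseteq> v'" "x : carrier (G v)"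
 show "r' v' v'' (r' v v' x) = r' v v'' x"
  using restrict_trans[OF v] assms[OF v(1,3)] assms[OF v(2) restrict_closed[OF v(1,3)]] assms[OF trans[OF v(2,1)] v(3)] by simp
next
 fix a b c u x y assume f: "functional_pair X a b c u" and xy: "x : carrier (G a)" "y : carrier (G b)" "r' a c x = r' b c y"
 note f' = functional_pairD[OF f]
 have "r a c x = r b c y" using xy assms[OF f'(5) xy(1)] assms[OF f'(6) xy(2)] by simp
 from glue[OF f xy(1,2) this] show "\<exists>!z. z : carrier (G u) & r' u a z = x & r' u b z = y"
  using assms[OF f'(8)] assms[OF f'(9)] by (simp cong: conj_cong)
next
 fix a b c u z assume f: "functional_pair X a b c u" and z: "z : carrier (G c)"
 note f' = functional_pairD[OF f]
 show "\<exists>x\<in>carrier (G a). \<exists>y\<in>carrier (G b). z = r' a c x \<otimes>\<^bsub>G c\<^esub> inv\<^bsub>G c\<^esub> (r' b c y)"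
  using difference[OF f z] assms[OF f'(5)] assms[OF f'(6)] by (simp cong: bex_cong)
next
 fix D s assume D: "D \<subseteq> carrier X" "!!a b. a : D ==> b : D ==> a ~= b ==> a \<sqinter> b = \<bottom>" "!!d. d : D ==> s d : carrier (G d)"
 have "r' (\<Squnion> D) d t = r (\<Squnion> D) d t" if "d : D" "t : carrier (G (\<Squnion> D))" for d t
  by (rule assms[OF sup_upper[OF D(1) that(1)] that(2)])
 then have "(t : carrier (G (\<Squnion> D)) & (\<forall>d\<in>D. r' (\<Squnion> D) d t = s d)) \<longleftrightarrow> (t : carrier (G (\<Squnion> D)) & (\<forall>d\<in>D. r (\<Squnion> D) d t = s d))" for t
  by auto
 then show "\<exists>!t. t : carrier (G (\<Squnion> D)) & (\<forall>d\<in>D. r' (\<Squnion> D) d t = s d)"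
  using glue_disjoint[of D s, OF D(1) D(2) D(3)] by simp
qed

end

lemma ex1_product:
 assumes "!!j. j : J ==> \<exists>!t. t : C j & Q j t"
 shows "\<exists>!t. t : Pi\<^sub>E J C & (\<forall>j\<in>J. Q j (t j))"
proof -
 define t where "t = (\<lambda>j\<in>J. THE t. t : C j & Q j t)"
 have t: "t j : C j & Q j (t j)" if "j : J" for j using theI'[OF assms[OF that]] that by (simp add: t_def)
 show ?thesis
 proof (rule ex1I[of _ t])
  show "t : Pi\<^sub>E J C & (\<forall>j\<in>J. Q j (t j))" using t by (auto simp: PiE_iff t_def extensional_def)
  fix s assume s: "s : Pi\<^sub>E J C & (\<forall>j\<in>J. Q j (s j))"
  show "s = t"
  proof (rule PiE_ext)
   show "s : Pi\<^sub>E J C" "t : Pi\<^sub>E J C" using s t by (auto simp: PiE_iff t_def extensional_def)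
   show "s j = t j" if "j : J" for j using assms[OF that] t[OF that] s that by (auto simp: PiE_iff)
  qed
 qed
qed

lemma restrict_eq_iff: "y : extensional J ==> restrict f J = y \<longleftrightarrow> (\<forall>j\<in>J. f j = y j)"
 by (auto simp: fun_eq_iff extensional_def restrict_def)

text \<open>Unique gluing holds factor by factor, and differences are chosen in all factors
  simultaneously.\<close>

lemma soft_sheaf_product:
 assumes X: "frame_lattice X" and J: "!!j. j : J ==> soft_sheaf X (G j) (r j)"
 shows "soft_sheaf X (%v. product_group J (%j. G j v)) (%v v' x. \<lambda>j\<in>J. r j v v' (x j))"
proof -
 interpret frame_lattice X by (rule X)
 note gr = soft_sheaf.group[OF J] and cl = soft_sheaf.restrict_closed[OF J]
 show ?thesis
 proof (rule soft_sheaf.intro[OF X soft_sheaf_axioms.intro])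
  fix v assume "v : carrier X"
  then show "comm_group (product_group J (%j. G j v))" by (intro comm_product_group gr)
 next
  fix v' v assume v: "v' \<sqsubseteq>\<^bsub>X\<^esub> v"
  show "(%x. \<lambda>j\<in>J. r j v v' (x j)) : hom (product_group J (%j. G j v)) (product_group J (%j. G j v'))"
   by (rule homI) (use cl[OF _ v] hom_mult[OF soft_sheaf.restrict_map[OF J v]] in \<open>auto simp: PiE_iff fun_eq_iff\<close>)
 next
  fix v' v v'' x assume v: "v' \<sqsubseteq>\<^bsub>X\<^esub> v" "v'' \<sqsubseteq>\<^bsub>X\<^esub> v'" "x : carrier (product_group J (%j. G j v))"
  show "(\<lambda>j\<in>J. r j v' v'' ((\<lambda>j\<in>J. r j v v' (x j)) j)) = (\<lambda>j\<in>J. r j v v'' (x j))"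
   by (rule restrict_ext) (use v(3) soft_sheaf.restrict_trans[OF J v(1,2)] in \<open>auto simp: PiE_iff\<close>)
 next
  fix a b c u x y assume f: "functional_pair X a b c u"
   and x: "x : carrier (product_group J (%j. G j a))" and y: "y : carrier (product_group J (%j. G j b))"
   and xy: "(\<lambda>j\<in>J. r j a c (x j)) = (\<lambda>j\<in>J. r j b c (y j))"
  have "\<exists>!t. t : Pi\<^sub>E J (%j. carrier (G j u)) & (\<forall>j\<in>J. r j u a (t j) = x j & r j u b (t j) = y j)"
  proof (rule ex1_product)
   fix j assume j: "j : J"
   have "r j a c (x j) = r j b c (y j)" using fun_cong[OF xy, of j] j by simp
   then show "\<exists>!t. t : carrier (G j u) & r j u a t = x j & r j u b t = y j"
    by (intro soft_sheaf.glue[OF J[OF j] f]) (use x y j in \<open>auto simp: PiE_iff\<close>)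
  qed
  moreover have "x : extensional J" "y : extensional J" using x y by (auto simp: PiE_iff)
  ultimately show "\<exists>!z. z : carrier (product_group J (%j. G j u)) & (\<lambda>j\<in>J. r j u a (z j)) = x & (\<lambda>j\<in>J. r j u b (z j)) = y"
   by (simp add: restrict_eq_iff ball_conj_distrib)
 next
  fix a b c u z assume f: "functional_pair X a b c u" and z: "z : carrier (product_group J (%j. G j c))"
  note f' = functional_pairD[OF f]
  have "\<forall>j\<in>J. \<exists>x y. x : carrier (G j a) & y : carrier (G j b) & z j = r j a c x \<otimes>\<^bsub>G j c\<^esub> inv\<^bsub>G j c\<^esub> (r j b c y)"
  proof
   fix j assume j: "j : J"
   then have "z j : carrier (G j c)" using z by (auto simp: PiE_iff)
   from soft_sheaf.difference[OF J[OF j] f this]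
   show "\<exists>x y. x : carrier (G j a) & y : carrier (G j b) & z j = r j a c x \<otimes>\<^bsub>G j c\<^esub> inv\<^bsub>G j c\<^esub> (r j b c y)" by blast
  qed
  then obtain x y where xy: "\<forall>j\<in>J. x j : carrier (G j a) & y j : carrier (G j b) & z j = r j a c (x j) \<otimes>\<^bsub>G j c\<^esub> inv\<^bsub>G j c\<^esub> (r j b c (y j))"
   by metis
  let ?x = "restrict x J" and ?y = "restrict y J"
  have gp: "Group.group (G j c)" if "j : J" for j using gr[OF that f'(3)] by (rule comm_group.axioms)
  have "(\<lambda>j\<in>J. r j b c (?y j)) : (\<Pi>\<^sub>E j\<in>J. carrier (G j c))" using cl[OF _ f'(6)] xy by auto
  then have i: "inv\<^bsub>product_group J (%j. G j c)\<^esub> (\<lambda>j\<in>J. r j b c (?y j)) = (\<lambda>j\<in>J. inv\<^bsub>G j c\<^esub> (r j b c (y j)))"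
   by (subst inv_product_group) (auto intro!: restrict_ext gp)
  have "z = (\<lambda>j\<in>J. r j a c (?x j)) \<otimes>\<^bsub>product_group J (%j. G j c)\<^esub> inv\<^bsub>product_group J (%j. G j c)\<^esub> (\<lambda>j\<in>J. r j b c (?y j))"
   unfolding i using xy z by (auto simp: PiE_iff fun_eq_iff extensional_def)
  moreover have "?x : carrier (product_group J (%j. G j a))" "?y : carrier (product_group J (%j. G j b))" using xy by auto
  ultimately show "\<exists>x\<in>carrier (product_group J (%j. G j a)). \<exists>y\<in>carrier (product_group J (%j. G j b)).
    z = (\<lambda>j\<in>J. r j a c (x j)) \<otimes>\<^bsub>product_group J (%j. G j c)\<^esub> inv\<^bsub>product_group J (%j. G j c)\<^esub> (\<lambda>j\<in>J. r j b c (y j))" by blast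
 next
  fix D s assume D: "D \<subseteq> carrier X" "!!a b. a : D ==> b : D ==> a ~= b ==> a \<sqinter>\<^bsub>X\<^esub> b = \<bottom>\<^bsub>X\<^esub>"
   and s: "!!d. d : D ==> s d : carrier (product_group J (%j. G j d))"
  let ?u = "\<Squnion>\<^bsub>X\<^esub> D"
  have "\<exists>!t. t : Pi\<^sub>E J (%j. carrier (G j ?u)) & (\<forall>j\<in>J. \<forall>d\<in>D. r j ?u d (t j) = s d j)"
  proof (rule ex1_product)
   fix j assume j: "j : J"
   show "\<exists>!t. t : carrier (G j ?u) & (\<forall>d\<in>D. r j ?u d t = s d j)"
    by (rule soft_sheaf.glue_disjoint[OF J[OF j] D]) (use s j in \<open>auto simp: PiE_iff\<close>)
  qed
  moreover have "s d : extensional J" if "d : D" for d using s[OF that] by (auto simp: PiE_iff)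
  then have "(\<forall>d\<in>D. (\<lambda>j\<in>J. r j ?u d (t j)) = s d) \<longleftrightarrow> (\<forall>j\<in>J. \<forall>d\<in>D. r j ?u d (t j) = s d j)" for t
   by (auto simp: restrict_eq_iff)
  ultimately show "\<exists>!t. t : carrier (product_group J (%j. G j ?u)) & (\<forall>d\<in>D. (\<lambda>j\<in>J. r j ?u d (t j)) = s d)"
   by simp
 qed
qed

lemma ex1_pair: "\<exists>!x. P x ==> \<exists>!y. Q y ==> \<exists>!z. P (fst z) & Q (snd z)"
 by (metis prod.collapse fst_conv snd_conv)

lemma soft_sheaf_pair:
 assumes 1: "soft_sheaf X G r" and 2: "soft_sheaf X G' r'"
 shows "soft_sheaf X (%v. G v \<times>\<times> G' v) (%v v'. map_prod (r v v') (r' v v'))"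
proof -
 interpret A: soft_sheaf X G r by (rule 1)
 interpret B: soft_sheaf X G' r' by (rule 2)
 show ?thesis
 proof (rule soft_sheaf.intro[OF A.frame_lattice_axioms soft_sheaf_axioms.intro])
  fix v assume v: "v : carrier X"
  interpret a: comm_group "G v" by (rule A.group[OF v])
  interpret b: comm_group "G' v" by (rule B.group[OF v])
  have "Group.group (G v \<times>\<times> G' v)" by (rule DirProd_group[OF a.is_group b.is_group])
  then show "comm_group (G v \<times>\<times> G' v)"
   by (rule group.group_comm_groupI) (auto simp: a.m_comm b.m_comm)
 next
  fix v' v assume v: "v' \<sqsubseteq>\<^bsub>X\<^esub> v"
  show "map_prod (r v v') (r' v v') : hom (G v \<times>\<times> G' v) (G v' \<times>\<times> G' v')"
   by (rule homI) (use A.restrict_closed[OF v] B.restrict_closed[OF v] hom_mult[OF A.restrict_map[OF v]] hom_mult[OF B.restrict_map[OF v]] in auto)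
 next
  fix v' v v'' x assume v: "v' \<sqsubseteq>\<^bsub>X\<^esub> v" "v'' \<sqsubseteq>\<^bsub>X\<^esub> v'" "x : carrier (G v \<times>\<times> G' v)"
  show "map_prod (r v' v'') (r' v' v'') (map_prod (r v v') (r' v v') x) = map_prod (r v v'') (r' v v'') x"
   using v(3) A.restrict_trans[OF v(1,2)] B.restrict_trans[OF v(1,2)] by auto
 next
  fix a b c u x y assume f: "functional_pair X a b c u"
   and xy: "x : carrier (G a \<times>\<times> G' a)" "y : carrier (G b \<times>\<times> G' b)" "map_prod (r a c) (r' a c) x = map_prod (r b c) (r' b c) y"
  have "\<exists>!z. z : carrier (G u) & r u a z = fst x & r u b z = fst y"
   by (rule A.glue[OF f]) (use xy in \<open>auto simp: map_prod_def split: prod.splits\<close>)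
  moreover have "\<exists>!z. z : carrier (G' u) & r' u a z = snd x & r' u b z = snd y"
   by (rule B.glue[OF f]) (use xy in \<open>auto simp: map_prod_def split: prod.splits\<close>)
  ultimately have "\<exists>!z. (fst z : carrier (G u) & r u a (fst z) = fst x & r u b (fst z) = fst y) &
   (snd z : carrier (G' u) & r' u a (snd z) = snd x & r' u b (snd z) = snd y)" by (rule ex1_pair)
  then show "\<exists>!z. z : carrier (G u \<times>\<times> G' u) & map_prod (r u a) (r' u a) z = x & map_prod (r u b) (r' u b) z = y"
   by (rule back_subst[of Ex1]) (auto simp: fun_eq_iff prod_eq_iff mem_Times_iff)
 next
  fix a b c u z assume f: "functional_pair X a b c u" and z: "z : carrier (G c \<times>\<times> G' c)"
  note f' = A.functional_pairD[OF f]
  interpret a: comm_group "G c" by (rule A.group[OF f'(3)])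
  interpret b: comm_group "G' c" by (rule B.group[OF f'(3)])
  obtain x y where xy: "x : carrier (G a)" "y : carrier (G b)" "fst z = r a c x \<otimes>\<^bsub>G c\<^esub> inv\<^bsub>G c\<^esub> (r b c y)"
   using A.difference[OF f, of "fst z"] z by auto
  obtain x' y' where xy': "x' : carrier (G' a)" "y' : carrier (G' b)" "snd z = r' a c x' \<otimes>\<^bsub>G' c\<^esub> inv\<^bsub>G' c\<^esub> (r' b c y')"
   using B.difference[OF f, of "snd z"] z by auto
  have "z = map_prod (r a c) (r' a c) (x, x') \<otimes>\<^bsub>G c \<times>\<times> G' c\<^esub> inv\<^bsub>G c \<times>\<times> G' c\<^esub> (map_prod (r b c) (r' b c) (y, y'))"
   using xy xy' inv_DirProd[OF a.is_group b.is_group A.restrict_closed[OF f'(6) xy(2)] B.restrict_closed[OF f'(6) xy'(2)]]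
   by (cases z) simp
  then show "\<exists>x\<in>carrier (G a \<times>\<times> G' a). \<exists>y\<in>carrier (G b \<times>\<times> G' b).
    z = map_prod (r a c) (r' a c) x \<otimes>\<^bsub>G c \<times>\<times> G' c\<^esub> inv\<^bsub>G c \<times>\<times> G' c\<^esub> (map_prod (r b c) (r' b c) y)"
   by (intro bexI[of _ "(x, x')"] bexI[of _ "(y, y')"]) (use xy xy' in auto)
 next
  fix D s assume D: "D \<subseteq> carrier X" "!!a b. a : D ==> b : D ==> a ~= b ==> a \<sqinter>\<^bsub>X\<^esub> b = \<bottom>\<^bsub>X\<^esub>"
   and s: "!!d. d : D ==> s d : carrier (G d \<times>\<times> G' d)"
  let ?u = "\<Squnion>\<^bsub>X\<^esub> D"
  have "\<exists>!t. t : carrier (G ?u) & (\<forall>d\<in>D. r ?u d t = fst (s d))"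
   by (rule A.glue_disjoint[OF D]) (use s in \<open>auto simp: mem_Times_iff\<close>)
  moreover have "\<exists>!t. t : carrier (G' ?u) & (\<forall>d\<in>D. r' ?u d t = snd (s d))"
   by (rule B.glue_disjoint[OF D]) (use s in \<open>auto simp: mem_Times_iff\<close>)
  ultimately have "\<exists>!t. (fst t : carrier (G ?u) & (\<forall>d\<in>D. r ?u d (fst t) = fst (s d))) &
   (snd t : carrier (G' ?u) & (\<forall>d\<in>D. r' ?u d (snd t) = snd (s d)))" by (rule ex1_pair)
  then show "\<exists>!t. t : carrier (G ?u \<times>\<times> G' ?u) & (\<forall>d\<in>D. map_prod (r ?u d) (r' ?u d) t = s d)"
   by (rule back_subst[of Ex1]) (auto simp: fun_eq_iff prod_eq_iff mem_Times_iff)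
 qed
qed

subsection \<open>Exactness is a numerably closed property\<close>

text \<open>As the degrees are integers, exactness at \<open>n + 1\<close> for all \<open>n\<close>
  covers every degree and avoids subtraction.\<close>

definition exact :: "'v cochain => bool" where
 "exact A \<longleftrightarrow> (\<forall>n. \<forall>x\<in>carrier (grp A (n + 1)). dif A (n + 1) x = \<one>\<^bsub>grp A (n + 1 + 1)\<^esub> --> x : dif A n ` carrier (grp A n))"

lemma (in group_hom) hom_difference:
 "[|x : carrier G; y : carrier G|] ==> h (x \<otimes> inv y) = h x \<otimes>\<^bsub>H\<^esub> inv\<^bsub>H\<^esub> (h y)"
 by simp

lemma (in comm_group) difference_swap:
 assumes "a : carrier G" "b : carrier G" "p : carrier G" "q : carrier G" "a \<otimes> inv b = p \<otimes> inv q"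
 shows "a \<otimes> inv p = b \<otimes> inv q"
proof -
 have "a = p \<otimes> inv q \<otimes> b" using assms inv_solve_right'[of a "p \<otimes> inv q" b] by (metis inv_closed m_closed inv_solve_right)
 moreover have "p \<otimes> (inv p \<otimes> inv q) = inv q" using assms(1-4) by (simp flip: m_assoc)
 ultimately show ?thesis using assms(1-4) by (simp add: m_ac)
qed

locale soft_complex = frame_lattice X for X :: "'a gorder" (structure) +
 fixes A :: "'a => 'g cochain" and r :: "'a => 'a => int => 'g => 'g"
 assumes complex: "v : carrier X ==> cochain_complex (A v)"
  and restrict_cochain_map: "v' \<sqsubseteq> v ==> cochain_map (A v) (A v') (r v v')"
  and soft: "soft_sheaf X (%v. grp (A v) n) (%v v'. r v v' n)"
begin

lemma group: "v : carrier X ==> comm_group (grp (A v) n)"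
 using complex by (simp add: cochain_complex_def)

lemma dif_hom: "v : carrier X ==> group_hom (grp (A v) n) (grp (A v) (n + 1)) (dif (A v) n)"
 using complex by (simp add: cochain_complex_def group_hom_def group_hom_axioms_def comm_group_def)

lemma dif_closed: "v : carrier X ==> x : carrier (grp (A v) n) ==> dif (A v) n x : carrier (grp (A v) (n + 1))"
 using group_hom.hom_closed[OF dif_hom] .

lemma dif_dif: "v : carrier X ==> x : carrier (grp (A v) n) ==> dif (A v) (n + 1) (dif (A v) n x) = \<one>\<^bsub>grp (A v) (n + 1 + 1)\<^esub>"
 using complex by (simp add: cochain_complex_def)

lemma r_hom: "v' \<sqsubseteq> v ==> group_hom (grp (A v) n) (grp (A v') n) (r v v' n)"
 by (rule soft_sheaf.restrict_group_hom[OF soft])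

lemma r_closed: "v' \<sqsubseteq> v ==> x : carrier (grp (A v) n) ==> r v v' n x : carrier (grp (A v') n)"
 by (rule group_hom.hom_closed[OF r_hom])

lemma r_dif: "v' \<sqsubseteq> v ==> x : carrier (grp (A v) n) ==> r v v' (n + 1) (dif (A v) n x) = dif (A v') n (r v v' n x)"
 using restrict_cochain_map by (simp add: cochain_map_def)

lemma cocycle_restrict:
 assumes "v' \<sqsubseteq> v" "x : carrier (grp (A v) n)" "dif (A v) n x = \<one>\<^bsub>grp (A v) (n + 1)\<^esub>"
 shows "dif (A v') n (r v v' n x) = \<one>\<^bsub>grp (A v') (n + 1)\<^esub>"
 using r_dif[OF assms(1,2)] group_hom.hom_one[OF r_hom[OF assms(1)]] assms(3) by simp

text \<open>The primitives of a cocycle on the two parts differ by a cocycle on the intersection.  By softness,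
 a primitive of the latter is a difference, which is used to make the primitives agree.\<close>

lemma exact_functional_pair:
 assumes f: "functional_pair X a b c u" and ex: "exact (A a)" "exact (A b)" "exact (A c)"
 shows "exact (A u)"
 unfolding exact_def
proof (intro allI ballI impI)
 fix n x assume x: "x : carrier (grp (A u) (n + 1))" and dx: "dif (A u) (n + 1) x = \<one>\<^bsub>grp (A u) (n + 1 + 1)\<^esub>"
 \<comment> \<open>Exactness on the intersection is used one degree lower; that degree is named
   \<open>m\<close>.\<close>
 obtain m where n: "n = m + 1" by (metis diff_add_cancel)
 note f' = functional_pairD[OF f]
 interpret C: comm_group "grp (A c) n" by (rule group[OF f'(3)])
 interpret C1: comm_group "grp (A c) (n + 1)" by (rule group[OF f'(3)])
 have local: "\<exists>y\<in>carrier (grp (A v) n). r u v (n + 1) x = dif (A v) n y" if v: "v \<sqsubseteq> u" "exact (A v)" for v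
  using v(2) r_closed[OF v(1) x] cocycle_restrict[OF v(1) x dx] unfolding exact_def by blast
 obtain ya where ya: "ya : carrier (grp (A a) n)" "r u a (n + 1) x = dif (A a) n ya" using local[OF f'(8) ex(1)] by blast
 obtain yb where yb: "yb : carrier (grp (A b) n)" "r u b (n + 1) x = dif (A b) n yb" using local[OF f'(9) ex(2)] by blast
 have dr: "dif (A c) n (r a c n ya) = r u c (n + 1) x" "dif (A c) n (r b c n yb) = r u c (n + 1) x"
  using r_dif[OF f'(5) ya(1)] r_dif[OF f'(6) yb(1)] ya(2) yb(2) soft_sheaf.restrict_trans[OF soft f'(8,5) x]
   soft_sheaf.restrict_trans[OF soft f'(9,6) x] by simp_all
 define t where "t = r a c n ya \<otimes>\<^bsub>grp (A c) n\<^esub> inv\<^bsub>grp (A c) n\<^esub> (r b c n yb)"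
 note cy = r_closed[OF f'(5) ya(1)] r_closed[OF f'(6) yb(1)]
 have t: "t : carrier (grp (A c) n)" using cy by (simp add: t_def)
 have "dif (A c) n t = \<one>\<^bsub>grp (A c) (n + 1)\<^esub>"
  using group_hom.hom_difference[OF dif_hom[OF f'(3)] cy] dr r_closed[OF f'(7) x] by (simp add: t_def)
 then obtain w where w: "w : carrier (grp (A c) m)" "t = dif (A c) m w" using ex(3) t unfolding exact_def n by blast
 obtain wa wb where wab: "wa : carrier (grp (A a) m)" "wb : carrier (grp (A b) m)"
  "w = r a c m wa \<otimes>\<^bsub>grp (A c) m\<^esub> inv\<^bsub>grp (A c) m\<^esub> (r b c m wb)"
  using soft_sheaf.difference[OF soft f w(1)] by blast
 note cw = r_closed[OF f'(5) wab(1)] r_closed[OF f'(6) wab(2)]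
 note da = dif_closed[OF f'(1) wab(1), folded n] and db = dif_closed[OF f'(2) wab(2), folded n]
 have tw: "t = r a c n (dif (A a) m wa) \<otimes>\<^bsub>grp (A c) n\<^esub> inv\<^bsub>grp (A c) n\<^esub> (r b c n (dif (A b) m wb))"
  using group_hom.hom_difference[OF dif_hom[OF f'(3)] cw] r_dif[OF f'(5) wab(1)] r_dif[OF f'(6) wab(2)] w(2) wab(3) by (simp add: n)
 interpret Ga: comm_group "grp (A a) n" by (rule group[OF f'(1)])
 interpret Gb: comm_group "grp (A b) n" by (rule group[OF f'(2)])
 define za where "za = ya \<otimes>\<^bsub>grp (A a) n\<^esub> inv\<^bsub>grp (A a) n\<^esub> (dif (A a) m wa)"
 define zb where "zb = yb \<otimes>\<^bsub>grp (A b) n\<^esub> inv\<^bsub>grp (A b) n\<^esub> (dif (A b) m wb)"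
 have z: "za : carrier (grp (A a) n)" "zb : carrier (grp (A b) n)" using ya(1) yb(1) da db by (simp_all add: za_def zb_def)
 have "r a c n za = r b c n zb"
  unfolding za_def zb_def group_hom.hom_difference[OF r_hom[OF f'(5)] ya(1) da] group_hom.hom_difference[OF r_hom[OF f'(6)] yb(1) db]
  by (rule C.difference_swap[OF cy r_closed[OF f'(5) da] r_closed[OF f'(6) db]]) (use tw t_def in simp)
 from soft_sheaf.glue[OF soft f z this]
 obtain y where y: "y : carrier (grp (A u) n)" "r u a n y = za" "r u b n y = zb" by blast
 have dz: "dif (A a) n za = r u a (n + 1) x" "dif (A b) n zb = r u b (n + 1) x"
 proof -
  interpret Ga1: comm_group "grp (A a) (n + 1)" by (rule group[OF f'(1)])
  interpret Gb1: comm_group "grp (A b) (n + 1)" by (rule group[OF f'(2)])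
  show "dif (A a) n za = r u a (n + 1) x"
   using group_hom.hom_difference[OF dif_hom[OF f'(1)] ya(1) da] dif_dif[OF f'(1) wab(1), folded n] ya(2) dif_closed[OF f'(1) ya(1)]
   by (simp add: za_def)
  show "dif (A b) n zb = r u b (n + 1) x"
   using group_hom.hom_difference[OF dif_hom[OF f'(2)] yb(1) db] dif_dif[OF f'(2) wab(2), folded n] yb(2) dif_closed[OF f'(2) yb(1)]
   by (simp add: zb_def)
 qed
 \<comment> \<open>The differential of the glued primitive agrees with \<open>x\<close> on both
   parts, so uniqueness of gluing identifies the two.\<close>
 have "\<exists>!z. z : carrier (grp (A u) (n + 1)) & r u a (n + 1) z = r u a (n + 1) x & r u b (n + 1) z = r u b (n + 1) x"
  by (rule soft_sheaf.glue[OF soft f r_closed[OF f'(8) x] r_closed[OF f'(9) x]])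
   (use soft_sheaf.restrict_trans[OF soft f'(8,5) x] soft_sheaf.restrict_trans[OF soft f'(9,6) x] in simp)
 moreover have "dif (A u) n y : carrier (grp (A u) (n + 1)) & r u a (n + 1) (dif (A u) n y) = r u a (n + 1) x & r u b (n + 1) (dif (A u) n y) = r u b (n + 1) x"
  using dif_closed[OF f'(4) y(1)] r_dif[OF f'(8) y(1)] r_dif[OF f'(9) y(1)] y dz by simp
 ultimately have "x = dif (A u) n y" using x by blast
 then show "x : dif (A u) n ` carrier (grp (A u) n)" using y(1) by blast
qed

text \<open>Primitives are chosen on the parts and glued without further condition; uniqueness of
  gluing identifies the differential with \<open>x\<close>.\<close>

lemma exact_disjoint:
 assumes D: "D \<subseteq> carrier X" "!!a b. a : D ==> b : D ==> a ~= b ==> a \<sqinter> b = \<bottom>" and ex: "!!d. d : D ==> exact (A d)"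
 shows "exact (A (\<Squnion> D))"
 unfolding exact_def
proof (intro allI ballI impI)
 let ?u = "\<Squnion> D"
 fix n x assume x: "x : carrier (grp (A ?u) (n + 1))" and dx: "dif (A ?u) (n + 1) x = \<one>\<^bsub>grp (A ?u) (n + 1 + 1)\<^esub>"
 have u: "?u : carrier X" and le: "!!d. d : D ==> d \<sqsubseteq> ?u" using D(1) sup_upper by auto
 have "\<exists>y\<in>carrier (grp (A d) n). r ?u d (n + 1) x = dif (A d) n y" if d: "d : D" for d
  using ex[OF d] r_closed[OF le[OF d] x] cocycle_restrict[OF le[OF d] x dx] unfolding exact_def by blast
 then obtain y where y: "!!d. d : D ==> y d : carrier (grp (A d) n)" "!!d. d : D ==> r ?u d (n + 1) x = dif (A d) n (y d)" by metis
 obtain t where t: "t : carrier (grp (A ?u) n)" "\<forall>d\<in>D. r ?u d n t = y d"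
  using soft_sheaf.glue_disjoint[OF soft D y(1)] by blast
 have "\<exists>!z. z : carrier (grp (A ?u) (n + 1)) & (\<forall>d\<in>D. r ?u d (n + 1) z = r ?u d (n + 1) x)"
  by (rule soft_sheaf.glue_disjoint[OF soft D r_closed[OF le x]])
 moreover have "r ?u d (n + 1) (dif (A ?u) n t) = r ?u d (n + 1) x" if "d : D" for d
  using r_dif[OF le[OF that] t(1)] t(2) y(2)[OF that] that by simp
 ultimately have "x = dif (A ?u) n t" using x dif_closed[OF u t(1)] by blast
 then show "x : dif (A ?u) n ` carrier (grp (A ?u) n)" using t(1) by blast
qed

text \<open>Heredity supplies exactness on the intersection in the Mayer--Vietoris step. It is
  regained for the union by intersecting the pair, or the disjoint family, with the smaller
  open.\<close>

theorem exact_numerably_closed: "numerably_closed X (%w. w : carrier X & (\<forall>v. v \<sqsubseteq> w --> exact (A v)))"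
 unfolding numerably_closed_def
proof (intro conjI allI ballI impI)
 fix v w assume "(v : carrier X & (\<forall>va. va \<sqsubseteq> v --> exact (A va))) & w \<sqsubseteq> v"
 then show "w : carrier X" using le_carrier by blast
next
 fix v w z assume vw: "(v : carrier X & (\<forall>va. va \<sqsubseteq> v --> exact (A va))) & w \<sqsubseteq> v" and z: "z \<sqsubseteq> w"
 have "z \<sqsubseteq> v" by (rule trans[OF z]) (use vw in simp)
 then show "exact (A z)" using vw by simp
next
 fix w \<phi> C B assume w: "w : carrier X" "C : carrier half_line" "B : carrier half_line"
  and *: "frame_hom half_line (open_sublocale X w) \<phi> & (\<phi> C : carrier X & (\<forall>va. va \<sqsubseteq> \<phi> C --> exact (A va))) &
   (\<phi> B : carrier X & (\<forall>va. va \<sqsubseteq> \<phi> B --> exact (A va)))"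
 then have f: "functional_pair X (\<phi> C) (\<phi> B) (\<phi> (C \<inter> B)) (\<phi> (C \<union> B))" unfolding functional_pair_def by blast
 note f' = functional_pairD[OF f]
 show "\<phi> (C \<union> B) : carrier X" by (rule f'(4))
 fix v assume v: "v \<sqsubseteq> \<phi> (C \<union> B)"
 then have vc: "v : carrier X" using le_carrier by blast
 note m = meet_lower[OF vc f'(1)] meet_lower[OF vc f'(2)] meet_lower[OF vc f'(3)]
 show "exact (A v)"
  by (rule exact_functional_pair[OF functional_pair_meet[OF f v]]) (use * m trans[OF m(9) f'(5)] in simp_all)
next
 fix D assume D: "D \<subseteq> carrier X"
  and *: "(\<forall>a\<in>D. \<forall>b\<in>D. a ~= b --> a \<sqinter> b = \<bottom>) & (\<forall>d\<in>D. d : carrier X & (\<forall>v. v \<sqsubseteq> d --> exact (A v)))"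
 show u: "\<Squnion> D : carrier X" using D by simp
 fix v assume v: "v \<sqsubseteq> \<Squnion> D"
 then have vc: "v : carrier X" using le_carrier by blast
 let ?D = "(%d. v \<sqinter> d) ` D"
 have eq: "\<Squnion> ?D = v" using meet_sup[OF vc D] meet_absorb(1)[OF vc u v] by simp
 have "exact (A (\<Squnion> ?D))"
 proof (rule exact_disjoint)
  show "?D \<subseteq> carrier X" using meet_lower(1)[OF vc] D by blast
  show "exact (A e)" if "e : ?D" for e using that * meet_lower(3)[OF vc] D by blast
  fix p q assume "p : ?D" "q : ?D" "p ~= q"
  then obtain d e where de: "d : D" "e : D" "d ~= e" "p = v \<sqinter> d" "q = v \<sqinter> e" by blast
  have c: "d : carrier X" "e : carrier X" using de D by auto
  note md = meet_lower[OF vc c(1)] and me = meet_lower[OF vc c(2)]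
  note mm = meet_lower[OF md(1) me(1)]
  show "p \<sqinter> q = \<bottom>" unfolding de(4,5)
  proof (rule antisymI)
   have "v \<sqinter> d \<sqinter> (v \<sqinter> e) \<sqsubseteq> d \<sqinter> e"
    by (rule meet_greatest[OF trans[OF mm(2) md(3)] trans[OF mm(3) me(3)] mm(1) c])
   then show "v \<sqinter> d \<sqinter> (v \<sqinter> e) \<sqsubseteq> \<bottom>" using * de(1-3) by simp
  qed (use mm(1) bottom_lower in auto)
 qed
 then show "exact (A v)" unfolding eq .
qed

end

subsection \<open>Product complexes and mapping cones\<close>

definition product_complex :: "'j set => ('j => 'v cochain) => ('j => 'v) cochain" where
 "product_complex J A = \<lparr>grp = (%n. product_group J (%j. grp (A j) n)), dif = (%n x. \<lambda>j\<in>J. dif (A j) n (x j))\<rparr>"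

lemma product_complex_simps [simp]:
 "grp (product_complex J A) n = product_group J (%j. grp (A j) n)"
 "dif (product_complex J A) n x = (\<lambda>j\<in>J. dif (A j) n (x j))"
 by (simp_all add: product_complex_def)

lemma product_complex:
 assumes "!!j. j : J ==> cochain_complex (A j)"
 shows "cochain_complex (product_complex J A)"
 unfolding cochain_complex_def
proof (intro allI conjI ballI)
 fix n
 show "comm_group (grp (product_complex J A) n)"
  using assms by (simp add: cochain_complex_def comm_product_group)
 have c: "dif (A j) n y : carrier (grp (A j) (n + 1))" if "j : J" "y : carrier (grp (A j) n)" for j y
  using assms[OF that(1)] that(2) by (auto simp: cochain_complex_def hom_def)
 have m: "dif (A j) n (x \<otimes>\<^bsub>grp (A j) n\<^esub> y) = dif (A j) n x \<otimes>\<^bsub>grp (A j) (n + 1)\<^esub> dif (A j) n y"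
  if "j : J" "x : carrier (grp (A j) n)" "y : carrier (grp (A j) n)" for j x y
  using assms[OF that(1)] that(2,3) by (auto simp: cochain_complex_def hom_def)
 show "dif (product_complex J A) n : hom (grp (product_complex J A) n) (grp (product_complex J A) (n + 1))"
  by (rule homI) (use c m in \<open>auto simp: PiE_iff fun_eq_iff\<close>)
 fix x assume "x : carrier (grp (product_complex J A) n)"
 then show "dif (product_complex J A) (n + 1) (dif (product_complex J A) n x) = \<one>\<^bsub>grp (product_complex J A) (n + 1 + 1)\<^esub>"
  using assms by (auto simp: cochain_complex_def PiE_iff fun_eq_iff)
qed

lemma product_complex_map:
 assumes h: "!!s. s : J' ==> h s : J" and f: "!!s. s : J' ==> cochain_map (A (h s)) (A' s) (f s)"
 shows "cochain_map (product_complex J A) (product_complex J' A') (%n x. \<lambda>s\<in>J'. f s n (x (h s)))"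
 unfolding cochain_map_def
proof (intro allI conjI ballI)
 fix n
 have c: "f s n y : carrier (grp (A' s) n)" if "s : J'" "y : carrier (grp (A (h s)) n)" for s y
  using f[OF that(1)] that(2) by (auto simp: cochain_map_def hom_def)
 have m: "f s n (x \<otimes>\<^bsub>grp (A (h s)) n\<^esub> y) = f s n x \<otimes>\<^bsub>grp (A' s) n\<^esub> f s n y"
  if "s : J'" "x : carrier (grp (A (h s)) n)" "y : carrier (grp (A (h s)) n)" for s x y
  using f[OF that(1)] that(2,3) by (auto simp: cochain_map_def hom_def)
 show "(%x. \<lambda>s\<in>J'. f s n (x (h s))) : hom (grp (product_complex J A) n) (grp (product_complex J' A') n)"
  by (rule homI) (use c m h in \<open>auto simp: PiE_iff fun_eq_iff\<close>)
 fix x assume "x : carrier (grp (product_complex J A) n)"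
 then show "(\<lambda>s\<in>J'. f s (n + 1) (dif (product_complex J A) n x (h s))) = dif (product_complex J' A') n (\<lambda>s\<in>J'. f s n (x (h s)))"
  using f h by (auto simp: cochain_map_def PiE_iff fun_eq_iff)
qed

lemma product_complex_cone:
 assumes f: "!!s. s : J ==> cochain_map B (A s) (f s)"
 shows "cochain_map B (product_complex J A) (%n x. \<lambda>s\<in>J. f s n x)"
 unfolding cochain_map_def
proof (intro allI conjI ballI)
 fix n
 have c: "f s n y : carrier (grp (A s) n)" if "s : J" "y : carrier (grp B n)" for s y
  using f[OF that(1)] that(2) by (auto simp: cochain_map_def hom_def)
 have m: "f s n (x \<otimes>\<^bsub>grp B n\<^esub> y) = f s n x \<otimes>\<^bsub>grp (A s) n\<^esub> f s n y"
  if "s : J" "x : carrier (grp B n)" "y : carrier (grp B n)" for s x y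
  using f[OF that(1)] that(2,3) by (auto simp: cochain_map_def hom_def)
 show "(%x. \<lambda>s\<in>J. f s n x) : hom (grp B n) (grp (product_complex J A) n)"
  by (rule homI) (use c m in \<open>auto simp: PiE_iff fun_eq_iff\<close>)
 fix x assume "x : carrier (grp B n)"
 then show "(\<lambda>s\<in>J. f s (n + 1) (dif B n x)) = dif (product_complex J A) n (\<lambda>s\<in>J. f s n x)"
  using f by (auto simp: cochain_map_def fun_eq_iff)
qed

text \<open>Its exactness encodes injectivity and surjectivity on cohomology at once, as a property
  of a single complex, whose sections can be glued.\<close>

definition mapping_cone :: "'v cochain => 'w cochain => (int => 'v => 'w) => ('v \<times> 'w) cochain" where
 "mapping_cone A B e = \<lparr>grp = (%k. grp A (k + 1) \<times>\<times> grp B k),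
  dif = (\<lambda>k (a, x). (inv\<^bsub>grp A (k + 1 + 1)\<^esub> (dif A (k + 1) a), e (k + 1) a \<otimes>\<^bsub>grp B (k + 1)\<^esub> dif B k x))\<rparr>"

lemma mapping_cone_simps [simp]:
 "grp (mapping_cone A B e) k = grp A (k + 1) \<times>\<times> grp B k"
 "dif (mapping_cone A B e) k (a, x) = (inv\<^bsub>grp A (k + 1 + 1)\<^esub> (dif A (k + 1) a), e (k + 1) a \<otimes>\<^bsub>grp B (k + 1)\<^esub> dif B k x)"
 by (simp_all add: mapping_cone_def)

lemma DirProd_comm_group: "comm_group G ==> comm_group H ==> comm_group (G \<times>\<times> H)"
 by (rule group.group_comm_groupI) (auto simp: comm_group_def comm_monoid.m_comm intro: DirProd_group)

locale complex_map =
 fixes A :: "'v cochain" and B :: "'w cochain" and e :: "int => 'v => 'w"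
 assumes A: "cochain_complex A" and B: "cochain_complex B" and e: "cochain_map A B e"
begin

lemma groups: "comm_group (grp A n)" "comm_group (grp B n)"
 using A B by (simp_all add: cochain_complex_def)

lemma homs: "group_hom (grp A n) (grp A (n + 1)) (dif A n)" "group_hom (grp B n) (grp B (n + 1)) (dif B n)"
 "group_hom (grp A n) (grp B n) (e n)"
 using A B e by (simp_all add: cochain_complex_def cochain_map_def group_hom_def group_hom_axioms_def comm_group_def)

lemmas closed = homs[THEN group_hom.hom_closed]

lemma dif_dif: "a : carrier (grp A n) ==> dif A (n + 1) (dif A n a) = \<one>\<^bsub>grp A (n + 1 + 1)\<^esub>"
 "x : carrier (grp B n) ==> dif B (n + 1) (dif B n x) = \<one>\<^bsub>grp B (n + 1 + 1)\<^esub>"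
 using A B by (simp_all add: cochain_complex_def)

lemma e_dif: "a : carrier (grp A n) ==> e (n + 1) (dif A n a) = dif B n (e n a)"
 using e by (simp add: cochain_map_def)

lemma mapping_cone_complex: "cochain_complex (mapping_cone A B e)"
 unfolding cochain_complex_def
proof (intro allI conjI ballI)
 \<comment> \<open>Keeps the degrees in the form \<open>k + 1 + 1\<close> in which the groups and
   differentials are indexed.\<close>
 note [[simproc del: int_combine_numerals]]
 fix k
 show "comm_group (grp (mapping_cone A B e) k)" using groups by (simp add: DirProd_comm_group)
 interpret A1: comm_group "grp A (k + 1)" by (rule groups)
 interpret A2: comm_group "grp A (k + 1 + 1)" by (rule groups)
 interpret A3: comm_group "grp A (k + 1 + 1 + 1)" by (rule groups)
 interpret B0: comm_group "grp B k" by (rule groups)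
 interpret B1: comm_group "grp B (k + 1)" by (rule groups)
 interpret B2: comm_group "grp B (k + 1 + 1)" by (rule groups)
 note h = group_hom.hom_mult[OF homs(1)] group_hom.hom_mult[OF homs(2)] group_hom.hom_mult[OF homs(3)]
 note i = group_hom.hom_inv[OF homs(1)] group_hom.hom_inv[OF homs(2)] group_hom.hom_inv[OF homs(3)]
 show "dif (mapping_cone A B e) k : hom (grp (mapping_cone A B e) k) (grp (mapping_cone A B e) (k + 1))"
 proof (rule homI)
  fix z assume "z : carrier (grp (mapping_cone A B e) k)"
  then show "dif (mapping_cone A B e) k z : carrier (grp (mapping_cone A B e) (k + 1))" using closed by (cases z) simp
 next
  fix z w assume zw: "z : carrier (grp (mapping_cone A B e) k)" "w : carrier (grp (mapping_cone A B e) k)"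
  obtain a x b y where [simp]: "z = (a, x)" "w = (b, y)" by (metis surj_pair)
  have c: "a : carrier (grp A (k + 1))" "b : carrier (grp A (k + 1))" "x : carrier (grp B k)" "y : carrier (grp B k)" using zw by simp_all
  show "dif (mapping_cone A B e) k (z \<otimes>\<^bsub>grp (mapping_cone A B e) k\<^esub> w) =
    dif (mapping_cone A B e) k z \<otimes>\<^bsub>grp (mapping_cone A B e) (k + 1)\<^esub> dif (mapping_cone A B e) k w"
   using c closed by (simp add: h A2.inv_mult A2.m_comm B1.m_ac)
 qed
 fix z assume "z : carrier (grp (mapping_cone A B e) k)"
 then obtain a x where z: "z = (a, x)" "a : carrier (grp A (k + 1))" "x : carrier (grp B k)" by auto
 have "inv\<^bsub>grp B (k + 1 + 1)\<^esub> (e (k + 1 + 1) (dif A (k + 1) a)) \<otimes>\<^bsub>grp B (k + 1 + 1)\<^esub> dif B (k + 1) (e (k + 1) a) = \<one>\<^bsub>grp B (k + 1 + 1)\<^esub>"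
  unfolding e_dif[OF z(2)] by (rule B2.l_inv[OF closed(2)[OF closed(3)[OF z(2)]]])
 then show "dif (mapping_cone A B e) (k + 1) (dif (mapping_cone A B e) k z) = \<one>\<^bsub>grp (mapping_cone A B e) (k + 1 + 1)\<^esub>"
  using z(2,3) closed dif_dif by (simp add: z(1) h i)
qed

text \<open>The product of the coboundaries with the image of a coset is again one coset, because
  \<open>e\<close> maps coboundaries to coboundaries.\<close>

lemma cohomology_map_coset:
 assumes x: "x : carrier (grp A n)"
 shows "cohomology_map A B e n (coboundaries A n #>\<^bsub>grp A n\<^esub> x) = coboundaries B n #>\<^bsub>grp B n\<^esub> (e n x)"
proof -
 obtain m where n: "n = m + 1" by (metis diff_add_cancel)
 interpret An: comm_group "grp A n" by (rule groups)
 interpret Bn: comm_group "grp B n" by (rule groups)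
 interpret dB: group_hom "grp B m" "grp B n" "dif B m" using homs(2)[of m] by (simp add: n)
 have cA: "coboundaries A n = dif A m ` carrier (grp A m)" and cB: "coboundaries B n = dif B m ` carrier (grp B m)"
  by (simp_all add: coboundaries_def n)
 have dA: "dif A m a : carrier (grp A n)" "e n (dif A m a) = dif B m (e m a)" if "a : carrier (grp A m)" for a
  using closed(1)[OF that] e_dif[OF that] by (simp_all add: n)
 have e1: "e m \<one>\<^bsub>grp A m\<^esub> = \<one>\<^bsub>grp B m\<^esub>" "\<one>\<^bsub>grp A m\<^esub> : carrier (grp A m)" "dif A m \<one>\<^bsub>grp A m\<^esub> = \<one>\<^bsub>grp A n\<^esub>"
  using group_hom.hom_one[OF homs(3)] group_hom.hom_one[OF homs(1)[of m]] groups(1)[of m]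
  by (simp_all add: n comm_group_def Group.group_def monoid.one_closed)
 show ?thesis
 proof (intro equalityI subsetI)
  fix y assume "y : cohomology_map A B e n (coboundaries A n #>\<^bsub>grp A n\<^esub> x)"
  then obtain b a where ba: "b : carrier (grp B m)" "a : carrier (grp A m)"
   "y = dif B m b \<otimes>\<^bsub>grp B n\<^esub> e n (dif A m a \<otimes>\<^bsub>grp A n\<^esub> x)"
   unfolding cohomology_map_def cA cB set_mult_def r_coset_def by auto
  have "y = dif B m (b \<otimes>\<^bsub>grp B m\<^esub> e m a) \<otimes>\<^bsub>grp B n\<^esub> e n x"
   using ba dA x closed(3)[OF x] closed(3)[OF ba(2)] group_hom.hom_mult[OF homs(3)] by (simp add: Bn.m_assoc)
  moreover have "b \<otimes>\<^bsub>grp B m\<^esub> e m a : carrier (grp B m)" using ba closed(3) by simp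
  ultimately show "y : coboundaries B n #>\<^bsub>grp B n\<^esub> (e n x)" unfolding cB r_coset_def by blast
 next
  fix y assume "y : coboundaries B n #>\<^bsub>grp B n\<^esub> (e n x)"
  then obtain b where b: "b : carrier (grp B m)" "y = dif B m b \<otimes>\<^bsub>grp B n\<^esub> e n x" unfolding cB r_coset_def by blast
  have "x = dif A m \<one>\<^bsub>grp A m\<^esub> \<otimes>\<^bsub>grp A n\<^esub> x" using e1 x by simp
  then have "x : coboundaries A n #>\<^bsub>grp A n\<^esub> x" unfolding cA r_coset_def using e1(2) by blast
  then show "y : cohomology_map A B e n (coboundaries A n #>\<^bsub>grp A n\<^esub> x)"
   unfolding cohomology_map_def cB set_mult_def using b by blast
 qed
qed

end

lemma cohomology_group:
 assumes A: "cochain_complex A"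
 shows "coboundaries A n \<lhd> (grp A n)\<lparr>carrier := cocycles A n\<rparr>" "comm_group ((grp A n)\<lparr>carrier := cocycles A n\<rparr>)"
  "subgroup (coboundaries A n) (grp A n)" "cocycles A n \<subseteq> carrier (grp A n)"
proof -
 obtain m where n: "n = m + 1" by (metis diff_add_cancel)
 have g: "comm_group (grp A k)" for k using A by (simp add: cochain_complex_def)
 have h: "group_hom (grp A k) (grp A (k + 1)) (dif A k)" for k
  using A by (simp add: cochain_complex_def group_hom_def group_hom_axioms_def comm_group_def)
 interpret dn: group_hom "grp A n" "grp A (n + 1)" "dif A n" by (rule h)
 interpret dm: group_hom "grp A m" "grp A n" "dif A m" using h[of m] by (simp add: n)
 interpret An: comm_group "grp A n" by (rule g)
 have Z: "subgroup (cocycles A n) (grp A n)" unfolding cocycles_def by (rule dn.subgroup_kernel)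
 show B: "subgroup (coboundaries A n) (grp A n)" using dm.img_is_subgroup by (simp add: coboundaries_def n)
 show "cocycles A n \<subseteq> carrier (grp A n)" by (rule subgroup.subset[OF Z])
 show cg: "comm_group ((grp A n)\<lparr>carrier := cocycles A n\<rparr>)"
  by (rule group.group_comm_groupI[OF subgroup.subgroup_is_group[OF Z comm_group.axioms(2)[OF g]]]) (use subgroup.mem_carrier[OF Z] in \<open>simp add: An.m_comm\<close>)
 have "coboundaries A n \<subseteq> cocycles A n"
  using A dm.hom_closed by (auto simp: coboundaries_def cocycles_def kernel_def n cochain_complex_def)
 then have "subgroup (coboundaries A n) ((grp A n)\<lparr>carrier := cocycles A n\<rparr>)"
  by (rule group.subgroup_incl[OF comm_group.axioms(2)[OF g] B Z])
 then show "coboundaries A n \<lhd> (grp A n)\<lparr>carrier := cocycles A n\<rparr>"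
  using comm_group.normal_iff_subgroup[OF cg] by simp
qed

context complex_map
begin

text \<open>Reduces to representatives, the form in which exactness of the cone delivers both
  halves.\<close>

lemma quasi_isomorphismI:
 assumes inj: "!!n a y. a : carrier (grp A (n + 1)) ==> dif A (n + 1) a = \<one>\<^bsub>grp A (n + 1 + 1)\<^esub> ==>
   y : carrier (grp B n) ==> e (n + 1) a = dif B n y ==> a : dif A n ` carrier (grp A n)"
  and surj: "!!n x. x : carrier (grp B (n + 1)) ==> dif B (n + 1) x = \<one>\<^bsub>grp B (n + 1 + 1)\<^esub> ==>
   \<exists>a\<in>carrier (grp A (n + 1)). dif A (n + 1) a = \<one>\<^bsub>grp A (n + 1 + 1)\<^esub> & (\<exists>y\<in>carrier (grp B n). x = e (n + 1) a \<otimes>\<^bsub>grp B (n + 1)\<^esub> dif B n y)"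
 shows "quasi_isomorphism A B e"
 unfolding quasi_isomorphism_def
proof (intro conjI allI A B e)
 fix n :: int
 obtain m where n: "n = m + 1" by (metis diff_add_cancel)
 let ?A = "(grp A n)\<lparr>carrier := cocycles A n\<rparr>" and ?B = "(grp B n)\<lparr>carrier := cocycles B n\<rparr>"
 interpret An: comm_group "grp A n" by (rule groups)
 interpret Bn: comm_group "grp B n" by (rule groups)
 interpret en: group_hom "grp A n" "grp B n" "e n" by (rule homs)
 note cA = cohomology_group[OF A, of n] and cB = cohomology_group[OF B, of n]
 interpret NA: normal "coboundaries A n" ?A by (rule cA(1))
 interpret NB: normal "coboundaries B n" ?B by (rule cB(1))
 have bA: "coboundaries A n = dif A m ` carrier (grp A m)" and bB: "coboundaries B n = dif B m ` carrier (grp B m)"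
  by (simp_all add: coboundaries_def n)
 have Z: "x : cocycles A n \<longleftrightarrow> x : carrier (grp A n) & dif A n x = \<one>\<^bsub>grp A (n + 1)\<^esub>"
  "y : cocycles B n \<longleftrightarrow> y : carrier (grp B n) & dif B n y = \<one>\<^bsub>grp B (n + 1)\<^esub>" for x y
  by (simp_all add: cocycles_def kernel_def)
 have eZ: "e n x : cocycles B n" if "x : cocycles A n" for x
  using that e_dif[of x n] group_hom.hom_one[OF homs(3)] by (simp add: Z)
 let ?H = "cohomology_map A B e n"
 have cosets: "carrier (cohomology A n) = {coboundaries A n #>\<^bsub>grp A n\<^esub> x | x. x : cocycles A n}"
  "carrier (cohomology B n) = {coboundaries B n #>\<^bsub>grp B n\<^esub> x | x. x : cocycles B n}"
  unfolding cohomology_def FactGroup_def RCOSETS_def by (auto simp: r_coset_def)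
 have mA: "(coboundaries A n #>\<^bsub>grp A n\<^esub> x) \<otimes>\<^bsub>cohomology A n\<^esub> (coboundaries A n #>\<^bsub>grp A n\<^esub> y) = coboundaries A n #>\<^bsub>grp A n\<^esub> (x \<otimes>\<^bsub>grp A n\<^esub> y)"
  if "x : cocycles A n" "y : cocycles A n" for x y
  using NA.rcos_sum[of x y] that by (simp add: cohomology_def FactGroup_def r_coset_def set_mult_def)
 have mB: "(coboundaries B n #>\<^bsub>grp B n\<^esub> x) \<otimes>\<^bsub>cohomology B n\<^esub> (coboundaries B n #>\<^bsub>grp B n\<^esub> y) = coboundaries B n #>\<^bsub>grp B n\<^esub> (x \<otimes>\<^bsub>grp B n\<^esub> y)"
  if "x : cocycles B n" "y : cocycles B n" for x y
  using NB.rcos_sum[of x y] that by (simp add: cohomology_def FactGroup_def r_coset_def set_mult_def)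
 have map: "?H (coboundaries A n #>\<^bsub>grp A n\<^esub> x) = coboundaries B n #>\<^bsub>grp B n\<^esub> (e n x)" if "x : cocycles A n" for x
  by (rule cohomology_map_coset) (use that Z in simp)
 have mZ: "x \<otimes>\<^bsub>grp A n\<^esub> y : cocycles A n" if "x : cocycles A n" "y : cocycles A n" for x y
  using NA.m_closed[of x y] that by simp
 show "?H : iso (cohomology A n) (cohomology B n)"
 proof (rule isoI)
  show "?H : hom (cohomology A n) (cohomology B n)"
  proof (rule homI)
   fix c assume "c : carrier (cohomology A n)"
   then show "?H c : carrier (cohomology B n)" unfolding cosets using map eZ by auto
  next
   fix c d assume "c : carrier (cohomology A n)" "d : carrier (cohomology A n)"
   then obtain x y where xy: "x : cocycles A n" "y : cocycles A n" "c = coboundaries A n #>\<^bsub>grp A n\<^esub> x" "d = coboundaries A n #>\<^bsub>grp A n\<^esub> y"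
    unfolding cosets by blast
   show "?H (c \<otimes>\<^bsub>cohomology A n\<^esub> d) = ?H c \<otimes>\<^bsub>cohomology B n\<^esub> ?H d"
    unfolding xy(3,4) mA[OF xy(1,2)] map[OF mZ[OF xy(1,2)]] map[OF xy(1)] map[OF xy(2)] mB[OF eZ[OF xy(1)] eZ[OF xy(2)]]
    using xy(1,2) by (simp add: Z(1))
  qed
  show "bij_betw ?H (carrier (cohomology A n)) (carrier (cohomology B n))"
  proof (rule bij_betw_imageI)
   show "inj_on ?H (carrier (cohomology A n))"
   proof (rule inj_onI)
    fix c d assume cd: "c : carrier (cohomology A n)" "d : carrier (cohomology A n)" "?H c = ?H d"
    then obtain x y where xy: "x : cocycles A n" "y : cocycles A n" "c = coboundaries A n #>\<^bsub>grp A n\<^esub> x" "d = coboundaries A n #>\<^bsub>grp A n\<^esub> y"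
     unfolding cosets by blast
    have xc: "x : carrier (grp A n)" "y : carrier (grp A n)" using xy Z by simp_all
    have "e n x : coboundaries B n #>\<^bsub>grp B n\<^esub> (e n x)"
     by (rule group.rcos_self[OF comm_group.axioms(2)[OF groups(2)] en.hom_closed[OF xc(1)] cB(3)])
    then have "e n x : coboundaries B n #>\<^bsub>grp B n\<^esub> (e n y)" using cd(3) xy map by simp
    then obtain b where b: "b : carrier (grp B m)" "e n x = dif B m b \<otimes>\<^bsub>grp B n\<^esub> e n y" unfolding r_coset_def bB by blast
    let ?a = "x \<otimes>\<^bsub>grp A n\<^esub> inv\<^bsub>grp A n\<^esub> y"
    have dbc: "dif B m b : carrier (grp B n)" using closed(2)[OF b(1)] by (simp add: n)
    have "e n ?a = dif B m b" using b(2) xc dbc by (simp add: Bn.m_assoc)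
    moreover have "dif A n ?a = \<one>\<^bsub>grp A (n + 1)\<^esub>"
    proof -
     interpret A1: comm_group "grp A (n + 1)" by (rule groups)
     show ?thesis using group_hom.hom_difference[OF homs(1) xc] xy(1,2) by (simp add: Z)
    qed
    moreover have "?a : carrier (grp A n)" using xc by simp
    ultimately have "?a : coboundaries A n" unfolding bA using inj[of ?a m b] b(1) by (simp add: n)
    then have "x : coboundaries A n #>\<^bsub>grp A n\<^esub> y"
     unfolding r_coset_def using xc by (auto simp: An.m_assoc intro!: bexI[of _ ?a])
    then show "c = d" unfolding xy(3,4) using group.repr_independence[OF comm_group.axioms(2)[OF groups(1)] _ xc(2) cA(3)] by simp
   qed
   show "?H ` carrier (cohomology A n) = carrier (cohomology B n)"
   proof (intro equalityI subsetI)
    fix c assume "c : ?H ` carrier (cohomology A n)"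
    then show "c : carrier (cohomology B n)" unfolding cosets using map eZ by auto
   next
    fix c assume "c : carrier (cohomology B n)"
    then obtain x where x: "x : cocycles B n" "c = coboundaries B n #>\<^bsub>grp B n\<^esub> x" unfolding cosets by blast
    obtain a y where ay: "a : carrier (grp A n)" "dif A n a = \<one>\<^bsub>grp A (n + 1)\<^esub>" "y : carrier (grp B m)" "x = e n a \<otimes>\<^bsub>grp B n\<^esub> dif B m y"
     using surj[of x m, folded n] x(1)[unfolded Z] by blast
    have dy: "dif B m y : carrier (grp B n)" using closed(2)[OF ay(3)] by (simp add: n)
    have "x : coboundaries B n #>\<^bsub>grp B n\<^esub> (e n a)"
     unfolding r_coset_def bB ay(4) Bn.m_comm[OF en.hom_closed[OF ay(1)] dy] using ay(3) by blast
    then have "c = coboundaries B n #>\<^bsub>grp B n\<^esub> (e n a)"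
     using x(2) group.repr_independence[OF comm_group.axioms(2)[OF groups(2)] _ en.hom_closed[OF ay(1)] cB(3)] by simp
    then show "c : ?H ` carrier (cohomology A n)" using map[of a] ay(1,2) unfolding cosets
     by (intro image_eqI[of _ _ "coboundaries A n #>\<^bsub>grp A n\<^esub> a"]) (auto simp: Z)
   qed
  qed
 qed
qed

text \<open>A cocycle \<open>x\<close> gives the cone cocycle \<open>(1, x)\<close>, whose primitive
  yields surjectivity. A cocycle \<open>a\<close> whose image is the differential of
  \<open>y\<close> gives \<open>(a, inv y)\<close>, whose primitive yields injectivity.\<close>

lemma exact_mapping_cone:
 assumes ex: "exact (mapping_cone A B e)"
 shows "quasi_isomorphism A B e"
proof (rule quasi_isomorphismI)
 note [[simproc del: int_combine_numerals]]
 fix n x assume x: "x : carrier (grp B (n + 1))" "dif B (n + 1) x = \<one>\<^bsub>grp B (n + 1 + 1)\<^esub>"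
 interpret A2: comm_group "grp A (n + 1 + 1)" by (rule groups)
 interpret A1: comm_group "grp A (n + 1)" by (rule groups)
 interpret A3: comm_group "grp A (n + 1 + 1 + 1)" by (rule groups)
 interpret B1: comm_group "grp B (n + 1)" by (rule groups)
 interpret B2: comm_group "grp B (n + 1 + 1)" by (rule groups)
 have "(\<one>\<^bsub>grp A (n + 1 + 1)\<^esub>, x) : dif (mapping_cone A B e) n ` carrier (grp (mapping_cone A B e) n)"
  using ex[unfolded exact_def, rule_format, of "(\<one>\<^bsub>grp A (n + 1 + 1)\<^esub>, x)" n] x
   group_hom.hom_one[OF homs(1)[of "n + 1 + 1"]] group_hom.hom_one[OF homs(3)[of "n + 1 + 1"]] by simp
 then obtain a y where ay: "a : carrier (grp A (n + 1))" "y : carrier (grp B n)"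
  "\<one>\<^bsub>grp A (n + 1 + 1)\<^esub> = inv\<^bsub>grp A (n + 1 + 1)\<^esub> (dif A (n + 1) a)" "x = e (n + 1) a \<otimes>\<^bsub>grp B (n + 1)\<^esub> dif B n y" by auto
 have "dif A (n + 1) a = \<one>\<^bsub>grp A (n + 1 + 1)\<^esub>" using ay(3) closed(1)[OF ay(1)] by (metis A2.inv_inv A2.inv_one)
 then show "\<exists>a\<in>carrier (grp A (n + 1)). dif A (n + 1) a = \<one>\<^bsub>grp A (n + 1 + 1)\<^esub> &
   (\<exists>y\<in>carrier (grp B n). x = e (n + 1) a \<otimes>\<^bsub>grp B (n + 1)\<^esub> dif B n y)" using ay by blast
next
 note [[simproc del: int_combine_numerals]]
 fix n a y assume a: "a : carrier (grp A (n + 1))" "dif A (n + 1) a = \<one>\<^bsub>grp A (n + 1 + 1)\<^esub>"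
  and y: "y : carrier (grp B n)" "e (n + 1) a = dif B n y"
 obtain m where n: "n = m + 1" by (metis diff_add_cancel)
 interpret A1: comm_group "grp A (n + 1)" by (rule groups)
 interpret A2: comm_group "grp A (n + 1 + 1)" by (rule groups)
 interpret B0: comm_group "grp B n" by (rule groups)
 interpret B1: comm_group "grp B (n + 1)" by (rule groups)
 let ?z = "(a, inv\<^bsub>grp B n\<^esub> y)"
 have yi: "inv\<^bsub>grp B n\<^esub> y : carrier (grp B n)" using y(1) by simp
 have "dif (mapping_cone A B e) n ?z = \<one>\<^bsub>grp (mapping_cone A B e) (n + 1)\<^esub>"
  using a y closed(2)[OF y(1)] group_hom.hom_inv[OF homs(2) y(1)] by simp
 then have "?z : dif (mapping_cone A B e) m ` carrier (grp (mapping_cone A B e) m)"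
  by (intro ex[unfolded exact_def, rule_format]) (use a yi in \<open>simp_all add: n\<close>)
 then obtain b x where b: "b : carrier (grp A n)" "a = inv\<^bsub>grp A (n + 1)\<^esub> (dif A n b)" by (auto simp: n)
 interpret A0: comm_group "grp A n" by (rule groups)
 have "a = dif A n (inv\<^bsub>grp A n\<^esub> b)" using b group_hom.hom_inv[OF homs(1) b(1)] by simp
 then show "a : dif A n ` carrier (grp A n)" using b(1) by blast
qed

end

lemma mapping_cone_map:
 assumes 1: "complex_map A B e" and 2: "complex_map A' B' e'" and f: "cochain_map A A' f" and g: "cochain_map B B' g"
  and sq: "!!n a. a : carrier (grp A n) ==> g n (e n a) = e' n (f n a)"
 shows "cochain_map (mapping_cone A B e) (mapping_cone A' B' e') (%k. map_prod (f (k + 1)) (g k))"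
proof -
 interpret E: complex_map A B e by (rule 1)
 interpret E': complex_map A' B' e' by (rule 2)
 interpret f: complex_map A A' f using E.A E'.A f by unfold_locales
 interpret g: complex_map B B' g using E.B E'.B g by unfold_locales
 show ?thesis
  unfolding cochain_map_def
 proof (intro allI conjI ballI)
  note [[simproc del: int_combine_numerals]]
  fix k
  show "map_prod (f (k + 1)) (g k) : hom (grp (mapping_cone A B e) k) (grp (mapping_cone A' B' e') k)"
   by (rule homI) (use f.closed g.closed group_hom.hom_mult[OF f.homs(3)] group_hom.hom_mult[OF g.homs(3)] in auto)
  fix z assume "z : carrier (grp (mapping_cone A B e) k)"
  then obtain a x where z: "z = (a, x)" "a : carrier (grp A (k + 1))" "x : carrier (grp B k)" by auto
  show "map_prod (f (k + 1 + 1)) (g (k + 1)) (dif (mapping_cone A B e) k z) = dif (mapping_cone A' B' e') k (map_prod (f (k + 1)) (g k) z)"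
   using z(2,3) E.closed sq f.e_dif g.e_dif group_hom.hom_inv[OF f.homs(3)] group_hom.hom_mult[OF g.homs(3)]
   by (simp add: z(1))
 qed
qed

section \<open>Sections over the opens of one object as soft sheaves\<close>

context sheaf_site
begin

text \<open>The function is pulled back along \<open>q\<close>. It lives on \<open>w\<close> only,
  but \<open>q\<close> maps into \<open>w\<close>, so the pullback is defined on the whole source of
  \<open>q\<close>.\<close>

lemma functional_numerable_cover:
 assumes f: "functional_pair (on_ob U M) a b c v" and q: "opn M q" "im q \<sqsubseteq>\<^bsub>on_ob U M\<^esub> v"
 shows "numerable_cover (on_ob U (src S q)) {arr_map (on_ar U q) a, arr_map (on_ar U q) b} (%x. x)"
proof -
 note q' = opnD[OF q(1)]
 interpret H: two_frames "on_ob U M" "on_ob U (src S q)" "arr_map (on_ar U q)" using U_frames[OF q'(1)] q'(2) by simp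
 obtain w \<phi> A B where *: "w : carrier (on_ob U M)" "half_line_hom (open_sublocale (on_ob U M) w) \<phi>" "A : carrier half_line" "B : carrier half_line"
  "a = \<phi> A" "b = \<phi> B" "c = \<phi> (A \<inter> B)" "v = \<phi> (A \<union> B)"
  by (rule H.X.functional_pairE[OF f])
 interpret P: half_line_hom "open_sublocale (on_ob U M) w" \<phi> by (rule *(2))
 have top: "arr_map (on_ar U q) z = \<top>\<^bsub>on_ob U (src S q)\<^esub>" if "im q \<sqsubseteq>\<^bsub>on_ob U M\<^esub> z" "z : carrier (on_ob U M)" for z
 proof -
  have "arr_map (on_ar U q) (im q) = \<top>\<^bsub>on_ob U (src S q)\<^esub>"
   using open_embedding_ontoD(3)[OF q'(4)] U_ar(2)[OF q'(1)] by simp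
  then show ?thesis
   using H.mono[OF that(1)] H.closed[OF that(2)] H.Y.top_higher by (intro H.Y.antisymI) simp_all
 qed
 have un: "A \<union> B : carrier half_line" by (rule half_line_Un[OF *(3,4)])
 have v: "v : carrier (on_ob U M)" "v \<sqsubseteq>\<^bsub>on_ob U M\<^esub> w" using P.closed[OF un] *(8) by simp_all
 have wt: "arr_map (on_ar U q) w = \<top>\<^bsub>on_ob U (src S q)\<^esub>" by (rule top[OF H.X.trans[OF q(2) v(2)] *(1)])
 define \<psi> where "\<psi> = compose (carrier half_line) (\<lambda>x\<in>carrier (open_sublocale (on_ob U M) w). arr_map (on_ar U q) x) \<phi>"
 have "frame_hom half_line (on_ob U (src S q)) \<psi>"
  unfolding \<psi>_def by (rule half_line_compose[OF P.hom H.restrict_hom[OF *(1) wt]])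
 then interpret Q: half_line_hom "on_ob U (src S q)" \<psi> by unfold_locales
 have \<psi>: "\<psi> V = arr_map (on_ar U q) (\<phi> V)" if "V : carrier half_line" for V
  using P.closed[OF that] that by (simp add: \<psi>_def compose_def)
 have "\<psi> (A \<union> B) = \<top>\<^bsub>on_ob U (src S q)\<^esub>" using \<psi>[OF un] top[OF q(2) v(1)] *(8) by simp
 from Q.numerable_cover_two[OF *(3,4) this] show ?thesis using \<psi>[OF *(3)] \<psi>[OF *(4)] *(5,6) by simp
qed

text \<open>With \<open>u\<close> the top this is \<open>F\<close> itself, with \<open>u\<close> a
  multiple intersection it is a factor of the Cech diagram. The lifts \<open>q v\<close> may be
  chosen arbitrarily.\<close>

lemma soft_sheaf_opens:
 assumes M: "M : ob S" and u: "u : carrier (on_ob U M)"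
  and q: "!!v. v : carrier (on_ob U M) ==> opn M (q v)" "!!v. v : carrier (on_ob U M) ==> im (q v) = u \<sqinter>\<^bsub>on_ob U M\<^esub> v"
 shows "soft_sheaf (on_ob U M) (%v. G (q v) n) (%v v'. res (q v) (q v') n)"
proof -
 interpret X: frame_lattice "on_ob U M" by (rule U_ob[OF M])
 have mono: "im (q v') \<sqsubseteq>\<^bsub>on_ob U M\<^esub> im (q v)" if "v' \<sqsubseteq>\<^bsub>on_ob U M\<^esub> v" for v v'
 proof -
  have c: "v : carrier (on_ob U M)" "v' : carrier (on_ob U M)" using that X.le_carrier by auto
  note m = X.meet_lower[OF u c(2)]
  show ?thesis unfolding q(2)[OF c(1)] q(2)[OF c(2)]
   by (rule X.meet_greatest[OF m(2) X.trans[OF m(3) that] m(1) u c(1)])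
 qed
 have opnq: "opn M (q v)" "opn M (q v')" if "v' \<sqsubseteq>\<^bsub>on_ob U M\<^esub> v" for v v' using that X.le_carrier q(1) by blast+
 have pair: "im (q c) = im (q a) \<sqinter>\<^bsub>on_ob U M\<^esub> im (q b)"
  "numerable_cover (on_ob U (src S (q v))) {arr_map (on_ar U (q v)) (im (q a)), arr_map (on_ar U (q v)) (im (q b))} (%x. x)"
  if f: "functional_pair (on_ob U M) a b c v" for a b c v
 proof -
  note f' = X.functional_pairD[OF f]
  note ma = X.meet_lower[OF u f'(1)] and mb = X.meet_lower[OF u f'(2)] and mc = X.meet_lower[OF u f'(3)]
  note mab = X.meet_lower[OF ma(1) mb(1)]
  show "im (q c) = im (q a) \<sqinter>\<^bsub>on_ob U M\<^esub> im (q b)"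
  proof (rule X.antisymI)
   show "im (q c) \<sqsubseteq>\<^bsub>on_ob U M\<^esub> im (q a) \<sqinter>\<^bsub>on_ob U M\<^esub> im (q b)"
    by (rule X.meet_greatest[OF mono[OF f'(5)] mono[OF f'(6)]]) (use opnD(7)[OF q(1)] f' in auto)
   show "im (q a) \<sqinter>\<^bsub>on_ob U M\<^esub> im (q b) \<sqsubseteq>\<^bsub>on_ob U M\<^esub> im (q c)"
    unfolding q(2)[OF f'(1)] q(2)[OF f'(2)] q(2)[OF f'(3)]
   proof (rule X.meet_greatest[OF X.trans[OF mab(2) ma(2)] _ mab(1) u f'(3)])
    show "u \<sqinter>\<^bsub>on_ob U M\<^esub> a \<sqinter>\<^bsub>on_ob U M\<^esub> (u \<sqinter>\<^bsub>on_ob U M\<^esub> b) \<sqsubseteq>\<^bsub>on_ob U M\<^esub> c"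
     unfolding f'(10)
     by (rule X.meet_greatest[OF X.trans[OF mab(2) ma(3)] X.trans[OF mab(3) mb(3)] mab(1) f'(1,2)])
   qed
   show "im (q c) : carrier (on_ob U M)" by (rule opnD(7)[OF q(1)[OF f'(3)]])
   show "im (q a) \<sqinter>\<^bsub>on_ob U M\<^esub> im (q b) : carrier (on_ob U M)"
    by (rule X.meet_lower(1)[OF opnD(7)[OF q(1)[OF f'(1)]] opnD(7)[OF q(1)[OF f'(2)]]])
  qed
  note o = q(1)[OF f'(4)]
  note o' = opnD[OF o]
  interpret H: two_frames "on_ob U M" "on_ob U (src S (q v))" "arr_map (on_ar U (q v))" using U_frames[OF o'(1)] o'(2) by simp
  have lq: "im (q v) \<sqsubseteq>\<^bsub>on_ob U M\<^esub> v" "im (q v) \<sqsubseteq>\<^bsub>on_ob U M\<^esub> u" using X.meet_lower[OF u f'(4)] q(2)[OF f'(4)] by simp_all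
  have "arr_map (on_ar U (q v)) (im (q v)) = \<top>\<^bsub>on_ob U (src S (q v))\<^esub>"
   using open_embedding_ontoD(3)[OF o'(4)] U_ar(2)[OF o'(1)] by simp
  then have ut: "arr_map (on_ar U (q v)) u = \<top>\<^bsub>on_ob U (src S (q v))\<^esub>"
   using H.mono[OF lq(2)] H.closed[OF u] H.Y.top_higher by (intro H.Y.antisymI) simp_all
  have "arr_map (on_ar U (q v)) (im (q z)) = arr_map (on_ar U (q v)) z" if "z : carrier (on_ob U M)" for z
   unfolding q(2)[OF that] H.hom_meet[OF u that] ut by (rule H.Y.meet_absorb(2)) (use H.closed[OF that] H.Y.top_higher in auto)
  then show "numerable_cover (on_ob U (src S (q v))) {arr_map (on_ar U (q v)) (im (q a)), arr_map (on_ar U (q v)) (im (q b))} (%x. x)"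
   using functional_numerable_cover[OF f o lq(1)] f'(1,2) by simp
 qed
 show ?thesis
 proof (rule soft_sheaf.intro[OF X.frame_lattice_axioms soft_sheaf_axioms.intro])
  fix v assume "v : carrier (on_ob U M)"
  then show "comm_group (G (q v) n)" by (rule G_group[OF opnD(1)[OF q(1)]])
 next
  fix v' v assume v: "v' \<sqsubseteq>\<^bsub>on_ob U M\<^esub> v"
  show "res (q v) (q v') n : hom (G (q v) n) (G (q v') n)" by (rule res_hom[OF opnq[OF v] mono[OF v]])
 next
  fix v' v v'' x assume v: "v' \<sqsubseteq>\<^bsub>on_ob U M\<^esub> v" "v'' \<sqsubseteq>\<^bsub>on_ob U M\<^esub> v'" "x : carrier (G (q v) n)"
  show "res (q v') (q v'') n (res (q v) (q v') n x) = res (q v) (q v'') n x"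
   by (rule res_res[OF opnq[OF v(1)] opnq(2)[OF v(2)] mono[OF v(1)] mono[OF v(2)] v(3)])
 next
  fix a b c v x y assume f: "functional_pair (on_ob U M) a b c v"
   and xy: "x : carrier (G (q a) n)" "y : carrier (G (q b) n)" "res (q a) (q c) n x = res (q b) (q c) n y"
  note f' = X.functional_pairD[OF f]
  show "\<exists>!z. z : carrier (G (q v) n) & res (q v) (q a) n z = x & res (q v) (q b) n z = y"
   by (rule glue_two[OF q(1)[OF f'(4)] q(1)[OF f'(1)] q(1)[OF f'(2)] q(1)[OF f'(3)] mono[OF f'(8)] mono[OF f'(9)] pair[OF f] xy])
 next
  fix a b c v z assume f: "functional_pair (on_ob U M) a b c v" and z: "z : carrier (G (q c) n)"
  note f' = X.functional_pairD[OF f]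
  show "\<exists>x\<in>carrier (G (q a) n). \<exists>y\<in>carrier (G (q b) n). z = res (q a) (q c) n x \<otimes>\<^bsub>G (q c) n\<^esub> inv\<^bsub>G (q c) n\<^esub> (res (q b) (q c) n y)"
   by (rule difference_two[OF q(1)[OF f'(4)] q(1)[OF f'(1)] q(1)[OF f'(2)] q(1)[OF f'(3)] mono[OF f'(8)] mono[OF f'(9)] pair[OF f] z])
 next
  fix D s assume D: "D \<subseteq> carrier (on_ob U M)" "!!a b. a : D ==> b : D ==> a ~= b ==> a \<sqinter>\<^bsub>on_ob U M\<^esub> b = \<bottom>\<^bsub>on_ob U M\<^esub>"
   and s: "!!d. d : D ==> s d : carrier (G (q d) n)"
  let ?v = "\<Squnion>\<^bsub>on_ob U M\<^esub> D"
  have v: "?v : carrier (on_ob U M)" using D(1) by simp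
  have Dc: "d : carrier (on_ob U M)" if "d : D" for d using that D(1) by blast
  have disj: "im (q a) \<sqinter>\<^bsub>on_ob U M\<^esub> im (q b) = \<bottom>\<^bsub>on_ob U M\<^esub>" if ab: "a : D" "b : D" "a ~= b" for a b
  proof (rule X.antisymI)
   note ma = X.meet_lower[OF u Dc[OF ab(1)]] and mb = X.meet_lower[OF u Dc[OF ab(2)]]
   note m = X.meet_lower[OF ma(1) mb(1)]
   show "im (q a) \<sqinter>\<^bsub>on_ob U M\<^esub> im (q b) \<sqsubseteq>\<^bsub>on_ob U M\<^esub> \<bottom>\<^bsub>on_ob U M\<^esub>"
    unfolding q(2)[OF Dc[OF ab(1)]] q(2)[OF Dc[OF ab(2)]] D(2)[OF ab, symmetric]
    by (rule X.meet_greatest[OF X.trans[OF m(2) ma(3)] X.trans[OF m(3) mb(3)] m(1) Dc[OF ab(1)] Dc[OF ab(2)]])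
   show c: "im (q a) \<sqinter>\<^bsub>on_ob U M\<^esub> im (q b) : carrier (on_ob U M)"
    using m(1) q(2)[OF Dc[OF ab(1)]] q(2)[OF Dc[OF ab(2)]] by simp
   show "\<bottom>\<^bsub>on_ob U M\<^esub> \<sqsubseteq>\<^bsub>on_ob U M\<^esub> im (q a) \<sqinter>\<^bsub>on_ob U M\<^esub> im (q b)" by (rule X.bottom_lower[OF c])
  qed simp
  \<comment> \<open>The choice \<open>q\<close> may fail to be injective on \<open>D\<close>. If two
    members share a lift, its image is disjoint from itself, hence empty, and carries a single
    section.\<close>
  define s' where "s' p = s (inv_into D q p)" for p
  have s': "s' (q d) = s d" if d: "d : D" for d
  proof (cases "inv_into D q (q d) = d")
   case False
   let ?d = "inv_into D q (q d)"
   have e: "?d : D" "q ?d = q d" using d by (auto intro: inv_into_into f_inv_into_f)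
   note o = q(1)[OF Dc[OF d]]
   have "im (q d) = \<bottom>\<^bsub>on_ob U M\<^esub>"
    using disj[OF e(1) d False] X.meet_absorb(1)[of "im (q d)" "im (q d)"] opnD(7)[OF o] unfolding e(2) by simp
   then show ?thesis unfolding s'_def by (rule trivial_group[OF o]) (use s[OF e(1)] s[OF d] e(2) in simp_all)
  qed (simp add: s'_def)
  have "\<exists>!t. t : carrier (G (q ?v) n) & (\<forall>p\<in>q ` D. res (q ?v) p n t = s' p)"
  proof (rule glue_disjoint[OF q(1)[OF v]])
   show "opn M p" if "p : q ` D" for p using that q(1) Dc by blast
   show "s' p : carrier (G p n)" if "p : q ` D" for p using that s s' by auto
   show "im a \<sqinter>\<^bsub>on_ob U M\<^esub> im b = \<bottom>\<^bsub>on_ob U M\<^esub>" if "a : q ` D" "b : q ` D" "a ~= b" for a b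
    using that disj by blast
   have "im ` q ` D = (%d. u \<sqinter>\<^bsub>on_ob U M\<^esub> d) ` D" unfolding image_image by (rule image_cong) (use q(2)[OF Dc] in simp_all)
   then show "\<Squnion>\<^bsub>on_ob U M\<^esub> (im ` q ` D) = im (q ?v)" using X.meet_sup[OF u D(1)] q(2)[OF v] by simp
  qed
  then show "\<exists>!t. t : carrier (G (q ?v) n) & (\<forall>d\<in>D. res (q ?v) (q d) n t = s d)" using s' by simp
 qed
qed

end

subsection \<open>The decalage of the simplex category\<close>

lemma simplex_simps [simp]:
 "ob simplex_category = UNIV" "src simplex_category = arr_src" "tgt simplex_category = arr_tgt"
 "idn simplex_category m = Arrow m m (\<lambda>k\<in>{..m}. k)"
 "cmp simplex_category g f = Arrow (arr_src f) (arr_tgt g) (compose {..arr_src f} (arr_map g) (arr_map f))"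
 by (simp_all add: simplex_category_def)

lemma simplex_ar: "f : ar simplex_category \<longleftrightarrow> arr_map f : extensional {..arr_src f} &
  (\<forall>k\<le>arr_src f. arr_map f k \<le> arr_tgt f) & (\<forall>k l. k \<le> l & l \<le> arr_src f --> arr_map f k \<le> arr_map f l)"
 unfolding simplex_category_def mono_on_def by (auto simp: PiE_iff)

lemma arrow_eqI: "[|arr_src f = arr_src g; arr_tgt f = arr_tgt g; !!k. arr_map f k = arr_map g k|] ==> f = g"
 by (rule arrow.expand) auto

lemma simplex_category: "category simplex_category"
proof
 fix f assume f: "f : ar simplex_category"
 show "cmp simplex_category f (idn simplex_category (src simplex_category f)) = f"
  by (rule arrow_eqI) (use f in \<open>auto simp: simplex_ar compose_def extensional_def\<close>)
 show "cmp simplex_category (idn simplex_category (tgt simplex_category f)) f = f"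
  by (rule arrow_eqI) (use f in \<open>auto simp: simplex_ar compose_def extensional_def\<close>)
next
 fix f g h assume f: "f : ar simplex_category" "g : ar simplex_category" "h : ar simplex_category"
  "src simplex_category g = tgt simplex_category f" "src simplex_category h = tgt simplex_category g"
 show "cmp simplex_category h (cmp simplex_category g f) = cmp simplex_category (cmp simplex_category h g) f"
  by (rule arrow_eqI) (use f in \<open>auto simp: simplex_ar compose_def\<close>)
qed (auto simp: simplex_ar compose_def)

lemma wordsD: "s : words I m ==> length s = Suc m & s ~= [] & set s \<subseteq> I"
 by (auto simp: words_def)

lemma subword_words:
 assumes "\<theta> : ar simplex_category" "s : words I (arr_tgt \<theta>)"
 shows "subword \<theta> s : words I (arr_src \<theta>)" "set (subword \<theta> s) \<subseteq> set s"
proof -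
 have "s ! arr_map \<theta> k : set s" if "k \<le> arr_src \<theta>" for k
  using assms that by (intro nth_mem) (auto simp: words_def simplex_ar less_Suc_eq_le)
 then show "set (subword \<theta> s) \<subseteq> set s" by (auto simp: subword_def)
 then show "subword \<theta> s : words I (arr_src \<theta>)" using assms(2) by (auto simp: words_def subword_def)
qed

lemma subword_cmp:
 assumes "f : ar simplex_category" "arr_src g = arr_tgt f"
 shows "subword (cmp simplex_category g f) s = subword f (subword g s)"
 unfolding subword_def
proof (rule map_cong)
 show "[0..<Suc (arr_src (cmp simplex_category g f))] = [0..<Suc (arr_src f)]" by simp
 fix k assume "k : set [0..<Suc (arr_src f)]"
 then have k: "k \<le> arr_src f" by auto
 then have "arr_map f k < Suc (arr_src g)" using assms by (simp add: simplex_ar less_Suc_eq_le)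
 then have "map (%k. s ! arr_map g k) [0..<Suc (arr_src g)] ! arr_map f k = s ! arr_map g (arr_map f k)"
  by (subst nth_map) (simp_all del: upt_Suc)
 then show "s ! arr_map (cmp simplex_category g f) k = map (%k. s ! arr_map g k) [0..<Suc (arr_src g)] ! arr_map f k"
  using k by (simp add: compose_def del: upt_Suc)
qed

text \<open>The join of \<open>[0]\<close> with an ordinal: \<open>dec\<close> extends a map by the
  new first vertex, \<open>dec_last\<close> includes the old ordinal as the last vertices, and
  \<open>dec_zero\<close> includes the new vertex.\<close>

definition dec :: "(nat, nat => nat) arrow => (nat, nat => nat) arrow" where
 "dec f = Arrow (Suc (arr_src f)) (Suc (arr_tgt f)) (\<lambda>k\<in>{..Suc (arr_src f)}. if k = 0 then 0 else Suc (arr_map f (k - 1)))"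

definition dec_last :: "nat => (nat, nat => nat) arrow" where
 "dec_last c = Arrow c (Suc c) (\<lambda>k\<in>{..c}. Suc k)"

definition dec_zero :: "nat => (nat, nat => nat) arrow" where
 "dec_zero c = Arrow 0 (Suc c) (\<lambda>k\<in>{..0}. 0)"

lemma dec_simps [simp]:
 "arr_src (dec f) = Suc (arr_src f)" "arr_tgt (dec f) = Suc (arr_tgt f)"
 "arr_src (dec_last c) = c" "arr_tgt (dec_last c) = Suc c"
 "arr_src (dec_zero c) = 0" "arr_tgt (dec_zero c) = Suc c"
 by (simp_all add: dec_def dec_last_def dec_zero_def)

lemma dec_ar: "f : ar simplex_category ==> dec f : ar simplex_category"
 "dec_last c : ar simplex_category" "dec_zero c : ar simplex_category"
proof -
 assume f: "f : ar simplex_category"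
 have "arr_map f (k - 1) \<le> arr_map f (l - 1)" if "k ~= 0" "k \<le> l" "l \<le> Suc (arr_src f)" for k l
 proof -
  have "k - 1 \<le> l - 1" "l - 1 \<le> arr_src f" using that by auto
  then show ?thesis using f unfolding simplex_ar by blast
 qed
 then show "dec f : ar simplex_category" using f by (auto simp: simplex_ar dec_def)
qed (auto simp: simplex_ar dec_last_def dec_zero_def)

lemma dec_functor: "endo_functor simplex_category Suc dec"
 unfolding endo_functor_def
proof (intro conjI ballI impI)
 fix f g assume fg: "f : ar simplex_category" "g : ar simplex_category" "src simplex_category g = tgt simplex_category f"
 show "dec (cmp simplex_category g f) = cmp simplex_category (dec g) (dec f)"
  by (rule arrow_eqI) (use fg in \<open>auto simp: dec_def compose_def simplex_ar\<close>)
qed (simp_all add: dec_ar)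

lemma dec_last_natural: "nat_from_id simplex_category Suc dec dec_last"
 unfolding nat_from_id_def
proof (intro conjI ballI)
 fix f assume f: "f : ar simplex_category"
 show "cmp simplex_category (dec_last (tgt simplex_category f)) f = cmp simplex_category (dec f) (dec_last (src simplex_category f))"
  by (rule arrow_eqI) (use f in \<open>auto simp: dec_def dec_last_def compose_def simplex_ar\<close>)
qed (simp_all add: dec_ar)

lemma dec_zero_cone: "cone_over simplex_category Suc dec 0 dec_zero"
 unfolding cone_over_def
proof (intro conjI ballI)
 fix f assume f: "f : ar simplex_category"
 show "dec_zero (tgt simplex_category f) = cmp simplex_category (dec f) (dec_zero (src simplex_category f))"
  by (rule arrow_eqI) (use f in \<open>auto simp: dec_def dec_zero_def compose_def simplex_ar\<close>)
qed (simp_all add: dec_ar)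

text \<open>On words the new vertex of the decalage is the prefixed index.\<close>

lemma subword_dec: "subword (dec f) (j # s) = j # subword f s"
proof -
 have "[0..<Suc (Suc (arr_src f))] = 0 # map Suc [0..<Suc (arr_src f)]"
  by (subst upt_conv_Cons) (simp_all only: map_Suc_upt zero_less_Suc)
 then show ?thesis unfolding subword_def dec_simps
  by (simp only: list.map map_map) (auto simp: dec_def)
qed

lemma subword_dec_last: "length s = Suc c ==> subword (dec_last c) (j # s) = s"
 by (rule nth_equalityI) (auto simp: subword_def dec_last_def simp del: upt_Suc)

lemma subword_dec_zero: "subword (dec_zero c) (j # s) = [j]"
 by (simp add: subword_def dec_zero_def)

subsection \<open>The \v{C}ech complex over an open\<close>

locale cech_site = sheaf_site S K U F
 for S :: "('o, 'm) category"
  and K :: "'o => 'm set set"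
  and U :: "('o, 'm, 'a gorder, ('a gorder, 'a => 'a) arrow) funct"
  and F :: "('o, 'm, 'v cochain, int => 'v => 'v) funct" +
 fixes M :: 'o and I :: "'i set" and p :: "'i => 'm" and N :: "'i list => 'm"
 assumes cover: "open_covering_family S K U M I p" and ints: "intersections S U M I p N"
begin

abbreviation X :: "'a gorder" where "X \<equiv> on_ob U M"

lemma M_ob: "M : ob S"
 using cover by (simp add: open_covering_family_def covering_family_def)

lemma p_opn: "i : I ==> opn M (p i)"
 using cover by (auto simp: open_covering_family_def covering_family_def arrows_to_def opn_def)

sublocale X: frame_lattice X by (rule U_ob[OF M_ob])

definition opens :: "'i list => 'a" where "opens s = \<Sqinter>\<^bsub>X\<^esub> (im ` p ` set s)"

lemma im_sub: "set s \<subseteq> I ==> im ` p ` set s \<subseteq> carrier X"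
 using opnD(7)[OF p_opn] by blast

lemma opens_closed: "set s \<subseteq> I ==> opens s : carrier X"
 unfolding opens_def using im_sub by simp

lemma opens_antimono:
 assumes "set t \<subseteq> set s" "set s \<subseteq> I"
 shows "opens s \<sqsubseteq>\<^bsub>X\<^esub> opens t"
 unfolding opens_def
proof (rule X.inf_greatest)
 show "im ` p ` set t \<subseteq> carrier X" by (rule im_sub) (use assms in blast)
 show "\<Sqinter>\<^bsub>X\<^esub> (im ` p ` set s) : carrier X" using im_sub[OF assms(2)] by simp
 show "\<Sqinter>\<^bsub>X\<^esub> (im ` p ` set s) \<sqsubseteq>\<^bsub>X\<^esub> x" if "x : im ` p ` set t" for x
  by (rule X.inf_lower[OF im_sub[OF assms(2)]]) (use that assms(1) in blast)
qed

text \<open>At the top element these are the given arrows, so that the construction below returns the given diagram there.\<close>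

definition part :: "'a => 'm" where
 "part w = (if w = \<top>\<^bsub>X\<^esub> then idn S M else SOME q. opn M q & im q = w)"

definition inter :: "'a => 'i list => 'm" where
 "inter w = (if w = \<top>\<^bsub>X\<^esub> then N else (%s. SOME q. opn M q & im q = opens s \<sqinter>\<^bsub>X\<^esub> w))"

lemma part: "w : carrier X ==> opn M (part w)" "w : carrier X ==> im (part w) = w"
proof -
 assume w: "w : carrier X"
 obtain q where "opn M q" "im q = w" by (rule opn_exists[OF M_ob w])
 then have "opn M q & im q = w" by simp
 then have "opn M (SOME q. opn M q & im q = w) & im (SOME q. opn M q & im q = w) = w" by (rule someI)
 then show "opn M (part w)" "im (part w) = w" using idn_opn[OF M_ob] by (auto simp: part_def)
qed

lemma inter:
 assumes w: "w : carrier X" and s: "s ~= []" "set s \<subseteq> I"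
 shows "opn M (inter w s)" "im (inter w s) = opens s \<sqinter>\<^bsub>X\<^esub> w"
proof -
 have "opn M (inter w s) & im (inter w s) = opens s \<sqinter>\<^bsub>X\<^esub> w"
 proof (cases "w = \<top>\<^bsub>X\<^esub>")
  case True
  have top: "opens s \<sqinter>\<^bsub>X\<^esub> \<top>\<^bsub>X\<^esub> = opens s"
   by (rule X.meet_absorb(1)) (use opens_closed[OF s(2)] X.top_higher in auto)
  have "opn M (N s) & im (N s) = opens s"
  \<comment> \<open>For words of one letter \<open>N\<close> returns a member of the family, which
    lifts an arbitrary open embedding; only longer words give lifts of open inclusions.\<close>
  proof (cases "length s = 1")
   case True
   then obtain i where i: "s = [i]" by (cases s) auto
   have "\<Sqinter>\<^bsub>X\<^esub> {im (p i)} = im (p i)"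
    by (rule X.inf_eqI) (use opnD(7)[OF p_opn] s i X.le_refl in auto)
   then show ?thesis using ints p_opn s by (simp add: i intersections_def opens_def)
  next
   case False
   obtain m where m: "length s = Suc m" "m > 0" using s(1) False by (cases s) auto
   then have "is_intersection S U M (p ` set s) (N s)" using ints s(2) by (simp add: intersections_def words_def)
   moreover have "\<Sqinter>\<^bsub>X\<^esub> ((%q. image_open (on_ar U q)) ` p ` set s) = opens s" by (simp add: opens_def im_def[abs_def])
   ultimately have "cartesian S Loc U (N s)" "tgt S (N s) = M" "on_ar U (N s) = open_inclusion X (opens s)"
    by (simp_all add: is_intersection_def)
   then show ?thesis using opnI[of "N s" M "opens s"] open_inclusion_onto[OF X.frame_lattice_axioms opens_closed[OF s(2)]] by simp
  qed
  then show ?thesis using True top by (simp add: inter_def)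
 next
  case False
  obtain q where "opn M q" "im q = opens s \<sqinter>\<^bsub>X\<^esub> w"
   by (rule opn_exists[OF M_ob X.meet_lower(1)[OF opens_closed[OF s(2)] w]])
  then have "opn M q & im q = opens s \<sqinter>\<^bsub>X\<^esub> w" by simp
  then have "opn M (SOME q. opn M q & im q = opens s \<sqinter>\<^bsub>X\<^esub> w) & im (SOME q. opn M q & im q = opens s \<sqinter>\<^bsub>X\<^esub> w) = opens s \<sqinter>\<^bsub>X\<^esub> w"
   by (rule someI)
  then show ?thesis using False by (simp add: inter_def)
 qed
 then show "opn M (inter w s)" "im (inter w s) = opens s \<sqinter>\<^bsub>X\<^esub> w" by simp_all
qed

lemma inter_word: "w : carrier X ==> s : words I m ==> opn M (inter w s)"
 using inter(1) wordsD by metis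

lemma inter_mono:
 assumes "v \<sqsubseteq>\<^bsub>X\<^esub> w" "s ~= []" "t ~= []" "set t \<subseteq> set s" "set s \<subseteq> I"
 shows "im (inter v s) \<sqsubseteq>\<^bsub>X\<^esub> im (inter w t)"
proof -
 have c: "v : carrier X" "w : carrier X" using X.le_carrier[OF assms(1)] by auto
 have t: "set t \<subseteq> I" using assms by blast
 note m = X.meet_lower[OF opens_closed[OF assms(5)] c(1)]
 show ?thesis unfolding inter(2)[OF c(1) assms(2,5)] inter(2)[OF c(2) assms(3) t]
  by (rule X.meet_greatest[OF X.trans[OF m(2) opens_antimono[OF assms(4,5)]] X.trans[OF m(3) assms(1)] m(1) opens_closed[OF t] c(2)])
qed

lemma part_inter:
 assumes "v \<sqsubseteq>\<^bsub>X\<^esub> w" "s ~= []" "set s \<subseteq> I"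
 shows "im (inter v s) \<sqsubseteq>\<^bsub>X\<^esub> im (part w)"
proof -
 have c: "v : carrier X" "w : carrier X" using X.le_carrier[OF assms(1)] by auto
 note m = X.meet_lower[OF opens_closed[OF assms(3)] c(1)]
 show ?thesis unfolding inter(2)[OF c(1) assms(2,3)] part(2)[OF c(2)] by (rule X.trans[OF m(3) assms(1)])
qed

lemma part_mono: "v \<sqsubseteq>\<^bsub>X\<^esub> w ==> im (part v) \<sqsubseteq>\<^bsub>X\<^esub> im (part w)"
 using part(2) X.le_carrier[of v w] by simp

definition cech_on where "cech_on w = cech S F I (inter w)"

lemma cech_on_ob: "on_ob (cech_on w) m = product_complex (words I m) (%s. on_ob F (src S (inter w s)))"
 by (simp add: cech_on_def cech_def product_complex_def)

lemma cech_on_ar: "on_ar (cech_on w) \<theta> n x = (\<lambda>s\<in>words I (arr_tgt \<theta>). res (inter w (subword \<theta> s)) (inter w s) n (x (subword \<theta> s)))"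
 by (simp add: cech_on_def cech_def res_def)

lemma cech_on_carrier: "x : carrier (grp (on_ob (cech_on w) m) n) \<longleftrightarrow> x : (\<Pi>\<^sub>E s\<in>words I m. carrier (G (inter w s) n))"
 by (simp add: cech_on_ob)

lemma le_refl: "w : carrier X ==> w \<sqsubseteq>\<^bsub>X\<^esub> w" by (rule X.le_refl)

lemma word_mono:
 assumes "v \<sqsubseteq>\<^bsub>X\<^esub> w" "s : words I m" "t : words I k" "set t \<subseteq> set s"
 shows "im (inter v s) \<sqsubseteq>\<^bsub>X\<^esub> im (inter w t)"
 by (rule inter_mono[OF assms(1)]) (use wordsD[OF assms(2)] wordsD[OF assms(3)] assms(4) in auto)

lemma cech_on_complex: "w : carrier X ==> cochain_complex (on_ob (cech_on w) m)"
 unfolding cech_on_ob by (rule product_complex, rule F_complex, rule opnD(6)[OF inter_word])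

lemma cech_on_diagram:
 assumes w: "w : carrier X"
 shows "diagram simplex_category (cech_on w)"
 unfolding diagram_def
proof (intro conjI ballI impI allI simplex_category)
 show "cochain_complex (on_ob (cech_on w) c)" for c by (rule cech_on_complex[OF w])
next
 fix f assume f: "f : ar simplex_category"
 note sw = subword_words[OF f]
 have "on_ar (cech_on w) f = (%n x. \<lambda>s\<in>words I (arr_tgt f). res (inter w (subword f s)) (inter w s) n (x (subword f s)))"
  by (rule ext, rule ext, rule cech_on_ar)
 then show "cochain_map (on_ob (cech_on w) (src simplex_category f)) (on_ob (cech_on w) (tgt simplex_category f)) (on_ar (cech_on w) f)"
  unfolding cech_on_ob simplex_simps
 proof (rule ssubst)
  show "cochain_map (product_complex (words I (arr_src f)) (%s. on_ob F (src S (inter w s)))) (product_complex (words I (arr_tgt f)) (%s. on_ob F (src S (inter w s))))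
    (%n x. \<lambda>s\<in>words I (arr_tgt f). res (inter w (subword f s)) (inter w s) n (x (subword f s)))"
  proof (rule product_complex_map[where h = "subword f" and f = "%s. res (inter w (subword f s)) (inter w s)"])
   fix s assume s: "s : words I (arr_tgt f)"
   show "subword f s : words I (arr_src f)" by (rule sw(1)[OF s])
   show "cochain_map (on_ob F (src S (inter w (subword f s)))) (on_ob F (src S (inter w s))) (res (inter w (subword f s)) (inter w s))"
    by (rule res_map[OF inter_word[OF w sw(1)[OF s]] inter_word[OF w s] word_mono[OF le_refl[OF w] s sw[OF s]]])
  qed
 qed
next
 fix f g n x assume f: "f : ar simplex_category" and g: "g : ar simplex_category" and fg: "src simplex_category g = tgt simplex_category f"
  and x: "x : carrier (grp (on_ob (cech_on w) (src simplex_category f)) n)"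
 have fg': "arr_src g = arr_tgt f" using fg by simp
 have tgt: "arr_tgt (cmp simplex_category g f) = arr_tgt g" by simp
 show "on_ar (cech_on w) (cmp simplex_category g f) n x = on_ar (cech_on w) g n (on_ar (cech_on w) f n x)"
  unfolding cech_on_ar[of w "cmp simplex_category g f"] cech_on_ar[of w g] tgt
 proof (rule restrict_ext)
  fix s assume s: "s : words I (arr_tgt g)"
  note gs = subword_words[OF g s]
  have gs': "subword g s : words I (arr_tgt f)" using gs(1) fg' by simp
  note fs = subword_words[OF f gs']
  have xs: "x (subword f (subword g s)) : carrier (G (inter w (subword f (subword g s))) n)"
   using x fs(1) unfolding cech_on_carrier by (auto simp: PiE_iff)
  have "res (inter w (subword g s)) (inter w s) n (res (inter w (subword f (subword g s))) (inter w (subword g s)) n (x (subword f (subword g s))))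
    = res (inter w (subword f (subword g s))) (inter w s) n (x (subword f (subword g s)))"
   by (rule res_res[OF inter_word[OF w fs(1)] inter_word[OF w gs(1)] inter_word[OF w s]
      word_mono[OF le_refl[OF w] gs(1) fs(1,2)] word_mono[OF le_refl[OF w] s gs] xs])
  then show "res (inter w (subword (cmp simplex_category g f) s)) (inter w s) n (x (subword (cmp simplex_category g f) s)) =
    res (inter w (subword g s)) (inter w s) n (on_ar (cech_on w) f n x (subword g s))"
   using gs' unfolding subword_cmp[OF f fg'] cech_on_ar by simp
 qed
qed

definition cone_on where "cone_on w m n a = (\<lambda>s\<in>words I m. res (part w) (inter w s) n a)"

lemma cone_on_map:
 assumes w: "w : carrier X"
 shows "cone_map simplex_category (on_ob F (src S (part w))) (cech_on w) (cone_on w)"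
 unfolding cone_map_def
proof (intro conjI ballI allI)
 fix c
 have "cone_on w c = (%n a. \<lambda>s\<in>words I c. res (part w) (inter w s) n a)" by (rule ext, rule ext, rule cone_on_def)
 then show "cochain_map (on_ob F (src S (part w))) (on_ob (cech_on w) c) (cone_on w c)"
  unfolding cech_on_ob
 proof (rule ssubst)
  show "cochain_map (on_ob F (src S (part w))) (product_complex (words I c) (%s. on_ob F (src S (inter w s))))
    (%n a. \<lambda>s\<in>words I c. res (part w) (inter w s) n a)"
  proof (rule product_complex_cone[where f = "%s. res (part w) (inter w s)"])
   fix s assume s: "s : words I c"
   show "cochain_map (on_ob F (src S (part w))) (on_ob F (src S (inter w s))) (res (part w) (inter w s))"
    by (rule res_map[OF part(1)[OF w] inter_word[OF w s] part_inter[OF le_refl[OF w]]]) (use wordsD[OF s] in simp_all)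
  qed
 qed
next
 fix f n a assume f: "f : ar simplex_category" and a: "a : carrier (grp (on_ob F (src S (part w))) n)"
 show "on_ar (cech_on w) f n (cone_on w (src simplex_category f) n a) = cone_on w (tgt simplex_category f) n a"
  unfolding cech_on_ar cone_on_def simplex_simps
 proof (rule restrict_ext)
  fix s assume s: "s : words I (arr_tgt f)"
  note fs = subword_words[OF f s]
  have "res (inter w (subword f s)) (inter w s) n (res (part w) (inter w (subword f s)) n a) = res (part w) (inter w s) n a"
   by (rule res_res[OF part(1)[OF w] inter_word[OF w fs(1)] inter_word[OF w s] _ word_mono[OF le_refl[OF w] s fs] a])
    (rule part_inter[OF le_refl[OF w]]; use wordsD[OF fs(1)] in simp)
  then show "res (inter w (subword f s)) (inter w s) n ((\<lambda>s\<in>words I (arr_src f). res (part w) (inter w s) n a) (subword f s)) = res (part w) (inter w s) n a"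
   using fs(1) by simp
 qed
qed

definition shrink where "shrink v w m n x = (\<lambda>s\<in>words I m. res (inter w s) (inter v s) n (x s))"

lemma shrink_natural:
 assumes vw: "v \<sqsubseteq>\<^bsub>X\<^esub> w"
 shows "natural_map simplex_category (cech_on w) (cech_on v) (shrink v w)"
 unfolding natural_map_def
proof (intro conjI ballI allI)
 have v: "v : carrier X" "w : carrier X" using X.le_carrier[OF vw] by auto
 fix c
 have "shrink v w c = (%n x. \<lambda>s\<in>words I c. res (inter w s) (inter v s) n (x s))" by (rule ext, rule ext, rule shrink_def)
 then show "cochain_map (on_ob (cech_on w) c) (on_ob (cech_on v) c) (shrink v w c)"
  unfolding cech_on_ob
 proof (rule ssubst)
  show "cochain_map (product_complex (words I c) (%s. on_ob F (src S (inter w s)))) (product_complex (words I c) (%s. on_ob F (src S (inter v s))))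
    (%n x. \<lambda>s\<in>words I c. res (inter w s) (inter v s) n (x s))"
  proof (rule product_complex_map[where h = "%s. s" and f = "%s. res (inter w s) (inter v s)"])
   fix s assume s: "s : words I c"
   then show "s : words I c" .
   show "cochain_map (on_ob F (src S (inter w s))) (on_ob F (src S (inter v s))) (res (inter w s) (inter v s))"
    by (rule res_map[OF inter_word[OF v(2) s] inter_word[OF v(1) s] word_mono[OF vw s s subset_refl]])
  qed
 qed
next
 have v: "v : carrier X" "w : carrier X" using X.le_carrier[OF vw] by auto
 fix f n x assume f: "f : ar simplex_category" and x: "x : carrier (grp (on_ob (cech_on w) (src simplex_category f)) n)"
 show "shrink v w (tgt simplex_category f) n (on_ar (cech_on w) f n x) = on_ar (cech_on v) f n (shrink v w (src simplex_category f) n x)"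
  unfolding cech_on_ar shrink_def simplex_simps
 proof (rule restrict_ext)
  fix s assume s: "s : words I (arr_tgt f)"
  note fs = subword_words[OF f s]
  have xs: "x (subword f s) : carrier (G (inter w (subword f s)) n)"
   using x fs(1) unfolding cech_on_carrier by (auto simp: PiE_iff)
  have "res (inter w s) (inter v s) n (res (inter w (subword f s)) (inter w s) n (x (subword f s))) = res (inter w (subword f s)) (inter v s) n (x (subword f s))"
   by (rule res_res[OF inter_word[OF v(2) fs(1)] inter_word[OF v(2) s] inter_word[OF v(1) s]
      word_mono[OF le_refl[OF v(2)] s fs] word_mono[OF vw s s subset_refl] xs])
  also have "\<dots> = res (inter v (subword f s)) (inter v s) n (res (inter w (subword f s)) (inter v (subword f s)) n (x (subword f s)))"
   by (rule res_res[OF inter_word[OF v(2) fs(1)] inter_word[OF v(1) fs(1)] inter_word[OF v(1) s]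
      word_mono[OF vw fs(1) fs(1) subset_refl] word_mono[OF le_refl[OF v(1)] s fs] xs, symmetric])
  finally show "res (inter w s) (inter v s) n ((\<lambda>s\<in>words I (arr_tgt f). res (inter w (subword f s)) (inter w s) n (x (subword f s))) s) =
    res (inter v (subword f s)) (inter v s) n ((\<lambda>s\<in>words I (arr_src f). res (inter w s) (inter v s) n (x s)) (subword f s))"
   using s fs(1) by simp
 qed
qed

end

lemma holim_dif_nil:
 assumes D: "diagram C D" and x: "x : carrier (grp (holim C D) k)" and c: "c : ob C"
 shows "dif (holim C D) k x (c, []) = dif (on_ob D c) k (x (c, []))"
proof -
 have "x (c, []) : carrier (grp (on_ob D c) k)" using holim_component[OF x, of c "[]" k] c by simp
 moreover have A: "cochain_complex (on_ob D c)" using D c by (simp add: diagram_def)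
 ultimately have d: "dif (on_ob D c) k (x (c, [])) : carrier (grp (on_ob D c) (k + 1))" by (auto simp: cochain_complex_def hom_def)
 interpret comm_group "grp (on_ob D c) (k + 1)" using A by (simp add: cochain_complex_def)
 show ?thesis using c d by (simp add: holim_def strings_def last_ob_def)
qed

context cech_site
begin

abbreviation "cech_total w \<equiv> holim simplex_category (cech_on w)"

text \<open>The presheaf of mapping cones to which the closure argument is applied.\<close>

definition cone_complex where
 "cone_complex w = mapping_cone (on_ob F (src S (part w))) (cech_total w) (to_holim simplex_category (cech_on w) (cone_on w))"

definition cone_restrict where
 "cone_restrict w v k = map_prod (res (part w) (part v) (k + 1)) (holim_map simplex_category (shrink v w) k)"

lemma part_complex_map:
 assumes w: "w : carrier X"
 shows "complex_map (on_ob F (src S (part w))) (cech_total w) (to_holim simplex_category (cech_on w) (cone_on w))"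
proof
 show A: "cochain_complex (on_ob F (src S (part w)))" by (rule F_complex[OF opnD(6)[OF part(1)[OF w]]])
 show "cochain_complex (cech_total w)" by (rule holim_complex[OF cech_on_diagram[OF w]])
 show "cochain_map (on_ob F (src S (part w))) (cech_total w) (to_holim simplex_category (cech_on w) (cone_on w))"
  by (rule to_holim_cochain_map[OF cech_on_diagram[OF w] A cone_on_map[OF w]])
qed

lemma holim_shrink_map:
 assumes "v \<sqsubseteq>\<^bsub>X\<^esub> w"
 shows "cochain_map (cech_total w) (cech_total v) (holim_map simplex_category (shrink v w))"
 using X.le_carrier[OF assms] by (intro holim_map_cochain_map cech_on_diagram shrink_natural[OF assms]) simp_all

lemma shrink_cone:
 assumes vw: "v \<sqsubseteq>\<^bsub>X\<^esub> w" and a: "a : carrier (G (part w) n)"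
 shows "holim_map simplex_category (shrink v w) n (to_holim simplex_category (cech_on w) (cone_on w) n a) =
  to_holim simplex_category (cech_on v) (cone_on v) n (res (part w) (part v) n a)"
proof (rule holim_eqI)
 have v: "v : carrier X" "w : carrier X" using X.le_carrier[OF vw] by auto
 note cw = complex_map.closed(3)[OF part_complex_map[OF v(2)] a]
 interpret H: complex_map "cech_total w" "cech_total v" "holim_map simplex_category (shrink v w)"
  by unfold_locales (intro holim_complex cech_on_diagram v holim_shrink_map vw)+
 show "holim_map simplex_category (shrink v w) n (to_holim simplex_category (cech_on w) (cone_on w) n a) : carrier (grp (cech_total v) n)"
  by (rule H.closed(3)[OF cw])
 show "to_holim simplex_category (cech_on v) (cone_on v) n (res (part w) (part v) n a) : carrier (grp (cech_total v) n)"
  by (rule complex_map.closed(3)[OF part_complex_map[OF v(1)] res_closed[OF part(1)[OF v(2)] part(1)[OF v(1)] part_mono[OF vw] a]])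
 fix c l assume cl: "composable simplex_category c l"
 note comp = holim_map_component[OF cl HOL.refl] to_holim_component[OF cl HOL.refl]
 show "holim_map simplex_category (shrink v w) n (to_holim simplex_category (cech_on w) (cone_on w) n a) (c, l) =
   to_holim simplex_category (cech_on v) (cone_on v) n (res (part w) (part v) n a) (c, l)"
 proof (cases "l = []")
  case True
  have "shrink v w c n (cone_on w c n a) = cone_on v c n (res (part w) (part v) n a)"
   unfolding shrink_def cone_on_def
  proof (rule restrict_ext)
   fix s assume s: "s : words I c"
   have ps: "im (inter x s) \<sqsubseteq>\<^bsub>X\<^esub> im (part y)" if "x \<sqsubseteq>\<^bsub>X\<^esub> y" for x y by (rule part_inter[OF that]) (use wordsD[OF s] in simp_all)
   have "res (inter w s) (inter v s) n (res (part w) (inter w s) n a) = res (part w) (inter v s) n a"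
    by (rule res_res[OF part(1)[OF v(2)] inter_word[OF v(2) s] inter_word[OF v(1) s] ps[OF le_refl[OF v(2)]] word_mono[OF vw s s subset_refl] a])
   also have "\<dots> = res (part v) (inter v s) n (res (part w) (part v) n a)"
    by (rule res_res[OF part(1)[OF v(2)] part(1)[OF v(1)] inter_word[OF v(1) s] part_mono[OF vw] ps[OF le_refl[OF v(1)]] a, symmetric])
   finally show "res (inter w s) (inter v s) n ((\<lambda>s\<in>words I c. res (part w) (inter w s) n a) s) = res (part v) (inter v s) n (res (part w) (part v) n a)"
    using s by simp
  qed
  then show ?thesis unfolding comp using True by simp
 next
  case False
  let ?e = "chain_end simplex_category c l" and ?m = "n - int (length l)"
  interpret Q: complex_map "on_ob (cech_on w) ?e" "on_ob (cech_on v) ?e" "shrink v w ?e"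
   using cech_on_complex[OF v(2)] cech_on_complex[OF v(1)] shrink_natural[OF vw] by unfold_locales (simp_all add: natural_map_def)
  show ?thesis unfolding comp using False group_hom.hom_one[OF Q.homs(3)] by simp
 qed
qed

text \<open>Each degree of the homotopy limit is a product, over strings and words \<open>s\<close>,
  of the sections over \<open>opens s \<sqinter> w\<close>, and each factor is soft by
  \<open>soft_sheaf_opens\<close>. The degree of a factor depends only on its string.\<close>

lemma total_soft: "soft_sheaf X (%v. grp (cech_total v) n) (%w v. holim_map simplex_category (shrink v w) n)"
proof -
 have inner: "soft_sheaf X (%v. product_group (words I m) (%s. G (inter v s) k)) (%w v x. \<lambda>s\<in>words I m. res (inter w s) (inter v s) k (x s))" for m k
 proof (rule soft_sheaf_product[OF X.frame_lattice_axioms])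
  fix s assume s: "s : words I m"
  note s' = wordsD[OF s]
  show "soft_sheaf X (%v. G (inter v s) k) (%w v. res (inter w s) (inter v s) k)"
   by (rule soft_sheaf_opens[OF M_ob opens_closed]) (use s' inter in auto)
 qed
 have "soft_sheaf X (%v. product_group (strings simplex_category) (\<lambda>\<sigma>. product_group (words I (last_ob simplex_category \<sigma>)) (%s. G (inter v s) (n - int (length (snd \<sigma>))))))
   (%w v x. \<lambda>\<sigma>\<in>strings simplex_category. \<lambda>s\<in>words I (last_ob simplex_category \<sigma>). res (inter w s) (inter v s) (n - int (length (snd \<sigma>))) (x \<sigma> s))"
  by (rule soft_sheaf_product[OF X.frame_lattice_axioms inner])
 moreover have "grp (cech_total v) n = product_group (strings simplex_category) (\<lambda>\<sigma>. product_group (words I (last_ob simplex_category \<sigma>)) (%s. G (inter v s) (n - int (length (snd \<sigma>)))))" for v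
  by (simp add: holim_def cech_on_ob)
 moreover have "holim_map simplex_category (shrink v w) n x =
   (\<lambda>\<sigma>\<in>strings simplex_category. \<lambda>s\<in>words I (last_ob simplex_category \<sigma>). res (inter w s) (inter v s) (n - int (length (snd \<sigma>))) (x \<sigma> s))" for w v x
  unfolding holim_map_def by (rule restrict_ext) (auto simp: shrink_def last_ob_chain_end split: prod.splits)
 then have "(%w v. holim_map simplex_category (shrink v w) n) = (%w v x. \<lambda>\<sigma>\<in>strings simplex_category. \<lambda>s\<in>words I (last_ob simplex_category \<sigma>). res (inter w s) (inter v s) (n - int (length (snd \<sigma>))) (x \<sigma> s))"
  by (intro ext) (simp only:)
 ultimately show ?thesis by (simp only:)
qed

sublocale cone: soft_complex X cone_complex cone_restrict
proof (rule soft_complex.intro[OF X.frame_lattice_axioms soft_complex_axioms.intro])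
 fix w assume "w : carrier X"
 then show "cochain_complex (cone_complex w)" unfolding cone_complex_def by (rule complex_map.mapping_cone_complex[OF part_complex_map])
next
 fix v w assume vw: "v \<sqsubseteq>\<^bsub>X\<^esub> w"
 have v: "v : carrier X" "w : carrier X" using X.le_carrier[OF vw] by auto
 have "cone_restrict w v = (%k. map_prod (res (part w) (part v) (k + 1)) (holim_map simplex_category (shrink v w) k))"
  by (rule ext) (rule cone_restrict_def)
 then show "cochain_map (cone_complex w) (cone_complex v) (cone_restrict w v)"
  unfolding cone_complex_def
  by (rule ssubst, intro mapping_cone_map[OF part_complex_map[OF v(2)] part_complex_map[OF v(1)]
   res_map[OF part(1)[OF v(2)] part(1)[OF v(1)] part_mono[OF vw]] holim_shrink_map[OF vw]] shrink_cone[OF vw])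
next
 fix n
 have top: "\<top>\<^bsub>X\<^esub> \<sqinter>\<^bsub>X\<^esub> v = v" if "v : carrier X" for v
  by (rule X.meet_absorb(2)[OF that X.top_closed X.top_higher[OF that]])
 have "soft_sheaf X (%v. G (part v) (n + 1)) (%w v. res (part w) (part v) (n + 1))"
  by (rule soft_sheaf_opens[OF M_ob X.top_closed part(1)]) (simp_all add: part(2) top)
 from soft_sheaf_pair[OF this total_soft[of n]]
 show "soft_sheaf X (%v. grp (cone_complex v) n) (%w v. cone_restrict w v n)"
  by (simp only: cone_complex_def mapping_cone_simps cone_restrict_def)
qed

subsection \<open>Contractibility below a member of the cover\<close>

lemma le_inter:
 assumes "z \<sqsubseteq>\<^bsub>X\<^esub> w" "!!i. i : set s ==> z \<sqsubseteq>\<^bsub>X\<^esub> im (p i)" "s ~= []" "set s \<subseteq> I"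
 shows "z \<sqsubseteq>\<^bsub>X\<^esub> im (inter w s)"
proof -
 have c: "z : carrier X" "w : carrier X" using X.le_carrier[OF assms(1)] by auto
 have "z \<sqsubseteq>\<^bsub>X\<^esub> opens s" unfolding opens_def
  by (rule X.inf_greatest[OF im_sub[OF assms(4)] c(1)]) (use assms(2) in blast)
 then show ?thesis unfolding inter(2)[OF c(2) assms(3,4)]
  by (rule X.meet_greatest[OF _ assms(1) c(1) opens_closed[OF assms(4)] c(2)])
qed

lemma inter_le:
 assumes "w : carrier X" "s ~= []" "set s \<subseteq> I"
 shows "im (inter w s) \<sqsubseteq>\<^bsub>X\<^esub> w" "i : set s ==> im (inter w s) \<sqsubseteq>\<^bsub>X\<^esub> im (p i)"
proof -
 note m = X.meet_lower[OF opens_closed[OF assms(3)] assms(1)]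
 show "im (inter w s) \<sqsubseteq>\<^bsub>X\<^esub> w" using inter(2)[OF assms] m(3) by simp
 assume "i : set s"
 then have "opens s \<sqsubseteq>\<^bsub>X\<^esub> im (p i)" unfolding opens_def by (intro X.inf_lower[OF im_sub[OF assms(3)]]) blast
 then show "im (inter w s) \<sqsubseteq>\<^bsub>X\<^esub> im (p i)" using X.trans[OF m(2)] inter(2)[OF assms] by simp
qed

context
 fixes w j assumes j: "j : I" and w: "w \<sqsubseteq>\<^bsub>X\<^esub> im (p j)"
begin

lemma wc: "w : carrier X" using X.le_carrier[OF w] by simp

lemma Cons_words: "s : words I c ==> j # s : words I (Suc c)" "[j] : words I 0"
 using j by (auto simp: words_def)

lemma inter_Cons: "s : words I c ==> im (inter w s) \<sqsubseteq>\<^bsub>X\<^esub> im (inter w (j # s))"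
 using wordsD[of s I c] j by (intro le_inter) (auto intro: inter_le wc X.trans[OF inter_le(1)[OF wc] w])

lemma part_single: "im (part w) \<sqsubseteq>\<^bsub>X\<^esub> im (inter w [j])"
 unfolding part(2)[OF wc] by (rule le_inter) (use j w wc X.le_refl in auto)

text \<open>The extra degeneracy. As \<open>w\<close> lies below the member of index
  \<open>j\<close>, the words \<open>j # s\<close> and \<open>s\<close> have the same open inside
  \<open>w\<close>; the restriction leads from one chosen lift to the other and exists by
  \<open>inter_Cons\<close>.\<close>

definition retract where "retract c n y = (\<lambda>s\<in>words I c. res (inter w (j # s)) (inter w s) n (y (j # s)))"

lemma retract_contraction: "contraction simplex_category (cech_on w) Suc dec dec_last 0 dec_zero retract"
proof
 show "diagram simplex_category (cech_on w)" by (rule cech_on_diagram[OF wc])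
 show "endo_functor simplex_category Suc dec" "nat_from_id simplex_category Suc dec dec_last" "cone_over simplex_category Suc dec 0 dec_zero"
  by (rule dec_functor dec_last_natural dec_zero_cone)+
next
 fix c :: nat
 have "retract c = (%n y. \<lambda>s\<in>words I c. res (inter w (j # s)) (inter w s) n (y (j # s)))" by (rule ext, rule ext, rule retract_def)
 then show "cochain_map (on_ob (cech_on w) (Suc c)) (on_ob (cech_on w) c) (retract c)"
  unfolding cech_on_ob
 proof (rule ssubst)
  show "cochain_map (product_complex (words I (Suc c)) (%s. on_ob F (src S (inter w s)))) (product_complex (words I c) (%s. on_ob F (src S (inter w s))))
    (%n y. \<lambda>s\<in>words I c. res (inter w (j # s)) (inter w s) n (y (j # s)))"
  proof (rule product_complex_map[where h = "%s. j # s" and f = "%s. res (inter w (j # s)) (inter w s)"])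
   fix s assume s: "s : words I c"
   show "j # s : words I (Suc c)" by (rule Cons_words(1)[OF s])
   show "cochain_map (on_ob F (src S (inter w (j # s)))) (on_ob F (src S (inter w s))) (res (inter w (j # s)) (inter w s))"
    by (rule res_map[OF inter_word[OF wc Cons_words(1)[OF s]] inter_word[OF wc s] inter_Cons[OF s]])
  qed
 qed
next
 fix f n y assume f: "f : ar simplex_category" and y: "y : carrier (grp (on_ob (cech_on w) (Suc (src simplex_category f))) n)"
 show "retract (tgt simplex_category f) n (on_ar (cech_on w) (dec f) n y) = on_ar (cech_on w) f n (retract (src simplex_category f) n y)"
  unfolding retract_def cech_on_ar simplex_simps
 proof (rule restrict_ext)
  fix s assume s: "s : words I (arr_tgt f)"
  note fs = subword_words[OF f s]
  note js = Cons_words(1)[OF s] and jfs = Cons_words(1)[OF fs(1)]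
  have yc: "y (j # subword f s) : carrier (G (inter w (j # subword f s)) n)" using y jfs unfolding cech_on_carrier by (auto simp: PiE_iff)
  have m: "im (inter w (j # s)) \<sqsubseteq>\<^bsub>X\<^esub> im (inter w (j # subword f s))" by (rule word_mono[OF le_refl[OF wc] js jfs]) (use fs(2) in auto)
  have "res (inter w (j # s)) (inter w s) n (res (inter w (j # subword f s)) (inter w (j # s)) n (y (j # subword f s))) = res (inter w (j # subword f s)) (inter w s) n (y (j # subword f s))"
   by (rule res_res[OF inter_word[OF wc jfs] inter_word[OF wc js] inter_word[OF wc s] m inter_Cons[OF s] yc])
  also have "\<dots> = res (inter w (subword f s)) (inter w s) n (res (inter w (j # subword f s)) (inter w (subword f s)) n (y (j # subword f s)))"
   by (rule res_res[OF inter_word[OF wc jfs] inter_word[OF wc fs(1)] inter_word[OF wc s] inter_Cons[OF fs(1)] word_mono[OF le_refl[OF wc] s fs] yc, symmetric])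
  finally show "res (inter w (j # s)) (inter w s) n ((\<lambda>s\<in>words I (arr_tgt (dec f)). res (inter w (subword (dec f) s)) (inter w s) n (y (subword (dec f) s))) (j # s)) =
    res (inter w (subword f s)) (inter w s) n ((\<lambda>s\<in>words I (arr_src f). res (inter w (j # s)) (inter w s) n (y (j # s))) (subword f s))"
   using js fs(1) by (simp add: subword_dec)
 qed
next
 fix c n x assume x: "x : carrier (grp (on_ob (cech_on w) c) n)"
 have "retract c n (on_ar (cech_on w) (dec_last c) n x) = restrict x (words I c)"
  unfolding retract_def cech_on_ar
 proof (rule restrict_ext)
  fix s assume s: "s : words I c"
  note js = Cons_words(1)[OF s]
  have xs: "x s : carrier (G (inter w s) n)" using x s unfolding cech_on_carrier by (auto simp: PiE_iff)
  have m: "im (inter w (j # s)) \<sqsubseteq>\<^bsub>X\<^esub> im (inter w s)" by (rule word_mono[OF le_refl[OF wc] js s]) auto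
  have "res (inter w (j # s)) (inter w s) n (res (inter w s) (inter w (j # s)) n (x s)) = x s"
   using res_res[OF inter_word[OF wc s] inter_word[OF wc js] inter_word[OF wc s] m inter_Cons[OF s] xs] res_self[OF inter_word[OF wc s] xs] by simp
  then show "res (inter w (j # s)) (inter w s) n ((\<lambda>s\<in>words I (arr_tgt (dec_last c)). res (inter w (subword (dec_last c) s)) (inter w s) n (x (subword (dec_last c) s))) (j # s)) = x s"
   using js subword_dec_last[of s c j] wordsD[OF s] by simp
 qed
 also have "\<dots> = x" by (rule extensional_restrict) (use x in \<open>simp add: cech_on_carrier PiE_iff\<close>)
 finally show "retract c n (on_ar (cech_on w) (dec_last c) n x) = x" .
qed

text \<open>Additively, a cone cocycle \<open>(a, x)\<close> satisfies \<open>d x = - e a\<close>.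
  At the word \<open>[j]\<close>, whose open inside \<open>w\<close> is \<open>w\<close> itself,
  this reads \<open>a = - d b\<close> for the component \<open>b\<close> of \<open>x\<close> there.
  The contraction then gives \<open>x = e b + d h\<close>, so \<open>(a, x)\<close> is the
  differential of \<open>(b, h)\<close>.\<close>

lemma exact_below: "exact (cone_complex w)"
 unfolding exact_def
proof (intro allI ballI impI)
 note [[simproc del: int_combine_numerals]]
 fix n z assume z: "z : carrier (grp (cone_complex w) (n + 1))" "dif (cone_complex w) (n + 1) z = \<one>\<^bsub>grp (cone_complex w) (n + 1 + 1)\<^esub>"
 let ?C = simplex_category and ?D = "cech_on w" and ?A = "on_ob F (src S (part w))" and ?B = "cech_total w"
 let ?e = "to_holim simplex_category (cech_on w) (cone_on w)"
 interpret E: complex_map ?A ?B ?e by (rule part_complex_map[OF wc])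
 interpret R: contraction ?C ?D Suc dec dec_last 0 dec_zero retract by (rule retract_contraction)
 note diag = cech_on_diagram[OF wc]
 obtain a x where ax: "z = (a, x)" "a : carrier (grp ?A (n + 1 + 1))" "x : carrier (grp ?B (n + 1))" using z(1) by (auto simp: cone_complex_def)
 have eq: "?e (n + 1 + 1) a \<otimes>\<^bsub>grp ?B (n + 1 + 1)\<^esub> dif ?B (n + 1) x = \<one>\<^bsub>grp ?B (n + 1 + 1)\<^esub>"
  using z(2) by (simp add: ax(1) cone_complex_def)
 have comp: "?e (n + 1 + 1) a (c, l) \<otimes>\<^bsub>holim_term ?C ?D (n + 1 + 1) c l\<^esub> dif ?B (n + 1) x (c, l) = \<one>\<^bsub>holim_term ?C ?D (n + 1 + 1) c l\<^esub>"
  if "composable ?C c l" for c l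
  using fun_cong[OF eq, of "(c, l)"] that unfolding holim_mult holim_one by (simp add: strings_def)
 have dx: "dif ?B (n + 1) x : carrier (grp ?B (n + 1 + 1))" by (rule E.closed(2)[OF ax(3)])
 have closed: "dif ?B (n + 1) x (c, l) = \<one>\<^bsub>grp (on_ob ?D (chain_end ?C c l)) (n + 1 + 1 - int (length l))\<^esub>"
  if cl: "composable ?C c l" and l: "l ~= []" for c l
 proof -
  interpret T: comm_group "holim_term ?C ?D (n + 1 + 1) c l"
   using cech_on_complex[OF wc] by (simp add: cochain_complex_def)
  have "?e (n + 1 + 1) a (c, l) = \<one>\<^bsub>holim_term ?C ?D (n + 1 + 1) c l\<^esub>" using to_holim_component[OF cl HOL.refl] l by simp
  then show ?thesis using comp[OF cl] T.l_one[OF holim_component[OF dx cl HOL.refl]] by simp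
 qed
 let ?q = "inter w [j]" and ?P = "part w"
 have q: "opn M ?q" "opn M ?P" using inter_word[OF wc Cons_words(2)] part(1)[OF wc] by auto
 have qP: "im ?q \<sqsubseteq>\<^bsub>X\<^esub> im ?P" "im ?P \<sqsubseteq>\<^bsub>X\<^esub> im ?q" using part_inter[OF le_refl[OF wc], of "[j]"] j part_single by auto
 define y where "y = x (0, []) [j]"
 have x0: "x (0, []) : carrier (grp (on_ob ?D 0) (n + 1))" using holim_component[OF ax(3), of 0 "[]" "n + 1"] by simp
 have y: "y : carrier (G ?q (n + 1))" using x0 Cons_words(2) unfolding cech_on_carrier y_def by (auto simp: PiE_iff)
 have "res ?P ?q (n + 1 + 1) a \<otimes>\<^bsub>G ?q (n + 1 + 1)\<^esub> dif (on_ob F (src S ?q)) (n + 1) y = \<one>\<^bsub>G ?q (n + 1 + 1)\<^esub>"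
 proof -
  have cl: "composable ?C 0 []" by simp
  have "?e (n + 1 + 1) a (0, []) = cone_on w 0 (n + 1 + 1) a" using to_holim_component[OF cl, of "n + 1 + 1" "n + 1 + 1"] by simp
  then have "cone_on w 0 (n + 1 + 1) a \<otimes>\<^bsub>grp (on_ob ?D 0) (n + 1 + 1)\<^esub> dif (on_ob ?D 0) (n + 1) (x (0, [])) = \<one>\<^bsub>grp (on_ob ?D 0) (n + 1 + 1)\<^esub>"
   using comp[OF cl] holim_dif_nil[OF diag ax(3), of 0] by simp
  from fun_cong[OF this, of "[j]"] show ?thesis using Cons_words(2) by (simp add: cech_on_ob cone_on_def y_def)
 qed
 note eqj = this
 define b where "b = res ?q ?P (n + 1) y"
 have b: "b : carrier (grp ?A (n + 1))" unfolding b_def by (rule res_closed[OF q qP(2) y])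
 interpret Q: complex_map "on_ob F (src S ?q)" ?A "res ?q ?P"
  by unfold_locales (rule F_complex[OF opnD(6)[OF q(1)]] E.A res_map[OF q qP(2)])+
 have ra: "res ?P ?q (n + 1 + 1) a : carrier (G ?q (n + 1 + 1))" by (rule res_closed[OF q(2,1) qP(1) ax(2)])
 have "res ?q ?P (n + 1 + 1) (res ?P ?q (n + 1 + 1) a) = a"
  using res_res[OF q(2,1,2) qP ax(2)] res_self[OF q(2) ax(2)] by simp
 then have "a \<otimes>\<^bsub>grp ?A (n + 1 + 1)\<^esub> dif ?A (n + 1) b = \<one>\<^bsub>grp ?A (n + 1 + 1)\<^esub>"
  using arg_cong[OF eqj, of "res ?q ?P (n + 1 + 1)"] group_hom.hom_mult[OF Q.homs(3) ra Q.closed(1)[OF y]] group_hom.hom_one[OF Q.homs(3)] Q.e_dif[OF y]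
  by (simp add: b_def)
 then have a: "a = inv\<^bsub>grp ?A (n + 1 + 1)\<^esub> (dif ?A (n + 1) b)"
  using group.inv_equality[OF comm_group.axioms(2)[OF E.groups(1)] _ E.closed(1)[OF b] ax(2)] by simp
 have nn: "n + 1 - 1 = n" by simp
 define h where "h = R.htpy n x"
 have h: "h : carrier (grp ?B n)" unfolding h_def by (rule R.htpy_carrier)
 have "x = ?e (n + 1) b \<otimes>\<^bsub>grp ?B (n + 1)\<^esub> dif ?B n h"
 proof (rule holim_eqI[OF ax(3)])
  note eb = E.closed(3)[OF b] and dh = E.closed(2)[OF h]
  interpret B1: comm_group "grp ?B (n + 1)" by (rule E.groups(2))
  show "?e (n + 1) b \<otimes>\<^bsub>grp ?B (n + 1)\<^esub> dif ?B n h : carrier (grp ?B (n + 1))" by (rule B1.m_closed[OF eb dh])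
  fix c l assume cl: "composable ?C c l"
  let ?T = "holim_term ?C ?D (n + 1) c l"
  interpret T: comm_group ?T using cech_on_complex[OF wc] by (simp add: cochain_complex_def)
  have ec: "?e (n + 1) b (c, l) = (if l = [] then cone_on w c (n + 1) b else \<one>\<^bsub>?T\<^esub>)"
   by (rule to_holim_component[OF cl HOL.refl])
  have "x (c, l) = dif ?B n h (c, l) \<otimes>\<^bsub>?T\<^esub>
    (if l = [] then retract c (n + 1 - int (length l)) (on_ar ?D (dec_zero c) (n + 1 - int (length l)) (x (0, []))) else \<one>\<^bsub>?T\<^esub>)"
   using R.contraction[OF ax(3) closed cl HOL.refl] unfolding nn h_def .
  moreover have "?e (n + 1) b (c, l) = (if l = [] then retract c (n + 1 - int (length l)) (on_ar ?D (dec_zero c) (n + 1 - int (length l)) (x (0, []))) else \<one>\<^bsub>?T\<^esub>)"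
  proof (cases "l = []")
   case True
   have "cone_on w c (n + 1) b = retract c (n + 1) (on_ar ?D (dec_zero c) (n + 1) (x (0, [])))"
    unfolding cone_on_def retract_def cech_on_ar
   proof (rule restrict_ext)
    fix s assume s: "s : words I c"
    note js = Cons_words(1)[OF s]
    have m: "im (inter w (j # s)) \<sqsubseteq>\<^bsub>X\<^esub> im ?q" by (rule word_mono[OF le_refl[OF wc] js Cons_words(2)]) simp
    have ps: "im (inter w s) \<sqsubseteq>\<^bsub>X\<^esub> im ?P" by (rule part_inter[OF le_refl[OF wc]]) (use wordsD[OF s] in simp_all)
    have "res ?P (inter w s) (n + 1) b = res ?q (inter w s) (n + 1) y"
     unfolding b_def by (rule res_res[OF q inter_word[OF wc s] qP(2) ps y])
    also have "\<dots> = res (inter w (j # s)) (inter w s) (n + 1) (res ?q (inter w (j # s)) (n + 1) y)"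
     by (rule res_res[OF q(1) inter_word[OF wc js] inter_word[OF wc s] m inter_Cons[OF s] y, symmetric])
    finally show "res ?P (inter w s) (n + 1) b = res (inter w (j # s)) (inter w s) (n + 1)
      ((\<lambda>s\<in>words I (arr_tgt (dec_zero c)). res (inter w (subword (dec_zero c) s)) (inter w s) (n + 1) (x (0, []) (subword (dec_zero c) s))) (j # s))"
     using js by (simp add: subword_dec_zero y_def)
   qed
   then show ?thesis using True ec by simp
  next
   case False
   then show ?thesis using ec by simp
  qed
  ultimately have "x (c, l) = dif ?B n h (c, l) \<otimes>\<^bsub>?T\<^esub> ?e (n + 1) b (c, l)" by simp
  also have "\<dots> = ?e (n + 1) b (c, l) \<otimes>\<^bsub>?T\<^esub> dif ?B n h (c, l)"
   by (rule T.m_comm[OF holim_component[OF dh cl HOL.refl] holim_component[OF eb cl HOL.refl]])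
  finally show "x (c, l) = (?e (n + 1) b \<otimes>\<^bsub>grp ?B (n + 1)\<^esub> dif ?B n h) (c, l)"
   using cl unfolding holim_mult by (simp add: strings_def)
 qed
 then have "z = dif (cone_complex w) n (b, h)" using a by (simp add: ax(1) cone_complex_def)
 moreover have "(b, h) : carrier (grp (cone_complex w) n)" using b h by (simp add: cone_complex_def)
 ultimately show "z : dif (cone_complex w) n ` carrier (grp (cone_complex w) n)" by blast
qed

end

section \<open>Exactness over the whole object and descent\<close>

text \<open>Opens whose inclusion lies in the sieve of the family are below a member, hence good.
  Applying \<open>covering_sieve_closed\<close> to the identity of \<open>X\<close> carries this to
  the top; in this way every covering family is reached, not only the numerable covers that generate
  the topology.\<close>

lemma exact_top: "exact (cone_complex \<top>\<^bsub>X\<^esub>)"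
proof -
 let ?P = "%w. w : carrier X & (\<forall>v. v \<sqsubseteq>\<^bsub>X\<^esub> w --> exact (cone_complex v))"
 let ?R = "generated_sieve Loc (on_ar U ` p ` I)"
 have sub: "p ` I \<subseteq> arrows_to S M" using p_opn by (auto simp: opn_def arrows_to_def)
 have "covering_family S K M (p ` I)" using cover by (simp add: open_covering_family_def)
 then have "covering_sieve Loc numerable_coverage X ?R"
  using creates_covering_families[OF M_ob sub] by (simp add: covering_family_def)
 note cs = this
 have XL: "X : ob Loc" by (rule frame_lattice_iff[THEN iffD1, OF X.frame_lattice_axioms])
 note id = category.idn_ar[OF Loc_category XL]
 have "?P \<top>\<^bsub>src Loc (idn Loc X)\<^esub>"
 proof (rule covering_sieve_closed[OF cs])
  show "idn Loc X : ar Loc" "tgt Loc (idn Loc X) = X" using id by blast+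
  show "numerably_closed (src Loc (idn Loc X)) ?P" using cone.exact_numerably_closed id by simp
  fix v assume v: "v : carrier (src Loc (idn Loc X))" and R: "cmp Loc (idn Loc X) (open_inclusion (src Loc (idn Loc X)) v) : ?R"
  have vX: "v : carrier X" using v id by simp
  note vo = open_inclusion_onto[OF X.frame_lattice_axioms vX]
  note va = open_embedding_ontoD[OF vo]
  have "cmp Loc (idn Loc (tgt Loc (open_inclusion X v))) (open_inclusion X v) = open_inclusion X v"
   by (rule category.cmp_idn_left[OF Loc_category va(1)])
  then have "open_inclusion X v : ?R" using R id by simp
  then obtain i g where ig: "i : I" "g : ar Loc" "tgt Loc g = src Loc (on_ar U (p i))" "open_inclusion X v = cmp Loc (on_ar U (p i)) g"
   unfolding generated_sieve_def by blast
  note pi = opnD[OF p_opn[OF ig(1)]]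
  note Up = U_ar[OF pi(1)]
  interpret Gt: two_frames "arr_tgt g" "arr_src g" "arr_map g" by (rule Loc_arD[OF ig(2)])
  have "arr_map (open_inclusion X v) (im (p i)) = arr_map g (arr_map (on_ar U (p i)) (im (p i)))"
   unfolding ig(4) by (rule Loc_cmp_map) (use Up pi in simp)
  also have "\<dots> = \<top>\<^bsub>arr_src g\<^esub>" using open_embedding_ontoD(3)[OF pi(4)] Gt.hom_top ig(3) by simp
  also have "arr_src g = arr_src (open_inclusion X v)" unfolding ig(4) by simp
  finally have vp: "v \<sqsubseteq>\<^bsub>X\<^esub> im (p i)"
   using open_embedding_top_iff[OF vo, of "im (p i)"] pi(7) by simp
  show "?P v"
  proof (intro conjI allI impI vX)
   fix u assume "u \<sqsubseteq>\<^bsub>X\<^esub> v"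
   then show "exact (cone_complex u)" by (rule exact_below[OF ig(1) X.trans[OF _ vp]])
  qed
 qed
 then show ?thesis using id X.le_refl[OF X.top_closed] by simp
qed

text \<open>At the top element \<open>part\<close> and \<open>inter\<close> return the given data by
  construction. There \<open>part\<close> is an identity, so restricting from it is the map along
  \<open>N s\<close>, as in \<open>cech_cone\<close>.\<close>

lemma descent: "quasi_isomorphism (on_ob F M) (holim simplex_category (cech S F I N))
 (to_holim simplex_category (cech S F I N) (cech_cone F I N))"
proof -
 have part: "part \<top>\<^bsub>X\<^esub> = idn S M" and c: "cech_on \<top>\<^bsub>X\<^esub> = cech S F I N" and int: "inter \<top>\<^bsub>X\<^esub> = N"
  by (simp_all add: part_def cech_on_def inter_def)
 note id = idn_ar[OF M_ob]
 have "cone_on \<top>\<^bsub>X\<^esub> m n a = cech_cone F I N m n a" for m n a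
  unfolding cone_on_def cech_cone_def part int
 proof (rule restrict_ext)
  fix s assume s: "s : words I m"
  note Ns = opnD[OF inter_word[OF X.top_closed s], unfolded int]
  have "induced S (idn S M) (N s) = N s"
   by (rule induced_eq[OF idn_opn(1)[OF M_ob] Ns(1)]) (use id Ns(2) cmp_idn_left[OF Ns(1)] in simp_all)
  then show "res (idn S M) (N s) n a = on_ar F (N s) n a" by (simp add: res_def)
 qed
 then have "cone_on \<top>\<^bsub>X\<^esub> = cech_cone F I N" by (intro ext) simp
 moreover have "src S (part \<top>\<^bsub>X\<^esub>) = M" using id part by simp
 ultimately show ?thesis
  using complex_map.exact_mapping_cone[OF part_complex_map[OF X.top_closed] exact_top[unfolded cone_complex_def]] by (simp only: c)
qed

end

theorem theorem1p9:
  fixes S :: "('o, 'm) category"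
    and K :: "'o \<Rightarrow> 'm set set"
    and U :: "('o, 'm, 'a gorder, ('a gorder, 'a \<Rightarrow> 'a) arrow) funct"
    and F :: "('o, 'm, 'v cochain, int \<Rightarrow> 'v \<Rightarrow> 'v) funct"
  assumes "numerable_site S K U"
    and "cochain_presheaf S F"
    and "\<And>n. is_sheaf S K U (degree_presheaf F n)"
    and "\<And>n. differences_surjective S K U (degree_presheaf F n)"
  shows "homotopy_descent TYPE('i) S K U F"
  unfolding homotopy_descent_def
proof (intro allI impI)
  fix M :: 'o and I :: "'i set" and p N
  assume "open_covering_family S K U M I p \<and> intersections S U M I p N"
  then have "cech_site S K U F M I p N"
    using assms by (simp add: cech_site_def cech_site_axioms_def sheaf_site_def sheaf_site_axioms_def)
  then show "quasi_isomorphism (on_ob F M) (holim simplex_category (cech S F I N)) (to_holim simplex_category (cech S F I N) (cech_cone F I N))"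
    by (rule cech_site.descent)
qed

end
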